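(* Let $(Z,d,\nu)$ be a compact, doubling metric measure space with $\operatorname{diam}(Z)<1$, and let $(\overline X_\varepsilon,d_\varepsilon)$ be its uniformized hyperbolic filling with parameters $\alpha=e^{1/4}$, $\tau=2$, $\varepsilon=\log\alpha=1/4$, equipped with the measures $\mu_\beta$, $\beta>0$. Let $E\subset Z$ be a closed set, and let $1<p<\infty$, $0<\theta<1$, and $\beta>0$ be such that $\beta/\varepsilon=p(1-\theta)$. Then $Z\setminus E$ satisfies a $(\theta,p)$-Hardy inequality (in $(Z,d,\nu)$) if and only if $\overline X_\varepsilon\setminus E$ satisfies a $p$-Hardy inequality with respect to $\mu_\beta$ (in $(\overline X_\varepsilon,d_\varepsilon,\mu_\beta)$).
   Context: Doubling: a Borel measure $\nu$ on a metric space is doubling if there is $C_\nu\ge1$ with $0<\nu(B(x,2r))\le C_\nu\nu(B(x,r))<\infty$ for all $x$ and $r>0$. Balls in $Z$ are denoted $B_Z(z,r)=\{y\in Z:d(y,z)<r\}$. Hyperbolic filling. Fix $z_0\in Z$, $A_0=\{z_0\}$, and for each $i\in\mathbb N$ let $A_i$ be a maximal $\alpha^{-i}$-separated subset of $Z$, chosen inductively so that $A_i\subset A_{i+1}$. The vertex set is $V=\bigcup_{i\ge0}\{(z,i):z\in A_i\}$. Two distinct vertices $(z,i),(y,j)$ are neighbors, $(z,i)\sim(y,j)$, iff either $i=j$ and $B_Z(z,\tau\alpha^{-i})\cap B_Z(y,\tau\alpha^{-i})\ne\varnothing$, or $|i-j|=1$ and $B_Z(z,\alpha^{-i})\cap B_Z(y,\alpha^{-j})\neq\varnothing$.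 $X$ is the metric graph obtained by gluing a unit interval $[v,w]$ between each pair of neighboring vertices $v,w$; $d_X$ is its path metric and $v_0=(z_0,0)$. The uniformized metric is $d_\varepsilon(x,y)=\inf_\gamma\int_\gamma e^{-\varepsilon d_X(\cdot,v_0)}\,ds$, the infimum over paths $\gamma$ in $X$ joining $x$ to $y$ and $ds$ being arc length with respect to $d_X$. $\overline X_\varepsilon$ is the completion of $X$ with respect to $d_\varepsilon$, and $\partial_\varepsilon X=\overline X_\varepsilon\setminus X$. $Z$ is identified with $\partial_\varepsilon X$ (bi-Lipschitzly): $z\in Z$ corresponds to the $d_\varepsilon$-limit of vertices $(z_i,i)$ with $z_i\in A_i$, $d(z_i,z)<\alpha^{-i}$. In this way $E\subset Z$ is a subset of $\overline X_\varepsilon$. For $\beta>0$ put $\hat\mu_\beta((z,i))=e^{-\beta i}\nu(B_Z(z,\alpha^{-i}))$ and $$\mu_\beta(A)=\sum_{v\in V}\sum_{w\sim v}\big(\hat\mu_\beta(v)+\hat\mu_\beta(w)\big)\,\mathcal H^1(A\cap[v,w]),$$ where $\mathcal H^1$ is the length measure on the unit-length edge $[v,w]$; $\mu_\beta$ is extended to $\overline X_\varepsilon$ by zero on $\partial_\varepsilon X$. Hardy inequalities. For a metric measure space $(Y,\rho,m)$ and open $\Omega\subset Y$, $\mathrm{Lip}_c(\Omega)$ is the set of Lipschitz functions with compact support in $\Omega$; distance to the empty set is $\infty$ by convention. $\Omega$ satisfies a $p$-Hardy inequality with respect to $m$ if there is $C_p\ge1$ with $\int_\Omega \frac{|u(x)|^p}{\rho(x,Y\setminus\Omega)^p}\,dm(x)\le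 C_p\int_\Omega g_u^p\,dm$ for all $u\in\mathrm{Lip}_c(\Omega)$, where $g_u$ is the minimal $p$-weak upper gradient of $u$ (a Borel $g\ge0$ is a $p$-weak upper gradient of $u$ if $|u(\gamma(b))-u(\gamma(a))|\le\int_\gamma g\,ds$ for all nonconstant compact rectifiable curves $\gamma:[a,b]\to Y$ outside a family of $p$-modulus zero). $\Omega$ satisfies a $(\theta,p)$-Hardy inequality if there is $C_{\theta,p}\ge1$ with $$\int_{\Omega}\frac{|u(x)|^p}{\rho(x,Y\setminus\Omega)^{\theta p}}\,dm(x)\le C_{\theta,p}\int_Y\int_Y\frac{|u(x)-u(y)|^p}{\rho(x,y)^{\theta p}\,m(B(x,\rho(x,y)))}\,dm(y)\,dm(x)$$ for all $u\in\mathrm{Lip}_c(\Omega)$. *)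

theory Defs
  imports "HOL-Analysis.Analysis"
begin

section \<open>Metric measure spaces\<close>

text \<open>
  A metric measure space is a pair of an abstract metric \<^typ>\<open>'a metric\<close> and a measure on the Borel
  sets of its carrier. A \<^class>\<open>metric_space\<close> type is turned into an abstract metric by the library
  constant \<^const>\<open>euclidean_metric\<close>, which, despite its name, is \<open>(UNIV, dist)\<close> on every such type.
\<close>

definition metric_borel :: "'a metric \<Rightarrow> 'a measure" where
  "metric_borel Y = sigma (mspace Y) {U. openin (mtopology_of Y) U}"

definition doubling_measure :: "'a metric \<Rightarrow> 'a measure \<Rightarrow> bool" where
  "doubling_measure Y m \<longleftrightarrow>
     (\<exists>C::real. C \<ge> 1 \<and>
        (\<forall>x\<in>mspace Y. \<forall>r>0.
           0 < emeasure m (mball_of Y x (2 * r)) \<and>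
           emeasure m (mball_of Y x (2 * r)) \<le> ennreal C * emeasure m (mball_of Y x r) \<and>
           ennreal C * emeasure m (mball_of Y x r) < \<infinity>))"

text \<open>The infimum over the empty set is \<open>\<infinity>\<close>, as required by the convention for the distance to \<open>{}\<close>.\<close>

definition dist_to_set :: "'a metric \<Rightarrow> 'a \<Rightarrow> 'a set \<Rightarrow> ennreal" where
  "dist_to_set Y x S = (INF y\<in>S. ennreal (mdist Y x y))"

text \<open>Only used with a positive exponent.\<close>

definition ennreal_powr :: "ennreal \<Rightarrow> real \<Rightarrow> ennreal" where
  "ennreal_powr x p = (if x = \<infinity> then \<infinity> else ennreal (enn2real x powr p))"

text \<open>
  Functions in \<open>Lip\<^sub>c(\<Omega>)\<close> are extended by zero to the whole space; a Lipschitz function with compact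
  support in the open set \<open>\<Omega>\<close> stays Lipschitz under this extension.
\<close>

definition Lip_c :: "'a metric \<Rightarrow> 'a set \<Rightarrow> ('a \<Rightarrow> real) set" where
  "Lip_c Y \<Omega> = {u. Lipschitz_continuous_map Y euclidean_metric u \<and>
     (let K = mtopology_of Y closure_of {x \<in> mspace Y. u x \<noteq> 0}
      in compactin (mtopology_of Y) K \<and> K \<subseteq> \<Omega>)}"


section \<open>Curves, modulus and upper gradients\<close>

definition curve_length :: "'a metric \<Rightarrow> (real \<Rightarrow> 'a) \<Rightarrow> real \<Rightarrow> real \<Rightarrow> ennreal" where
  "curve_length Y \<gamma> a b =
     (SUP ts \<in> {ts. sorted ts \<and> set ts \<subseteq> {a..b}}.
        \<Sum>i<length ts - 1. ennreal (mdist Y (\<gamma> (ts ! i)) (\<gamma> (ts ! Suc i))))"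

definition rectifiable_curve :: "'a metric \<Rightarrow> (real \<Rightarrow> 'a) \<Rightarrow> real \<Rightarrow> real \<Rightarrow> bool" where
  "rectifiable_curve Y \<gamma> a b \<longleftrightarrow>
     a \<le> b \<and> continuous_map (top_of_set {a..b}) (mtopology_of Y) \<gamma> \<and> curve_length Y \<gamma> a b < \<infinity>"

text \<open>
  A rectifiable curve is constant on any interval on which its length function is constant, so the
  value below does not depend on the chosen parameter \<open>t\<close>.
\<close>

definition arc_length_param :: "'a metric \<Rightarrow> (real \<Rightarrow> 'a) \<Rightarrow> real \<Rightarrow> real \<Rightarrow> real \<Rightarrow> 'a" where
  "arc_length_param Y \<gamma> a b s = \<gamma> (SOME t. t \<in> {a..b} \<and> enn2real (curve_length Y \<gamma> a t) = s)"

definition line_integral ::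
    "'a metric \<Rightarrow> ('a \<Rightarrow> ennreal) \<Rightarrow> (real \<Rightarrow> 'a) \<Rightarrow> real \<Rightarrow> real \<Rightarrow> ennreal" where
  "line_integral Y g \<gamma> a b =
     (\<integral>\<^sup>+ s \<in> {0..enn2real (curve_length Y \<gamma> a b)}. g (arc_length_param Y \<gamma> a b s) \<partial>lborel)"

text \<open>A family of curves is a set of triples \<open>(\<gamma>, a, b)\<close> standing for \<open>\<gamma> : [a, b] \<rightarrow> Y\<close>.\<close>

definition p_modulus ::
    "'a metric \<Rightarrow> 'a measure \<Rightarrow> real \<Rightarrow> ((real \<Rightarrow> 'a) \<times> real \<times> real) set \<Rightarrow> ennreal" where
  "p_modulus Y m p \<Gamma> =
     (INF h \<in> {h \<in> borel_measurable (metric_borel Y). \<forall>(\<gamma>, a, b) \<in> \<Gamma>. line_integral Y h \<gamma> a b \<ge> 1}.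
        \<integral>\<^sup>+ x. ennreal_powr (h x) p \<partial>m)"

definition weak_upper_gradient ::
    "'a metric \<Rightarrow> 'a measure \<Rightarrow> real \<Rightarrow> ('a \<Rightarrow> real) \<Rightarrow> ('a \<Rightarrow> ennreal) \<Rightarrow> bool" where
  "weak_upper_gradient Y m p u g \<longleftrightarrow>
     g \<in> borel_measurable (metric_borel Y) \<and>
     (\<exists>\<Gamma>. p_modulus Y m p \<Gamma> = 0 \<and>
       (\<forall>\<gamma> a b. rectifiable_curve Y \<gamma> a b \<and> \<not> \<gamma> constant_on {a..b} \<and> (\<gamma>, a, b) \<notin> \<Gamma> \<longrightarrow>
          ennreal \<bar>u (\<gamma> b) - u (\<gamma> a)\<bar> \<le> line_integral Y g \<gamma> a b))"

text \<open>
  The minimal \<open>p\<close>-weak upper gradient is the \<open>m\<close>-a.e. smallest one among those in \<open>L\<^sup>p\<close>. It exists and is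
  \<open>m\<close>-a.e. unique as soon as \<open>u\<close> has some \<open>p\<close>-weak upper gradient in \<open>L\<^sup>p\<close>; this is the case for
  every \<open>u\<close> in \<open>Lip\<^sub>c\<close> if compact sets have finite measure.
\<close>

definition minimal_weak_upper_gradient ::
    "'a metric \<Rightarrow> 'a measure \<Rightarrow> real \<Rightarrow> ('a \<Rightarrow> real) \<Rightarrow> ('a \<Rightarrow> ennreal) \<Rightarrow> bool" where
  "minimal_weak_upper_gradient Y m p u g \<longleftrightarrow>
     weak_upper_gradient Y m p u g \<and> (\<integral>\<^sup>+ x. ennreal_powr (g x) p \<partial>m) < \<infinity> \<and>
     (\<forall>h. weak_upper_gradient Y m p u h \<and> (\<integral>\<^sup>+ x. ennreal_powr (h x) p \<partial>m) < \<infinity> \<longrightarrow>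
        (AE x in m. g x \<le> h x))"


section \<open>Hardy inequalities\<close>

definition hardy_inequality :: "'a metric \<Rightarrow> 'a measure \<Rightarrow> real \<Rightarrow> 'a set \<Rightarrow> bool" where
  "hardy_inequality Y m p \<Omega> \<longleftrightarrow>
     (\<exists>C::real. C \<ge> 1 \<and>
        (\<forall>u \<in> Lip_c Y \<Omega>. \<forall>g. minimal_weak_upper_gradient Y m p u g \<longrightarrow>
           (\<integral>\<^sup>+ x \<in> \<Omega>. (ennreal (\<bar>u x\<bar> powr p) / ennreal_powr (dist_to_set Y x (mspace Y - \<Omega>)) p) \<partial>m)
             \<le> ennreal C * (\<integral>\<^sup>+ x \<in> \<Omega>. ennreal_powr (g x) p \<partial>m)))"

text \<open>On the diagonal the integrand of the double integral is \<open>0 / 0 = 0\<close>.\<close>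

definition fractional_hardy_inequality ::
    "'a metric \<Rightarrow> 'a measure \<Rightarrow> real \<Rightarrow> real \<Rightarrow> 'a set \<Rightarrow> bool" where
  "fractional_hardy_inequality Y m \<theta> p \<Omega> \<longleftrightarrow>
     (\<exists>C::real. C \<ge> 1 \<and>
        (\<forall>u \<in> Lip_c Y \<Omega>.
           (\<integral>\<^sup>+ x \<in> \<Omega>. (ennreal (\<bar>u x\<bar> powr p) /
                ennreal_powr (dist_to_set Y x (mspace Y - \<Omega>)) (\<theta> * p)) \<partial>m)
             \<le> ennreal C *
               (\<integral>\<^sup>+ x. (\<integral>\<^sup>+ y. (ennreal (\<bar>u x - u y\<bar> powr p) /
                  (ennreal (mdist Y x y powr (\<theta> * p)) * emeasure m (mball_of Y x (mdist Y x y)))) \<partial>m) \<partial>m)))"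


section \<open>Completion of a metric space\<close>

definition Cauchy_sequences :: "'a metric \<Rightarrow> (nat \<Rightarrow> 'a) set" where
  "Cauchy_sequences Y = {f. Metric_space.MCauchy (mspace Y) (mdist Y) f}"

definition Cauchy_equivalence :: "'a metric \<Rightarrow> ((nat \<Rightarrow> 'a) \<times> (nat \<Rightarrow> 'a)) set" where
  "Cauchy_equivalence Y = {(f, g). f \<in> Cauchy_sequences Y \<and> g \<in> Cauchy_sequences Y \<and>
     (\<lambda>n. mdist Y (f n) (g n)) \<longlonglongrightarrow> 0}"

text \<open>
  The limit does not depend on the representatives. The value \<open>0\<close> off the carrier is there because
  \<^typ>\<open>'a metric\<close> requires distances to be nonnegative and symmetric there as well.
\<close>

definition completion_metric :: "'a metric \<Rightarrow> (nat \<Rightarrow> 'a) set metric" where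
  "completion_metric Y =
     (let M = Cauchy_sequences Y // Cauchy_equivalence Y
      in metric (M, \<lambda>F G. if F \<in> M \<and> G \<in> M
           then lim (\<lambda>n. mdist Y ((SOME f. f \<in> F) n) ((SOME g. g \<in> G) n)) else 0))"

definition completion_embedding :: "'a metric \<Rightarrow> 'a \<Rightarrow> (nat \<Rightarrow> 'a) set" where
  "completion_embedding Y x = Cauchy_equivalence Y `` {\<lambda>n. x}"


section \<open>Metric graphs with unit-length edges\<close>

text \<open>
  A graph is given by its vertex set \<open>V\<close> and a symmetric, irreflexive neighbor relation \<open>N\<close> on \<open>V\<close>.
  A point of the metric graph is represented by its barycentric coordinates: the point at
  distance \<open>t\<close> from \<open>v\<close> on the edge \<open>[v, w]\<close> is the function with value \<open>1 - t\<close> at \<open>v\<close> and \<open>t\<close> at \<open>w\<close>.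
  This performs the gluing, since \<open>edge_point v w 0\<close> does not depend on \<open>w\<close>
  and \<open>edge_point v w t = edge_point w v (1 - t)\<close>.
\<close>

definition vertex_point :: "'v \<Rightarrow> 'v \<Rightarrow> real" where
  "vertex_point v = indicator {v}"

definition edge_point :: "'v \<Rightarrow> 'v \<Rightarrow> real \<Rightarrow> 'v \<Rightarrow> real" where
  "edge_point v w t = (\<lambda>x. (1 - t) * vertex_point v x + t * vertex_point w x)"

definition graph_points :: "'v set \<Rightarrow> ('v \<Rightarrow> 'v \<Rightarrow> bool) \<Rightarrow> ('v \<Rightarrow> real) set" where
  "graph_points V N = vertex_point ` V \<union> {edge_point v w t | v w t. N v w \<and> t \<in> {0..1}}"

text \<open>
  \<open>graph_path V N x y l\<close>: there is a path of length \<open>l\<close> from \<open>x\<close> to \<open>y\<close> that is a concatenation of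
  finitely many segments of edges.
\<close>

inductive graph_path ::
    "'v set \<Rightarrow> ('v \<Rightarrow> 'v \<Rightarrow> bool) \<Rightarrow> ('v \<Rightarrow> real) \<Rightarrow> ('v \<Rightarrow> real) \<Rightarrow> real \<Rightarrow> bool"
  for V N where
  trivial: "x \<in> graph_points V N \<Longrightarrow> graph_path V N x x 0"
| segment: "graph_path V N x (edge_point v w s) l \<Longrightarrow> N v w \<Longrightarrow> s \<in> {0..1} \<Longrightarrow> t \<in> {0..1} \<Longrightarrow>
    graph_path V N x (edge_point v w t) (l + \<bar>t - s\<bar>)"

definition graph_metric :: "'v set \<Rightarrow> ('v \<Rightarrow> 'v \<Rightarrow> bool) \<Rightarrow> ('v \<Rightarrow> real) metric" where
  "graph_metric V N =
     metric (graph_points V N, \<lambda>x y. enn2real (INF l \<in> {l. graph_path V N x y l}. ennreal l))"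


section \<open>Uniformization\<close>

definition uniformized_metric :: "'a metric \<Rightarrow> real \<Rightarrow> 'a \<Rightarrow> 'a metric" where
  "uniformized_metric X \<epsilon> x0 =
     metric (mspace X, \<lambda>x y.
       enn2real (INF (\<gamma>, a, b) \<in> {(\<gamma>, a, b). rectifiable_curve X \<gamma> a b \<and> \<gamma> a = x \<and> \<gamma> b = y}.
         line_integral X (\<lambda>z. ennreal (exp (- \<epsilon> * mdist X z x0))) \<gamma> a b))"


section \<open>Hyperbolic fillings\<close>

definition separated :: "real \<Rightarrow> 'z::metric_space set \<Rightarrow> bool" where
  "separated r S \<longleftrightarrow> (\<forall>x\<in>S. \<forall>y\<in>S. x \<noteq> y \<longrightarrow> r \<le> dist x y)"

definition maximal_separated :: "real \<Rightarrow> 'z::metric_space set \<Rightarrow> bool" where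
  "maximal_separated r S \<longleftrightarrow> separated r S \<and> (\<forall>T. S \<subseteq> T \<and> separated r T \<longrightarrow> T = S)"

definition filling_nets :: "real \<Rightarrow> 'z::metric_space \<Rightarrow> (nat \<Rightarrow> 'z set) \<Rightarrow> bool" where
  "filling_nets \<alpha> z0 A \<longleftrightarrow>
     A 0 = {z0} \<and> (\<forall>i\<ge>1. maximal_separated (1 / \<alpha> ^ i) (A i)) \<and> (\<forall>i. A i \<subseteq> A (Suc i))"

definition filling_vertices :: "(nat \<Rightarrow> 'z set) \<Rightarrow> ('z \<times> nat) set" where
  "filling_vertices A = {(z, i). z \<in> A i}"

definition filling_neighbors ::
    "real \<Rightarrow> real \<Rightarrow> (nat \<Rightarrow> 'z::metric_space set) \<Rightarrow> 'z \<times> nat \<Rightarrow> 'z \<times> nat \<Rightarrow> bool" where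
  "filling_neighbors \<alpha> \<tau> A = (\<lambda>(z, i) (y, j).
     (z, i) \<in> filling_vertices A \<and> (y, j) \<in> filling_vertices A \<and> (z, i) \<noteq> (y, j) \<and>
     (i = j \<and> ball z (\<tau> / \<alpha> ^ i) \<inter> ball y (\<tau> / \<alpha> ^ i) \<noteq> {} \<or>
      (j = Suc i \<or> i = Suc j) \<and> ball z (1 / \<alpha> ^ i) \<inter> ball y (1 / \<alpha> ^ j) \<noteq> {}))"

definition filling :: "real \<Rightarrow> real \<Rightarrow> (nat \<Rightarrow> 'z::metric_space set) \<Rightarrow> ('z \<times> nat \<Rightarrow> real) metric" where
  "filling \<alpha> \<tau> A = graph_metric (filling_vertices A) (filling_neighbors \<alpha> \<tau> A)"

definition uniformized_filling ::
    "real \<Rightarrow> real \<Rightarrow> real \<Rightarrow> 'z \<Rightarrow> (nat \<Rightarrow> 'z::metric_space set) \<Rightarrow> ('z \<times> nat \<Rightarrow> real) metric" where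
  "uniformized_filling \<alpha> \<tau> \<epsilon> z0 A = uniformized_metric (filling \<alpha> \<tau> A) \<epsilon> (vertex_point (z0, 0))"

type_synonym 'z completed_filling_point = "(nat \<Rightarrow> 'z \<times> nat \<Rightarrow> real) set"

definition completed_filling ::
    "real \<Rightarrow> real \<Rightarrow> real \<Rightarrow> 'z \<Rightarrow> (nat \<Rightarrow> 'z::metric_space set) \<Rightarrow> 'z completed_filling_point metric" where
  "completed_filling \<alpha> \<tau> \<epsilon> z0 A = completion_metric (uniformized_filling \<alpha> \<tau> \<epsilon> z0 A)"

definition filling_embedding ::
    "real \<Rightarrow> real \<Rightarrow> real \<Rightarrow> 'z \<Rightarrow> (nat \<Rightarrow> 'z::metric_space set) \<Rightarrow>
     ('z \<times> nat \<Rightarrow> real) \<Rightarrow> 'z completed_filling_point" where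
  "filling_embedding \<alpha> \<tau> \<epsilon> z0 A = completion_embedding (uniformized_filling \<alpha> \<tau> \<epsilon> z0 A)"

text \<open>The point of the boundary of the uniformized filling that is identified with \<open>z\<close>.\<close>

definition filling_boundary_point ::
    "real \<Rightarrow> real \<Rightarrow> real \<Rightarrow> 'z \<Rightarrow> (nat \<Rightarrow> 'z::metric_space set) \<Rightarrow> 'z \<Rightarrow> 'z completed_filling_point" where
  "filling_boundary_point \<alpha> \<tau> \<epsilon> z0 A z =
     (THE \<xi>. \<xi> \<in> mspace (completed_filling \<alpha> \<tau> \<epsilon> z0 A) \<and>
        (\<forall>\<zeta>. (\<forall>i. \<zeta> i \<in> A i \<and> dist (\<zeta> i) z < 1 / \<alpha> ^ i) \<longrightarrow>
           limitin (mtopology_of (completed_filling \<alpha> \<tau> \<epsilon> z0 A))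
             (\<lambda>i. filling_embedding \<alpha> \<tau> \<epsilon> z0 A (vertex_point (\<zeta> i, i))) \<xi> sequentially))"

definition vertex_weight :: "real \<Rightarrow> 'z::metric_space measure \<Rightarrow> real \<Rightarrow> 'z \<times> nat \<Rightarrow> ennreal" where
  "vertex_weight \<alpha> \<nu> \<beta> = (\<lambda>(z, i). ennreal (exp (- \<beta> * real i)) * emeasure \<nu> (ball z (1 / \<alpha> ^ i)))"

text \<open>
  The length of \<open>B \<inter> [v, w]\<close> is the Lebesgue measure of the set of parameters in \<open>[0, 1]\<close> of its points.
  The resulting measure is zero on the boundary because no edge meets it. As in the defining formula,
  the sum runs over ordered pairs of neighbors.
\<close>

definition filling_measure ::
    "real \<Rightarrow> real \<Rightarrow> real \<Rightarrow> 'z \<Rightarrow> (nat \<Rightarrow> 'z::metric_space set) \<Rightarrow> 'z measure \<Rightarrow> real \<Rightarrow>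
     'z completed_filling_point measure" where
  "filling_measure \<alpha> \<tau> \<epsilon> z0 A \<nu> \<beta> =
     measure_of (mspace (completed_filling \<alpha> \<tau> \<epsilon> z0 A))
       (sets (metric_borel (completed_filling \<alpha> \<tau> \<epsilon> z0 A)))
       (\<lambda>B. \<integral>\<^sup>+ v. (\<integral>\<^sup>+ w. (vertex_weight \<alpha> \<nu> \<beta> v + vertex_weight \<alpha> \<nu> \<beta> w) *
               emeasure lborel {t \<in> {0..1}. filling_embedding \<alpha> \<tau> \<epsilon> z0 A (edge_point v w t) \<in> B}
             \<partial>count_space {w. filling_neighbors \<alpha> \<tau> A v w})
           \<partial>count_space (filling_vertices A))"

end

theory Submission
  imports Defs
begin

text \<open>
  The Besov energy of a function on \<open>Z\<close> with exponent \<open>\<theta>\<close> is a trace of the Dirichlet energy on the filling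
  with respect to \<open>\<mu>\<^sub>\<beta>\<close>, because \<open>\<beta>/\<epsilon> = p(1 - \<theta>)\<close>, and the two Hardy quotients correspond in the same
  way. Write \<open>r\<^sub>i = \<alpha>\<^sup>-\<^sup>i\<close>. An edge at the vertex \<open>(z, i)\<close> has \<open>d\<^sub>\<epsilon>\<close>-length comparable to \<open>r\<^sub>i\<close>, mass
  comparable to \<open>r\<^sub>i\<^sup>p\<^sup>(\<^sup>1\<^sup>-\<^sup>\<theta>\<^sup>)\<nu>(B(z, r\<^sub>i))\<close>, and distance comparable to \<open>d(z, e) + r\<^sub>i\<close> from the boundary point
  \<open>e\<close>. Hence the energy of a function that is linear on edges with vertex values \<open>U\<close> is comparable to the
  discrete energy \<open>\<Sum> r\<^sub>i\<^sup>-\<^sup>\<theta>\<^sup>p \<nu>(B(z, r\<^sub>i)) |U(z, i) - U(w)|\<^sup>p\<close> over all edges, called \<open>vertex_energy\<close> below.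

  Boundary to filling: let \<open>u\<close> be Lipschitz on the filling and \<open>h\<close> a weak upper gradient. A single edge has
  positive modulus, so \<open>h\<close> controls the increments of \<open>u\<close> along edges and therefore the vertex energy. The
  values of \<open>u\<close> on \<open>Z\<close> are limits along chains of vertices; a discrete Hardy inequality sums the telescoping
  tails, which bounds the Besov energy of the trace (\<open>besov_energy_le_tails\<close>) and the difference between
  \<open>u\<close> at a vertex and its trace nearby. So the Hardy quotient of \<open>u\<close> is at most that of the trace plus energies
  (\<open>hardy_lhs_le\<close>), and the fractional Hardy inequality applies to the trace.

  Filling to boundary: for \<open>u\<close> on \<open>Z\<close>, let the value at the vertex \<open>(z, i)\<close> be \<open>u(x)\<close> at a point \<open>x\<close> of
  \<open>B(z, r\<^sub>i)\<close> where the local oscillation of \<open>u\<close> is not larger than twice its mean. The vertex energy of this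
  sample is at most a multiple of the Besov energy of \<open>u\<close>. Its piecewise linear extension is Lipschitz, vanishes
  near \<open>E\<close>, and has the slope along edges as minimal weak upper gradient (\<open>slope_minimal\<close>), so the Hardy
  inequality on the filling applies. A point \<open>x\<close> with \<open>d(x, E)\<close> between \<open>r\<^sub>i\<^sub>+\<^sub>1\<close> and \<open>r\<^sub>i\<close> is charged to a vertex
  of level \<open>i\<close> near \<open>x\<close> and to the edge from there to level \<open>i + 1\<close> (\<open>fractional_lhs_le\<close>).

  The metric \<open>d\<^sub>\<epsilon>\<close> enters through curves of unit speed: explicit curves bound it from above, and a mean value
  inequality for functions whose local Lipschitz constant is at most the weight bounds it from below.
\<close>

section \<open>Lengths of curves and parametrization by arc length\<close>

fun chain_length :: "'a metric => 'a list => real" where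
  "chain_length Y (x # y # zs) = mdist Y x y + chain_length Y (y # zs)"
| "chain_length Y zs = 0"

lemma chain_length_nonneg [simp]: "0 <= chain_length Y xs"
  by (induction Y xs rule: chain_length.induct) auto

lemma sum_dist_eq_chain_length:
  "(\<Sum>i<length ts - 1. ennreal (mdist Y (\<gamma> (ts ! i)) (\<gamma> (ts ! Suc i)))) = ennreal (chain_length Y (map \<gamma> ts))"
proof (induction ts rule: induct_list012)
  case (3 x y zs)
  then show ?case
    by (simp add: sum.lessThan_Suc_shift ennreal_plus[symmetric] del: ennreal_plus sum.lessThan_Suc)
qed auto

lemma curve_length_alt:
  "curve_length Y \<gamma> a b = (SUP ts \<in> {ts. sorted ts & set ts <= {a..b}}. ennreal (chain_length Y (map \<gamma> ts)))"
  unfolding curve_length_def sum_dist_eq_chain_length ..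

lemma chain_length_split:
  "chain_length Y (xs @ c # ys) = chain_length Y (xs @ [c]) + chain_length Y (c # ys)"
  by (induction Y xs rule: chain_length.induct) auto

lemma chain_length_append_ge: "chain_length Y xs + chain_length Y ys <= chain_length Y (xs @ ys)"
proof (induction Y xs rule: chain_length.induct)
  case ("2_2" Y v) then show ?case by (cases ys) auto
qed auto

lemma chain_length_insert:
  assumes "set xs <= mspace Y" "set ys <= mspace Y" "c \<in> mspace Y"
  shows "chain_length Y (xs @ ys) <= chain_length Y (xs @ c # ys)"
  using assms
proof (induction Y xs rule: chain_length.induct)
  case ("2_1" Y) then show ?case by (cases ys) auto
next
  case ("2_2" Y v) then show ?case by (cases ys) (auto simp: mdist_triangle)
qed auto

lemma curve_length_upper:
  assumes "sorted ts" "set ts <= {a..b}"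
  shows "ennreal (chain_length Y (map \<gamma> ts)) <= curve_length Y \<gamma> a b"
  unfolding curve_length_alt by (rule SUP_upper) (use assms in auto)

lemma curve_length_leI:
  assumes "!!ts. sorted ts ==> set ts <= {a..b} ==> ennreal (chain_length Y (map \<gamma> ts)) <= C"
  shows "curve_length Y \<gamma> a b <= C"
  unfolding curve_length_alt by (rule SUP_least) (use assms in auto)

lemma curve_length_cong:
  "(!!t. t \<in> {a..b} ==> \<gamma> t = \<gamma>' t) ==> curve_length Y \<gamma> a b = curve_length Y \<gamma>' a b"
  unfolding curve_length_alt by (intro SUP_cong refl arg_cong[where f = ennreal] arg_cong[where f = "chain_length Y"]) auto

text \<open>A chain through \<open>[a, b]\<close> does not get shorter when \<open>c\<close> is inserted, and splits there.\<close>
lemma curve_length_add: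
  assumes "a <= c" "c <= b" and \<gamma>: "\<gamma> \<in> {a..b} \<rightarrow> mspace Y"
  shows "curve_length Y \<gamma> a b = curve_length Y \<gamma> a c + curve_length Y \<gamma> c b"
proof (rule antisym)
  show "curve_length Y \<gamma> a b <= curve_length Y \<gamma> a c + curve_length Y \<gamma> c b"
  proof (rule curve_length_leI)
    fix ts assume ts: "sorted ts" "set ts <= {a..b}"
    define xs where "xs = filter (%t. t <= c) ts"
    define ys where "ys = filter (%t. ~ t <= c) ts"
    have eq: "ts = xs @ ys"
      using ts(1) unfolding xs_def ys_def
    proof (induction ts)
      case (Cons t ts)
      show ?case
      proof (cases "t <= c")
        case False
        then have "filter (%t. t <= c) ts = []" using Cons(2) by (auto simp: filter_empty_conv)
        then show ?thesis using Cons False by auto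
      qed (use Cons in auto)
    qed simp
    have s: "sorted xs" "sorted ys" "set xs <= {a..c}" "set ys <= {c..b}"
      using ts by (auto simp: xs_def ys_def sorted_wrt_filter)
    have "chain_length Y (map \<gamma> ts) <= chain_length Y (map \<gamma> xs @ \<gamma> c # map \<gamma> ys)"
      unfolding eq map_append
      by (rule chain_length_insert) (use assms s in \<open>auto simp: Pi_iff subset_iff\<close>)
    also have "... = chain_length Y (map \<gamma> (xs @ [c])) + chain_length Y (map \<gamma> (c # ys))"
      by (subst chain_length_split) simp
    finally have "ennreal (chain_length Y (map \<gamma> ts)) \<le>
      ennreal (chain_length Y (map \<gamma> (xs @ [c]))) + ennreal (chain_length Y (map \<gamma> (c # ys)))"
      by (simp add: ennreal_plus[symmetric] del: ennreal_plus)
    also have "... <= curve_length Y \<gamma> a c + curve_length Y \<gamma> c b"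
      by (intro add_mono curve_length_upper) (use s assms in \<open>auto simp: sorted_append\<close>)
    finally show "ennreal (chain_length Y (map \<gamma> ts)) <= curve_length Y \<gamma> a c + curve_length Y \<gamma> c b" .
  qed
  have *: "ennreal (chain_length Y (map \<gamma> xs)) + ennreal (chain_length Y (map \<gamma> ys)) <= curve_length Y \<gamma> a b"
    if "sorted xs" "set xs <= {a..c}" "sorted ys" "set ys <= {c..b}" for xs ys
  proof -
    have "ennreal (chain_length Y (map \<gamma> xs)) + ennreal (chain_length Y (map \<gamma> ys)) <= ennreal (chain_length Y (map \<gamma> (xs @ ys)))"
      using chain_length_append_ge[of Y "map \<gamma> xs" "map \<gamma> ys"]
      by (simp add: ennreal_plus[symmetric] del: ennreal_plus)
    also have "... <= curve_length Y \<gamma> a b"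
      by (rule curve_length_upper) (use that assms in \<open>fastforce simp: sorted_append\<close>)+
    finally show ?thesis .
  qed
  have ne: "{ts::real list. sorted ts & set ts <= {a..b}} ~= {}" for a b
    by (intro ex_in_conv[THEN iffD1] exI[of _ "[]"]) simp
  show "curve_length Y \<gamma> a c + curve_length Y \<gamma> c b <= curve_length Y \<gamma> a b"
    unfolding curve_length_alt[of Y \<gamma> a c] curve_length_alt[of Y \<gamma> c b]
    apply (subst ennreal_SUP_add_left[symmetric, OF ne])
    apply (rule SUP_least)
    apply (subst ennreal_SUP_add_right[OF ne])
    apply (rule SUP_least)
    using * by auto
qed

lemma dist_le_curve_length: "s <= t ==> ennreal (mdist Y (\<gamma> s) (\<gamma> t)) <= curve_length Y \<gamma> s t"
  using curve_length_upper[of "[s,t]" s t Y \<gamma>] by simp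

lemma curve_length_le_increment:
  assumes R: "!!s t. a <= s ==> s <= t ==> t <= b ==> mdist Y (\<gamma> s) (\<gamma> t) <= R t - R s" and "a <= b"
  shows "curve_length Y \<gamma> a b <= ennreal (R b - R a)"
proof (rule curve_length_leI)
  have R': "R s <= R t" if "a <= s" "s <= t" "t <= b" for s t
    using R[OF that] mdist_nonneg[of Y "\<gamma> s" "\<gamma> t"] by linarith
  have *: "chain_length Y (map \<gamma> ts) <= R b - R (hd ts)" if "sorted ts" "set ts <= {a..b}" "ts ~= []" for ts
    using that
  proof (induction ts rule: induct_list012)
    case (3 x y zs)
    then show ?case using R[of x y] by fastforce
  qed (use R' in auto)
  fix ts assume "sorted ts" "set ts <= {a..b}"
  then show "ennreal (chain_length Y (map \<gamma> ts)) <= ennreal (R b - R a)"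
    using *[of ts] R'[of a "hd ts"] R'[of a b] assms(2)
    by (cases "ts = []") (auto intro!: ennreal_leI simp: subset_iff)
qed

text \<open>A chain that almost realizes the length, with its parameters truncated to a slightly different
  interval, is still a chain of almost the same length.\<close>
lemma curve_length_lower_semicontinuous:
  assumes \<gamma>: "continuous_map (top_of_set {a..b}) (mtopology_of Y) \<gamma>"
    and xy: "a <= x" "x <= y" "y <= b" and c: "ennreal c < curve_length Y \<gamma> x y" "0 <= c"
  shows "\<exists>\<delta>>0. \<forall>x' y'. a <= x' & x' <= y' & y' <= b & \<bar>x' - x\<bar> < \<delta> & \<bar>y' - y\<bar> < \<delta> -->
            ennreal c < curve_length Y \<gamma> x' y'"
proof -
  obtain ts where ts: "sorted ts" "set ts <= {x..y}" and cts: "ennreal c < ennreal (chain_length Y (map \<gamma> ts))"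
    using c unfolding curve_length_alt less_SUP_iff by blast
  define clip where "clip = (%p s. max a (min b (max (fst p) (min (snd p) s))) :: real)"
  have \<gamma>space: "\<gamma> \<in> {a..b} \<rightarrow> mspace Y"
    using \<gamma> continuous_map_funspace by fastforce
  have clip: "clip p s \<in> {a..b}" for p s using xy by (auto simp: clip_def)
  have cc: "continuous_map euclidean (mtopology_of Y) (%p. \<gamma> (clip p s))" for s
  proof -
    have "continuous_map euclidean (top_of_set {a..b}) (%p. clip p s)"
      unfolding continuous_map_in_subtopology using clip
      by (auto simp: clip_def image_subset_iff intro!: continuous_intros)
    from continuous_map_compose[OF this \<gamma>] show ?thesis by (simp add: o_def)
  qed
  have cont: "continuous_on UNIV (%p. chain_length Y (map (%s. \<gamma> (clip p s)) ts))"
  proof (induction ts rule: induct_list012)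
    case (3 u v zs)
    have "continuous_on UNIV (%p. mdist Y (\<gamma> (clip p u)) (\<gamma> (clip p v)))"
      using continuous_map_mdist[OF cc cc] by simp
    from continuous_on_add[OF this 3(2)] show ?case by simp
  qed auto
  have "map (%s. \<gamma> (clip (x, y) s)) ts = map \<gamma> ts"
    using ts xy by (force simp: clip_def subset_iff max_def min_def)
  then have eq: "chain_length Y (map (%s. \<gamma> (clip (x, y) s)) ts) = chain_length Y (map \<gamma> ts)"
    by (rule arg_cong)
  have "open ((%p. chain_length Y (map (%s. \<gamma> (clip p s)) ts)) -` {c<..})"
    using cont open_greaterThan by (rule open_vimage[rotated])
  moreover have "(x, y) \<in> (%p. chain_length Y (map (%s. \<gamma> (clip p s)) ts)) -` {c<..}"
    using cts c eq by (simp add: ennreal_less_iff)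
  ultimately obtain S T where ST: "open S" "open T" "x \<in> S" "y \<in> T"
     "S \<times> T <= (%p. chain_length Y (map (%s. \<gamma> (clip p s)) ts)) -` {c<..}"
    by (metis open_prod_elim mem_Sigma_iff)
  obtain d1 d2 where d: "d1 > 0" "d2 > 0" "ball x d1 <= S" "ball y d2 <= T"
    using ST by (metis open_contains_ball)
  have "ennreal c < curve_length Y \<gamma> x' y'"
    if h: "a <= x'" "x' <= y'" "y' <= b" "\<bar>x' - x\<bar> < min d1 d2" "\<bar>y' - y\<bar> < min d1 d2" for x' y'
  proof -
    have "x' \<in> S" "y' \<in> T" using h d by (auto simp: dist_real_def subset_iff abs_minus_commute)
    then have "c < chain_length Y (map \<gamma> (map (clip (x', y')) ts))"
      using ST(5) by (auto simp: o_def subset_iff)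
    moreover have "sorted (map (clip (x', y')) ts)"
      using ts(1) by (auto simp: sorted_map clip_def elim!: sorted_wrt_mono_rel[rotated])
    moreover have "set (map (clip (x', y')) ts) <= {x'..y'}"
      using h by (auto simp: clip_def)
    ultimately show ?thesis
      using curve_length_upper[of "map (clip (x', y')) ts" x' y' Y \<gamma>] c
      by (metis ennreal_less_iff less_le_trans)
  qed
  then show ?thesis using d by (intro exI[of _ "min d1 d2"]) auto
qed

lemma rectifiable_curve_funspace: "rectifiable_curve Y \<gamma> a b ==> \<gamma> \<in> {a..b} \<rightarrow> mspace Y"
  unfolding rectifiable_curve_def using continuous_map_funspace by fastforce

lemma curve_length_finite:
  assumes "rectifiable_curve Y \<gamma> a b" "a <= s" "s <= t" "t <= b"
  shows "curve_length Y \<gamma> s t < \<infinity>"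
proof -
  have "curve_length Y \<gamma> a b = curve_length Y \<gamma> a s + (curve_length Y \<gamma> s t + curve_length Y \<gamma> t b)"
    using rectifiable_curve_funspace[OF assms(1)] assms
    by (subst curve_length_add[of a s], simp, simp, simp, subst curve_length_add[of s t b]) (auto simp: Pi_iff)
  moreover have "curve_length Y \<gamma> a b < \<infinity>" using assms by (simp add: rectifiable_curve_def)
  ultimately show ?thesis by (auto simp: less_top)
qed

text \<open>The lengths of the parts before and after \<open>t\<close> are lower semicontinuous in \<open>t\<close>, and their sum is constant.\<close>
lemma continuous_on_curve_length:
  assumes "rectifiable_curve Y \<gamma> a b"
  shows "continuous_on {a..b} (%t. enn2real (curve_length Y \<gamma> a t))"
  unfolding continuous_on_iff
proof (intro ballI allI impI)
  fix t and e :: real assume t: "t \<in> {a..b}" and e: "0 < e"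
  have ab: "a <= b" and \<gamma>: "continuous_map (top_of_set {a..b}) (mtopology_of Y) \<gamma>"
    using assms by (auto simp: rectifiable_curve_def)
  define L L' where "L = (%t. enn2real (curve_length Y \<gamma> a t))" and "L' = (%t. enn2real (curve_length Y \<gamma> t b))"
  have fin: "curve_length Y \<gamma> a s = ennreal (L s)" "curve_length Y \<gamma> s b = ennreal (L' s)" if "s \<in> {a..b}" for s
    using that curve_length_finite[OF assms] ab by (auto simp: L_def L'_def less_top)
  have nn: "0 <= L s" "0 <= L' s" for s by (auto simp: L_def L'_def)
  have sum: "L s + L' s = L b" if "s \<in> {a..b}" for s
  proof -
    have "ennreal (L b) = ennreal (L s) + ennreal (L' s)"
      using fin[OF that] fin(1)[of b] curve_length_add[of a s b \<gamma> Y] rectifiable_curve_funspace[OF assms] that ab by auto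
    then show ?thesis using nn by (simp add: ennreal_plus[symmetric] del: ennreal_plus)
  qed
  have 1: "\<exists>d>0. \<forall>s\<in>{a..b}. \<bar>s - t\<bar> < d --> L t - e < L s"
  proof (cases "L t - e < 0")
    case True
    then show ?thesis using nn by (intro exI[of _ 1]) (meson less_le_trans zero_less_one)
  next
    case False
    then have "ennreal (L t - e) < curve_length Y \<gamma> a t" using False e t by (simp add: fin ennreal_less_iff)
    from curve_length_lower_semicontinuous[OF \<gamma> _ _ _ this] False t obtain d where d: "d > 0"
      "\<forall>x' y'. a <= x' & x' <= y' & y' <= b & \<bar>x' - a\<bar> < d & \<bar>y' - t\<bar> < d --> ennreal (L t - e) < curve_length Y \<gamma> x' y'"
      by auto
    have "L t - e < L s" if "s \<in> {a..b}" "\<bar>s - t\<bar> < d" for s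
      using d(2)[rule_format, of a s] that d(1) False by (auto simp: fin ennreal_less_iff)
    then show ?thesis using d by blast
  qed
  have 2: "\<exists>d>0. \<forall>s\<in>{a..b}. \<bar>s - t\<bar> < d --> L' t - e < L' s"
  proof (cases "L' t - e < 0")
    case True
    then show ?thesis using nn by (intro exI[of _ 1]) (meson less_le_trans zero_less_one)
  next
    case False
    have "ennreal (L' t - e) < curve_length Y \<gamma> t b" using False e t by (simp add: fin ennreal_less_iff)
    from curve_length_lower_semicontinuous[OF \<gamma> _ _ _ this] False t obtain d where d: "d > 0"
      "\<forall>x' y'. a <= x' & x' <= y' & y' <= b & \<bar>x' - t\<bar> < d & \<bar>y' - b\<bar> < d --> ennreal (L' t - e) < curve_length Y \<gamma> x' y'"
      by auto
    have "L' t - e < L' s" if "s \<in> {a..b}" "\<bar>s - t\<bar> < d" for s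
      using d(2)[rule_format, of s b] that d(1) False by (auto simp: fin ennreal_less_iff)
    then show ?thesis using d by blast
  qed
  obtain d1 d2 where d: "d1 > 0" "d2 > 0" "\<forall>s\<in>{a..b}. \<bar>s - t\<bar> < d1 --> L t - e < L s"
    "\<forall>s\<in>{a..b}. \<bar>s - t\<bar> < d2 --> L' t - e < L' s" using 1 2 by blast
  have "\<bar>L s - L t\<bar> < e" if "s \<in> {a..b}" "\<bar>s - t\<bar> < min d1 d2" for s
    using d that sum[of s] sum[OF t] by (smt (verit))
  then show "\<exists>d>0. \<forall>x'\<in>{a..b}. dist x' t < d --> dist (enn2real (curve_length Y \<gamma> a x')) (enn2real (curve_length Y \<gamma> a t)) < e"
    using d by (intro exI[of _ "min d1 d2"]) (auto simp: L_def dist_real_def)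
qed

text \<open>Lipschitz with constant one and of full length; equivalently, parametrized by arc length.\<close>
definition unit_speed :: "'a metric => (real => 'a) => real => bool" where
  "unit_speed Y \<sigma> l \<longleftrightarrow> 0 <= l & \<sigma> \<in> {0..l} \<rightarrow> mspace Y \<and>
     (\<forall>s\<in>{0..l}. \<forall>t\<in>{0..l}. mdist Y (\<sigma> s) (\<sigma> t) <= \<bar>s - t\<bar>) & ennreal l <= curve_length Y \<sigma> 0 l"

lemma unit_speed_lipschitz:
  assumes "unit_speed Y \<sigma> l" "s \<in> {0..l}" "t \<in> {0..l}" shows "mdist Y (\<sigma> s) (\<sigma> t) <= \<bar>s - t\<bar>"
  using assms unfolding unit_speed_def by blast

lemma unit_speed_mspace: "unit_speed Y \<sigma> l ==> s \<in> {0..l} ==> \<sigma> s \<in> mspace Y"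
  by (auto simp: unit_speed_def)

lemma unit_speed_nonneg: "unit_speed Y \<sigma> l ==> 0 <= l"
  by (auto simp: unit_speed_def)

lemma lipschitz_continuous_map_interval:
  assumes "\<sigma> \<in> {a..b} \<rightarrow> mspace Y" "!!s t. s \<in> {a..b} ==> t \<in> {a..b} ==> mdist Y (\<sigma> s) (\<sigma> t) <= K * \<bar>s - t\<bar>"
  shows "continuous_map (top_of_set {a..b}) (mtopology_of Y) (\<sigma> :: real => _)"
proof -
  have "Lipschitz_continuous_map (submetric euclidean_metric {a..b}) Y \<sigma>"
    unfolding Lipschitz_continuous_map_def using assms
    by (auto simp: dist_real_def mspace_submetric intro!: exI[of _ K])
  then show ?thesis
    by (metis Lipschitz_imp_uniformly_continuous_map mtopology_of_euclidean mtopology_of_submetric uniformly_continuous_imp_continuous_map)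
qed

text \<open>The length of each half is at most its parameter length, and the two halves add up to at least \<open>l\<close>.\<close>
lemma unit_speed_length:
  assumes u: "unit_speed Y \<sigma> l" and s: "s \<in> {0..l}"
  shows "curve_length Y \<sigma> 0 s = ennreal s"
proof -
  have 1: "curve_length Y \<sigma> x y <= ennreal (y - x)" if "0 <= x" "x <= y" "y <= l" for x y
  proof (rule curve_length_le_increment)
    fix s t assume "x <= s" "s <= t" "t <= y"
    then have "s \<in> {0..l}" "t \<in> {0..l}" using that by auto
    then have "mdist Y (\<sigma> s) (\<sigma> t) <= \<bar>s - t\<bar>" using u by (simp add: unit_speed_def)
    then show "mdist Y (\<sigma> s) (\<sigma> t) <= t - s" using \<open>s <= t\<close> by simp
  qed fact
  have "ennreal l <= curve_length Y \<sigma> 0 s + curve_length Y \<sigma> s l"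
    using u s by (subst curve_length_add[symmetric]) (auto simp: unit_speed_def)
  also have "... <= curve_length Y \<sigma> 0 s + ennreal (l - s)"
    using 1[of s l] s by (intro add_left_mono) auto
  finally have *: "ennreal l <= curve_length Y \<sigma> 0 s + ennreal (l - s)" .
  have le: "curve_length Y \<sigma> 0 s <= ennreal s" using 1[of 0 s] s by auto
  obtain c where c: "curve_length Y \<sigma> 0 s = ennreal c" "0 <= c"
    using le by (cases "curve_length Y \<sigma> 0 s") (auto simp: top_unique)
  have "l <= c + (l - s)" using * c s by (simp add: ennreal_plus[symmetric] del: ennreal_plus)
  then show ?thesis using le c s by (auto intro!: antisym)
qed

lemma unit_speed_rectifiable: "unit_speed Y \<sigma> l ==> rectifiable_curve Y \<sigma> 0 l"
  unfolding rectifiable_curve_def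
  using unit_speed_length[of Y \<sigma> l l] lipschitz_continuous_map_interval[of \<sigma> 0 l Y 1]
  by (auto simp: unit_speed_def)

lemma unit_speed_line_integral:
  assumes "unit_speed Y \<sigma> l"
  shows "line_integral Y g \<sigma> 0 l = (\<integral>\<^sup>+s\<in>{0..l}. g (\<sigma> s) \<partial>lborel)"
proof -
  have l: "enn2real (curve_length Y \<sigma> 0 s) = s" if "s \<in> {0..l}" for s
    using unit_speed_length[OF assms that] that by simp
  have "0 <= l" using assms by (simp add: unit_speed_def)
  have "arc_length_param Y \<sigma> 0 l s = \<sigma> s" if s: "s \<in> {0..l}" for s
  proof -
    have "(SOME t. t \<in> {0..l} & enn2real (curve_length Y \<sigma> 0 t) = s) = s"
      by (rule some_equality) (use l s in auto)
    then show ?thesis unfolding arc_length_param_def by simp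
  qed
  then show ?thesis unfolding line_integral_def using l[of l] \<open>0 <= l\<close>
    by (auto intro!: nn_integral_cong simp: indicator_def)
qed

lemma rectifiable_length_split:
  assumes r: "rectifiable_curve Y \<gamma> a b" and "a <= s" "s <= t" "t <= b"
  shows "enn2real (curve_length Y \<gamma> a t) = enn2real (curve_length Y \<gamma> a s) + enn2real (curve_length Y \<gamma> s t)"
  using assms rectifiable_curve_funspace[OF r] curve_length_finite[OF r]
  by (subst curve_length_add[of a s t]) (auto simp: enn2real_plus Pi_iff)

text \<open>The choice of a parameter in \<open>arc_length_param\<close> is harmless: where its length is constant, the curve is constant.\<close>
lemma rectifiable_unit_speed:
  assumes r: "rectifiable_curve Y \<gamma> a b"
  shows "\<exists>\<sigma> l. unit_speed Y \<sigma> l & \<sigma> 0 = \<gamma> a & \<sigma> l = \<gamma> b & l = enn2real (curve_length Y \<gamma> a b) \<and>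
    (\<forall>t\<in>{a..b}. \<sigma> (enn2real (curve_length Y \<gamma> a t)) = \<gamma> t) \<and>
    (\<forall>g. line_integral Y g \<gamma> a b = (\<integral>\<^sup>+s\<in>{0..l}. g (\<sigma> s) \<partial>lborel))"
proof -
  have ab: "a <= b" and \<gamma>: "continuous_map (top_of_set {a..b}) (mtopology_of Y) \<gamma>"
    using assms by (auto simp: rectifiable_curve_def)
  have sp: "\<gamma> \<in> {a..b} \<rightarrow> mspace Y" by (rule rectifiable_curve_funspace[OF r])
  define L where "L = (%t. enn2real (curve_length Y \<gamma> a t))"
  define \<sigma> where "\<sigma> = arc_length_param Y \<gamma> a b"
  have L0: "L a = 0"
  proof -
    have "\<gamma> a \<in> mspace Y" using sp ab by auto
    then have "mdist Y (\<gamma> s) (\<gamma> t) <= 0" if "a <= s" "s <= t" "t <= a" for s t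
      using that by (metis dual_order.antisym dual_order.trans mdist_zero order_refl)
    then have "curve_length Y \<gamma> a a <= ennreal (0 - 0)"
      by (intro curve_length_le_increment[of a a Y \<gamma> "%_. 0"]) auto
    then show ?thesis by (simp add: L_def)
  qed
  have dL: "mdist Y (\<gamma> s) (\<gamma> t) <= L t - L s" if "a <= s" "s <= t" "t <= b" for s t
  proof -
    have "ennreal (mdist Y (\<gamma> s) (\<gamma> t)) <= curve_length Y \<gamma> s t" using that by (intro dist_le_curve_length)
    then have "mdist Y (\<gamma> s) (\<gamma> t) <= enn2real (curve_length Y \<gamma> s t)"
      using curve_length_finite[OF r, of s t] that by (cases "curve_length Y \<gamma> s t") (auto simp: less_top)
    then show ?thesis using rectifiable_length_split[OF r, of s t] that by (simp add: L_def)
  qed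
  have Lmono: "L s <= L t" if "a <= s" "s <= t" "t <= b" for s t
    using dL[OF that] mdist_nonneg[of Y "\<gamma> s" "\<gamma> t"] by linarith
  have Lcont: "continuous_on {a..b} L" unfolding L_def by (rule continuous_on_curve_length[OF r])
  have ex: "\<exists>t. t \<in> {a..b} & L t = s" if "s \<in> {0..L b}" for s
  proof -
    have "L a <= s" "s <= L b" using that L0 by auto
    from IVT'[OF this ab Lcont] show ?thesis by auto
  qed
  have eqL: "\<gamma> s = \<gamma> t" if "s \<in> {a..b}" "t \<in> {a..b}" "L s = L t" for s t
  proof -
    have *: "\<gamma> x = \<gamma> y" if xy: "x \<in> {a..b}" "y \<in> {a..b}" "L x = L y" "x <= y" for x y
    proof -
      have "mdist Y (\<gamma> x) (\<gamma> y) = 0"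
        using dL[of x y] xy mdist_nonneg[of Y "\<gamma> x" "\<gamma> y"] by simp
      moreover have "\<gamma> x \<in> mspace Y" "\<gamma> y \<in> mspace Y" using sp xy by blast+
      ultimately show ?thesis by simp
    qed
    show ?thesis using * that by (metis linear)
  qed
  have sel: "\<exists>t. t \<in> {a..b} & L t = s & \<sigma> s = \<gamma> t" if "s \<in> {0..L b}" for s
    using someI_ex[OF ex[OF that]] unfolding \<sigma>_def arc_length_param_def L_def by blast
  have \<sigma>L: "\<sigma> (L t) = \<gamma> t" if "t \<in> {a..b}" for t
  proof -
    have "L t \<in> {0..L b}" using Lmono[of a t] Lmono[of t b] that L0 by simp
    then obtain t' where t': "t' \<in> {a..b}" "L t' = L t" "\<sigma> (L t) = \<gamma> t'" using sel by blast
    have "\<gamma> t' = \<gamma> t" by (rule eqL) (use t' that in auto)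
    with t' show ?thesis by simp
  qed
  have lip: "mdist Y (\<sigma> x) (\<sigma> y) <= \<bar>x - y\<bar>" if x: "x \<in> {0..L b}" and y: "y \<in> {0..L b}" for x y
  proof -
    obtain s where "s \<in> {a..b}" "L s = x" "\<sigma> x = \<gamma> s" using sel[OF x] by blast
    moreover obtain t where "t \<in> {a..b}" "L t = y" "\<sigma> y = \<gamma> t" using sel[OF y] by blast
    ultimately have st: "s \<in> {a..b}" "L s = x" "\<sigma> x = \<gamma> s" "t \<in> {a..b}" "L t = y" "\<sigma> y = \<gamma> t" .
    show ?thesis
    proof (cases "s <= t")
      case True
      then show ?thesis using dL[of s t] st by auto
    next
      case False
      then show ?thesis using dL[of t s] st mdist_commute[of Y "\<gamma> t" "\<gamma> s"] by auto
    qed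
  qed
  have "curve_length Y \<gamma> a b <= curve_length Y \<sigma> 0 (L b)"
  proof (rule curve_length_leI)
    fix ts assume ts: "sorted ts" "set ts <= {a..b}"
    have "map \<gamma> ts = map \<sigma> (map L ts)" using ts \<sigma>L by (simp add: subset_iff)
    moreover have "sorted (map L ts)"
      using ts Lmono by (auto simp: sorted_map subset_iff intro: sorted_wrt_mono_rel[rotated])
    moreover have "set (map L ts) <= {0..L b}" using ts Lmono L0 by (fastforce simp: subset_iff)
    ultimately show "ennreal (chain_length Y (map \<gamma> ts)) <= curve_length Y \<sigma> 0 (L b)"
      by (simp only: curve_length_upper)
  qed
  moreover have "curve_length Y \<gamma> a b = ennreal (L b)"
    using curve_length_finite[OF r, of a b] ab by (simp add: L_def less_top)
  moreover have "\<sigma> \<in> {0..L b} \<rightarrow> mspace Y" using sel sp by fastforce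
  moreover have "0 <= L b" by (simp add: L_def)
  ultimately have "unit_speed Y \<sigma> (L b)"
    using lip unfolding unit_speed_def by simp
  moreover have "\<sigma> 0 = \<gamma> a" "\<sigma> (L b) = \<gamma> b" using \<sigma>L[of a] \<sigma>L[of b] L0 ab by auto
  moreover have "line_integral Y g \<gamma> a b = (\<integral>\<^sup>+s\<in>{0..L b}. g (\<sigma> s) \<partial>lborel)" for g
    by (simp add: line_integral_def L_def \<sigma>_def)
  moreover have "L b = enn2real (curve_length Y \<gamma> a b)" "\<forall>t\<in>{a..b}. \<sigma> (enn2real (curve_length Y \<gamma> a t)) = \<gamma> t"
    using \<sigma>L by (simp_all add: L_def)
  ultimately show ?thesis by (intro exI[of _ \<sigma>] exI[of _ "L b"] conjI allI)
qed

lemma curve_length_shift: "curve_length Y (%s. \<sigma> (s - c)) (a + c) (b + c) = curve_length Y \<sigma> a b"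
proof -
  have *: "curve_length Y (%s. \<sigma> (s - c)) (a + c) (b + c) <= curve_length Y \<sigma> a b" for \<sigma> :: "real => 'a" and a b c
  proof (rule curve_length_leI)
    fix ts assume "sorted ts" "set ts <= {a + c..b + c}"
    then have "sorted (map (%s. s - c) ts)" "set (map (%s. s - c) ts) <= {a..b}"
      by (auto simp: sorted_map)
    from curve_length_upper[OF this, of Y \<sigma>]
    show "ennreal (chain_length Y (map (%s. \<sigma> (s - c)) ts)) <= curve_length Y \<sigma> a b"
      by (simp add: o_def)
  qed
  show ?thesis
    using *[of \<sigma> c a b] *[of "%s. \<sigma> (s - c)" "-c" "a + c" "b + c"] by simp
qed

lemma chain_length_rev: "chain_length Y (rev xs) = chain_length Y xs"
proof (induction Y xs rule: chain_length.induct)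
  case (1 Y x y zs)
  have "chain_length Y (rev (x # y # zs)) = chain_length Y (rev zs @ [y]) + chain_length Y [y, x]"
    using chain_length_split[of Y "rev zs" y "[x]"] by simp
  then show ?case using 1 by (simp add: mdist_commute)
qed auto

lemma curve_length_reverse: "curve_length Y \<sigma> 0 l <= curve_length Y (%s. \<sigma> (l - s)) 0 l"
proof (rule curve_length_leI)
  fix ts assume ts: "sorted ts" "set ts <= {0..l}"
  have "sorted (rev (map (%s. l - s) ts))" "set (rev (map (%s. l - s) ts)) <= {0..l}"
    using ts by (auto simp: sorted_map sorted_wrt_rev sorted_wrt_map elim!: sorted_wrt_mono_rel[rotated])
  from curve_length_upper[OF this, of Y "%s. \<sigma> (l - s)"]
  have "ennreal (chain_length Y (rev (map \<sigma> ts))) <= curve_length Y (%s. \<sigma> (l - s)) 0 l"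
    by (simp add: rev_map[symmetric] o_def)
  then show "ennreal (chain_length Y (map \<sigma> ts)) <= curve_length Y (%s. \<sigma> (l - s)) 0 l"
    by (simp only: chain_length_rev)
qed

lemma unit_speed_reverse:
  assumes u: "unit_speed Y \<sigma> l" shows "unit_speed Y (%s. \<sigma> (l - s)) l"
  unfolding unit_speed_def
proof (intro conjI ballI)
  show "0 <= l" "(%s. \<sigma> (l - s)) \<in> {0..l} \<rightarrow> mspace Y" using u by (auto simp: unit_speed_def)
  show "ennreal l <= curve_length Y (%s. \<sigma> (l - s)) 0 l"
    using curve_length_reverse[of Y \<sigma> l] u unfolding unit_speed_def by (meson order_trans)
  fix s t assume "s \<in> {0..l}" "t \<in> {0..l}"
  then show "mdist Y (\<sigma> (l - s)) (\<sigma> (l - t)) <= \<bar>s - t\<bar>"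
    using unit_speed_lipschitz[OF u, of "l - s" "l - t"] by (simp add: abs_minus_commute)
qed

lemma unit_speed_join:
  assumes u: "unit_speed Y \<sigma> l" "unit_speed Y \<tau> m" and eq: "\<sigma> l = \<tau> 0"
  shows "unit_speed Y (%s. if s <= l then \<sigma> s else \<tau> (s - l)) (l + m)"
proof -
  let ?r = "%s. if s <= l then \<sigma> s else \<tau> (s - l)"
  have lm: "0 <= l" "0 <= m" using u unit_speed_nonneg by blast+
  have sp: "?r \<in> {0..l + m} \<rightarrow> mspace Y" using unit_speed_mspace[OF u(1)] unit_speed_mspace[OF u(2)] by simp
  have cross: "mdist Y (\<sigma> s) (\<tau> (t - l)) <= t - s" if "0 <= s" "s <= l" "l <= t" "t <= l + m" for s t
  proof -
    have "\<sigma> s \<in> mspace Y" "\<sigma> l \<in> mspace Y" "\<tau> (t - l) \<in> mspace Y"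
      using that lm by (simp_all add: unit_speed_mspace[OF u(1)] unit_speed_mspace[OF u(2)])
    then have "mdist Y (\<sigma> s) (\<tau> (t - l)) <= mdist Y (\<sigma> s) (\<sigma> l) + mdist Y (\<tau> 0) (\<tau> (t - l))"
      using mdist_triangle eq by metis
    also have "... <= \<bar>s - l\<bar> + \<bar>0 - (t - l)\<bar>"
      by (intro add_mono unit_speed_lipschitz[OF u(1)] unit_speed_lipschitz[OF u(2)]) (use that lm in auto)
    finally show ?thesis using that by auto
  qed
  have lip: "mdist Y (?r s) (?r t) <= \<bar>s - t\<bar>" if s: "s \<in> {0..l + m}" "t \<in> {0..l + m}" for s t
  proof -
    consider "s <= l" "t <= l" | "s <= l" "~ t <= l" | "~ s <= l" "t <= l" | "~ s <= l" "~ t <= l" by blast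
    then show ?thesis
    proof cases
      case 1 then show ?thesis using unit_speed_lipschitz[OF u(1), of s t] s by simp
    next
      case 2 then show ?thesis using cross[of s t] s by auto
    next
      case 3 then show ?thesis using cross[of t s] s mdist_commute[of Y "\<tau> (s - l)" "\<sigma> t"] by simp
    next
      case 4
      then have "mdist Y (\<tau> (s - l)) (\<tau> (t - l)) <= \<bar>(s - l) - (t - l)\<bar>"
        using s by (intro unit_speed_lipschitz[OF u(2)]) auto
      then show ?thesis using 4 by simp
    qed
  qed
  have "curve_length Y ?r 0 (l + m) = curve_length Y ?r 0 l + curve_length Y ?r l (l + m)"
    by (rule curve_length_add) (use lm sp in auto)
  also have "curve_length Y ?r 0 l = curve_length Y \<sigma> 0 l" by (rule curve_length_cong) auto
  also have "curve_length Y ?r l (l + m) = curve_length Y (%s. \<tau> (s - l)) (0 + l) (m + l)"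
    unfolding add.commute[of m] add_0 by (rule curve_length_cong) (use eq in \<open>auto simp: add.commute\<close>)
  also have "... = curve_length Y \<tau> 0 m" by (rule curve_length_shift)
  finally have "curve_length Y ?r 0 (l + m) = ennreal (l + m)"
    using unit_speed_length[OF u(1), of l] unit_speed_length[OF u(2), of m] lm by simp
  then show ?thesis unfolding unit_speed_def using lm sp lip by (intro conjI ballI) simp_all
qed

section \<open>A mean value inequality\<close>

text \<open>The inequality with a linear error \<open>\<eta>(y - x)\<close> is additive over adjacent intervals and holds on all short intervals
  around every point outside \<open>F\<close>, so bisection gives it globally. The null set \<open>F\<close> is covered by an open set of small
  measure, on which the Lipschitz bound costs little.\<close>
lemma increment_le_nn_integral:
  fixes f :: "real => real" and k :: "real => ennreal"
  assumes ab: "a <= b" and k: "(%s. k s * indicator {a..b} s) \<in> borel_measurable lborel"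
    and F: "F \<in> null_sets lebesgue" and L: "0 <= L"
    and lip: "!!x y. F ~= {} ==> a <= x ==> x <= y ==> y <= b ==> \<bar>f y - f x\<bar> <= L * (y - x)"
    and loc: "!!x \<eta>. x \<in> {a..b} - F ==> 0 < \<eta> ==> \<exists>\<delta>>0. \<forall>x' y'. a <= x' & x' <= x & x <= y' & y' <= b & y' - x' < \<delta> -->
        ennreal \<bar>f y' - f x'\<bar> <= (\<integral>\<^sup>+s\<in>{x'<..y'}. k s \<partial>lborel) + ennreal (\<eta> * (y' - x'))"
  shows "ennreal \<bar>f b - f a\<bar> <= (\<integral>\<^sup>+s\<in>{a..b}. k s \<partial>lborel)"
proof -
  have main: "ennreal \<bar>f b - f a\<bar> <= (\<integral>\<^sup>+s\<in>{a..b}. k s \<partial>lborel) + ennreal (\<eta> * (b - a + L))" if \<eta>: "0 < \<eta>" for \<eta>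
  proof -
    obtain O' where O': "open O'" "F <= O'" "emeasure lebesgue (O' - F) < ennreal \<eta>"
      using sets_lebesgue_outer_open[of F \<eta>] F \<eta> by blast
    have "emeasure lebesgue O' <= emeasure lebesgue (O' - F) + emeasure lebesgue F"
    proof -
      have "O' = (O' - F) \<union> F" "O' - F \<in> sets lebesgue" "F \<in> sets lebesgue"
        using O' F by (auto simp: null_sets_def borel_open intro!: sets.Diff)
      then show ?thesis using emeasure_subadditive[of "O' - F" lebesgue F] by simp
    qed
    then have meas: "emeasure lborel O' <= ennreal \<eta>"
      using F O' null_setsD1[OF F] by (simp add: borel_open)
    define P where "P = (%x y. a <= x & y <= b --> ennreal \<bar>f y - f x\<bar> \<le>
      (\<integral>\<^sup>+s\<in>{x<..y}. k s \<partial>lborel) + ennreal (\<eta> * (y - x)) + ennreal L * emeasure lborel (O' \<inter> {x<..y}))"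
    have "P a b" using ab
    proof (induct rule: Bolzano)
      case (trans x y z)
      show ?case unfolding P_def
      proof (intro impI, elim conjE)
        assume xz: "a <= x" "z <= b"
        have k': "(%s. k s * indicator {c<..d} s) \<in> borel_measurable lborel" if "a <= c" "d <= b" for c d
        proof -
          have "(%s. (k s * indicator {a..b} s) * indicator {c<..d} s) \<in> borel_measurable lborel"
            using k by measurable
          also have "(%s. (k s * indicator {a..b} s) * indicator {c<..d} s) = (%s. k s * indicator {c<..d} s)"
            using that by (auto simp: indicator_def)
          finally show ?thesis .
        qed
        have "(\<integral>\<^sup>+s\<in>{x<..z}. k s \<partial>lborel) = (\<integral>\<^sup>+s. k s * indicator {x<..y} s + k s * indicator {y<..z} s \<partial>lborel)"
          using trans by (intro nn_integral_cong) (auto simp: indicator_def)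
        also have "... = (\<integral>\<^sup>+s\<in>{x<..y}. k s \<partial>lborel) + (\<integral>\<^sup>+s\<in>{y<..z}. k s \<partial>lborel)"
          using trans xz by (intro nn_integral_add k') auto
        finally have 1: "(\<integral>\<^sup>+s\<in>{x<..z}. k s \<partial>lborel) = (\<integral>\<^sup>+s\<in>{x<..y}. k s \<partial>lborel) + (\<integral>\<^sup>+s\<in>{y<..z}. k s \<partial>lborel)" .
        have "O' \<inter> {x<..z} = (O' \<inter> {x<..y}) \<union> (O' \<inter> {y<..z})" using trans by auto
        then have 2: "emeasure lborel (O' \<inter> {x<..z}) = emeasure lborel (O' \<inter> {x<..y}) + emeasure lborel (O' \<inter> {y<..z})"
          using O'(1) by (simp add: plus_emeasure disjoint_iff borel_open)
        have 3: "ennreal (\<eta> * (z - x)) = ennreal (\<eta> * (y - x)) + ennreal (\<eta> * (z - y))"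
          using trans \<eta> by (simp add: ennreal_plus[symmetric] algebra_simps del: ennreal_plus)
        have "ennreal \<bar>f z - f x\<bar> <= ennreal \<bar>f y - f x\<bar> + ennreal \<bar>f z - f y\<bar>"
          by (simp add: ennreal_plus[symmetric] del: ennreal_plus)
        also have "... <= ((\<integral>\<^sup>+s\<in>{x<..y}. k s \<partial>lborel) + ennreal (\<eta> * (y - x)) + ennreal L * emeasure lborel (O' \<inter> {x<..y}))
           + ((\<integral>\<^sup>+s\<in>{y<..z}. k s \<partial>lborel) + ennreal (\<eta> * (z - y)) + ennreal L * emeasure lborel (O' \<inter> {y<..z}))"
          using trans xz unfolding P_def by (intro add_mono) auto
        also have "... = (\<integral>\<^sup>+s\<in>{x<..z}. k s \<partial>lborel) + ennreal (\<eta> * (z - x)) + ennreal L * emeasure lborel (O' \<inter> {x<..z})"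
          unfolding 1 2 3 by (simp only: distrib_left ac_simps)
        finally show "ennreal \<bar>f z - f x\<bar> <= ..." .
      qed
    next
      case (local x)
      show ?case
      proof (cases "x \<in> F")
        case True
        then obtain d where d: "d > 0" "ball x d <= O'" using O' open_contains_ball by blast
        have "P x' y'" if h: "x' <= x" "x <= y'" "y' - x' < d" for x' y'
          unfolding P_def
        proof (intro impI, elim conjE)
          assume xy: "a <= x'" "y' <= b"
          have "{x'<..y'} <= O'" using h d by (auto simp: dist_real_def subset_iff)
          then have "O' \<inter> {x'<..y'} = {x'<..y'}" by blast
          then have "ennreal L * emeasure lborel (O' \<inter> {x'<..y'}) = ennreal (L * (y' - x'))"
            using h L by (simp add: ennreal_mult)
          moreover have "ennreal \<bar>f y' - f x'\<bar> <= ennreal (L * (y' - x'))"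
            using lip[of x' y'] True h xy by (intro ennreal_leI) auto
          ultimately show "ennreal \<bar>f y' - f x'\<bar> <= (\<integral>\<^sup>+s\<in>{x'<..y'}. k s \<partial>lborel) + ennreal (\<eta> * (y' - x')) +
            ennreal L * emeasure lborel (O' \<inter> {x'<..y'})" by (metis add_increasing zero_le)
        qed
        then show ?thesis using d by blast
      next
        case False
        then obtain \<delta> where \<delta>: "\<delta> > 0" "\<forall>x' y'. a <= x' & x' <= x & x <= y' & y' <= b & y' - x' < \<delta> -->
          ennreal \<bar>f y' - f x'\<bar> <= (\<integral>\<^sup>+s\<in>{x'<..y'}. k s \<partial>lborel) + ennreal (\<eta> * (y' - x'))"
          using loc[of x \<eta>] local \<eta> by auto
        have "P x' y'" if h: "x' <= x" "x <= y'" "y' - x' < \<delta>" for x' y'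
          unfolding P_def using \<delta>(2) h by (auto intro: add_increasing2)
        then show ?thesis using \<delta> by blast
      qed
    qed
    then have "ennreal \<bar>f b - f a\<bar> <= (\<integral>\<^sup>+s\<in>{a<..b}. k s \<partial>lborel) + ennreal (\<eta> * (b - a)) + ennreal L * emeasure lborel (O' \<inter> {a<..b})"
      by (simp add: P_def)
    also have "... <= (\<integral>\<^sup>+s\<in>{a..b}. k s \<partial>lborel) + ennreal (\<eta> * (b - a)) + ennreal L * ennreal \<eta>"
    proof (intro add_mono mult_left_mono order_refl)
      show "(\<integral>\<^sup>+s\<in>{a<..b}. k s \<partial>lborel) <= (\<integral>\<^sup>+s\<in>{a..b}. k s \<partial>lborel)"
        by (intro nn_integral_mono) (auto simp: indicator_def)
      show "emeasure lborel (O' \<inter> {a<..b}) <= ennreal \<eta>"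
        using O'(1) by (intro order_trans[OF emeasure_mono meas]) (auto simp: borel_open)
    qed auto
    also have "... = (\<integral>\<^sup>+s\<in>{a..b}. k s \<partial>lborel) + ennreal (\<eta> * (b - a + L))"
      using \<eta> L ab by (simp add: ennreal_mult[symmetric] ennreal_plus[symmetric] add.assoc distrib_left mult.commute del: ennreal_plus)
    finally show ?thesis .
  qed
  show ?thesis
  proof (rule ennreal_le_epsilon)
    fix e :: real assume e: "0 < e"
    have "ennreal \<bar>f b - f a\<bar> <= (\<integral>\<^sup>+s\<in>{a..b}. k s \<partial>lborel) + ennreal (e / (b - a + L + 1) * (b - a + L))"
      using main[of "e / (b - a + L + 1)"] e ab L by simp
    also have "... <= (\<integral>\<^sup>+s\<in>{a..b}. k s \<partial>lborel) + ennreal e"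
      using e ab L by (intro add_left_mono ennreal_leI) (simp add: field_simps)
    finally show "ennreal \<bar>f b - f a\<bar> <= (\<integral>\<^sup>+s\<in>{a..b}. k s \<partial>lborel) + ennreal e" .
  qed
qed

section \<open>The uniformized metric\<close>

locale uniformization =
  fixes X :: "'a metric" and \<epsilon> :: real and x0 :: 'a
  assumes eps: "0 < \<epsilon>" and x0: "x0 \<in> mspace X"
    and joined: "!!x y. x \<in> mspace X ==> y \<in> mspace X ==> \<exists>\<sigma> l. unit_speed X \<sigma> l & \<sigma> 0 = x & \<sigma> l = y"
begin

definition \<rho> :: "'a => real" where "\<rho> x = exp (- \<epsilon> * mdist X x x0)"

definition weighted_length :: "(real => 'a) => real => ennreal" where
  "weighted_length \<sigma> l = (\<integral>\<^sup>+s\<in>{0..l}. ennreal (\<rho> (\<sigma> s)) \<partial>lborel)"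

definition D :: "'a => 'a => ennreal" where
  "D x y = (INF (\<gamma>, a, b) \<in> {(\<gamma>, a, b). rectifiable_curve X \<gamma> a b & \<gamma> a = x & \<gamma> b = y}.
         line_integral X (%z. ennreal (exp (- \<epsilon> * mdist X z x0))) \<gamma> a b)"

lemma \<rho>_pos [simp]: "0 < \<rho> x" "0 <= \<rho> x" and \<rho>_le_1 [simp]: "\<rho> x <= 1"
  using eps by (auto simp: \<rho>_def)

lemma \<rho>_lower:
  assumes "x \<in> mspace X" "y \<in> mspace X" shows "\<rho> x * exp (- \<epsilon> * mdist X x y) <= \<rho> y"
proof -
  have "mdist X y x0 <= mdist X x y + mdist X x x0"
    using mdist_triangle[of y X x x0] assms x0 by (simp add: mdist_commute[of X y x])
  then have "\<epsilon> * mdist X y x0 <= \<epsilon> * (mdist X x y + mdist X x x0)"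
    using eps by (intro mult_left_mono) auto
  then show ?thesis unfolding \<rho>_def exp_add[symmetric] by (simp add: algebra_simps)
qed

lemma \<rho>_lipschitz:
  assumes "x \<in> mspace X" "y \<in> mspace X" shows "\<bar>\<rho> x - \<rho> y\<bar> <= \<epsilon> * mdist X x y"
proof -
  have *: "\<rho> x - \<rho> y <= \<epsilon> * mdist X x y" if "x \<in> mspace X" "y \<in> mspace X" for x y
  proof -
    have "1 - \<epsilon> * mdist X x y <= exp (- \<epsilon> * mdist X x y)"
      using exp_ge_add_one_self[of "- \<epsilon> * mdist X x y"] by simp
    then have "\<rho> x * (1 - \<epsilon> * mdist X x y) <= \<rho> x * exp (- \<epsilon> * mdist X x y)"
      by (intro mult_left_mono) auto
    also have "... <= \<rho> y" by (rule \<rho>_lower[OF that])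
    finally have "\<rho> x - \<rho> y <= \<rho> x * (\<epsilon> * mdist X x y)" by (simp add: algebra_simps)
    also have "... <= 1 * (\<epsilon> * mdist X x y)" using eps by (intro mult_right_mono) auto
    finally show ?thesis by simp
  qed
  show ?thesis using *[OF assms] *[OF assms(2,1)] unfolding mdist_commute[of X y x] by simp
qed

lemma weight_measurable:
  assumes "unit_speed X \<sigma> l"
  shows "(%s. ennreal (\<rho> (\<sigma> s)) * indicator {0..l} s) \<in> borel_measurable lborel"
proof -
  have "continuous_on {0..l} (%s. \<rho> (\<sigma> s))"
  proof (rule lipschitz_on_continuous_on[of \<epsilon>], rule lipschitz_onI)
    fix s t assume st: "s \<in> {0..l}" "t \<in> {0..l}"
    have "\<bar>\<rho> (\<sigma> s) - \<rho> (\<sigma> t)\<bar> <= \<epsilon> * mdist X (\<sigma> s) (\<sigma> t)"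
      using unit_speed_mspace[OF assms] st by (intro \<rho>_lipschitz)
    also have "... <= \<epsilon> * \<bar>s - t\<bar>" using eps unit_speed_lipschitz[OF assms st] by (intro mult_left_mono) auto
    finally show "dist (\<rho> (\<sigma> s)) (\<rho> (\<sigma> t)) <= \<epsilon> * dist s t" by (simp add: dist_real_def)
  qed (use eps in simp)
  then have "(%s. indicator {0..l} s *\<^sub>R \<rho> (\<sigma> s)) \<in> borel_measurable borel"
    by (intro borel_measurable_continuous_on_indicator) auto
  then have "(%s. ennreal (indicator {0..l} s *\<^sub>R \<rho> (\<sigma> s))) \<in> borel_measurable lborel" by simp
  also have "(%s. ennreal (indicator {0..l} s *\<^sub>R \<rho> (\<sigma> s))) = (%s. ennreal (\<rho> (\<sigma> s)) * indicator {0..l} s)"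
    by (auto simp: indicator_def)
  finally show ?thesis .
qed

lemma D_le: "unit_speed X \<sigma> l ==> D (\<sigma> 0) (\<sigma> l) <= weighted_length \<sigma> l"
  unfolding D_def weighted_length_def \<rho>_def unit_speed_line_integral[symmetric]
  by (rule INF_lower2[of "(\<sigma>, 0, l)"])
    (auto simp: unit_speed_rectifiable unit_speed_line_integral)

lemma D_less:
  assumes "D x y < c"
  shows "\<exists>\<sigma> l. unit_speed X \<sigma> l & \<sigma> 0 = x & \<sigma> l = y & weighted_length \<sigma> l < c"
proof -
  obtain \<gamma> a b where g: "rectifiable_curve X \<gamma> a b" "\<gamma> a = x" "\<gamma> b = y"
    "line_integral X (%z. ennreal (exp (- \<epsilon> * mdist X z x0))) \<gamma> a b < c"
    using assms unfolding D_def INF_less_iff by auto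
  obtain \<sigma> l where s: "unit_speed X \<sigma> l" "\<sigma> 0 = \<gamma> a" "\<sigma> l = \<gamma> b"
    "!!g. line_integral X g \<gamma> a b = (\<integral>\<^sup>+s\<in>{0..l}. g (\<sigma> s) \<partial>lborel)"
    using rectifiable_unit_speed[OF g(1)] by blast
  show ?thesis
    by (intro exI[of _ \<sigma>] exI[of _ l]) (use s g in \<open>simp add: weighted_length_def \<rho>_def\<close>)
qed

lemma D_finite:
  assumes "x \<in> mspace X" "y \<in> mspace X" shows "D x y < \<infinity>"
proof -
  obtain \<sigma> l where s: "unit_speed X \<sigma> l" "\<sigma> 0 = x" "\<sigma> l = y" using joined[OF assms] by blast
  have "weighted_length \<sigma> l <= (\<integral>\<^sup>+s\<in>{0..l}. 1 \<partial>lborel)"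
    unfolding weighted_length_def by (intro nn_integral_mono mult_right_mono) (auto simp: ennreal_le_1)
  also have "... < \<infinity>" by (simp add: emeasure_lborel_Icc_eq)
  finally show ?thesis using D_le[OF s(1)] s by auto
qed

text \<open>Along a curve that leaves \<open>x\<close>, the weight decays at most exponentially, and the
  curve is at least as long as the distance of its end points.\<close>
lemma D_lower:
  assumes xy: "x \<in> mspace X" "y \<in> mspace X" and m: "0 <= m" "m <= mdist X x y"
  shows "ennreal (m * \<rho> x * exp (- \<epsilon> * m)) <= D x y"
proof (rule ccontr)
  assume "~ ?thesis"
  then obtain \<sigma> l where s: "unit_speed X \<sigma> l" "\<sigma> 0 = x" "\<sigma> l = y"
    and less: "weighted_length \<sigma> l < ennreal (m * \<rho> x * exp (- \<epsilon> * m))"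
    using D_less by (meson not_le)
  have l: "0 <= l" using unit_speed_nonneg[OF s(1)] .
  have ml: "m <= l" using unit_speed_lipschitz[OF s(1), of 0 l] s m l by auto
  have "\<rho> x * exp (- \<epsilon> * m) <= \<rho> (\<sigma> t)" if t: "t \<in> {0..m}" for t
  proof -
    have "mdist X x (\<sigma> t) <= m" using unit_speed_lipschitz[OF s(1), of 0 t] s t ml by auto
    then have "\<rho> x * exp (- \<epsilon> * m) <= \<rho> x * exp (- \<epsilon> * mdist X x (\<sigma> t))"
      using eps by (intro mult_left_mono) auto
    also have "... <= \<rho> (\<sigma> t)" using unit_speed_mspace[OF s(1), of t] t ml xy by (intro \<rho>_lower) auto
    finally show ?thesis .
  qed
  then have "(\<integral>\<^sup>+t. ennreal (\<rho> x * exp (- \<epsilon> * m)) * indicator {0..m} t \<partial>lborel) <= weighted_length \<sigma> l"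
    unfolding weighted_length_def using ml by (intro nn_integral_mono) (auto simp: indicator_def intro!: ennreal_leI)
  also have "(\<integral>\<^sup>+t. ennreal (\<rho> x * exp (- \<epsilon> * m)) * indicator {0..m} t \<partial>lborel) = ennreal (m * \<rho> x * exp (- \<epsilon> * m))"
    using m by (subst nn_integral_cmult_indicator) (auto simp: ennreal_mult[symmetric] mult_ac)
  finally show False using less by simp
qed

lemma D_commute_le: "D y x <= D x y"
proof (rule ccontr)
  assume "~ ?thesis"
  then obtain \<sigma> l where s: "unit_speed X \<sigma> l" "\<sigma> 0 = x" "\<sigma> l = y" and less: "weighted_length \<sigma> l < D y x"
    using D_less by (meson not_le)
  have "D y x <= weighted_length (%s. \<sigma> (l - s)) l"
    using D_le[OF unit_speed_reverse[OF s(1)]] s by simp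
  also have "... = (\<integral>\<^sup>+s. ennreal (\<rho> (\<sigma> (l + (-1) * s))) * indicator {0..l} (l + (-1) * s) \<partial>lborel)"
    unfolding weighted_length_def by (intro nn_integral_cong) (auto simp: indicator_def)
  also have "... = weighted_length \<sigma> l"
    unfolding weighted_length_def using weight_measurable[OF s(1)]
    by (subst nn_integral_real_affine[where c="-1" and t=l]) auto
  finally show False using less by simp
qed

lemma D_triangle:
  assumes "x \<in> mspace X" "y \<in> mspace X" "z \<in> mspace X"
  shows "D x z <= D x y + D y z"
proof (rule ennreal_le_epsilon)
  fix e :: real assume e: "0 < e"
  have "D x y < D x y + ennreal (e / 2)" "D y z < D y z + ennreal (e / 2)"
    using D_finite assms e by (auto simp: less_top ennreal_add_left_cancel_less[of _ 0, simplified])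
  then obtain \<sigma> l \<tau> m where s: "unit_speed X \<sigma> l" "\<sigma> 0 = x" "\<sigma> l = y" "weighted_length \<sigma> l < D x y + ennreal (e / 2)"
    and t: "unit_speed X \<tau> m" "\<tau> 0 = y" "\<tau> m = z" "weighted_length \<tau> m < D y z + ennreal (e / 2)"
    using D_less[of x y] D_less[of y z] by metis
  let ?r = "%s. if s <= l then \<sigma> s else \<tau> (s - l)"
  have l: "0 <= l" "0 <= m" using unit_speed_nonneg s t by blast+
  have "D x z <= weighted_length ?r (l + m)"
  proof -
    have "D (?r 0) (?r (l + m)) <= weighted_length ?r (l + m)"
      by (rule D_le[OF unit_speed_join[OF s(1) t(1)]]) (use s t in simp)
    moreover have "?r (l + m) = z" using s t l by (cases "m = 0") auto
    ultimately show ?thesis using s l by simp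
  qed
  also have "... <= (\<integral>\<^sup>+u. ennreal (\<rho> (\<sigma> u)) * indicator {0..l} u +
      ennreal (\<rho> (\<tau> (-l + 1 * u))) * indicator {0..m} (-l + 1 * u) \<partial>lborel)"
    unfolding weighted_length_def by (intro nn_integral_mono) (auto simp: indicator_def)
  also have "... = weighted_length \<sigma> l + (\<integral>\<^sup>+u. ennreal (\<rho> (\<tau> (-l + 1 * u))) * indicator {0..m} (-l + 1 * u) \<partial>lborel)"
    unfolding weighted_length_def
  proof (rule nn_integral_add)
    show "(%u. ennreal (\<rho> (\<tau> (-l + 1 * u))) * indicator {0..m} (-l + 1 * u)) \<in> borel_measurable lborel"
      using measurable_compose[OF _ weight_measurable[OF t(1), simplified measurable_lborel2], of "%u. -l + 1 * u" lborel]
      by simp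
  qed (rule weight_measurable[OF s(1)])
  also have "(\<integral>\<^sup>+u. ennreal (\<rho> (\<tau> (-l + 1 * u))) * indicator {0..m} (-l + 1 * u) \<partial>lborel) = weighted_length \<tau> m"
    unfolding weighted_length_def using weight_measurable[OF t(1)]
    by (subst nn_integral_real_affine[where c=1 and t="-l"]) auto
  also have "weighted_length \<sigma> l + weighted_length \<tau> m <= (D x y + ennreal (e / 2)) + (D y z + ennreal (e / 2))"
    using s t by (intro add_mono) auto
  also have "... = D x y + D y z + (ennreal (e / 2) + ennreal (e / 2))" by (simp only: ac_simps)
  also have "ennreal (e / 2) + ennreal (e / 2) = ennreal e"
    using e by (simp add: ennreal_plus[symmetric] del: ennreal_plus)
  finally show "D x z <= D x y + D y z + ennreal e" .
qed

lemma Metric_space_D: "Metric_space (mspace X) (%x y. enn2real (D x y))"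
proof
  show "enn2real (D x y) = enn2real (D y x)" for x y
    using D_commute_le[of x y] D_commute_le[of y x] by (metis antisym)
  fix x y assume xy: "x \<in> mspace X" "y \<in> mspace X"
  show "(enn2real (D x y) = 0) = (x = y)"
  proof
    assume "enn2real (D x y) = 0"
    then have "D x y = 0" using D_finite[OF xy] by (auto simp: enn2real_eq_0_iff)
    then have "mdist X x y * \<rho> x * exp (- \<epsilon> * mdist X x y) <= 0"
      using D_lower[OF xy, of "mdist X x y"] by (simp add: ennreal_eq_0_iff)
    then have "mdist X x y <= 0" using \<rho>_pos(1)[of x] unfolding mult_le_0_iff by (smt (verit) exp_gt_zero mult_pos_pos)
    then have "mdist X x y = 0" using mdist_nonneg[of X x y] by linarith
    then show "x = y" using xy by simp
  next
    assume "x = y"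
    moreover have "mdist X x x = 0" using xy by simp
    then have "mdist X x x <= 0" by linarith
    then have "unit_speed X (%_. x) 0" using xy by (auto simp: unit_speed_def)
    then have "D x x <= weighted_length (%_. x) 0" using D_le by fastforce
    moreover have "weighted_length (%_. x) 0 = 0" by (simp add: weighted_length_def nn_integral_cmult_indicator)
    ultimately show "enn2real (D x y) = 0" by simp
  qed
next
  fix x y z assume xyz: "x \<in> mspace X" "y \<in> mspace X" "z \<in> mspace X"
  have "enn2real (D x z) <= enn2real (D x y + D y z)"
    using D_finite xyz by (intro enn2real_mono D_triangle) auto
  also have "... = enn2real (D x y) + enn2real (D y z)" using D_finite xyz by (intro enn2real_plus) auto
  finally show "enn2real (D x z) <= enn2real (D x y) + enn2real (D y z)" .
qed auto

abbreviation Xe :: "'a metric" where "Xe \<equiv> uniformized_metric X \<epsilon> x0"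

lemma uniformized_metric_eq: "Xe = metric (mspace X, %x y. enn2real (D x y))"
  unfolding uniformized_metric_def D_def ..

lemma mspace_Xe [simp]: "mspace Xe = mspace X"
  unfolding uniformized_metric_eq by (rule Metric_space.mspace_metric[OF Metric_space_D])

lemma mdist_Xe: "mdist Xe x y = enn2real (D x y)"
  unfolding uniformized_metric_eq by (subst Metric_space.mdist_metric[OF Metric_space_D]) simp

lemma ennreal_mdist_Xe: "x \<in> mspace X ==> y \<in> mspace X ==> ennreal (mdist Xe x y) = D x y"
  unfolding mdist_Xe using D_finite by (auto simp: less_top)

lemma mdist_Xe_le: "unit_speed X \<sigma> l ==> ennreal (mdist Xe (\<sigma> 0) (\<sigma> l)) <= weighted_length \<sigma> l"
  using D_le[of \<sigma> l] unit_speed_mspace[of X \<sigma> l] unit_speed_nonneg[of X \<sigma> l] by (subst ennreal_mdist_Xe) auto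

lemma mdist_Xe_lower:
  assumes xy: "x \<in> mspace X" "y \<in> mspace X" and m: "0 <= m" "m <= mdist X x y"
  shows "m * \<rho> x * exp (- \<epsilon> * m) <= mdist Xe x y"
  using D_lower[OF assms] unfolding ennreal_mdist_Xe[OF xy, symmetric] by (simp add: ennreal_le_iff)

text \<open>The mean value inequality along a curve of unit speed whose weighted length is almost the distance.\<close>
lemma lipschitz_uniformizedI:
  assumes K: "0 <= K" and xy: "x \<in> mspace X" "y \<in> mspace X"
    and loc: "!!x. x \<in> mspace X ==> \<exists>\<delta>>0. \<forall>y\<in>mspace X. mdist X x y < \<delta> --> \<bar>f x - f y\<bar> <= K * \<rho> x * mdist X x y"
  shows "\<bar>f x - f y\<bar> <= K * mdist Xe x y"
proof -
  have *: "ennreal \<bar>f x - f y\<bar> <= ennreal K * weighted_length \<sigma> l"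
    if s: "unit_speed X \<sigma> l" "\<sigma> 0 = x" "\<sigma> l = y" for \<sigma> l
  proof -
    have l: "0 <= l" using unit_speed_nonneg[OF s(1)] .
    have meas: "(%s. ennreal (K * \<rho> (\<sigma> s)) * indicator {0..l} s) \<in> borel_measurable lborel"
      using borel_measurable_times_ennreal[OF measurable_const[of "ennreal K"] weight_measurable[OF s(1)]] K
      by (simp add: ennreal_mult mult.assoc)
    have "ennreal \<bar>f (\<sigma> l) - f (\<sigma> 0)\<bar> <= (\<integral>\<^sup>+s\<in>{0..l}. ennreal (K * \<rho> (\<sigma> s)) \<partial>lborel)"
    proof (rule increment_le_nn_integral[where F="{}" and L=0, OF l meas])
      fix s \<eta> :: real assume s': "s \<in> {0..l} - {}" and \<eta>: "0 < \<eta>"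
      have \<sigma>s: "\<sigma> s \<in> mspace X" using unit_speed_mspace[OF s(1)] s' by auto
      obtain \<delta> where \<delta>: "\<delta> > 0" "!!y. y \<in> mspace X ==> mdist X (\<sigma> s) y < \<delta> ==> \<bar>f (\<sigma> s) - f y\<bar> <= K * \<rho> (\<sigma> s) * mdist X (\<sigma> s) y"
        using loc[OF \<sigma>s] by blast
      define \<delta>' where "\<delta>' = min \<delta> (\<eta> / (K * \<epsilon> + 1))"
      have \<delta>': "0 < \<delta>'" "\<delta>' <= \<delta>" "K * \<epsilon> * \<delta>' <= \<eta>"
      proof -
        have Ke: "0 <= K * \<epsilon>" using K eps by simp
        then show "0 < \<delta>'" "\<delta>' <= \<delta>" using \<delta> \<eta> by (auto simp: \<delta>'_def)
        have "K * \<epsilon> * \<delta>' <= (K * \<epsilon>) * (\<eta> / (K * \<epsilon> + 1))" using Ke by (intro mult_left_mono) (auto simp: \<delta>'_def)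
        also have "... <= \<eta>" using Ke \<eta> by (simp add: field_simps)
        finally show "K * \<epsilon> * \<delta>' <= \<eta>" .
      qed
      have "ennreal \<bar>f (\<sigma> y') - f (\<sigma> x')\<bar> <= (\<integral>\<^sup>+s\<in>{x'<..y'}. ennreal (K * \<rho> (\<sigma> s)) \<partial>lborel) + ennreal (\<eta> * (y' - x'))"
        if h: "0 <= x'" "x' <= s" "s <= y'" "y' <= l" "y' - x' < \<delta>'" for x' y'
      proof -
        have d: "mdist X (\<sigma> s) (\<sigma> r) <= \<bar>s - r\<bar>" if "x' <= r" "r <= y'" for r
          using unit_speed_lipschitz[OF s(1), of s r] that h by auto
        have inc: "\<bar>f (\<sigma> s) - f (\<sigma> r)\<bar> <= K * \<rho> (\<sigma> s) * \<bar>s - r\<bar>" if "x' <= r" "r <= y'" for r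
        proof -
          have "\<bar>f (\<sigma> s) - f (\<sigma> r)\<bar> <= K * \<rho> (\<sigma> s) * mdist X (\<sigma> s) (\<sigma> r)"
            using d[OF that] unit_speed_mspace[OF s(1), of r] that h \<delta>' by (intro \<delta>(2)) auto
          also have "... <= K * \<rho> (\<sigma> s) * \<bar>s - r\<bar>" using d[OF that] K by (intro mult_left_mono) auto
          finally show ?thesis .
        qed
        have "\<bar>f (\<sigma> y') - f (\<sigma> x')\<bar> <= K * \<rho> (\<sigma> s) * \<bar>s - x'\<bar> + K * \<rho> (\<sigma> s) * \<bar>s - y'\<bar>"
          using inc[of x'] inc[of y'] h by linarith
        also have "... = K * \<rho> (\<sigma> s) * (y' - x')" using h by (simp add: algebra_simps)
        finally have 1: "\<bar>f (\<sigma> y') - f (\<sigma> x')\<bar> <= K * \<rho> (\<sigma> s) * (y' - x')" .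
        define c where "c = max 0 (K * \<rho> (\<sigma> s) - \<eta>)"
        have "c <= K * \<rho> (\<sigma> r)" if r: "x' <= r" "r <= y'" for r
        proof -
          have "\<rho> (\<sigma> s) - \<rho> (\<sigma> r) <= \<epsilon> * mdist X (\<sigma> s) (\<sigma> r)"
            using \<rho>_lipschitz[OF \<sigma>s, of "\<sigma> r"] unit_speed_mspace[OF s(1), of r] r h by auto
          also have "... <= \<epsilon> * \<delta>'" using d[OF r] h r eps by (intro mult_left_mono) auto
          finally have "K * (\<rho> (\<sigma> s) - \<rho> (\<sigma> r)) <= K * (\<epsilon> * \<delta>')" using K by (intro mult_left_mono)
          then show ?thesis using \<delta>'(3) K by (simp add: c_def algebra_simps)
        qed
        then have "(\<integral>\<^sup>+r. ennreal c * indicator {x'<..y'} r \<partial>lborel) <= (\<integral>\<^sup>+s\<in>{x'<..y'}. ennreal (K * \<rho> (\<sigma> s)) \<partial>lborel)"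
          by (intro nn_integral_mono) (auto simp: indicator_def intro!: ennreal_leI)
        moreover have "(\<integral>\<^sup>+r. ennreal c * indicator {x'<..y'} r \<partial>lborel) = ennreal (c * (y' - x'))"
          using h by (simp add: nn_integral_cmult_indicator ennreal_mult c_def)
        moreover have "ennreal \<bar>f (\<sigma> y') - f (\<sigma> x')\<bar> <= ennreal (c * (y' - x')) + ennreal (\<eta> * (y' - x'))"
        proof -
          have "K * \<rho> (\<sigma> s) * (y' - x') <= (c + \<eta>) * (y' - x')" using h by (intro mult_right_mono) (auto simp: c_def)
          with 1 have "\<bar>f (\<sigma> y') - f (\<sigma> x')\<bar> <= c * (y' - x') + \<eta> * (y' - x')" by (simp add: algebra_simps)
          then show ?thesis using h \<eta> by (simp add: ennreal_plus[symmetric] c_def del: ennreal_plus)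
        qed
        ultimately show ?thesis by (metis (no_types, lifting) add_right_mono order_trans)
      qed
      then show "\<exists>\<delta>>0. \<forall>x' y'. 0 <= x' & x' <= s & s <= y' & y' <= l & y' - x' < \<delta> -->
          ennreal \<bar>f (\<sigma> y') - f (\<sigma> x')\<bar> <= (\<integral>\<^sup>+s\<in>{x'<..y'}. ennreal (K * \<rho> (\<sigma> s)) \<partial>lborel) + ennreal (\<eta> * (y' - x'))"
        using \<delta>'(1) by blast
    qed auto
    also have "... = ennreal K * weighted_length \<sigma> l"
      unfolding weighted_length_def using K weight_measurable[OF s(1)]
      by (subst nn_integral_cmult[symmetric]) (auto simp: ennreal_mult mult.assoc)
    finally show ?thesis using s by (simp add: abs_minus_commute)
  qed
  show ?thesis
  proof (rule ccontr)
    assume "~ ?thesis"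
    then have lt: "K * mdist Xe x y < \<bar>f x - f y\<bar>" by simp
    show False
    proof (cases "K = 0")
      case True
      obtain \<sigma> l where s: "unit_speed X \<sigma> l" "\<sigma> 0 = x" "\<sigma> l = y" using joined[OF xy] by blast
      have "ennreal \<bar>f x - f y\<bar> <= 0" using *[OF s] True by simp
      then show ?thesis using True lt by simp
    next
      case False
      then have "mdist Xe x y < \<bar>f x - f y\<bar> / K" using K lt by (simp add: field_simps)
      then have "D x y < ennreal (\<bar>f x - f y\<bar> / K)"
        unfolding ennreal_mdist_Xe[OF xy, symmetric] by (simp add: ennreal_less_iff)
      then obtain \<sigma> l where s: "unit_speed X \<sigma> l" "\<sigma> 0 = x" "\<sigma> l = y" "weighted_length \<sigma> l < ennreal (\<bar>f x - f y\<bar> / K)"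
        using D_less by blast
      have "ennreal K * weighted_length \<sigma> l < ennreal K * ennreal (\<bar>f x - f y\<bar> / K)"
        using s K False by (intro ennreal_mult_strict_left_mono) auto
      also have "... = ennreal \<bar>f x - f y\<bar>" using K False by (simp add: ennreal_mult[symmetric])
      finally show ?thesis using *[OF s(1-3)] by simp
    qed
  qed
qed

end

section \<open>Metric graphs\<close>

lemma edge_point_0 [simp]: "edge_point v w 0 = vertex_point v"
  and edge_point_1 [simp]: "edge_point v w 1 = vertex_point w"
  by (auto simp: edge_point_def)

lemma edge_point_swap: "edge_point v w t = edge_point w v (1 - t)"
  by (auto simp: edge_point_def)

text \<open>For \<open>x\<close> in barycentric coordinates this is the extension of \<open>f\<close> that is linear on every edge.\<close>
definition pl :: "('v => real) => ('v => real) => real" where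
  "pl f x = (\<Sum>v | x v ~= 0. x v * f v)"

lemma pl_edge:
  assumes "v ~= w" shows "pl f (edge_point v w t) = (1 - t) * f v + t * f w"
proof -
  have "pl f (edge_point v w t) = (\<Sum>u\<in>{v, w}. edge_point v w t u * f u)"
    unfolding pl_def by (rule sum.mono_neutral_left) (auto simp: edge_point_def vertex_point_def indicator_def split: if_splits)
  then show ?thesis using assms by (simp add: edge_point_def vertex_point_def)
qed

lemma pl_vertex [simp]: "pl f (vertex_point v) = f v"
proof -
  have "{u. vertex_point v u ~= 0} = {v}" by (auto simp: vertex_point_def indicator_def split: if_splits)
  then show ?thesis by (simp add: pl_def vertex_point_def)
qed

locale metric_graph =
  fixes V :: "'v set" and N :: "'v => 'v => bool"
  assumes N_V: "N v w ==> v \<in> V & w \<in> V"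
    and N_sym: "N v w ==> N w v" and N_irrefl: "N v w ==> v ~= w"
    and N_connected: "v \<in> V ==> w \<in> V ==> N\<^sup>*\<^sup>* v w"
begin

abbreviation "points \<equiv> graph_points V N"
abbreviation "gpath \<equiv> graph_path V N"

lemma vertex_point_in [simp]: "v \<in> V ==> vertex_point v \<in> points"
  by (auto simp: graph_points_def)

lemma edge_point_in: "N v w ==> t \<in> {0..1} ==> edge_point v w t \<in> points"
  by (auto simp: graph_points_def)

lemma points_cases:
  assumes "x \<in> points"
  obtains v where "v \<in> V" "x = vertex_point v" | v w t where "N v w" "0 < t" "t < 1" "x = edge_point v w t"
proof -
  have "(\<exists>v\<in>V. x = vertex_point v) \<or> (\<exists>v w t. N v w & 0 <= t & t <= 1 & x = edge_point v w t)"
    using assms by (auto simp: graph_points_def)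
  then show ?thesis
  proof (elim disjE bexE exE conjE)
    fix v w t assume h: "N v w" "0 <= t" "t <= 1" "x = edge_point v w t"
    consider "t = 0" | "t = 1" | "0 < t" "t < 1" using h by fastforce
    then show ?thesis using that h N_V[OF h(1)] by cases auto
  qed (use that in auto)
qed

lemma path_points: "gpath x y l ==> x \<in> points & y \<in> points & 0 <= l"
  by (induction rule: graph_path.induct) (auto simp: edge_point_in)

lemma path_trans: "gpath y z m ==> gpath x y l ==> gpath x z (l + m)"
proof (induction arbitrary: x l rule: graph_path.induct)
  case (segment y v w s l' t)
  then have "gpath x (edge_point v w t) (l + l' + \<bar>t - s\<bar>)" by (intro graph_path.segment) auto
  then show ?case by (simp add: add.assoc)
qed auto

lemma path_edge: "N v w ==> s \<in> {0..1} ==> t \<in> {0..1} ==> gpath (edge_point v w s) (edge_point v w t) \<bar>t - s\<bar>"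
proof -
  assume h: "N v w" "s \<in> {0..1}" "t \<in> {0..1}"
  have "gpath (edge_point v w s) (edge_point v w s) 0" by (rule graph_path.trivial[OF edge_point_in[OF h(1,2)]])
  from graph_path.segment[OF this h] show ?thesis by simp
qed

lemma path_sym: "gpath x y l ==> gpath y x l"
proof (induction rule: graph_path.induct)
  case (segment x v w s l t)
  from path_trans[OF segment(5) path_edge[of v w t s]] segment
  show ?case by (simp add: add.commute abs_minus_commute)
qed (auto intro: graph_path.trivial)

lemma path_exists:
  assumes "x \<in> points" "y \<in> points" shows "\<exists>l. gpath x y l"
proof -
  have v: "\<exists>v\<in>V. \<exists>l. gpath x (vertex_point v) l" if "x \<in> points" for x
    using that
  proof (cases rule: points_cases)
    case (1 v)
    then show ?thesis using graph_path.trivial[OF vertex_point_in[OF 1(1)]] by blast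
  next
    case (2 v w t)
    then show ?thesis using path_edge[of v w t 0] N_V[of v w] by auto
  qed
  obtain v l where v1: "v \<in> V" "gpath x (vertex_point v) l" using v[OF assms(1)] by blast
  obtain w m where w1: "w \<in> V" "gpath y (vertex_point w) m" using v[OF assms(2)] by blast
  have "\<exists>k. gpath (vertex_point v) (vertex_point w) k"
    using N_connected[OF v1(1) w1(1)]
  proof (induction rule: rtranclp_induct)
    case base show ?case using graph_path.trivial[OF vertex_point_in[OF v1(1)]] by blast
  next
    case (step a b)
    then obtain k where "gpath (vertex_point v) (vertex_point a) k" by blast
    from path_trans[OF _ this] path_edge[OF step(2), of 0 1] show ?case by auto
  qed
  then show ?thesis using path_trans path_sym[OF w1(2)] v1 by blast
qed

text \<open>A piecewise linear function changes along a path at a rate that is bounded by its increments over edges. With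
  indicator functions this separates points, so the path metric is definite.\<close>
lemma path_pl_lipschitz:
  assumes f: "!!v w. N v w ==> \<bar>f v - f w\<bar> <= K" and "gpath x y l"
  shows "\<bar>pl f x - pl f y\<bar> <= K * l"
  using assms(2)
proof (induction rule: graph_path.induct)
  case (segment x v w s l t)
  have "pl f (edge_point v w s) - pl f (edge_point v w t) = (t - s) * (f v - f w)"
    using N_irrefl[OF segment(2)] by (simp add: pl_edge algebra_simps)
  then have "\<bar>pl f (edge_point v w s) - pl f (edge_point v w t)\<bar> <= \<bar>t - s\<bar> * K"
    using f[OF segment(2)] by (simp add: abs_mult mult_left_mono)
  then show ?case using segment by (simp add: algebra_simps)
qed auto

lemma pl_coordinate: "x \<in> points ==> pl (indicator {u}) x = x u"
proof (erule points_cases)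
  fix v w t assume "N v w" "x = edge_point v w t"
  then show ?thesis using N_irrefl[of v w]
    by (simp add: pl_edge) (auto simp: edge_point_def vertex_point_def indicator_def)
next
  fix v assume "x = vertex_point v"
  then show ?thesis by (simp only: pl_vertex) (simp add: vertex_point_def indicator_def)
qed

definition dG :: "('v => real) => ('v => real) => real" where
  "dG x y = enn2real (INF l \<in> {l. gpath x y l}. ennreal l)"

lemma dG_le: "gpath x y l ==> dG x y <= l"
proof -
  assume p: "gpath x y l"
  have "(INF l \<in> {l. gpath x y l}. ennreal l) <= ennreal l" using p by (intro INF_lower) auto
  then have "enn2real (INF l \<in> {l. gpath x y l}. ennreal l) <= enn2real (ennreal l)" by (rule enn2real_mono) simp
  then show ?thesis using path_points[OF p] by (simp add: dG_def)
qed

lemma dG_less: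
  assumes "x \<in> points" "y \<in> points" "dG x y < r" shows "\<exists>l<r. gpath x y l"
proof -
  let ?I = "INF l \<in> {l. gpath x y l}. ennreal l"
  obtain l where l: "gpath x y l" using path_exists[OF assms(1,2)] by blast
  then have "?I <= ennreal l" by (intro INF_lower) auto
  then have "?I < \<infinity>" by (auto simp: less_top intro: le_less_trans)
  then have eq: "?I = ennreal (dG x y)" by (simp add: dG_def less_top)
  have r: "0 < r" using assms(3) unfolding dG_def by (smt (verit) enn2real_nonneg)
  have "?I < ennreal r" unfolding eq using assms(3) r by (intro ennreal_lessI) auto
  then obtain l where "gpath x y l" "ennreal l < ennreal r" by (auto simp: INF_less_iff)
  then show ?thesis using path_points[of x y l] by (auto simp: ennreal_less_iff)
qed

lemma dG_pl_lipschitz: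
  assumes f: "!!v w. N v w ==> \<bar>f v - f w\<bar> <= K" and K: "0 <= K" and xy: "x \<in> points" "y \<in> points"
  shows "\<bar>pl f x - pl f y\<bar> <= K * dG x y"
proof (rule field_le_epsilon)
  fix e :: real assume e: "0 < e"
  have "dG x y < dG x y + e / (K + 1)" using e K by simp
  then obtain l where l: "l < dG x y + e / (K + 1)" "gpath x y l" using dG_less[OF xy] by blast
  have "\<bar>pl f x - pl f y\<bar> <= K * l" by (rule path_pl_lipschitz[OF f l(2)])
  also have "... <= K * (dG x y + e / (K + 1))" using l K by (intro mult_left_mono) auto
  also have "... <= K * dG x y + e" using e K by (simp add: field_simps)
  finally show "\<bar>pl f x - pl f y\<bar> <= K * dG x y + e" .
qed

text \<open>Barycentric coordinates do not increase distances, since every one of them is the linear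
  extension of an indicator function.\<close>
lemma coordinate_le_dG:
  assumes "x \<in> points" "y \<in> points" shows "\<bar>x u - y u\<bar> <= dG x y"
  using dG_pl_lipschitz[of "indicator {u}" 1 x y] assms by (simp add: pl_coordinate indicator_def)

lemma dG_sym: "dG x y = dG y x"
proof -
  have "{l. gpath x y l} = {l. gpath y x l}" using path_sym by blast
  then show ?thesis by (simp add: dG_def)
qed

lemma Metric_space_dG: "Metric_space points dG"
proof
  show "0 <= dG x y" for x y by (simp add: dG_def)
  show "dG x y = dG y x" for x y by (rule dG_sym)
  fix x y assume xy: "x \<in> points" "y \<in> points"
  show "(dG x y = 0) = (x = y)"
  proof
    assume "dG x y = 0"
    then have "x u = y u" for u using coordinate_le_dG[OF xy, of u] by simp
    then show "x = y" by blast
  next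
    assume "x = y"
    then have "dG x y <= 0" using graph_path.trivial[OF xy(1)] by (intro dG_le) simp
    then show "dG x y = 0" using \<open>0 <= dG x y\<close> by simp
  qed
next
  fix x y z assume p: "x \<in> points" "y \<in> points" "z \<in> points"
  show "dG x z <= dG x y + dG y z"
  proof (rule field_le_epsilon)
    fix e :: real assume e: "0 < e"
    obtain l where l: "l < dG x y + e / 2" "gpath x y l" using dG_less[OF p(1,2), of "dG x y + e / 2"] e by auto
    obtain m where m: "m < dG y z + e / 2" "gpath y z m" using dG_less[OF p(2,3), of "dG y z + e / 2"] e by auto
    have "dG x z <= l + m" by (rule dG_le[OF path_trans[OF m(2) l(2)]])
    then show "dG x z <= dG x y + dG y z + e" using l m by simp
  qed
qed

abbreviation "X \<equiv> graph_metric V N"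

lemma mspace_X [simp]: "mspace X = points" and mdist_X [simp]: "mdist X = dG"
proof -
  have "X = metric (points, dG)" unfolding graph_metric_def dG_def ..
  then show "mspace X = points" "mdist X = dG"
    by (simp_all add: Metric_space.mspace_metric[OF Metric_space_dG] Metric_space.mdist_metric[OF Metric_space_dG])
qed

lemma dG_edge:
  assumes "N v w" "s \<in> {0..1}" "t \<in> {0..1}"
  shows "dG (edge_point v w s) (edge_point v w t) = \<bar>s - t\<bar>"
proof (rule antisym)
  show "dG (edge_point v w s) (edge_point v w t) <= \<bar>s - t\<bar>"
    using dG_le[OF path_edge[OF assms]] by (simp add: abs_minus_commute)
  show "\<bar>s - t\<bar> <= dG (edge_point v w s) (edge_point v w t)"
    using coordinate_le_dG[of "edge_point v w s" "edge_point v w t" w] edge_point_in[OF assms(1)] assms N_irrefl[OF assms(1)]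
    by (simp add: edge_point_def vertex_point_def)
qed

lemma unit_speed_edge:
  assumes "N v w" "s \<in> {0..1}" "t \<in> {0..1}" "s <= t"
  shows "unit_speed X (%r. edge_point v w (s + r)) (t - s)"
proof -
  have "ennreal (t - s) <= curve_length X (%r. edge_point v w (s + r)) 0 (t - s)"
    using dist_le_curve_length[of 0 "t - s" X "%r. edge_point v w (s + r)"] assms by (simp add: dG_edge)
  then show ?thesis unfolding unit_speed_def using assms by (auto simp: dG_edge edge_point_in)
qed

lemma unit_speed_edge_decreasing:
  assumes "N v w" "s \<in> {0..1}" "t \<in> {0..1}" "s <= t"
  shows "unit_speed X (%r. edge_point v w (t - r)) (t - s)"
  using unit_speed_reverse[OF unit_speed_edge[OF assms]] by (simp add: algebra_simps)

lemma unit_speed_joined: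
  assumes "x \<in> points" "y \<in> points"
  shows "\<exists>\<sigma> l. unit_speed X \<sigma> l & \<sigma> 0 = x & \<sigma> l = y"
proof -
  obtain l where "gpath x y l" using path_exists[OF assms] by blast
  then show ?thesis
  proof (induction rule: graph_path.induct)
    case (trivial x)
    then have "unit_speed X (%_. x) 0" by (auto simp: unit_speed_def Metric_space.mdist_zero[OF Metric_space_dG])
    then show ?case by blast
  next
    case (segment x v w s l t)
    obtain \<sigma> m where \<sigma>: "unit_speed X \<sigma> m" "\<sigma> 0 = x" "\<sigma> m = edge_point v w s" using segment by blast
    obtain \<tau> k where \<tau>: "unit_speed X \<tau> k" "\<tau> 0 = edge_point v w s" "\<tau> k = edge_point v w t"
    proof (cases "s <= t")
      case True
      from unit_speed_edge[OF segment(2,3,4) True] that show ?thesis by force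
    next
      case False
      with unit_speed_edge_decreasing[OF segment(2,4,3)] that show ?thesis by force
    qed
    have nn: "0 <= m" "0 <= k" using \<sigma> \<tau> unit_speed_nonneg by blast+
    from unit_speed_join[OF \<sigma>(1) \<tau>(1)] \<sigma> \<tau> nn show ?case
      by (intro exI[of _ "%s. if s <= m then \<sigma> s else \<tau> (s - m)"] exI[of _ "m + k"]) (cases "k = 0"; simp)
  qed
qed

text \<open>The barycentric coordinates at \<open>v\<close> and \<open>w\<close> stay positive within this distance, which leaves only
  points of the same edge.\<close>
lemma near_edge_point:
  assumes vw: "N v w" and t: "0 < t" "t < 1" and y: "y \<in> points" "dG (edge_point v w t) y < min t (1 - t)"
  shows "\<exists>s. 0 < s & s < 1 & y = edge_point v w s & \<bar>t - s\<bar> = dG (edge_point v w t) y"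
proof -
  have ne: "v ~= w" using N_irrefl[OF vw] .
  let ?x = "edge_point v w t"
  have x: "?x \<in> points" using edge_point_in vw t by auto
  have pos: "0 < y v" "0 < y w"
    using coordinate_le_dG[OF x y(1), of v] coordinate_le_dG[OF x y(1), of w] y(2) ne
    by (auto simp: edge_point_def vertex_point_def)
  have "\<exists>s. 0 < s & s < 1 & y = edge_point v w s" using y(1)
  proof (cases rule: points_cases)
    case (1 u)
    then show ?thesis using pos ne by (auto simp: vertex_point_def indicator_def split: if_splits)
  next
    case (2 a b s)
    then have "{v, w} <= {a, b}"
      using pos by (auto simp: edge_point_def vertex_point_def indicator_def of_bool_def split: if_splits)
    then have "a = v & b = w \<or> a = w & b = v" using ne by auto
    then show ?thesis
    proof
      assume "a = w & b = v"
      then show ?thesis using 2 edge_point_swap[of w v s] by (intro exI[of _ "1 - s"]) auto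
    qed (use 2 in auto)
  qed
  then obtain s where s: "0 < s" "s < 1" "y = edge_point v w s" by blast
  then show ?thesis using dG_edge[OF vw, of t s] t by auto
qed

lemma near_vertex:
  assumes v: "v \<in> V" and y: "y \<in> points" "dG (vertex_point v) y < 1"
  shows "y = vertex_point v \<or> (\<exists>w s. N v w & s \<in> {0..1} & y = edge_point v w s & s = dG (vertex_point v) y)"
proof -
  have "vertex_point v v = 1" by (simp add: vertex_point_def)
  then have pos: "0 < y v" using coordinate_le_dG[OF vertex_point_in[OF v] y(1), of v] y by linarith
  show ?thesis using y(1)
  proof (cases rule: points_cases)
    case (1 u)
    then show ?thesis using pos by (auto simp: vertex_point_def indicator_def split: if_splits)
  next
    case (2 a b s)
    then have "v = a \<or> v = b"
      using pos by (auto simp: edge_point_def vertex_point_def indicator_def of_bool_def split: if_splits)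
    then obtain w s' where "N v w" "0 < s'" "s' < 1" "y = edge_point v w s'"
    proof
      assume "v = b"
      then show ?thesis using 2 N_sym[of a b] edge_point_swap[of a b s] that[of a "1 - s"] by auto
    qed (use 2 that in auto)
    then show ?thesis using dG_edge[of v w 0 s'] by auto
  qed
qed

end

locale uniformized_graph = metric_graph V N for V :: "'v set" and N +
  fixes \<epsilon> :: real and x0 :: "'v => real"
  assumes eps: "0 < \<epsilon>" and x0: "x0 \<in> graph_points V N"

sublocale uniformized_graph \<subseteq> uniformization "graph_metric V N" \<epsilon> x0
  by unfold_locales (use eps x0 unit_speed_joined in auto)

context uniformized_graph
begin

text \<open>The slope of the extension with respect to the path metric is at most \<open>K\<rho>\<close> at every point, and
  \<open>d\<^sub>\<epsilon>\<close> weights lengths by \<open>\<rho>\<close>.\<close>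
lemma pl_lipschitz_uniformized:
  assumes K: "0 <= K" and f: "!!v w t. N v w ==> t \<in> {0..1} ==> \<bar>f v - f w\<bar> <= K * \<rho> (edge_point v w t)"
    and xy: "x \<in> points" "y \<in> points"
  shows "\<bar>pl f x - pl f y\<bar> <= K * mdist Xe x y"
proof (rule lipschitz_uniformizedI[OF K])
  fix x assume "x \<in> mspace X"
  then have x: "x \<in> points" by simp
  then show "\<exists>\<delta>>0. \<forall>y\<in>mspace X. mdist X x y < \<delta> --> \<bar>pl f x - pl f y\<bar> <= K * \<rho> x * mdist X x y"
  proof (cases rule: points_cases)
    case (1 v)
    have "\<bar>pl f x - pl f y\<bar> <= K * \<rho> x * dG x y" if y: "y \<in> points" "dG x y < 1" for y
      using near_vertex[OF 1(1) y(1) y(2)[unfolded 1(2)]] unfolding 1(2)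
    proof (elim disjE exE conjE)
      assume "y = vertex_point v"
      then show "\<bar>pl f (vertex_point v) - pl f y\<bar> <= K * \<rho> (vertex_point v) * dG (vertex_point v) y"
        using K by (simp add: dG_def)
    next
      fix w s assume h: "N v w" "s \<in> {0..1}" "y = edge_point v w s" "s = dG (vertex_point v) y"
      have "pl f (vertex_point v) - pl f y = (f v - f w) * s"
        unfolding h(3) pl_vertex pl_edge[OF N_irrefl[OF h(1)]] by (simp add: algebra_simps)
      then have "\<bar>pl f (vertex_point v) - pl f y\<bar> = \<bar>f v - f w\<bar> * s"
        using h(2) by (simp add: abs_mult)
      also have "... <= K * \<rho> (vertex_point v) * s"
        using f[OF h(1), of 0] h(2) by (intro mult_right_mono) auto
      finally show "\<bar>pl f (vertex_point v) - pl f y\<bar> <= K * \<rho> (vertex_point v) * dG (vertex_point v) y"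
        using h(4) by simp
    qed
    then show ?thesis by (intro exI[of _ 1]) auto
  next
    case (2 v w t)
    have "\<bar>pl f x - pl f y\<bar> <= K * \<rho> x * dG x y" if y: "y \<in> points" "dG x y < min t (1 - t)" for y
    proof -
      obtain s where s: "y = edge_point v w s" "\<bar>t - s\<bar> = dG x y"
        using near_edge_point[OF 2(1-3) y(1)] y(2) 2(4) by auto
      have "pl f x - pl f y = (s - t) * (f v - f w)"
        using s 2 N_irrefl[OF 2(1)] by (simp add: pl_edge algebra_simps)
      then have "\<bar>pl f x - pl f y\<bar> = \<bar>f v - f w\<bar> * \<bar>t - s\<bar>" by (simp add: abs_mult abs_minus_commute)
      also have "... <= K * \<rho> x * \<bar>t - s\<bar>" using f[OF 2(1), of t] 2 by (intro mult_right_mono) auto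
      finally show ?thesis using s by simp
    qed
    then show ?thesis using 2 by (intro exI[of _ "min t (1 - t)"]) auto
  qed
qed (use xy in auto)

lemma mdist_Xe_edge_le:
  assumes vw: "N v w" and st: "s \<in> {0..1}" "t \<in> {0..1}" "s <= t"
  shows "ennreal (mdist Xe (edge_point v w s) (edge_point v w t)) <= (\<integral>\<^sup>+r\<in>{s..t}. ennreal (\<rho> (edge_point v w r)) \<partial>lborel)"
proof -
  let ?\<sigma> = "%r. edge_point v w (s + r)"
  have u: "unit_speed X ?\<sigma> (t - s)" by (rule unit_speed_edge[OF assms])
  have "ennreal (mdist Xe (edge_point v w s) (edge_point v w t)) <= weighted_length ?\<sigma> (t - s)"
    using mdist_Xe_le[OF u] by simp
  also have "... = (\<integral>\<^sup>+r. ennreal (\<rho> (?\<sigma> (- s + 1 * r))) * indicator {0..t - s} (- s + 1 * r) \<partial>lborel)"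
    unfolding weighted_length_def using weight_measurable[OF u]
    by (subst nn_integral_real_affine[where c=1 and t="-s"]) auto
  also have "... = (\<integral>\<^sup>+r\<in>{s..t}. ennreal (\<rho> (edge_point v w r)) \<partial>lborel)"
    by (intro nn_integral_cong) (auto simp: indicator_def)
  finally show ?thesis .
qed

end

section \<open>The hyperbolic filling\<close>

locale hyperbolic_filling =
  fixes A :: "nat => 'z::metric_space set" and z0 :: 'z
  assumes cpt: "compact (UNIV :: 'z set)" and diam: "diameter (UNIV :: 'z set) < 1"
    and nets: "filling_nets (exp (1 / 4)) z0 A"
begin

definition r :: "nat => real" where "r i = exp (- (real i / 4))"
abbreviation "V \<equiv> filling_vertices A"
abbreviation "N \<equiv> filling_neighbors (exp (1 / 4)) 2 A"

lemma r_eq: "c / exp (1 / 4) ^ i = c * r i"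
proof -
  have "exp (1 / 4 :: real) ^ i = exp (real i / 4)" by (simp flip: exp_of_nat_mult)
  then show ?thesis by (simp add: r_def exp_minus field_simps)
qed

lemma r_pos [simp]: "0 < r i" "0 <= r i" by (auto simp: r_def)

lemma exp_quarter: "1 < exp (1 / 4 :: real)" "exp (1 / 4 :: real) < 2"
proof -
  have "exp (1 / 4 :: real) <= 1 + 1 / 4 + (1 / 4)\<^sup>2" by (rule exp_bound) auto
  then show "exp (1 / 4 :: real) < 2" by (simp add: power2_eq_square)
qed auto

lemma r_Suc: "r i = exp (1 / 4) * r (Suc i)"
  by (simp add: r_def add_divide_distrib exp_add[symmetric] exp_minus[symmetric] flip: exp_add)

lemma r_antimono: "i <= j ==> r j <= r i" by (auto simp: r_def)

lemma r_Suc_less: "r (Suc i) < r i" by (simp add: r_def)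

lemma r_le_Suc: "r i <= 2 * r (Suc i)"
  unfolding r_Suc[of i] using exp_quarter by (intro mult_right_mono) auto

lemma r_0 [simp]: "r 0 = 1" by (simp add: r_def)

lemma r_tendsto_0: "r \<longlonglongrightarrow> 0"
proof -
  have "r = (%i. exp (- (1 / 4)) ^ i)" by (auto simp: r_def fun_eq_iff simp flip: exp_of_nat_mult)
  moreover have "(%i. exp (- (1 / 4) :: real) ^ i) \<longlonglongrightarrow> 0" by (rule LIMSEQ_realpow_zero) auto
  ultimately show ?thesis by metis
qed

lemma dist_less_1: "dist x (y::'z) < 1"
  using diameter_bounded_bound[of "UNIV :: 'z set" x y] cpt compact_imp_bounded diam by force

lemma A_0: "A 0 = {z0}" and A_Suc: "A i <= A (Suc i)"
  and A_maximal: "1 <= i ==> maximal_separated (r i) (A i)"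
  using nets r_eq[of 1] by (auto simp: filling_nets_def)

lemma A_separated: "x \<in> A i ==> y \<in> A i ==> x ~= y ==> r i <= dist x y"
  using A_maximal[of i] A_0 by (cases "i = 0") (auto simp: maximal_separated_def separated_def)

lemma finite_A [simp]: "finite (A i)"
proof (rule ccontr)
  assume inf: "infinite (A i)"
  then obtain x where x: "x islimpt (A i)"
    using cpt by (metis compact_eq_Bolzano_Weierstrass subset_UNIV)
  then have "infinite (A i \<inter> ball x (r i / 2))" using islimpt_eq_infinite_ball[of x "A i"] r_pos(1)[of i] by simp
  then obtain a where a: "a \<in> A i \<inter> ball x (r i / 2)" using infinite_imp_nonempty by blast
  have "infinite (A i \<inter> ball x (r i / 2) - {a})" using \<open>infinite (A i \<inter> ball x (r i / 2))\<close> by simp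
  then obtain b where b: "b \<in> A i \<inter> ball x (r i / 2) - {a}" using infinite_imp_nonempty by blast
  have "dist a b <= dist x a + dist x b" by (metis dist_commute dist_triangle)
  then show False using a b A_separated[of a i b] by auto
qed

lemma net_dense: "\<exists>a\<in>A i. dist a z < r i"
proof (cases "i = 0")
  case True then show ?thesis using A_0 dist_less_1[of z0 z] by auto
next
  case False
  then have m: "maximal_separated (r i) (A i)" using A_maximal by simp
  show ?thesis
  proof (rule ccontr)
    assume c: "~ ?thesis"
    then have far: "r i <= dist a z" if "a \<in> A i" for a using that by force
    then have "separated (r i) (insert z (A i))"
      using m far dist_commute[of z] unfolding maximal_separated_def separated_def by auto
    then have "z \<in> A i" using m unfolding maximal_separated_def by blast
    then show False using c by auto
  qed
qed

definition near :: "nat => 'z => 'z" where "near i z = (SOME a. a \<in> A i & dist a z < r i)"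

lemma near: "near i z \<in> A i" "dist (near i z) z < r i"
  using someI_ex[of "%a. a \<in> A i & dist a z < r i"] net_dense[of i z] unfolding near_def by blast+

lemma N_iff: "N (z, i) (y, j) \<longleftrightarrow> z \<in> A i & y \<in> A j & (z, i) ~= (y, j) \<and>
    (i = j & ball z (2 * r i) \<inter> ball y (2 * r i) ~= {} \<or>
     (j = Suc i \<or> i = Suc j) & ball z (r i) \<inter> ball y (r j) ~= {})"
  by (auto simp: filling_neighbors_def filling_vertices_def r_eq)

lemma V_iff [simp]: "(z, i) \<in> V \<longleftrightarrow> z \<in> A i" by (simp add: filling_vertices_def)

lemma same_level_neighbors:
  assumes "z \<in> A i" "y \<in> A i" "dist z x < 2 * r i" "dist y x < 2 * r i" "z ~= y"
  shows "N (z, i) (y, i)"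
  unfolding N_iff using assms by (auto simp: set_eq_iff)

lemma next_level_neighbors:
  assumes "z \<in> A i" "y \<in> A (Suc i)" "dist z x < r i" "dist y x < r (Suc i)"
  shows "N (z, i) (y, Suc i)"
  unfolding N_iff using assms by (auto simp: set_eq_iff)

lemma neighbors_sym: "N v w ==> N w v"
  by (cases v; cases w) (auto simp: N_iff Int_commute)

lemma neighbors_close:
  assumes "N (z, i) (y, j)"
  shows "dist z y < 4 * r i" "r j <= 2 * r i" "r i <= 2 * r j" "j <= Suc i" "i <= Suc j" "z \<in> A i" "y \<in> A j"
proof -
  have *: "dist z y < s + t" if "ball z s \<inter> ball y t ~= {}" for s t
  proof -
    obtain x where "x \<in> ball z s" "x \<in> ball y t" using \<open>ball z s \<inter> ball y t ~= {}\<close> by blast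
    then have x: "dist z x < s" "dist y x < t" by auto
    have "dist z y <= dist z x + dist y x" by (metis dist_commute dist_triangle)
    then show ?thesis using x by simp
  qed
  consider (same) "i = j" "dist z y < 2 * r i + 2 * r i" | (adj) "j = Suc i \<or> i = Suc j" "dist z y < r i + r j"
    using assms * unfolding N_iff by blast
  then have "dist z y < 4 * r i & r j <= 2 * r i & r i <= 2 * r j & j <= Suc i & i <= Suc j"
  proof cases
    case adj
    then have "r j <= 2 * r i" "r i <= 2 * r j"
      using r_le_Suc[of i] r_le_Suc[of j] r_Suc_less[of i] r_Suc_less[of j] r_pos(1)[of i] r_pos(1)[of j] by auto
    then show ?thesis using adj r_pos(1)[of i] by auto
  qed auto
  then show "dist z y < 4 * r i" "r j <= 2 * r i" "r i <= 2 * r j" "j <= Suc i" "i <= Suc j" by blast+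
  show "z \<in> A i" "y \<in> A j" using assms by (auto simp: N_iff)
qed

lemma parent: "z \<in> A (Suc i) ==> N (near i z, i) (z, Suc i)"
  using next_level_neighbors[of "near i z" i z z] near[of i z] by simp

lemma child: "z \<in> A i ==> N (z, i) (z, Suc i)"
  using next_level_neighbors[of z i z z] A_Suc by auto

lemma connected_to_root: "z \<in> A i ==> N\<^sup>*\<^sup>* (z, i) (z0, 0)"
proof (induction i arbitrary: z)
  case 0 then show ?case using A_0 by auto
next
  case (Suc i)
  from neighbors_sym[OF parent[OF Suc(2)]] Suc(1)[OF near(1)] show ?case
    by (rule converse_rtranclp_into_rtranclp)
qed

sublocale uniformized_graph V N "1 / 4" "vertex_point (z0, 0)"
proof
  show "v \<in> V & w \<in> V" "v ~= w" if "N v w" for v w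
    using that by (cases v; cases w; auto simp: N_iff)+
  show "N w v" if "N v w" for v w using that by (rule neighbors_sym)
  fix v w assume vw: "v \<in> V" "w \<in> V"
  have sym: "symp N" using neighbors_sym by (auto simp: symp_def)
  have "N\<^sup>*\<^sup>* v (z0, 0)" "N\<^sup>*\<^sup>* w (z0, 0)" using vw connected_to_root by (cases v; cases w; auto)+
  then show "N\<^sup>*\<^sup>* v w" using sym by (metis rtranclp_trans symp_rtranclp sympD)
next
  have "(z0, 0) \<in> V" using A_0 by simp
  then show "vertex_point (z0, 0) \<in> graph_points V N" by (auto simp: graph_points_def)
qed auto

lemma root_distance: "z \<in> A i ==> dG (vertex_point (z, i)) (vertex_point (z0, 0)) <= real i"
proof (induction i arbitrary: z)
  case 0
  then show ?case using A_0 Metric_space.mdist_zero[OF Metric_space_dG] by simp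
next
  case (Suc i)
  have "dG (vertex_point (z, Suc i)) (vertex_point (near i z, i)) = 1"
    using dG_edge[OF neighbors_sym[OF parent[OF Suc(2)]], of 0 1] by simp
  moreover have "dG (vertex_point (z, Suc i)) (vertex_point (z0, 0)) \<le>
    dG (vertex_point (z, Suc i)) (vertex_point (near i z, i)) + dG (vertex_point (near i z, i)) (vertex_point (z0, 0))"
    using Suc(2) near(1) A_0 by (intro Metric_space.triangle[OF Metric_space_dG]) auto
  ultimately show ?case using Suc(1)[OF near(1)[of i z]] by simp
qed

text \<open>The distance to the root is the level up to one unit: it changes by at most one along an edge, and parents give
  a path to the root of this length. The factor two bounds \<open>\<alpha> = e\<^sup>1\<^sup>/\<^sup>4\<close> with room to spare.\<close>
lemma weight_bounds:
  assumes n: "N (z, i) w" and t: "t \<in> {0..1}"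
  shows "r i / 2 <= \<rho> (edge_point (z, i) w t)" "\<rho> (edge_point (z, i) w t) <= 2 * r i"
proof -
  obtain y j where w: "w = (y, j)" by (cases w)
  let ?x = "edge_point (z, i) w t" and ?o = "vertex_point (z0, 0)"
  have zi: "z \<in> A i" using neighbors_close[OF n[unfolded w]] by simp
  have x: "?x \<in> points" "?o \<in> points" using edge_point_in[OF n t] A_0 by auto
  have "\<bar>pl (%v. real (snd v)) ?x - pl (%v. real (snd v)) ?o\<bar> <= 1 * dG ?x ?o"
  proof (rule dG_pl_lipschitz[OF _ _ x])
    show "\<bar>real (snd v) - real (snd w)\<bar> <= 1" if "N v w" for v w
      using that neighbors_close(4,5)[of "fst v" "snd v" "fst w" "snd w"] by auto
  qed simp
  moreover have "pl (%v. real (snd v)) ?x = (1 - t) * real i + t * real j"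
    using pl_edge[OF N_irrefl[OF n]] by (simp add: w)
  moreover have "real i - 1 <= (1 - t) * real i + t * real j"
  proof -
    have "t * (real i - real j) <= 1 * 1"
    proof -
      have "real i - real j <= 1" using neighbors_close(5)[OF n[unfolded w]] by simp
      then have "t * (real i - real j) <= t * 1" using t by (intro mult_left_mono) auto
      then show ?thesis using t by simp
    qed
    then show ?thesis by (simp add: algebra_simps)
  qed
  ultimately have low: "real i - 1 <= dG ?x ?o" by simp
  have "dG ?x (vertex_point (z, i)) = \<bar>t - 0\<bar>" using dG_edge[OF n t, of 0] by simp
  moreover have "dG ?x ?o <= dG ?x (vertex_point (z, i)) + dG (vertex_point (z, i)) ?o"
    using x zi by (intro Metric_space.triangle[OF Metric_space_dG]) auto
  ultimately have up: "dG ?x ?o <= real i + 1" using root_distance[OF zi] t by simp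
  have "\<rho> ?x <= exp (1 / 4) * r i" unfolding \<rho>_def r_def using low by (simp flip: exp_add)
  also have "... <= 2 * r i" using exp_quarter by (intro mult_right_mono) auto
  finally show "\<rho> ?x <= 2 * r i" .
  have "exp (- (1 / 4)) * r i <= \<rho> ?x" unfolding \<rho>_def r_def using up by (simp flip: exp_add)
  moreover have "1 / 2 <= exp (- (1 / 4 :: real))" using exp_quarter by (simp add: exp_minus field_simps)
  then have "1 / 2 * r i <= exp (- (1 / 4)) * r i" by (intro mult_right_mono) auto
  ultimately show "r i / 2 <= \<rho> ?x" by linarith
qed

lemma pl_lipschitz_filling:
  assumes K: "0 <= K" and f: "!!z i w. N (z, i) w ==> \<bar>f (z, i) - f w\<bar> <= K * r i"
    and xy: "x \<in> points" "y \<in> points"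
  shows "\<bar>pl f x - pl f y\<bar> <= 2 * K * mdist Xe x y"
proof (rule pl_lipschitz_uniformized[OF _ _ xy])
  fix v w t assume n: "N v w" and t: "t \<in> {0..1::real}"
  obtain z i where v: "v = (z, i)" by (cases v)
  have "\<bar>f v - f w\<bar> <= K * r i" using f n v by simp
  also have "... <= K * (2 * \<rho> (edge_point v w t))"
    using weight_bounds(1)[of z i w t] n t K v by (intro mult_left_mono) auto
  finally show "\<bar>f v - f w\<bar> <= 2 * K * \<rho> (edge_point v w t)" by (simp add: mult_ac)
qed (use K in simp)

lemma mdist_Xe_edge_bound:
  assumes n: "N (z, i) w" and st: "s \<in> {0..1}" "t \<in> {0..1}"
  shows "mdist Xe (edge_point (z, i) w s) (edge_point (z, i) w t) <= 2 * r i * \<bar>s - t\<bar>"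
proof -
  have *: "mdist Xe (edge_point (z, i) w s) (edge_point (z, i) w t) <= 2 * r i * (t - s)"
    if st: "s \<in> {0..1}" "t \<in> {0..1}" "s <= t" for s t
  proof -
    have "ennreal (mdist Xe (edge_point (z, i) w s) (edge_point (z, i) w t)) <= (\<integral>\<^sup>+q\<in>{s..t}. ennreal (\<rho> (edge_point (z, i) w q)) \<partial>lborel)"
      by (rule mdist_Xe_edge_le[OF n st])
    also have "... <= (\<integral>\<^sup>+q. ennreal (2 * r i) * indicator {s..t} q \<partial>lborel)"
      using weight_bounds(2)[OF n] st by (intro nn_integral_mono) (auto simp: indicator_def intro!: ennreal_leI)
    also have "... = ennreal (2 * r i * (t - s))"
      using st by (subst nn_integral_cmult_indicator) (auto simp: ennreal_mult)
    finally show ?thesis using st by (subst (asm) ennreal_le_iff) auto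
  qed
  show ?thesis
  proof (cases "s <= t")
    case True then show ?thesis using *[OF st] by simp
  next
    case False
    then have "mdist Xe (edge_point (z, i) w t) (edge_point (z, i) w s) <= 2 * r i * \<bar>s - t\<bar>"
      using *[OF st(2,1)] by simp
    then show ?thesis by (metis mdist_commute)
  qed
qed

end

section \<open>Completions\<close>

context fixes Y :: "'a metric" begin

lemma Cauchy_sequences_iff:
  "f \<in> Cauchy_sequences Y \<longleftrightarrow> (\<forall>n. f n \<in> mspace Y) & (\<forall>e>0. \<exists>N. \<forall>m\<ge>N. \<forall>n\<ge>N. mdist Y (f m) (f n) < e)"
  unfolding Cauchy_sequences_def Metric_space.MCauchy_def[OF Metric_space_mspace_mdist] by fastforce

lemma Cauchy_equivalence_iff:
  "(f, g) \<in> Cauchy_equivalence Y \<longleftrightarrow> f \<in> Cauchy_sequences Y & g \<in> Cauchy_sequences Y & (%n. mdist Y (f n) (g n)) \<longlonglongrightarrow> 0"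
  by (simp add: Cauchy_equivalence_def)

lemma mdist_quadrilateral:
  assumes "x \<in> mspace Y" "y \<in> mspace Y" "x' \<in> mspace Y" "y' \<in> mspace Y"
  shows "\<bar>mdist Y x y - mdist Y x' y'\<bar> <= mdist Y x x' + mdist Y y y'"
  using mdist_triangle[of x Y x' y] mdist_triangle[of x' Y y' y] mdist_triangle[of x' Y x y'] mdist_triangle[of x Y y y']
    mdist_commute[of Y x' x] mdist_commute[of Y y' y] assms by linarith

lemma Cauchy_equivalence_equiv: "equiv (Cauchy_sequences Y) (Cauchy_equivalence Y)"
proof (rule equivI)
  show "Cauchy_equivalence Y <= Cauchy_sequences Y \<times> Cauchy_sequences Y"
    by (auto simp: Cauchy_equivalence_iff)
  show "refl_on (Cauchy_sequences Y) (Cauchy_equivalence Y)"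
  proof (rule refl_onI)
    fix f assume f: "f \<in> Cauchy_sequences Y"
    then have "mdist Y (f n) (f n) = 0" for n by (simp add: Cauchy_sequences_iff)
    then show "(f, f) \<in> Cauchy_equivalence Y" using f by (simp only: Cauchy_equivalence_iff) simp
  qed
  show "sym (Cauchy_equivalence Y)"
    by (rule symI) (simp add: Cauchy_equivalence_iff mdist_commute)
  show "trans (Cauchy_equivalence Y)"
  proof (rule transI)
    fix f g h assume a: "(f, g) \<in> Cauchy_equivalence Y" "(g, h) \<in> Cauchy_equivalence Y"
    then have "(%n. mdist Y (f n) (g n) + mdist Y (g n) (h n)) \<longlonglongrightarrow> 0"
      using tendsto_add[of "%n. mdist Y (f n) (g n)" 0 _ "%n. mdist Y (g n) (h n)" 0] by (simp add: Cauchy_equivalence_iff)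
    then have "(%n. mdist Y (f n) (h n)) \<longlonglongrightarrow> 0"
      by (rule Lim_null_comparison[rotated])
        (use a in \<open>auto simp: Cauchy_equivalence_iff Cauchy_sequences_iff intro!: always_eventually mdist_triangle\<close>)
    then show "(f, h) \<in> Cauchy_equivalence Y" using a by (simp add: Cauchy_equivalence_iff)
  qed
qed

lemma Cauchy_dist_convergent:
  assumes "f \<in> Cauchy_sequences Y" "g \<in> Cauchy_sequences Y"
  shows "convergent (%n. mdist Y (f n) (g n))"
proof (rule Cauchy_convergent, rule CauchyI)
  fix e :: real assume "0 < e"
  then have e2: "0 < e / 2" by simp
  obtain N1 where N1: "\<forall>m\<ge>N1. \<forall>n\<ge>N1. mdist Y (f m) (f n) < e / 2" using assms(1) e2 unfolding Cauchy_sequences_iff by blast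
  obtain N2 where N2: "\<forall>m\<ge>N2. \<forall>n\<ge>N2. mdist Y (g m) (g n) < e / 2" using assms(2) e2 unfolding Cauchy_sequences_iff by blast
  have "norm (mdist Y (f m) (g m) - mdist Y (f n) (g n)) < e" if "m >= max N1 N2" "n >= max N1 N2" for m n
  proof -
    have "\<bar>mdist Y (f m) (g m) - mdist Y (f n) (g n)\<bar> <= mdist Y (f m) (f n) + mdist Y (g m) (g n)"
      using assms by (intro mdist_quadrilateral) (auto simp: Cauchy_sequences_iff)
    also have "... < e / 2 + e / 2" using N1 N2 that by (intro add_strict_mono) auto
    finally show ?thesis by simp
  qed
  then show "\<exists>M. \<forall>m\<ge>M. \<forall>n\<ge>M. norm (mdist Y (f m) (g m) - mdist Y (f n) (g n)) < e" by blast
qed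

lemma Cauchy_dist_limit_unique:
  assumes "(f, f') \<in> Cauchy_equivalence Y" "(g, g') \<in> Cauchy_equivalence Y"
    and lim: "(%n. mdist Y (f n) (g n)) \<longlonglongrightarrow> c"
  shows "(%n. mdist Y (f' n) (g' n)) \<longlonglongrightarrow> c"
proof -
  have "(%n. mdist Y (f n) (f' n) + mdist Y (g n) (g' n)) \<longlonglongrightarrow> 0"
    using tendsto_add[of "%n. mdist Y (f n) (f' n)" 0 _ "%n. mdist Y (g n) (g' n)" 0] assms by (simp add: Cauchy_equivalence_iff)
  then have "(%n. mdist Y (f n) (g n) - mdist Y (f' n) (g' n)) \<longlonglongrightarrow> 0"
    by (rule Lim_null_comparison[rotated])
      (use assms in \<open>auto simp: Cauchy_equivalence_iff Cauchy_sequences_iff intro!: always_eventually mdist_quadrilateral\<close>)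
  from tendsto_diff[OF lim this] show ?thesis by simp
qed

definition completion_points :: "(nat => 'a) set set" where
  "completion_points = Cauchy_sequences Y // Cauchy_equivalence Y"

definition completion_dist :: "(nat => 'a) set => (nat => 'a) set => real" where
  "completion_dist F G = (if F \<in> completion_points & G \<in> completion_points
     then lim (%n. mdist Y ((SOME f. f \<in> F) n) ((SOME g. g \<in> G) n)) else 0)"

lemma completion_rep:
  assumes "F \<in> completion_points"
  shows "(SOME f. f \<in> F) \<in> F" "f \<in> F ==> f \<in> Cauchy_sequences Y" "f \<in> F ==> g \<in> F ==> (f, g) \<in> Cauchy_equivalence Y"
proof -
  have "F ~= {}" using assms in_quotient_imp_non_empty[OF Cauchy_equivalence_equiv] by (auto simp: completion_points_def)
  then show "(SOME f. f \<in> F) \<in> F" by (simp add: some_in_eq)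
  show "f \<in> Cauchy_sequences Y" if "f \<in> F"
    using that assms in_quotient_imp_subset[OF Cauchy_equivalence_equiv] by (auto simp: completion_points_def)
  show "(f, g) \<in> Cauchy_equivalence Y" if "f \<in> F" "g \<in> F"
    using that assms in_quotient_imp_in_rel[OF Cauchy_equivalence_equiv, of F f g] by (auto simp: completion_points_def)
qed

lemma completion_dist_limit:
  assumes F: "F \<in> completion_points" "f \<in> F" and G: "G \<in> completion_points" "g \<in> G"
  shows "(%n. mdist Y (f n) (g n)) \<longlonglongrightarrow> completion_dist F G"
proof -
  let ?f = "SOME f. f \<in> F" and ?g = "SOME g. g \<in> G"
  have "(%n. mdist Y (?f n) (?g n)) \<longlonglongrightarrow> completion_dist F G"
    using Cauchy_dist_convergent[OF completion_rep(2)[OF F(1) completion_rep(1)[OF F(1)]] completion_rep(2)[OF G(1) completion_rep(1)[OF G(1)]]]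
    F G by (simp add: completion_dist_def convergent_LIMSEQ_iff)
  then show ?thesis
    by (rule Cauchy_dist_limit_unique[rotated 2]) (use completion_rep F G in blast)+
qed

lemma Metric_space_completion: "Metric_space completion_points completion_dist"
proof
  show nonneg: "0 <= completion_dist F G" for F G
  proof (cases "F \<in> completion_points & G \<in> completion_points")
    case True
    then show ?thesis
      using LIMSEQ_le_const[OF completion_dist_limit[of F _ G, OF _ completion_rep(1) _ completion_rep(1)], of 0] by auto
  qed (auto simp: completion_dist_def)
  show "completion_dist F G = completion_dist G F" for F G
  proof (cases "F \<in> completion_points & G \<in> completion_points")
    case True
    then obtain f g where fg: "f \<in> F" "g \<in> G" using completion_rep(1) by metis
    have "(%n. mdist Y (f n) (g n)) \<longlonglongrightarrow> completion_dist F G" using True fg by (intro completion_dist_limit) auto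
    moreover have "(%n. mdist Y (f n) (g n)) \<longlonglongrightarrow> completion_dist G F"
      unfolding mdist_commute[of Y "f _"] using True fg by (intro completion_dist_limit) auto
    ultimately show ?thesis by (rule LIMSEQ_unique)
  qed (auto simp: completion_dist_def)
  fix F G assume FG: "F \<in> completion_points" "G \<in> completion_points"
  obtain f where f: "f \<in> F" using completion_rep(1)[OF FG(1)] by blast
  obtain g where g: "g \<in> G" using completion_rep(1)[OF FG(2)] by blast
  have lim: "(%n. mdist Y (f n) (g n)) \<longlonglongrightarrow> completion_dist F G" by (rule completion_dist_limit) fact+
  show "(completion_dist F G = 0) = (F = G)"
  proof
    assume "completion_dist F G = 0"
    then have "(f, g) \<in> Cauchy_equivalence Y" using lim completion_rep(2) FG f g by (auto simp: Cauchy_equivalence_iff)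
    then show "F = G"
      using quotient_eqI[OF Cauchy_equivalence_equiv] FG f g unfolding completion_points_def by metis
  next
    assume "F = G"
    then have "(%n. mdist Y (f n) (g n)) \<longlonglongrightarrow> 0" using completion_rep(3)[OF FG(1), of f g] f g by (simp add: Cauchy_equivalence_iff)
    then show "completion_dist F G = 0" using lim LIMSEQ_unique by blast
  qed
next
  fix F G H assume FGH: "F \<in> completion_points" "G \<in> completion_points" "H \<in> completion_points"
  obtain f g h where f: "f \<in> F" "g \<in> G" "h \<in> H" using completion_rep(1) FGH by metis
  have in_space: "f n \<in> mspace Y" "g n \<in> mspace Y" "h n \<in> mspace Y" for n
    using completion_rep(2) FGH f unfolding Cauchy_sequences_iff by metis+
  show "completion_dist F H <= completion_dist F G + completion_dist G H"
  proof (rule LIMSEQ_le)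
    show "(%n. mdist Y (f n) (h n)) \<longlonglongrightarrow> completion_dist F H" using FGH f by (intro completion_dist_limit)
    show "(%n. mdist Y (f n) (g n) + mdist Y (g n) (h n)) \<longlonglongrightarrow> completion_dist F G + completion_dist G H"
      using FGH f by (intro tendsto_add completion_dist_limit)
    show "\<exists>N. \<forall>n\<ge>N. mdist Y (f n) (h n) <= mdist Y (f n) (g n) + mdist Y (g n) (h n)"
      using in_space by (blast intro: mdist_triangle)
  qed
qed

lemma mspace_completion: "mspace (completion_metric Y) = completion_points"
  and mdist_completion: "mdist (completion_metric Y) = completion_dist"
proof -
  have "completion_metric Y = metric (completion_points, completion_dist)"
    unfolding completion_metric_def Let_def completion_points_def completion_dist_def ..
  then show "mspace (completion_metric Y) = completion_points" "mdist (completion_metric Y) = completion_dist"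
    by (simp_all add: Metric_space.mspace_metric[OF Metric_space_completion] Metric_space.mdist_metric[OF Metric_space_completion])
qed

lemma Cauchy_class:
  assumes "f \<in> Cauchy_sequences Y"
  shows "Cauchy_equivalence Y `` {f} \<in> completion_points" "f \<in> Cauchy_equivalence Y `` {f}"
  using assms Cauchy_equivalence_equiv equiv_class_self unfolding completion_points_def by (auto simp: quotientI equiv_class_self)

lemma const_Cauchy: "x \<in> mspace Y ==> (%n. x) \<in> Cauchy_sequences Y"
proof -
  assume x: "x \<in> mspace Y"
  then have "mdist Y x x = 0" by simp
  note h = this
  show ?thesis unfolding Cauchy_sequences_iff by (intro conjI allI impI exI[of _ 0]) (simp_all add: x h)
qed

lemma completion_embedding_in: "x \<in> mspace Y ==> completion_embedding Y x \<in> mspace (completion_metric Y)"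
  unfolding completion_embedding_def mspace_completion by (intro Cauchy_class const_Cauchy)

lemma completion_embedding_isometric:
  assumes "x \<in> mspace Y" "y \<in> mspace Y"
  shows "mdist (completion_metric Y) (completion_embedding Y x) (completion_embedding Y y) = mdist Y x y"
proof -
  have "(%n. mdist Y ((%n. x) n) ((%n. y) n)) \<longlonglongrightarrow> completion_dist (completion_embedding Y x) (completion_embedding Y y)"
    unfolding completion_embedding_def using assms by (intro completion_dist_limit Cauchy_class const_Cauchy)
  then show ?thesis unfolding mdist_completion by (simp add: LIMSEQ_const_iff)
qed

lemma Cauchy_class_dist_le:
  assumes f: "f \<in> Cauchy_sequences Y" and y: "y \<in> mspace Y" and le: "!!n. n >= N ==> mdist Y (f n) y <= e"
  shows "mdist (completion_metric Y) (Cauchy_equivalence Y `` {f}) (completion_embedding Y y) <= e"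
proof (rule LIMSEQ_le_const2)
  show "(%n. mdist Y (f n) ((%n. y) n)) \<longlonglongrightarrow> mdist (completion_metric Y) (Cauchy_equivalence Y `` {f}) (completion_embedding Y y)"
    unfolding completion_embedding_def mdist_completion by (intro completion_dist_limit Cauchy_class const_Cauchy f y)
qed (use le in blast)

lemma completion_dense:
  assumes F: "F \<in> mspace (completion_metric Y)" and e: "0 < e"
  shows "\<exists>x\<in>mspace Y. mdist (completion_metric Y) F (completion_embedding Y x) < e"
proof -
  have F': "F \<in> completion_points" using F by (simp add: mspace_completion)
  obtain f where f: "f \<in> F" "f \<in> Cauchy_sequences Y" using completion_rep F' by metis
  have eq: "F = Cauchy_equivalence Y `` {f}"
    using F' f Cauchy_class quotient_eqI[OF Cauchy_equivalence_equiv, of F "Cauchy_equivalence Y `` {f}" f f]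
      completion_rep(3)[OF F' f(1) f(1)] unfolding completion_points_def by blast
  obtain N where N: "\<forall>m\<ge>N. \<forall>n\<ge>N. mdist Y (f m) (f n) < e / 2"
    using f e unfolding Cauchy_sequences_iff by (meson half_gt_zero)
  have fN: "f N \<in> mspace Y" using f by (simp add: Cauchy_sequences_iff)
  have "mdist (completion_metric Y) F (completion_embedding Y (f N)) <= e / 2"
    unfolding eq by (rule Cauchy_class_dist_le[OF f(2) fN]) (use N in \<open>auto intro: less_imp_le\<close>)
  then show ?thesis using fN e by (intro bexI[of _ "f N"]) auto
qed

text \<open>A Cauchy sequence of classes is approximated, with errors tending to zero, by points of the original space;
  these form a Cauchy sequence whose class is the limit.\<close>
lemma completion_complete: "mcomplete_of (completion_metric Y)"
proof -
  let ?C = "completion_metric Y"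
  interpret C: Metric_space "mspace ?C" "mdist ?C" by simp
  have "\<exists>G. limitin C.mtopology F G sequentially" if F: "C.MCauchy F" for F
  proof -
    have Fin: "F n \<in> mspace ?C" for n using F unfolding C.MCauchy_def by blast
    have "\<exists>x. x \<in> mspace Y & mdist ?C (F n) (completion_embedding Y x) < 1 / real (Suc n)" for n
      using completion_dense[OF Fin, of "1 / real (Suc n)" n] by auto
    then obtain x where x: "!!n. x n \<in> mspace Y" "!!n. mdist ?C (F n) (completion_embedding Y (x n)) < 1 / real (Suc n)" by metis
    have small: "\<exists>N. \<forall>n\<ge>N. 1 / real (Suc n) < e" if "0 < e" for e :: real
    proof -
      obtain N where "1 / real (Suc N) < e" using \<open>0 < e\<close> nat_approx_posE by blast
      moreover have "1 / real (Suc n) <= 1 / real (Suc N)" if "n >= N" for n using that by (intro divide_left_mono) auto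
      ultimately show ?thesis by (meson order_le_less_trans)
    qed
    have xe: "completion_embedding Y (x n) \<in> mspace ?C" for n using x completion_embedding_in by blast
    have xC: "x \<in> Cauchy_sequences Y"
      unfolding Cauchy_sequences_iff
    proof (intro conjI allI impI)
      fix e :: real assume "0 < e"
      then have e3: "0 < e / 3" by simp
      obtain N1 where N1: "\<forall>n\<ge>N1. 1 / real (Suc n) < e / 3" using small[OF e3] by blast
      obtain N2 where N2: "\<forall>m\<ge>N2. \<forall>n\<ge>N2. mdist ?C (F m) (F n) < e / 3" using F e3 unfolding C.MCauchy_def by meson
      have "mdist Y (x m) (x n) < e" if mn: "m >= max N1 N2" "n >= max N1 N2" for m n
      proof -
        have "mdist Y (x m) (x n) = mdist ?C (completion_embedding Y (x m)) (completion_embedding Y (x n))"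
          using completion_embedding_isometric x by simp
        also have "... <= mdist ?C (completion_embedding Y (x m)) (F m) + (mdist ?C (F m) (F n) + mdist ?C (F n) (completion_embedding Y (x n)))"
          using C.triangle[OF xe[of m] Fin[of m] xe[of n]] C.triangle[OF Fin[of m] Fin[of n] xe[of n]] by linarith
        also have "... < e / 3 + (e / 3 + e / 3)"
        proof (intro add_strict_mono)
          have "1 / real (Suc m) < e / 3" "1 / real (Suc n) < e / 3" using N1 mn by (meson max.bounded_iff)+
          then show "mdist ?C (completion_embedding Y (x m)) (F m) < e / 3"
            "mdist ?C (F n) (completion_embedding Y (x n)) < e / 3"
            using x(2)[of m] x(2)[of n] unfolding C.commute[of "completion_embedding Y (x m)" "F m"] by linarith+
          show "mdist ?C (F m) (F n) < e / 3" using N2 mn by (meson max.bounded_iff)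
        qed
        finally show ?thesis by simp
      qed
      then show "\<exists>N. \<forall>m\<ge>N. \<forall>n\<ge>N. mdist Y (x m) (x n) < e" by blast
    qed (rule x)
    let ?G = "Cauchy_equivalence Y `` {x}"
    have G: "?G \<in> mspace ?C" using Cauchy_class[OF xC] by (simp add: mspace_completion)
    have "\<exists>N. \<forall>n\<ge>N. F n \<in> mspace ?C & mdist ?C (F n) ?G < e" if "0 < e" for e
    proof -
      have e2: "0 < e / 2" using that by simp
      obtain N1 where N1: "\<forall>n\<ge>N1. 1 / real (Suc n) < e / 2" using small[OF e2] by blast
      obtain N2 where N2: "\<forall>m\<ge>N2. \<forall>n\<ge>N2. mdist Y (x m) (x n) < e / 2" using xC e2 unfolding Cauchy_sequences_iff by blast
      have "mdist ?C (F n) ?G < e" if n: "n >= max N1 N2" for n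
      proof -
        have "mdist ?C ?G (completion_embedding Y (x n)) <= e / 2"
          by (rule Cauchy_class_dist_le[OF xC x(1), of N2]) (use N2 n in \<open>auto intro: less_imp_le\<close>)
        moreover have "1 / real (Suc n) < e / 2" using N1 n by (meson max.bounded_iff)
        then have "mdist ?C (F n) (completion_embedding Y (x n)) < e / 2" using x(2)[of n] by linarith
        ultimately show ?thesis
          using C.triangle[OF Fin[of n] xe[of n] G] C.commute[of ?G "completion_embedding Y (x n)"] by linarith
      qed
      then show ?thesis using Fin by blast
    qed
    then have "limitin C.mtopology F ?G sequentially" using G unfolding C.limit_metric_sequentially by blast
    then show ?thesis by blast
  qed
  then show ?thesis unfolding mcomplete_of_def C.mcomplete_def by blast
qed

end

section \<open>The boundary of the uniformized filling\<close>

context hyperbolic_filling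
begin

abbreviation "Y \<equiv> completed_filling (exp (1 / 4)) 2 (1 / 4) z0 A"
abbreviation "emb \<equiv> filling_embedding (exp (1 / 4)) 2 (1 / 4) z0 A"
abbreviation "bdry \<equiv> filling_boundary_point (exp (1 / 4)) 2 (1 / 4) z0 A"
abbreviation "edge v w t \<equiv> emb (edge_point v w t)"
abbreviation "vert v \<equiv> emb (vertex_point v)"

lemma Y_eq: "Y = completion_metric Xe"
  unfolding completed_filling_def uniformized_filling_def filling_def ..

lemma emb_eq: "emb = completion_embedding Xe"
  unfolding filling_embedding_def uniformized_filling_def filling_def ..

sublocale YM: Metric_space "mspace Y" "mdist Y" by simp

lemma emb_in: "x \<in> points ==> emb x \<in> mspace Y"
  unfolding Y_eq emb_eq by (rule completion_embedding_in) simp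

lemma emb_isometric: "x \<in> points ==> y \<in> points ==> mdist Y (emb x) (emb y) = mdist Xe x y"
  unfolding Y_eq emb_eq by (rule completion_embedding_isometric) simp_all

lemma emb_dense: "F \<in> mspace Y ==> 0 < e ==> \<exists>x\<in>points. mdist Y F (emb x) < e"
  using completion_dense[of F Xe e] unfolding Y_eq emb_eq by simp

lemma Y_complete: "YM.mcomplete"
  using completion_complete[of Xe] unfolding Y_eq mcomplete_of_def .

lemma vert_in: "v \<in> V ==> vert v \<in> mspace Y"
  by (intro emb_in vertex_point_in)

lemma edge_in: "N v w ==> t \<in> {0..1} ==> edge v w t \<in> mspace Y"
  by (intro emb_in edge_point_in)

lemma edge_dist_le:
  assumes "N (z, i) w" "s \<in> {0..1}" "t \<in> {0..1}"
  shows "mdist Y (edge (z, i) w s) (edge (z, i) w t) <= 2 * r i * \<bar>s - t\<bar>"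
  using mdist_Xe_edge_bound[OF assms] emb_isometric edge_point_in[OF assms(1)] assms by simp

lemma neighbor_dist_le: "N (z, i) w ==> mdist Y (vert (z, i)) (vert w) <= 2 * r i"
  using edge_dist_le[of z i w 0 1] by simp

text \<open>Since \<open>1 - e\<^sup>-\<^sup>1\<^sup>/\<^sup>4 > 1/5\<close>, the lengths of the edges of a descending chain telescope.\<close>
lemma two_r_le: "2 * r i <= 10 * (r i - r (Suc i))"
proof -
  have "1 + 1 / 4 <= exp (1 / 4 :: real)" by (rule exp_ge_add_one_self)
  then have "(1 + 1 / 4) * r (Suc i) <= exp (1 / 4) * r (Suc i)" by (intro mult_right_mono) auto
  then show ?thesis using r_Suc[of i] by simp
qed

definition chain :: "'z => (nat => 'z) => bool" where
  "chain z \<zeta> \<longleftrightarrow> (\<forall>i. \<zeta> i \<in> A i & dist (\<zeta> i) z < r i)"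

lemma chain_near: "chain z (%i. near i z)" using near by (simp add: chain_def)

lemma chain_step: "chain z \<zeta> ==> N (\<zeta> i, i) (\<zeta> (Suc i), Suc i)"
  by (rule next_level_neighbors[of _ _ _ z]) (auto simp: chain_def)

lemma chain_dist:
  assumes c: "chain z \<zeta>" and ij: "i <= j"
  shows "mdist Y (vert (\<zeta> i, i)) (vert (\<zeta> j, j)) <= 10 * r i - 10 * r j"
  using ij
proof (induction j rule: dec_induct)
  case base
  have "vert (\<zeta> i, i) \<in> mspace Y" using c by (auto simp: chain_def intro!: vert_in)
  then show ?case by simp
next
  case (step n)
  have "vert (\<zeta> k, k) \<in> mspace Y" for k using c by (auto simp: chain_def intro!: vert_in)
  then have "mdist Y (vert (\<zeta> i, i)) (vert (\<zeta> (Suc n), Suc n)) \<le>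
     mdist Y (vert (\<zeta> i, i)) (vert (\<zeta> n, n)) + mdist Y (vert (\<zeta> n, n)) (vert (\<zeta> (Suc n), Suc n))"
    by (intro YM.triangle)
  also have "... <= (10 * r i - 10 * r n) + 2 * r n"
    using step neighbor_dist_le[OF chain_step[OF c]] by (intro add_mono)
  finally show ?case using two_r_le[of n] by simp
qed

lemma small_r: "0 < e ==> \<exists>n. \<forall>i\<ge>n. r i < e"
  using r_tendsto_0 by (auto simp: lim_sequentially dist_real_def)

lemma chain_limit:
  assumes c: "chain z \<zeta>"
  shows "\<exists>\<xi>. limitin YM.mtopology (%i. vert (\<zeta> i, i)) \<xi> sequentially"
proof -
  have v: "vert (\<zeta> i, i) \<in> mspace Y" for i using c by (auto simp: chain_def intro!: vert_in)
  have "YM.MCauchy (%i. vert (\<zeta> i, i))"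
    unfolding YM.MCauchy_def
  proof (intro conjI allI impI)
    fix e :: real assume "0 < e"
    then obtain n where n: "\<forall>i\<ge>n. r i < e / 10" using small_r[of "e / 10"] by auto
    have *: "mdist Y (vert (\<zeta> i, i)) (vert (\<zeta> j, j)) < e" if "n <= i" "i <= j" for i j
    proof -
      have "mdist Y (vert (\<zeta> i, i)) (vert (\<zeta> j, j)) <= 10 * r i - 10 * r j" by (rule chain_dist[OF c that(2)])
      moreover have "10 * r i < e" using n that by (simp add: field_simps)
      ultimately show ?thesis using r_pos(1)[of j] by linarith
    qed
    have "mdist Y (vert (\<zeta> i, i)) (vert (\<zeta> j, j)) < e" if "n <= i" "n <= j" for i j
    proof (cases "i <= j")
      case True then show ?thesis using * that by blast
    next
      case False
      then have "mdist Y (vert (\<zeta> j, j)) (vert (\<zeta> i, i)) < e" using *[of j i] that by simp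
      then show ?thesis by (metis YM.commute)
    qed
    then show "\<exists>n. \<forall>i j. n <= i --> n <= j --> mdist Y (vert (\<zeta> i, i)) (vert (\<zeta> j, j)) < e" by blast
  qed (use v in blast)
  then show ?thesis using Y_complete unfolding YM.mcomplete_def by blast
qed

lemma same_level_dist:
  assumes "a \<in> A i" "b \<in> A i" "dist a x < 2 * r i" "dist b x < 2 * r i"
  shows "mdist Y (vert (a, i)) (vert (b, i)) <= 2 * r i"
proof (cases "a = b")
  case True
  have "vert (b, i) \<in> mspace Y" using assms by (auto intro!: vert_in)
  then show ?thesis using True by simp
qed (use neighbor_dist_le[OF same_level_neighbors[OF assms]] in auto)

text \<open>Two chains to the same point are joined by edges at every level, so they have the same limit, which is
  therefore the point selected by the definite description.\<close>
lemma bdry_limit: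
  assumes c: "chain z \<zeta>"
  shows "limitin YM.mtopology (%i. vert (\<zeta> i, i)) (bdry z) sequentially"
proof -
  obtain \<xi> where \<xi>: "limitin YM.mtopology (%i. vert (near i z, i)) \<xi> sequentially"
    using chain_limit[OF chain_near] by blast
  have \<xi>M: "\<xi> \<in> mspace Y" using \<xi> by (simp add: YM.limit_metric_sequentially)
  have all: "limitin YM.mtopology (%i. vert (\<eta> i, i)) \<xi> sequentially" if e: "chain z \<eta>" for \<eta>
    unfolding YM.limit_metric_sequentially
  proof (intro conjI allI impI \<xi>M)
    fix e :: real assume "0 < e"
    then obtain n m where n: "\<forall>i\<ge>n. r i < e / 4" and m: "\<forall>i\<ge>m. mdist Y (vert (near i z, i)) \<xi> < e / 2"
      using small_r[of "e / 4"] \<xi> unfolding YM.limit_metric_sequentially by (metis half_gt_zero divide_pos_pos zero_less_numeral)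
    have "vert (\<eta> i, i) \<in> mspace Y & mdist Y (vert (\<eta> i, i)) \<xi> < e" if "i >= max n m" for i
    proof -
      have v: "vert (\<eta> i, i) \<in> mspace Y" "vert (near i z, i) \<in> mspace Y"
        using e near by (auto simp: chain_def intro!: vert_in)
      have "dist (\<eta> i) z < 2 * r i" "dist (near i z) z < 2 * r i"
        using e near(2)[of i z] r_pos(1)[of i] unfolding chain_def by (smt (verit))+
      then have "mdist Y (vert (\<eta> i, i)) (vert (near i z, i)) <= 2 * r i"
        using e near by (intro same_level_dist) (auto simp: chain_def)
      moreover have "r i < e / 4" "mdist Y (vert (near i z, i)) \<xi> < e / 2" using n m that by auto
      moreover have "mdist Y (vert (\<eta> i, i)) \<xi> <= mdist Y (vert (\<eta> i, i)) (vert (near i z, i)) + mdist Y (vert (near i z, i)) \<xi>"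
        using v \<xi>M by (intro YM.triangle)
      ultimately show ?thesis using v by linarith
    qed
    then show "\<exists>N. \<forall>n\<ge>N. vert (\<eta> n, n) \<in> mspace Y & mdist Y (vert (\<eta> n, n)) \<xi> < e" by blast
  qed
  have "bdry z = \<xi>"
    unfolding filling_boundary_point_def mtopology_of_def r_eq mult_1
  proof (rule the_equality, intro conjI allI impI \<xi>M)
    fix \<eta> assume "\<forall>i. \<eta> i \<in> A i & dist (\<eta> i) z < r i"
    then show "limitin YM.mtopology (%i. vert (\<eta> i, i)) \<xi> sequentially" by (intro all) (simp add: chain_def)
  next
    fix \<xi>' assume h: "\<xi>' \<in> mspace Y & (\<forall>\<zeta>. (\<forall>i. \<zeta> i \<in> A i & dist (\<zeta> i) z < r i) --> limitin YM.mtopology (%i. vert (\<zeta> i, i)) \<xi>' sequentially)"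
    moreover have "\<forall>i. near i z \<in> A i & dist (near i z) z < r i" using near by simp
    ultimately have "limitin YM.mtopology (%i. vert (near i z, i)) \<xi>' sequentially"
      by (elim conjE allE[of _ "%i. near i z"]) simp
    then show "\<xi>' = \<xi>" using YM.limitin_metric_unique \<xi> trivial_limit_sequentially by blast
  qed
  then show ?thesis using all[OF c] by simp
qed

lemma bdry_in: "bdry z \<in> mspace Y"
  using bdry_limit[OF chain_near] by (simp add: YM.limit_metric_sequentially)

lemma bdry_dist_le:
  assumes a: "a \<in> A i" "dist a z < r i"
  shows "mdist Y (vert (a, i)) (bdry z) <= 10 * r i"
proof (rule field_le_epsilon)
  fix e :: real assume e: "0 < e"
  define \<zeta> where "\<zeta> = (%j. if j = i then a else near j z)"
  have c: "chain z \<zeta>" using a near by (simp add: chain_def \<zeta>_def)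
  obtain m where m: "\<forall>j\<ge>m. vert (\<zeta> j, j) \<in> mspace Y & mdist Y (vert (\<zeta> j, j)) (bdry z) < e"
    using bdry_limit[OF c] e unfolding YM.limit_metric_sequentially by blast
  define j where "j = max i m"
  have "vert (a, i) \<in> mspace Y" using a by (auto intro!: vert_in)
  then have "mdist Y (vert (a, i)) (bdry z) <= mdist Y (vert (a, i)) (vert (\<zeta> j, j)) + mdist Y (vert (\<zeta> j, j)) (bdry z)"
    using m bdry_in by (intro YM.triangle) (auto simp: j_def)
  moreover have "mdist Y (vert (a, i)) (vert (\<zeta> j, j)) <= 10 * r i - 10 * r j"
    using chain_dist[OF c, of i j] by (simp add: j_def \<zeta>_def)
  moreover have "mdist Y (vert (\<zeta> j, j)) (bdry z) < e" using m by (simp add: j_def)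
  ultimately show "mdist Y (vert (a, i)) (bdry z) <= 10 * r i + e" using r_pos(1)[of j] by linarith
qed

lemma level_exists:
  assumes "0 < d" "d < 1" shows "\<exists>i. r (Suc i) <= d & d < r i"
proof -
  define k where "k = (LEAST k. r k <= d)"
  obtain n where "\<forall>i\<ge>n. r i < d" using small_r[OF assms(1)] by blast
  then have "r n <= d" by (simp add: less_imp_le)
  then have k: "r k <= d" unfolding k_def by (rule LeastI)
  then have "k ~= 0" using assms by (cases "k = 0") auto
  then obtain i where i: "k = Suc i" by (cases k) auto
  then have "~ r i <= d" unfolding k_def using not_less_Least[of i "%k. r k <= d"] k_def by simp
  then show ?thesis using k i by auto
qed

text \<open>The chains to the two points pass through equal or neighboring vertices at the level where \<open>r\<^sub>i\<close> is comparable
  to their distance; from there each of them is at distance at most \<open>10 r\<^sub>i\<close>, and \<open>2(10 + 10 + 2) = 44\<close>.\<close>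
lemma bdry_lipschitz: "mdist Y (bdry z) (bdry y) <= 44 * dist z y"
proof (cases "z = y")
  case True then show ?thesis using bdry_in[of y] by simp
next
  case False
  then obtain i where i: "r (Suc i) <= dist z y" "dist z y < r i" using level_exists[of "dist z y"] dist_less_1 by auto
  have v: "vert (near i x, i) \<in> mspace Y" for x using near by (auto intro!: vert_in)
  have "dist (near i z) y <= dist (near i z) z + dist z y" by (rule dist_triangle)
  then have "dist (near i z) y < 2 * r i" "dist (near i y) y < 2 * r i"
    using near(2)[of i z] near(2)[of i y] i(2) r_pos(1)[of i] by linarith+
  then have "mdist Y (vert (near i z, i)) (vert (near i y, i)) <= 2 * r i"
    using near(1) by (intro same_level_dist[of _ _ _ y])
  moreover have "mdist Y (vert (near i z, i)) (bdry z) <= 10 * r i" "mdist Y (vert (near i y, i)) (bdry y) <= 10 * r i"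
    using bdry_dist_le near by blast+
  moreover have "mdist Y (bdry z) (bdry y) <= mdist Y (bdry z) (vert (near i z, i)) + mdist Y (vert (near i z, i)) (bdry y)"
    "mdist Y (vert (near i z, i)) (bdry y) <= mdist Y (vert (near i z, i)) (vert (near i y, i)) + mdist Y (vert (near i y, i)) (bdry y)"
    using v bdry_in by (blast intro: YM.triangle)+
  ultimately have "mdist Y (bdry z) (bdry y) <= 22 * r i"
    unfolding YM.commute[of "bdry z" "vert (near i z, i)"] by linarith
  then show ?thesis using r_le_Suc[of i] i by linarith
qed

lemma edge_bdry_dist_le:
  assumes n: "N (z, i) w" and t: "t \<in> {0..1}"
  shows "mdist Y (edge (z, i) w t) (bdry e) <= 44 * (dist z e + r i)"
proof -
  have z: "z \<in> A i" using n by (cases w) (auto simp: N_iff)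
  have p: "edge (z, i) w t \<in> mspace Y" "vert (z, i) \<in> mspace Y" "bdry z \<in> mspace Y" "bdry e \<in> mspace Y"
    using edge_in[OF n t] z bdry_in by (auto intro!: vert_in)
  have "mdist Y (edge (z, i) w t) (vert (z, i)) <= 2 * r i * \<bar>t - 0\<bar>" using edge_dist_le[OF n t, of 0] by simp
  also have "... <= 2 * r i * 1" using t by (intro mult_left_mono) auto
  finally have "mdist Y (edge (z, i) w t) (vert (z, i)) <= 2 * r i" by simp
  moreover have "mdist Y (vert (z, i)) (bdry z) <= 10 * r i" using bdry_dist_le[OF z, of z] by simp
  moreover have "mdist Y (bdry z) (bdry e) <= 44 * dist z e" by (rule bdry_lipschitz)
  moreover have "mdist Y (edge (z, i) w t) (bdry e) <= mdist Y (edge (z, i) w t) (vert (z, i)) + mdist Y (vert (z, i)) (bdry e)"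
    "mdist Y (vert (z, i)) (bdry e) <= mdist Y (vert (z, i)) (bdry z) + mdist Y (bdry z) (bdry e)"
    using p by (blast intro: YM.triangle)+
  ultimately have "mdist Y (edge (z, i) w t) (bdry e) <= 44 * dist z e + 44 * r i" using r_pos(1)[of i] by linarith
  then show ?thesis by simp
qed

text \<open>The function \<open>(z, i) \<mapsto> d(z, e) + \<alpha>\<^sup>-\<^sup>i\<close> on the vertices has a Lipschitz extension that
  vanishes at the boundary point \<open>e\<close>, so it bounds the distance to \<open>e\<close> from below.\<close>
lemma edge_bdry_dist_ge:
  assumes n: "N (z, i) w" and t: "t \<in> {0..1}"
  shows "dist z e + r i <= 110 * mdist Y (edge (z, i) w t) (bdry e)"
proof -
  define f where "f = (%v. dist (fst v) e + r (snd v))"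
  let ?x = "edge_point (z, i) w t"
  have x: "?x \<in> points" by (rule edge_point_in[OF n t])
  have f: "\<bar>f (z, i) - f w\<bar> <= 5 * r i" if n: "N (z, i) w" for z i w
  proof -
    obtain y j where w: "w = (y, j)" by (cases w)
    have "\<bar>dist z e - dist y e\<bar> <= dist z y" by (metis abs_dist_diff_le dist_commute)
    then show ?thesis using neighbors_close[OF n[unfolded w]] r_pos(1)[of i] r_pos(1)[of j] unfolding f_def w by simp
  qed
  have le: "pl f ?x <= 10 * mdist Y (emb ?x) (bdry e)"
  proof (rule field_le_epsilon)
    fix d :: real assume d: "0 < d"
    then obtain m where m: "\<forall>i\<ge>m. r i < d / 102" using small_r[of "d / 102"] by auto
    let ?v = "(near m e, m)"
    have v: "?v \<in> V" using near by simp
    have "\<bar>pl f ?x - pl f (vertex_point ?v)\<bar> <= 2 * 5 * mdist Xe ?x (vertex_point ?v)"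
      by (rule pl_lipschitz_filling) (use f x v in auto)
    moreover have "pl f (vertex_point ?v) < 2 * r m" using near(2)[of m e] by (simp add: f_def)
    moreover have "mdist Xe ?x (vertex_point ?v) = mdist Y (emb ?x) (vert ?v)" using emb_isometric x v by simp
    moreover have "mdist Y (emb ?x) (vert ?v) <= mdist Y (emb ?x) (bdry e) + mdist Y (bdry e) (vert ?v)"
      using x v bdry_in by (intro YM.triangle emb_in vert_in)
    moreover have "mdist Y (bdry e) (vert ?v) <= 10 * r m" using bdry_dist_le[OF near] by (metis YM.commute)
    moreover have "102 * r m < d" using m[rule_format, of m] by simp
    ultimately show "pl f ?x <= 10 * mdist Y (emb ?x) (bdry e) + d" by linarith
  qed
  obtain y j where w: "w = (y, j)" by (cases w)
  have "dist z e <= dist z y + dist y e" by (rule dist_triangle)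
  then have "dist z e + r i <= 11 * dist y e + 11 * r j"
    using neighbors_close(1-3)[OF n[unfolded w]] r_pos(1)[of i] zero_le_dist[of y e] by linarith
  then have "f (z, i) <= 11 * f w" by (simp add: f_def w)
  then have "t * f (z, i) <= t * (11 * f w)" using t by (intro mult_left_mono) auto
  moreover have "(1 - t) * f (z, i) <= (1 - t) * (11 * f (z, i))" using t by (intro mult_left_mono) (auto simp: f_def)
  moreover have "pl f ?x = (1 - t) * f (z, i) + t * f w" by (rule pl_edge[OF N_irrefl[OF n]])
  ultimately have "f (z, i) <= 11 * pl f ?x" by (simp add: algebra_simps)
  then show ?thesis using le by (simp add: f_def)
qed

lemma edge_not_bdry: "N v w ==> t \<in> {0..1} ==> edge v w t ~= bdry e"
proof
  assume n: "N v w" and t: "t \<in> {0..1}" and eq: "edge v w t = bdry e"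
  obtain z i where v: "v = (z, i)" by (cases v)
  have "mdist Y (edge (z, i) w t) (bdry e) = 0" using eq bdry_in v by simp
  then show False using edge_bdry_dist_ge[OF n[unfolded v] t, of e] r_pos(1)[of i] zero_le_dist[of z e] by linarith
qed

section \<open>Compactness and open edges\<close>

lemma edge_continuous: "N v w ==> continuous_map (top_of_set {0..1}) YM.mtopology (edge v w)"
proof -
  assume n: "N v w"
  obtain z i where v: "v = (z, i)" by (cases v)
  have "continuous_map (top_of_set {0..1}) (mtopology_of Y) (edge v w)"
    by (rule lipschitz_continuous_map_interval[where K="2 * r i"])
      (use edge_in[OF n] edge_dist_le n v in auto)
  then show ?thesis by (simp add: mtopology_of_def)
qed

text \<open>The completion is totally bounded: points on edges of large level lie near vertices of one fixed level, and the
  remaining edges are finite in number and are subdivided.\<close>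
lemma Y_compact: "compact_space YM.mtopology"
proof -
  have "\<exists>K. finite K & K <= mspace Y & mspace Y <= (\<Union>x\<in>K. YM.mball x e)" if e: "0 < e" for e
  proof -
    obtain n where n: "\<forall>i\<ge>n. r i < e / 44" using small_r[of "e / 44"] e by auto
    obtain m where m: "1 / real (Suc m) < e / 4" using nat_approx_posE[of "e / 4"] e by auto
    define W where "W = (SIGMA i:{..n}. A i)"
    have finW: "finite W" by (simp add: W_def)
    define K1 where "K1 = (%(i, z). vert (z, i)) ` W"
    define K2 where "K2 = (%((i, z), (j, y), k). edge (z, i) (y, j) (real k / real (Suc m))) `
      {((i, z), (j, y), k). (i, z) \<in> W & (j, y) \<in> W & k <= Suc m & N (z, i) (y, j)}"
    have "{((i, z), (j, y), k). (i, z) \<in> W & (j, y) \<in> W & k <= Suc m & N (z, i) (y, j)} <= W \<times> W \<times> {..Suc m}" by auto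
    then have "finite {((i, z), (j, y), k). (i, z) \<in> W & (j, y) \<in> W & k <= Suc m & N (z, i) (y, j)}"
      by (rule finite_subset) (simp add: finW)
    then have fin: "finite (K1 \<union> K2)" unfolding K1_def K2_def using finW by (intro finite_UnI finite_imageI)
    have sub: "K1 \<union> K2 <= mspace Y"
    proof -
      have "K1 <= mspace Y" unfolding K1_def W_def by (auto intro!: vert_in)
      moreover have "K2 <= mspace Y"
      proof
        fix F assume "F \<in> K2"
        then obtain i z j y k where "F = edge (z, i) (y, j) (real k / real (Suc m))" "k <= Suc m" "N (z, i) (y, j)"
          unfolding K2_def by auto
        then show "F \<in> mspace Y" by (simp only:) (intro edge_in, simp_all)
      qed
      ultimately show ?thesis by blast
    qed
    have near_K: "\<exists>k\<in>K1 \<union> K2. mdist Y k (emb x) < e / 2" if x: "x \<in> points" for x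
    proof -
      have "\<exists>z i w t. N (z, i) w & t \<in> {0..1} & x = edge_point (z, i) w t"
        using x
      proof (cases rule: points_cases)
        case (1 v)
        then obtain z i where "v = (z, i)" "z \<in> A i" by (cases v) auto
        then show ?thesis using child[of z i] 1 by (intro exI[of _ z] exI[of _ i] exI[of _ "(z, Suc i)"] exI[of _ 0]) auto
      next
        case (2 v w t)
        obtain z i where "v = (z, i)" by (cases v)
        then show ?thesis using 2
          by (intro exI[of _ z] exI[of _ i] exI[of _ w] exI[of _ t]) simp
      qed
      then obtain z i w t where zi: "N (z, i) w" "t \<in> {0..1}" "x = edge_point (z, i) w t" by blast
      obtain y j where w: "w = (y, j)" by (cases w)
      note nc = neighbors_close[OF zi(1)[unfolded w]]
      have px: "emb x \<in> mspace Y" using x by (rule emb_in)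
      show ?thesis
      proof (cases "i < n")
        case True
        define k where "k = nat \<lfloor>t * real (Suc m)\<rfloor>"
        define s where "s = real k / real (Suc m)"
        have fl: "0 <= \<lfloor>t * real (Suc m)\<rfloor>" using zi by simp
        have k1: "real k <= t * real (Suc m)" "t * real (Suc m) < real k + 1"
          unfolding k_def using fl by (auto simp: of_nat_nat)
        have "t * real (Suc m) <= 1 * real (Suc m)" using zi by (intro mult_right_mono) auto
        then have "real k <= real (Suc m)" using k1(1) unfolding mult_1 by (rule order_trans[rotated])
        then have kle: "k <= Suc m" by (simp only: of_nat_le_iff)
        have s: "s \<in> {0..1}" using kle by (auto simp: s_def field_simps)
        have st: "\<bar>s - t\<bar> <= 1 / real (Suc m)"
        proof -
          have "s - t = (real k - t * real (Suc m)) / real (Suc m)"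
            unfolding s_def by (simp add: diff_divide_distrib del: of_nat_Suc)
          then have "\<bar>s - t\<bar> = \<bar>real k - t * real (Suc m)\<bar> / real (Suc m)" by (simp only: abs_divide abs_of_nat)
          also have "... <= 1 / real (Suc m)" using k1 by (intro divide_right_mono) (auto simp del: of_nat_Suc)
          finally show ?thesis .
        qed
        have "mdist Y (edge (z, i) w s) (emb x) <= 2 * r i * \<bar>s - t\<bar>" unfolding zi(3) by (rule edge_dist_le[OF zi(1) s zi(2)])
        also have "... <= 2 * 1 * (1 / real (Suc m))" using st r_antimono[of 0 i] by (intro mult_mono) auto
        also have "... < e / 2" using m by simp
        finally have "mdist Y (edge (z, i) w s) (emb x) < e / 2" .
        moreover have "edge (z, i) w s \<in> K2"
          unfolding K2_def using nc True zi w kle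
          by (intro image_eqI[of _ _ "((i, z), (j, y), k)"]) (auto simp: s_def W_def)
        ultimately show ?thesis by blast
      next
        case False
        have v: "vert (near n z, n) \<in> mspace Y" "vert (near n z, n) \<in> K1" using near by (auto intro!: vert_in simp: K1_def W_def image_iff)
        have "mdist Y (edge (z, i) w 0) (emb x) <= 2 * r i * \<bar>0 - t\<bar>" unfolding zi(3) by (rule edge_dist_le[OF zi(1) _ zi(2)]) simp
        also have "... <= 2 * r i * 1" using zi by (intro mult_left_mono) auto
        finally have "mdist Y (vert (z, i)) (emb x) <= 2 * r i" by simp
        moreover have "mdist Y (vert (near n z, n)) (bdry z) <= 10 * r n" using bdry_dist_le[OF near] .
        moreover have "mdist Y (vert (z, i)) (bdry z) <= 10 * r i" using bdry_dist_le[OF nc(6), of z] by simp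
        moreover have "mdist Y (vert (near n z, n)) (emb x) <= mdist Y (vert (near n z, n)) (bdry z) + mdist Y (bdry z) (emb x)"
          "mdist Y (bdry z) (emb x) <= mdist Y (bdry z) (vert (z, i)) + mdist Y (vert (z, i)) (emb x)"
          using v px bdry_in nc(6) by (auto intro!: YM.triangle vert_in)
        moreover have "r i <= r n" "r n < e / 44" using False n r_antimono by auto
        ultimately have "mdist Y (vert (near n z, n)) (emb x) < e / 2"
          unfolding YM.commute[of "bdry z" "vert (z, i)"] by linarith
        then show ?thesis using v by blast
      qed
    qed
    have "mspace Y <= (\<Union>x\<in>K1 \<union> K2. YM.mball x e)"
    proof
      fix F assume F: "F \<in> mspace Y"
      obtain x where x: "x \<in> points" "mdist Y F (emb x) < e / 2" using emb_dense[OF F, of "e / 2"] e by auto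
      obtain k where k: "k \<in> K1 \<union> K2" "mdist Y k (emb x) < e / 2" using near_K[OF x(1)] by blast
      have km: "k \<in> mspace Y" using k sub by blast
      have "mdist Y k F <= mdist Y k (emb x) + mdist Y (emb x) F" using km F emb_in[OF x(1)] by (intro YM.triangle)
      then have "mdist Y k F < e" using k x unfolding YM.commute[of "emb x" F] by linarith
      then show "F \<in> (\<Union>x\<in>K1 \<union> K2. YM.mball x e)" using k km F by (auto simp: YM.in_mball)
    qed
    then show ?thesis using fin sub by blast
  qed
  then have "YM.mtotally_bounded (mspace Y)" unfolding YM.mtotally_bounded_def by blast
  then show ?thesis using YM.compact_space_eq_mcomplete_mtotally_bounded Y_complete by blast
qed

lemma edge_dist_ge:
  assumes n: "N v w" and st: "s \<in> {0..1}" "t \<in> {0..1}"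
  shows "\<bar>s - t\<bar> * \<rho> (edge_point v w s) * exp (- (1 / 4) * \<bar>s - t\<bar>) <= mdist Y (edge v w s) (edge v w t)"
proof -
  have p: "edge_point v w s \<in> points" "edge_point v w t \<in> points" using edge_point_in n st by auto
  show ?thesis
    unfolding emb_isometric[OF p] using mdist_Xe_lower[of "edge_point v w s" "edge_point v w t" "\<bar>s - t\<bar>"] p dG_edge[OF n st] by simp
qed

text \<open>A compact piece of the edge around \<open>t\<close> is closed in the completion, and near the point all points of the
  graph lie in it.\<close>
lemma near_open_edge:
  assumes n: "N v w" and t: "0 < t" "t < 1"
  shows "\<exists>\<delta>>0. \<forall>F\<in>mspace Y. mdist Y (edge v w t) F < \<delta> --> (\<exists>s. 0 < s & s < 1 & F = edge v w s)"
proof -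
  let ?x = "edge_point v w t"
  have x: "?x \<in> points" using edge_point_in[OF n, of t] t by auto
  define m where "m = min t (1 - t) / 2"
  have m: "0 < m" "m < t" "m < 1 - t" using t by (auto simp: m_def min_def)
  define \<delta> where "\<delta> = m * \<rho> ?x * exp (- (1 / 4) * m)"
  have \<delta>: "0 < \<delta>" using m by (simp add: \<delta>_def)
  have pt: "\<exists>s\<in>{t - m..t + m}. y = edge_point v w s" if y: "y \<in> points" "mdist Y (emb ?x) (emb y) < \<delta>" for y
  proof -
    have "dG ?x y < m"
    proof (rule ccontr)
      assume "~ ?thesis"
      then have "m * \<rho> ?x * exp (- (1 / 4) * m) <= mdist Xe ?x y"
        using m x y by (intro mdist_Xe_lower) auto
      then show False using y emb_isometric[OF x y(1)] by (simp add: \<delta>_def)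
    qed
    moreover have "dG ?x y < min t (1 - t)" using calculation m by simp
    ultimately show ?thesis using near_edge_point[OF n t y(1)] by (auto simp: abs_less_iff intro!: bexI)
  qed
  define K where "K = edge v w ` {t - m..t + m}"
  have "compactin YM.mtopology K"
    unfolding K_def
  proof (rule image_compactin[OF _ edge_continuous[OF n]])
    show "compactin (top_of_set {0..1}) {t - m..t + m}"
      using m by (auto simp: compactin_subtopology)
  qed
  then have Kc: "closedin YM.mtopology K" using YM.Hausdorff_space_mtopology compactin_imp_closedin by blast
  have "\<exists>s. 0 < s & s < 1 & F = edge v w s" if F: "F \<in> mspace Y" "mdist Y (edge v w t) F < \<delta>" for F
  proof -
    have "F \<in> YM.mtopology closure_of K"
      unfolding YM.metric_closure_of
    proof (simp, intro conjI F(1) allI impI)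
      fix q :: real assume q: "0 < q"
      define q' where "q' = min q (\<delta> - mdist Y (edge v w t) F)"
      have q': "0 < q'" using q F by (simp add: q'_def)
      obtain y where y: "y \<in> points" "mdist Y F (emb y) < q'" using emb_dense[OF F(1) q'] by blast
      have "mdist Y (emb ?x) (emb y) <= mdist Y (emb ?x) F + mdist Y F (emb y)"
        using emb_in x y F by (intro YM.triangle) auto
      then have "mdist Y (emb ?x) (emb y) < \<delta>" using y by (simp add: q'_def)
      from pt[OF y(1) this] have "emb y \<in> K" by (auto simp: K_def)
      then show "\<exists>y\<in>K. y \<in> mspace Y & mdist Y F y < q" using y emb_in[OF y(1)] by (intro bexI[of _ "emb y"]) (auto simp: q'_def)
    qed
    then have "F \<in> K" using Kc by (simp add: closure_of_closedin)
    then obtain s where "F = edge v w s" "t - m <= s" "s <= t + m" by (auto simp: K_def)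
    then show ?thesis using m by (intro exI[of _ s]) auto
  qed
  then show ?thesis using \<delta> by blast
qed

definition open_edges :: "(nat => 'z \<times> nat => real) set set" where
  "open_edges = {edge v w t |v w t. N v w & 0 < t & t < 1}"

lemma open_edges_openin: "openin YM.mtopology open_edges"
  unfolding YM.openin_mtopology
proof (intro conjI allI impI)
  show "open_edges <= mspace Y" by (auto simp: open_edges_def intro!: edge_in)
  fix F assume "F \<in> open_edges"
  then obtain v w t where h: "N v w" "0 < t" "t < 1" "F = edge v w t" by (auto simp: open_edges_def)
  obtain q where q: "q > 0" "\<forall>G\<in>mspace Y. mdist Y (edge v w t) G < q --> (\<exists>s. 0 < s & s < 1 & G = edge v w s)"
    using near_open_edge[OF h(1-3)] by blast
  have "G \<in> open_edges" if "G \<in> YM.mball F q" for G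
  proof -
    have "G \<in> mspace Y" "mdist Y (edge v w t) G < q" using that h(4) by (simp_all add: YM.in_mball)
    then obtain s where "0 < s" "s < 1" "G = edge v w s" using q(2) by blast
    then show ?thesis using h(1) unfolding open_edges_def by blast
  qed
  then show "\<exists>q>0. YM.mball F q <= open_edges" using q(1) by blast
qed

end

section \<open>Line integrals along edges\<close>

lemma curve_measurable:
  assumes "continuous_map (top_of_set {a..b}) (mtopology_of M) (\<gamma> :: real => 'a)"
  shows "\<gamma> \<in> measurable (restrict_space lborel {a..b}) (metric_borel M)"
  unfolding metric_borel_def
proof (rule measurable_measure_of)
  show "{U. openin (mtopology_of M) U} <= Pow (mspace M)"
    using openin_subset[of "mtopology_of M"] by auto
  show "\<gamma> \<in> space (restrict_space lborel {a..b}) \<rightarrow> mspace M"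
    using continuous_map_funspace[OF assms] by (auto simp: space_restrict_space Pi_iff)
  fix U assume "U \<in> {U. openin (mtopology_of M) U}"
  then have "openin (top_of_set {a..b}) {t \<in> {a..b}. \<gamma> t \<in> U}"
    using assms by (simp add: continuous_map_def)
  then obtain T where "open T" "{t \<in> {a..b}. \<gamma> t \<in> U} = {a..b} \<inter> T" by (auto simp: openin_open)
  moreover have "\<gamma> -` U \<inter> space (restrict_space lborel {a..b}) = {t \<in> {a..b}. \<gamma> t \<in> U}"
    by (auto simp: space_restrict_space)
  ultimately show "\<gamma> -` U \<inter> space (restrict_space lborel {a..b}) \<in> sets (restrict_space lborel {a..b})"
    by (auto simp: sets_restrict_space borel_open)
qed

lemma curve_measurable_indicator:
  fixes f :: "'a => ennreal"
  assumes "continuous_map (top_of_set {a..b}) (mtopology_of M) (\<gamma> :: real => 'a)" "f \<in> borel_measurable (metric_borel M)"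
  shows "(%t. f (\<gamma> t) * indicator {a..b} t) \<in> borel_measurable lborel"
  using measurable_compose[OF curve_measurable[OF assms(1)] assms(2)]
  by (subst (asm) borel_measurable_restrict_space_iff_ennreal) auto

context hyperbolic_filling
begin

text \<open>The weight along an edge, continued by constants so that it is continuous on the whole line and has a primitive
  that is differentiable at the end points as well.\<close>
definition wclamp :: "'z \<times> nat => 'z \<times> nat => real => real" where
  "wclamp v w q = \<rho> (edge_point v w (max 0 (min 1 q)))"

definition wprim :: "'z \<times> nat => 'z \<times> nat => real => real" where
  "wprim v w q = integral {-1..q} (wclamp v w)"

lemma wclamp_eq: "q \<in> {0..1} ==> wclamp v w q = \<rho> (edge_point v w q)"
  by (simp add: wclamp_def)

lemma wclamp_pos: "0 < wclamp v w q" and wclamp_nonneg [simp]: "0 <= wclamp v w q" by (simp_all add: wclamp_def)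

lemma wclamp_continuous: "N v w ==> continuous_on S (wclamp v w)"
proof (rule lipschitz_on_continuous_on[of "1 / 4"], rule lipschitz_onI)
  fix s t assume n: "N v w"
  have *: "max 0 (min 1 s) \<in> {0..1}" for s :: real by auto
  have "\<bar>wclamp v w s - wclamp v w t\<bar> <= 1 / 4 * dG (edge_point v w (max 0 (min 1 s))) (edge_point v w (max 0 (min 1 t)))"
    unfolding wclamp_def using \<rho>_lipschitz edge_point_in[OF n *] by simp
  also have "... = 1 / 4 * \<bar>max 0 (min 1 s) - max 0 (min 1 t)\<bar>" using dG_edge[OF n * *] by simp
  also have "... <= 1 / 4 * \<bar>s - t\<bar>" by (auto simp: max_def min_def)
  finally show "dist (wclamp v w s) (wclamp v w t) <= 1 / 4 * dist s t" by (simp add: dist_real_def)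
qed simp

lemma wprim_deriv:
  assumes n: "N v w" and q: "q \<in> {0..1}"
  shows "(wprim v w has_real_derivative wclamp v w q) (at q)"
proof -
  have "(wprim v w has_real_derivative wclamp v w q) (at q within {-1..2})"
    unfolding wprim_def using q by (intro integral_has_real_derivative wclamp_continuous[OF n]) auto
  moreover have "at q within {-1..2} = at q" using q by (intro at_within_Icc_at) auto
  ultimately show ?thesis by metis
qed

lemma wprim_nn_integral:
  assumes n: "N v w" and st: "0 <= s" "s <= t" "t <= 1"
  shows "(\<integral>\<^sup>+q\<in>{s..t}. ennreal (\<rho> (edge_point v w q)) \<partial>lborel) = ennreal (wprim v w t - wprim v w s)"
proof -
  have "(\<integral>\<^sup>+q\<in>{s..t}. ennreal (\<rho> (edge_point v w q)) \<partial>lborel) = (\<integral>\<^sup>+q\<in>{s..t}. ennreal (wclamp v w q) \<partial>lborel)"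
    by (intro nn_integral_cong) (use st wclamp_eq in \<open>auto simp: indicator_def\<close>)
  also have "... = ennreal (wprim v w t - wprim v w s)"
  proof (rule nn_integral_FTC_Icc)
    show "wclamp v w \<in> borel_measurable borel" using wclamp_continuous[OF n] by (rule borel_measurable_continuous_onI)
  qed (use st wprim_deriv[OF n] in auto)
  finally show ?thesis .
qed

lemma wprim_mono:
  assumes n: "N v w" and st: "0 <= s" "s < t" "t <= 1" shows "wprim v w s < wprim v w t"
proof (rule DERIV_pos_imp_increasing[OF st(2)])
  fix x assume "s <= x" "x <= t"
  then show "\<exists>y. (wprim v w has_real_derivative y) (at x) & 0 < y"
    using wprim_deriv[OF n, of x] wclamp_pos[of v w x] st by auto
qed

lemma edge_dist_le_wprim:
  assumes n: "N v w" and st: "0 <= s" "s <= t" "t <= 1"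
  shows "mdist Y (edge v w s) (edge v w t) <= wprim v w t - wprim v w s"
proof -
  have "wprim v w s <= wprim v w t" using wprim_mono[OF n, of s t] st by (cases "s = t") auto
  moreover have "ennreal (mdist Xe (edge_point v w s) (edge_point v w t)) <= ennreal (wprim v w t - wprim v w s)"
    using mdist_Xe_edge_le[OF n, of s t] st wprim_nn_integral[OF n st] by simp
  ultimately show ?thesis using emb_isometric edge_point_in[OF n] st by (simp add: ennreal_le_iff)
qed

text \<open>The lower bound for \<open>d\<^sub>\<epsilon>\<close> loses only a factor \<open>e\<^sup>-\<^sup>(\<^sup>t\<^sup>-\<^sup>s\<^sup>)\<close>, which tends to one under subdivision. This is how the
  exact length of an edge is found.\<close>
lemma edge_dist_ge_wprim:
  assumes n: "N v w" and st: "0 <= s" "s <= t" "t <= 1"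
  shows "exp (- (t - s)) * (wprim v w t - wprim v w s) <= mdist Y (edge v w s) (edge v w t)"
proof -
  let ?k = "t - s"
  have k: "0 <= ?k" using st by simp
  have "\<rho> (edge_point v w q) <= \<rho> (edge_point v w s) * exp (1 / 4 * ?k)" if q: "q \<in> {s..t}" for q
  proof -
    have p: "edge_point v w q \<in> points" "edge_point v w s \<in> points" using edge_point_in[OF n] q st by auto
    have "\<rho> (edge_point v w q) * exp (- (1 / 4) * dG (edge_point v w q) (edge_point v w s)) <= \<rho> (edge_point v w s)"
      using \<rho>_lower p by fastforce
    moreover have "dG (edge_point v w q) (edge_point v w s) = q - s" using dG_edge[OF n, of q s] q st by simp
    ultimately have "\<rho> (edge_point v w q) <= \<rho> (edge_point v w s) * exp (1 / 4 * (q - s))"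
      by (simp add: exp_minus field_simps)
    also have "... <= \<rho> (edge_point v w s) * exp (1 / 4 * ?k)" using q by (intro mult_left_mono) auto
    finally show ?thesis .
  qed
  then have "(\<integral>\<^sup>+q\<in>{s..t}. ennreal (\<rho> (edge_point v w q)) \<partial>lborel) <= (\<integral>\<^sup>+q. ennreal (\<rho> (edge_point v w s) * exp (1 / 4 * ?k)) * indicator {s..t} q \<partial>lborel)"
    by (intro nn_integral_mono) (auto simp: indicator_def intro!: ennreal_leI)
  also have "... = ennreal (\<rho> (edge_point v w s) * exp (1 / 4 * ?k) * ?k)"
    using st by (subst nn_integral_cmult_indicator) (auto simp: ennreal_mult)
  finally have "ennreal (wprim v w t - wprim v w s) <= ennreal (\<rho> (edge_point v w s) * exp (1 / 4 * ?k) * ?k)"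
    unfolding wprim_nn_integral[OF n st] .
  then have "wprim v w t - wprim v w s <= \<rho> (edge_point v w s) * exp (1 / 4 * ?k) * ?k"
    using k by (subst (asm) ennreal_le_iff) auto
  then have "exp (- ?k) * (wprim v w t - wprim v w s) <= exp (- ?k) * (\<rho> (edge_point v w s) * exp (1 / 4 * ?k) * ?k)"
    by (intro mult_left_mono) auto
  also have "... = (exp (- ?k) * exp (1 / 4 * ?k)) * (?k * \<rho> (edge_point v w s))" by (simp add: mult_ac)
  also have "... <= exp (- (1 / 4) * ?k) * (?k * \<rho> (edge_point v w s))"
  proof (intro mult_right_mono)
    have "- x + 1 / 4 * x <= - (1 / 4) * x" if "0 <= x" for x :: real using that by simp
    then have "- ?k + 1 / 4 * ?k <= - (1 / 4) * ?k" using k by blast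
    then show "exp (- ?k) * exp (1 / 4 * ?k) <= exp (- (1 / 4) * ?k)" by (simp only: exp_add[symmetric] exp_le_cancel_iff)
  qed (use k in auto)
  also have "... <= mdist Y (edge v w s) (edge v w t)"
    using edge_dist_ge[OF n, of s t] st by (simp add: mult_ac)
  finally show ?thesis .
qed

lemma edge_continuous_sub: "N v w ==> 0 <= s ==> t <= 1 ==> continuous_map (top_of_set {s..t}) (mtopology_of Y) (edge v w)"
  using continuous_map_from_subtopology_mono[OF edge_continuous, of v w "{s..t}"] by (simp add: mtopology_of_def)

lemma edge_curve_length:
  assumes n: "N v w" and st: "0 <= s" "s <= t" "t <= 1"
  shows "curve_length Y (edge v w) s t = ennreal (wprim v w t - wprim v w s)"
proof (rule antisym)
  show "curve_length Y (edge v w) s t <= ennreal (wprim v w t - wprim v w s)"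
    using edge_dist_le_wprim[OF n] st by (intro curve_length_le_increment) auto
  have *: "ennreal (exp (- h) * (wprim v w t - wprim v w s)) <= curve_length Y (edge v w) s t" if h: "0 < h" for h
  proof -
    define P where "P = (%x y. s <= x & y <= t --> ennreal (exp (- h) * (wprim v w y - wprim v w x)) <= curve_length Y (edge v w) x y)"
    have le: "wprim v w x <= wprim v w y" if "s <= x" "x <= y" "y <= t" for x y
      using wprim_mono[OF n, of x y] st that by (cases "x = y") auto
    have "P s t" using st(2)
    proof (induct rule: Bolzano)
      case (trans x y z)
      show ?case unfolding P_def
      proof (intro impI, elim conjE)
        assume xz: "s <= x" "z <= t"
        have "ennreal (exp (- h) * (wprim v w z - wprim v w x)) =
          ennreal (exp (- h) * (wprim v w y - wprim v w x)) + ennreal (exp (- h) * (wprim v w z - wprim v w y))"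
          using le[of x y] le[of y z] trans xz by (subst ennreal_plus[symmetric]) (auto simp: algebra_simps)
        also have "... <= curve_length Y (edge v w) x y + curve_length Y (edge v w) y z"
          using trans xz unfolding P_def by (intro add_mono) auto
        also have "... = curve_length Y (edge v w) x z"
          using trans xz st edge_in[OF n] by (intro curve_length_add[symmetric]) auto
        finally show "ennreal (exp (- h) * (wprim v w z - wprim v w x)) <= curve_length Y (edge v w) x z" .
      qed
    next
      case (local x)
      have "P a b" if ab: "a <= x" "x <= b" "b - a < h" for a b
        unfolding P_def
      proof (intro impI, elim conjE)
        assume h': "s <= a" "b <= t"
        have "exp (- h) * (wprim v w b - wprim v w a) <= exp (- (b - a)) * (wprim v w b - wprim v w a)"
          using le[of a b] ab h' by (intro mult_right_mono) auto
        also have "... <= mdist Y (edge v w a) (edge v w b)" using ab h' st by (intro edge_dist_ge_wprim[OF n]) auto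
        finally have "ennreal (exp (- h) * (wprim v w b - wprim v w a)) <= ennreal (mdist Y (edge v w a) (edge v w b))"
          by (rule ennreal_leI)
        also have "... <= curve_length Y (edge v w) a b" using ab by (intro dist_le_curve_length) auto
        finally show "ennreal (exp (- h) * (wprim v w b - wprim v w a)) <= curve_length Y (edge v w) a b" .
      qed
      then show ?case using h by blast
    qed
    then show ?thesis by (simp add: P_def)
  qed
  have "((%h. ennreal (exp (- h) * (wprim v w t - wprim v w s))) \<longlongrightarrow> ennreal (exp (- 0) * (wprim v w t - wprim v w s))) (at_right 0)"
    by (intro tendsto_intros)
  then have "ennreal (exp (- 0) * (wprim v w t - wprim v w s)) <= curve_length Y (edge v w) s t"
    by (rule tendsto_upperbound) (auto simp: eventually_at_filter intro!: always_eventually *)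
  then show "ennreal (wprim v w t - wprim v w s) <= curve_length Y (edge v w) s t" by simp
qed

lemma edge_rectifiable:
  "N v w ==> 0 <= s ==> s <= t ==> t <= 1 ==> rectifiable_curve Y (edge v w) s t"
  unfolding rectifiable_curve_def using edge_curve_length[of v w s t] edge_continuous_sub[of v w s t] by simp

text \<open>The arc length parameter along an edge is the primitive of \<open>\<rho>\<close>, so the claim is the substitution rule.\<close>
lemma edge_line_integral:
  assumes n: "N v w" and st: "0 <= s" "s < t" "t <= 1" and g: "g \<in> borel_measurable (metric_borel Y)"
  shows "line_integral Y g (edge v w) s t = (\<integral>\<^sup>+q\<in>{s..t}. g (edge v w q) * ennreal (\<rho> (edge_point v w q)) \<partial>lborel)"
proof -
  obtain \<sigma> l where \<sigma>: "unit_speed Y \<sigma> l" "l = enn2real (curve_length Y (edge v w) s t)"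
    "\<forall>q\<in>{s..t}. \<sigma> (enn2real (curve_length Y (edge v w) s q)) = edge v w q"
    "!!g. line_integral Y g (edge v w) s t = (\<integral>\<^sup>+x\<in>{0..l}. g (\<sigma> x) \<partial>lborel)"
    using rectifiable_unit_speed[OF edge_rectifiable[OF n, of s t]] st by auto
  define P where "P = (%q. wprim v w q - wprim v w s)"
  have le: "wprim v w s <= wprim v w q" if "s <= q" "q <= t" for q
    using wprim_mono[OF n, of s q] st that by (cases "s = q") auto
  have P: "enn2real (curve_length Y (edge v w) s q) = P q" if "q \<in> {s..t}" for q
    using edge_curve_length[OF n, of s q] that st le[of q] by (simp add: P_def)
  have cont: "continuous_map (top_of_set {0..l}) (mtopology_of Y) \<sigma>"
    using unit_speed_rectifiable[OF \<sigma>(1)] by (simp add: rectifiable_curve_def)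
  have Pst: "P s = 0" "P t = l" using P[of t] st \<sigma>(2) by (auto simp: P_def)
  let ?f = "%x. g (\<sigma> x) * indicator {0..l} x"
  have f: "?f \<in> borel_measurable borel" using curve_measurable_indicator[OF cont g] by simp
  have "line_integral Y g (edge v w) s t = (\<integral>\<^sup>+x. ?f x * indicator {P s..P t} x \<partial>lborel)"
    unfolding \<sigma>(4) Pst by (intro nn_integral_cong) (auto simp: indicator_def)
  also have "... = (\<integral>\<^sup>+q. ?f (P q) * ennreal (wclamp v w q) * indicator {s..t} q \<partial>lborel)"
  proof (rule nn_integral_substitution_aux[OF f])
    show "(P has_real_derivative wclamp v w q) (at q)" if "q \<in> {s..t}" for q
      unfolding P_def using wprim_deriv[OF n, of q] that st by (auto intro!: derivative_eq_intros)
  qed (use st wclamp_continuous[OF n] in auto)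
  also have "... = (\<integral>\<^sup>+q\<in>{s..t}. g (edge v w q) * ennreal (\<rho> (edge_point v w q)) \<partial>lborel)"
  proof (intro nn_integral_cong)
    fix q :: real
    have "?f (P q) = g (edge v w q)" "wclamp v w q = \<rho> (edge_point v w q)" if q: "q \<in> {s..t}"
    proof -
      have "\<sigma> (P q) = edge v w q" using \<sigma>(3) P[OF q] q by metis
      moreover have "0 <= P q" using le[of q] q by (simp add: P_def)
      moreover have "P q <= P t" using wprim_mono[OF n, of q t] q st by (cases "q = t") (auto simp: P_def)
      ultimately show "?f (P q) = g (edge v w q)" using Pst by simp
      show "wclamp v w q = \<rho> (edge_point v w q)" using q st by (intro wclamp_eq) auto
    qed
    then show "?f (P q) * ennreal (wclamp v w q) * indicator {s..t} q = g (edge v w q) * ennreal (\<rho> (edge_point v w q)) * indicator {s..t} q"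
      by (cases "q \<in> {s..t}") auto
  qed
  finally show ?thesis .
qed

lemma edge_not_constant:
  assumes n: "N v w" and st: "0 <= s" "s < t" "t <= 1" shows "~ edge v w constant_on {s..t}"
proof
  assume "edge v w constant_on {s..t}"
  then have eq: "edge v w s = edge v w t" using st by (auto simp: constant_on_def)
  have "0 < exp (- (t - s)) * (wprim v w t - wprim v w s)" using wprim_mono[OF n st] by simp
  also have "... <= mdist Y (edge v w s) (edge v w t)" using st by (intro edge_dist_ge_wprim[OF n]) auto
  also have "... = 0" using eq edge_in[OF n, of t] st by simp
  finally show False by simp
qed

end

section \<open>The measure on the filling\<close>

locale weighted_filling = hyperbolic_filling A z0 for A :: "nat => 'z::metric_space set" and z0 :: 'z +
  fixes \<nu> :: "'z measure" and \<beta> :: real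
  assumes sets_\<nu>: "sets \<nu> = sets borel" and doubling: "doubling_measure euclidean_metric \<nu>"
begin

abbreviation "wt \<equiv> vertex_weight (exp (1 / 4)) \<nu> \<beta>"
abbreviation "\<mu> \<equiv> filling_measure (exp (1 / 4)) 2 (1 / 4) z0 A \<nu> \<beta>"

lemma wt_eq: "wt (z, i) = ennreal (exp (- \<beta> * real i)) * emeasure \<nu> (ball z (r i))"
  using r_eq[of 1 i] by (simp add: vertex_weight_def)

lemma doubling_constant:
  obtains C where "C >= 1" "!!x s. 0 < s ==> 0 < emeasure \<nu> (ball x s)" "!!x s. 0 < s ==> emeasure \<nu> (ball x s) < \<infinity>"
    "!!x s. 0 < s ==> emeasure \<nu> (ball x (2 * s)) <= ennreal C * emeasure \<nu> (ball x s)"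
proof -
  have b: "mball_of euclidean_metric x s = ball x s" for x :: 'z and s by auto
  obtain C :: real where C: "C >= 1" "!!x s. 0 < s ==> 0 < emeasure \<nu> (ball x (2 * s)) \<and>
     emeasure \<nu> (ball x (2 * s)) <= ennreal C * emeasure \<nu> (ball x s) & ennreal C * emeasure \<nu> (ball x s) < \<infinity>"
    using doubling unfolding doubling_measure_def b by auto
  show ?thesis
  proof (rule that[OF C(1)])
    fix x :: 'z and s :: real assume s: "0 < s"
    show "0 < emeasure \<nu> (ball x s)" using C(2)[of "s / 2" x] s by simp
    have "1 * emeasure \<nu> (ball x s) <= ennreal C * emeasure \<nu> (ball x s)"
      using C(1) by (intro mult_right_mono) auto
    then show "emeasure \<nu> (ball x s) < \<infinity>" using C(2)[OF s, of x] by (auto intro: le_less_trans)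
    show "emeasure \<nu> (ball x (2 * s)) <= ennreal C * emeasure \<nu> (ball x s)" using C(2)[OF s] by blast
  qed
qed

lemma ball_pos: "0 < s ==> 0 < emeasure \<nu> (ball x s)" and ball_finite: "0 < s ==> emeasure \<nu> (ball x s) < \<infinity>"
  by (rule doubling_constant; blast)+

lemma wt_pos: "0 < wt v" and wt_finite: "wt v < \<infinity>"
  using ball_pos[of "r (snd v)" "fst v"] ball_finite[of "r (snd v)" "fst v"] wt_eq[of "fst v" "snd v"]
  by (auto simp: ennreal_zero_less_mult_iff ennreal_mult_less_top)

text \<open>The integral with respect to \<open>\<mu>\<^sub>\<beta>\<close>, written as a sum over directed edges.\<close>
definition edge_int :: "((nat => 'z \<times> nat => real) set => ennreal) => ennreal" where
  "edge_int f = (\<integral>\<^sup>+ v. (\<integral>\<^sup>+ w. (wt v + wt w) * (\<integral>\<^sup>+ t\<in>{0..1}. f (edge v w t) \<partial>lborel)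
      \<partial>count_space {w. N v w}) \<partial>count_space V)"

lemma edge_measurable:
  fixes f :: "_ => ennreal"
  assumes "N v w" "f \<in> borel_measurable (metric_borel Y)"
  shows "(%t. f (edge v w t) * indicator {0..1} t) \<in> borel_measurable borel"
  using curve_measurable_indicator[OF edge_continuous_sub[OF assms(1) order_refl order_refl] assms(2)] by simp

lemma space_metric_borel [simp]: "space (metric_borel M) = mspace M"
  by (simp add: metric_borel_def space_measure_of_conv)

lemma edge_int_add:
  assumes "f \<in> borel_measurable (metric_borel Y)" "g \<in> borel_measurable (metric_borel Y)"
  shows "edge_int (%x. f x + g x) = edge_int f + edge_int g"
proof -
  have "(wt v + wt w) * (\<integral>\<^sup>+ t\<in>{0..1}. (f (edge v w t) + g (edge v w t)) \<partial>lborel) =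
    (wt v + wt w) * (\<integral>\<^sup>+ t\<in>{0..1}. f (edge v w t) \<partial>lborel) + (wt v + wt w) * (\<integral>\<^sup>+ t\<in>{0..1}. g (edge v w t) \<partial>lborel)" if "N v w" for v w
  proof -
    have "(\<integral>\<^sup>+ t\<in>{0..1}. (f (edge v w t) + g (edge v w t)) \<partial>lborel) =
      (\<integral>\<^sup>+ t\<in>{0..1}. f (edge v w t) \<partial>lborel) + (\<integral>\<^sup>+ t\<in>{0..1}. g (edge v w t) \<partial>lborel)"
      unfolding distrib_right using edge_measurable[OF that] assms by (intro nn_integral_add) auto
    then show ?thesis by (simp add: distrib_left)
  qed
  then have "edge_int (%x. f x + g x) = (\<integral>\<^sup>+ v. (\<integral>\<^sup>+ w. (wt v + wt w) * (\<integral>\<^sup>+ t\<in>{0..1}. f (edge v w t) \<partial>lborel) +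
     (wt v + wt w) * (\<integral>\<^sup>+ t\<in>{0..1}. g (edge v w t) \<partial>lborel) \<partial>count_space {w. N v w}) \<partial>count_space V)"
    unfolding edge_int_def by (intro nn_integral_cong) auto
  then show ?thesis unfolding edge_int_def by (simp add: nn_integral_add)
qed

lemma edge_int_cmult:
  assumes "f \<in> borel_measurable (metric_borel Y)"
  shows "edge_int (%x. c * f x) = c * edge_int f"
proof -
  have "(wt v + wt w) * (\<integral>\<^sup>+ t\<in>{0..1}. (c * f (edge v w t)) \<partial>lborel) = c * ((wt v + wt w) * (\<integral>\<^sup>+ t\<in>{0..1}. f (edge v w t) \<partial>lborel))" if "N v w" for v w
  proof -
    have "(\<integral>\<^sup>+ t\<in>{0..1}. (c * f (edge v w t)) \<partial>lborel) = c * (\<integral>\<^sup>+ t\<in>{0..1}. f (edge v w t) \<partial>lborel)"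
      unfolding mult.assoc using edge_measurable[OF that] assms by (intro nn_integral_cmult) auto
    then show ?thesis by (simp add: mult_ac)
  qed
  then have "edge_int (%x. c * f x) = (\<integral>\<^sup>+ v. (\<integral>\<^sup>+ w. c * ((wt v + wt w) * (\<integral>\<^sup>+ t\<in>{0..1}. f (edge v w t) \<partial>lborel)) \<partial>count_space {w. N v w}) \<partial>count_space V)"
    unfolding edge_int_def by (intro nn_integral_cong) auto
  then show ?thesis unfolding edge_int_def by (simp add: nn_integral_cmult)
qed

lemma edge_int_SUP:
  assumes f: "!!i. f i \<in> borel_measurable (metric_borel Y)" and inc: "incseq f"
  shows "edge_int (SUP i. f i) = (SUP i. edge_int (f i))"
proof -
  have inc': "f i x <= f j x" if "i <= j" for i j x using inc that by (auto simp: incseq_def le_fun_def)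
  have "(\<integral>\<^sup>+ t\<in>{0..1}. (SUP i. f i) (edge v w t) \<partial>lborel) = (SUP i. \<integral>\<^sup>+ t\<in>{0..1}. f i (edge v w t) \<partial>lborel)" if "N v w" for v w
  proof -
    have "(\<integral>\<^sup>+ t\<in>{0..1}. (SUP i. f i) (edge v w t) \<partial>lborel) = (\<integral>\<^sup>+ t. (SUP i. f i (edge v w t) * indicator {0..1} t) \<partial>lborel)"
      by (intro nn_integral_cong) (auto simp: indicator_def SUP_apply image_comp)
    also have "... = (SUP i. \<integral>\<^sup>+ t\<in>{0..1}. f i (edge v w t) \<partial>lborel)"
    proof (rule nn_integral_monotone_convergence_SUP)
      show "(%t. f i (edge v w t) * indicator {0..1} t) \<in> borel_measurable lborel" for i
        using edge_measurable[OF that f] by simp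
    qed (use inc' in \<open>auto intro!: mult_right_mono simp: incseq_def le_fun_def\<close>)
    finally show ?thesis .
  qed
  moreover have mono: "(\<integral>\<^sup>+ t\<in>{0..1}. f i (edge v w t) \<partial>lborel) <= (\<integral>\<^sup>+ t\<in>{0..1}. f j (edge v w t) \<partial>lborel)" if "i <= j" for i j v w
    using inc'[OF that] by (intro nn_integral_mono mult_right_mono) auto
  ultimately have "edge_int (SUP i. f i) = (\<integral>\<^sup>+ v. (\<integral>\<^sup>+ w. (SUP i. (wt v + wt w) * (\<integral>\<^sup>+ t\<in>{0..1}. f i (edge v w t) \<partial>lborel)) \<partial>count_space {w. N v w}) \<partial>count_space V)"
    unfolding edge_int_def by (intro nn_integral_cong) (auto simp: SUP_mult_left_ennreal)
  also have "... = (\<integral>\<^sup>+ v. (SUP i. (\<integral>\<^sup>+ w. (wt v + wt w) * (\<integral>\<^sup>+ t\<in>{0..1}. f i (edge v w t) \<partial>lborel) \<partial>count_space {w. N v w})) \<partial>count_space V)"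
    by (intro nn_integral_cong nn_integral_monotone_convergence_SUP) (auto simp: incseq_def le_fun_def intro!: mult_left_mono mono)
  also have "... = (SUP i. edge_int (f i))"
    unfolding edge_int_def
    by (intro nn_integral_monotone_convergence_SUP) (auto simp: incseq_def le_fun_def intro!: nn_integral_mono mult_left_mono mono)
  finally show ?thesis .
qed

lemma sets_\<mu> [simp]: "sets \<mu> = sets (metric_borel Y)"
  unfolding filling_measure_def
  by (subst sets_measure_of) (use sets.space_closed[of "metric_borel Y"] sets.sigma_sets_eq[of "metric_borel Y"] in auto)

lemma space_\<mu> [simp]: "space \<mu> = mspace Y"
  unfolding filling_measure_def by (subst space_measure_of_conv) simp

text \<open>Integration over the edges is countably additive, by monotone convergence, so \<open>measure_of\<close> does not
  collapse to the zero measure.\<close>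
lemma emeasure_\<mu>:
  assumes "B \<in> sets (metric_borel Y)" shows "emeasure \<mu> B = edge_int (indicator B)"
proof -
  have len: "(\<integral>\<^sup>+ t\<in>{0..1}. indicator B (edge v w t) \<partial>lborel) = emeasure lborel {t \<in> {0..1}. edge v w t \<in> B}"
    if n: "N v w" and B: "B \<in> sets (metric_borel Y)" for v w B
  proof -
    have "edge v w -` B \<inter> space (restrict_space lborel {0..1}) \<in> sets (restrict_space lborel {0..1})"
      by (rule measurable_sets[OF curve_measurable[OF edge_continuous_sub[OF n order_refl order_refl]] B])
    then have "{t \<in> {0..1}. edge v w t \<in> B} \<in> sets lborel"
      by (subst (asm) sets_restrict_space_iff) (auto simp: space_restrict_space Int_def conj_commute)
    then have "(\<integral>\<^sup>+ t. indicator {t \<in> {0..1}. edge v w t \<in> B} t \<partial>lborel) = emeasure lborel {t \<in> {0..1}. edge v w t \<in> B}"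
      by (rule nn_integral_indicator)
    moreover have "(\<integral>\<^sup>+ t\<in>{0..1}. indicator B (edge v w t) \<partial>lborel) = (\<integral>\<^sup>+ t. indicator {t \<in> {0..1}. edge v w t \<in> B} t \<partial>lborel)"
      by (intro nn_integral_cong) (auto split: split_indicator)
    ultimately show ?thesis by simp
  qed
  have eq: "(\<integral>\<^sup>+ v. (\<integral>\<^sup>+ w. (wt v + wt w) * emeasure lborel {t \<in> {0..1}. edge v w t \<in> B}
             \<partial>count_space {w. N v w}) \<partial>count_space V) = edge_int (indicator B)" if "B \<in> sets (metric_borel Y)" for B
    unfolding edge_int_def using len that by (intro nn_integral_cong) auto
  have "emeasure \<mu> B = (%B. \<integral>\<^sup>+ v. (\<integral>\<^sup>+ w. (wt v + wt w) * emeasure lborel {t \<in> {0..1}. edge v w t \<in> B}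
             \<partial>count_space {w. N v w}) \<partial>count_space V) B"
    unfolding filling_measure_def
  proof (rule emeasure_measure_of_sigma)
    show "sigma_algebra (mspace Y) (sets (metric_borel Y))" using sets.sigma_algebra_axioms[of "metric_borel Y"] by simp
    show "positive (sets (metric_borel Y)) (%B. \<integral>\<^sup>+ v. (\<integral>\<^sup>+ w. (wt v + wt w) * emeasure lborel {t \<in> {0..1}. edge v w t \<in> B}
             \<partial>count_space {w. N v w}) \<partial>count_space V)" by (simp add: positive_def)
    show "countably_additive (sets (metric_borel Y)) (%B. \<integral>\<^sup>+ v. (\<integral>\<^sup>+ w. (wt v + wt w) * emeasure lborel {t \<in> {0..1}. edge v w t \<in> B}
             \<partial>count_space {w. N v w}) \<partial>count_space V)"
    proof (rule countably_additiveI)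
      fix D :: "nat => _ set" assume D: "range D <= sets (metric_borel Y)" "disjoint_family D" "\<Union> (range D) \<in> sets (metric_borel Y)"
      have meas: "indicator (D i) \<in> borel_measurable (metric_borel Y)" for i using D(1) by auto
      have pre: "edge_int (indicator (\<Union> (range D))) = (\<Sum>i. edge_int (indicator (D i)))"
      proof -
        have "(\<integral>\<^sup>+ t\<in>{0..1}. indicator (\<Union> (range D)) (edge v w t) \<partial>lborel) = (\<Sum>i. \<integral>\<^sup>+ t\<in>{0..1}. indicator (D i) (edge v w t) \<partial>lborel)" if "N v w" for v w
        proof -
          have "(\<integral>\<^sup>+ t\<in>{0..1}. indicator (\<Union> (range D)) (edge v w t) \<partial>lborel) = (\<integral>\<^sup>+ t. (\<Sum>i. indicator (D i) (edge v w t) * indicator {0..1} t) \<partial>lborel)"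
            unfolding ennreal_suminf_multc suminf_indicator[OF D(2)] ..
          also have "... = (\<Sum>i. \<integral>\<^sup>+ t\<in>{0..1}. indicator (D i) (edge v w t) \<partial>lborel)"
            by (intro nn_integral_suminf) (use edge_measurable[OF that meas] in simp)
          finally show ?thesis .
        qed
        then have "edge_int (indicator (\<Union> (range D))) = (\<integral>\<^sup>+ v. (\<integral>\<^sup>+ w. (\<Sum>i. (wt v + wt w) * (\<integral>\<^sup>+ t\<in>{0..1}. indicator (D i) (edge v w t) \<partial>lborel))
             \<partial>count_space {w. N v w}) \<partial>count_space V)"
          unfolding edge_int_def by (intro nn_integral_cong) auto
        also have "... = (\<integral>\<^sup>+ v. (\<Sum>i. \<integral>\<^sup>+ w. (wt v + wt w) * (\<integral>\<^sup>+ t\<in>{0..1}. indicator (D i) (edge v w t) \<partial>lborel)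
             \<partial>count_space {w. N v w}) \<partial>count_space V)"
          by (intro nn_integral_cong nn_integral_suminf) auto
        also have "... = (\<Sum>i. edge_int (indicator (D i)))" unfolding edge_int_def by (intro nn_integral_suminf) auto
        finally show ?thesis .
      qed
      have "(\<Sum>i. (%B. \<integral>\<^sup>+ v. (\<integral>\<^sup>+ w. (wt v + wt w) * emeasure lborel {t \<in> {0..1}. edge v w t \<in> B} \<partial>count_space {w. N v w}) \<partial>count_space V) (D i))
        = (\<Sum>i. edge_int (indicator (D i)))" using D(1) by (intro arg_cong[where f = suminf] ext eq) auto
      then show "(\<Sum>i. \<integral>\<^sup>+ v. (\<integral>\<^sup>+ w. (wt v + wt w) * emeasure lborel {t \<in> {0..1}. edge v w t \<in> D i} \<partial>count_space {w. N v w}) \<partial>count_space V) =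
         (\<integral>\<^sup>+ v. (\<integral>\<^sup>+ w. (wt v + wt w) * emeasure lborel {t \<in> {0..1}. edge v w t \<in> \<Union> (range D)} \<partial>count_space {w. N v w}) \<partial>count_space V)"
        using eq[OF D(3)] pre by simp
    qed
  qed fact
  then show ?thesis using eq[OF assms] by simp
qed

lemma nn_integral_\<mu>:
  assumes "f \<in> borel_measurable (metric_borel Y)"
  shows "(\<integral>\<^sup>+ x. f x \<partial>\<mu>) = edge_int f"
proof -
  have m: "measurable \<mu> borel = measurable (metric_borel Y) borel" for N by (intro measurable_cong_sets) auto
  show ?thesis using assms
  proof (induction rule: borel_measurable_induct)
    case (cong f g)
    have "(\<integral>\<^sup>+ x. f x \<partial>\<mu>) = (\<integral>\<^sup>+ x. g x \<partial>\<mu>)" using cong by (intro nn_integral_cong) auto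
    moreover have "edge_int f = edge_int g"
      unfolding edge_int_def
    proof (intro nn_integral_cong)
      fix v w assume "w \<in> space (count_space {w. N v w})"
      then have n: "N v w" by simp
      have "f (edge v w t) * indicator {0..1} t = g (edge v w t) * indicator {0..1} t" for t :: real
      proof (cases "t \<in> {0..1}")
        case True
        then have "edge v w t \<in> space (metric_borel Y)" using edge_in[OF n True] by simp
        then show ?thesis using cong(3) by simp
      qed simp
      then show "(wt v + wt w) * (\<integral>\<^sup>+ t\<in>{0..1}. f (edge v w t) \<partial>lborel) = (wt v + wt w) * (\<integral>\<^sup>+ t\<in>{0..1}. g (edge v w t) \<partial>lborel)"
        by presburger
    qed
    ultimately show ?case using cong by simp
  next
    case (set B) then show ?case using emeasure_\<mu> by simp
  next
    case (mult u c) then show ?case using edge_int_cmult m by (subst nn_integral_cmult) (auto simp: m)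
  next
    case (add u v) then show ?case using edge_int_add m by (subst nn_integral_add) (auto simp: m)
  next
    case (seq U)
    have "(\<integral>\<^sup>+ x. (SUP i. U i) x \<partial>\<mu>) = (\<integral>\<^sup>+ x. (SUP i. U i x) \<partial>\<mu>)" by (simp only: SUP_apply)
    also have "... = (SUP i. \<integral>\<^sup>+ x. U i x \<partial>\<mu>)"
      by (rule nn_integral_monotone_convergence_SUP) (use seq in \<open>auto simp: m\<close>)
    also have "... = (SUP i. edge_int (U i))" using seq by simp
    also have "... = edge_int (SUP i. U i)" by (rule edge_int_SUP[symmetric]) (use seq in auto)
    finally show ?case .
  qed
qed

end

section \<open>Powers of extended nonnegative numbers\<close>

lemma ennreal_powr_mono: "x <= y ==> 0 < p ==> ennreal_powr x p <= ennreal_powr y p"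
  by (cases x; cases y) (auto simp: ennreal_powr_def top_unique intro!: ennreal_leI powr_mono2)

lemma ennreal_powr_ennreal: "0 <= x ==> ennreal_powr (ennreal x) p = ennreal (x powr p)"
  by (simp add: ennreal_powr_def)

lemma ennreal_powr_top [simp]: "ennreal_powr top p = top" "ennreal_powr 0 p = 0"
  by (simp_all add: ennreal_powr_def)

lemma measurable_ennreal_powr [measurable]:
  assumes "f \<in> borel_measurable M" shows "(%x. ennreal_powr (f x) p) \<in> borel_measurable M"
proof -
  have "(%x::ennreal. enn2real x powr p) \<in> borel_measurable borel"
    by (rule powr_real_measurable) auto
  then have "(%x. ennreal_powr x p) \<in> borel_measurable borel"
    unfolding ennreal_powr_def by (intro measurable_If) auto
  from measurable_compose[OF assms this] show ?thesis .
qed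

text \<open>Either \<open>x\<close> is at most \<open>\<eta>\<close> or \<open>x = \<eta>\<^sup>1\<^sup>-\<^sup>p (x/\<eta>)\<^sup>1\<^sup>-\<^sup>p x\<^sup>p <= \<eta>\<^sup>1\<^sup>-\<^sup>p x\<^sup>p\<close>. Integrated, and with the right choice
  of \<open>\<eta>\<close>, this replaces the inequality of Jensen up to a constant.\<close>
lemma le_plus_ennreal_powr:
  assumes "0 < \<eta>" "1 < p"
  shows "x <= ennreal \<eta> + ennreal (\<eta> powr (1 - p)) * ennreal_powr x p"
proof (cases x)
  case (real y)
  have "y <= \<eta> + \<eta> powr (1 - p) * y powr p"
  proof (cases "y <= \<eta>")
    case False
    then have "y powr (1 - p) <= \<eta> powr (1 - p)" using assms by (intro powr_mono2') auto
    then have "y powr (1 - p) * y powr p <= \<eta> powr (1 - p) * y powr p" by (intro mult_right_mono) auto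
    moreover have "y powr (1 - p) * y powr p = y" using False assms by (simp flip: powr_add)
    ultimately show ?thesis using assms by simp
  qed (simp add: add_increasing2)
  then show ?thesis using real assms
    by (simp add: ennreal_powr_ennreal ennreal_mult[symmetric] ennreal_plus[symmetric] del: ennreal_plus)
qed (use assms in \<open>simp add: ennreal_mult_top\<close>)

lemma nn_integral_le_powr:
  assumes f: "f \<in> borel_measurable M" and M: "emeasure M (space M) <= 1" and \<eta>: "0 < \<eta>" "1 < p"
  shows "(\<integral>\<^sup>+x. f x \<partial>M) <= ennreal \<eta> + ennreal (\<eta> powr (1 - p)) * (\<integral>\<^sup>+x. ennreal_powr (f x) p \<partial>M)"
proof -
  have "(\<integral>\<^sup>+x. f x \<partial>M) <= (\<integral>\<^sup>+x. ennreal \<eta> + ennreal (\<eta> powr (1 - p)) * ennreal_powr (f x) p \<partial>M)"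
    by (intro nn_integral_mono le_plus_ennreal_powr \<eta>)
  also have "... = ennreal \<eta> * emeasure M (space M) + ennreal (\<eta> powr (1 - p)) * (\<integral>\<^sup>+x. ennreal_powr (f x) p \<partial>M)"
    using f by (simp add: nn_integral_add nn_integral_cmult)
  also have "... <= ennreal \<eta> * 1 + ennreal (\<eta> powr (1 - p)) * (\<integral>\<^sup>+x. ennreal_powr (f x) p \<partial>M)"
    using M by (intro add_right_mono mult_left_mono) auto
  finally show ?thesis by simp
qed

lemma powr_nn_integral_le:
  assumes f: "f \<in> borel_measurable M" and M: "emeasure M (space M) <= 1" and p: "1 < p"
  shows "ennreal_powr (\<integral>\<^sup>+x. f x \<partial>M) p <= ennreal (2 powr p) * (\<integral>\<^sup>+x. ennreal_powr (f x) p \<partial>M)"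
proof (cases "\<integral>\<^sup>+x. ennreal_powr (f x) p \<partial>M")
  case (real I)
  have *: "(\<integral>\<^sup>+x. f x \<partial>M) <= ennreal (2 * \<eta>)" if \<eta>: "0 < \<eta>" "I <= \<eta> powr p" for \<eta>
  proof -
    have "(\<integral>\<^sup>+x. f x \<partial>M) <= ennreal \<eta> + ennreal (\<eta> powr (1 - p)) * ennreal I"
      using nn_integral_le_powr[OF f M \<eta>(1) p] real by simp
    also have "... = ennreal (\<eta> + \<eta> powr (1 - p) * I)"
      using \<eta> real by (simp add: ennreal_mult)
    also have "... <= ennreal (\<eta> + \<eta> powr (1 - p) * \<eta> powr p)"
      using \<eta> by (intro ennreal_leI add_left_mono mult_left_mono) auto
    also have "\<eta> powr (1 - p) * \<eta> powr p = \<eta>" using \<eta> by (simp flip: powr_add)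
    finally show ?thesis by simp
  qed
  show ?thesis
  proof (cases "I = 0")
    case True
    have "(\<integral>\<^sup>+x. f x \<partial>M) <= 0"
    proof (rule ennreal_le_epsilon)
      fix e :: real assume "0 < e"
      then show "(\<integral>\<^sup>+x. f x \<partial>M) <= 0 + ennreal e" using *[of "e / 2"] True by simp
    qed
    then show ?thesis by simp
  next
    case False
    then have I: "0 < I" using real by simp
    have "ennreal_powr (\<integral>\<^sup>+x. f x \<partial>M) p <= ennreal_powr (ennreal (2 * I powr (1 / p))) p"
      using *[of "I powr (1 / p)"] I p by (intro ennreal_powr_mono) (auto simp: powr_powr)
    also have "... = ennreal (2 powr p * I)" using I p by (simp add: ennreal_powr_ennreal powr_mult powr_powr)
    finally show ?thesis using real by (simp add: ennreal_mult)
  qed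
next
  case top
  then show ?thesis by (simp add: ennreal_mult_top)
qed

section \<open>A density bounded below on intervals\<close>

text \<open>An open set is a countable union of intervals with disjoint interiors.\<close>
lemma open_density_lower_bound:
  fixes k :: "real => ennreal"
  assumes k: "k \<in> borel_measurable lborel" and T: "open T" "T <= {0<..<1}"
    and int: "!!s t. 0 <= s ==> s < t ==> t <= 1 ==> ennreal (c * (t - s)) <= (\<integral>\<^sup>+q\<in>{s..t}. k q \<partial>lborel)" and c: "0 <= c"
  shows "ennreal c * emeasure lborel T <= (\<integral>\<^sup>+q\<in>T. k q \<partial>lborel)"
proof -
  have "\<forall>x. \<exists>e>0. x \<in> T --> ball x e <= T" using T(1) by (metis open_contains_ball zero_less_one)
  then obtain e where e: "!!x. 0 < e x" "!!x. x \<in> T ==> ball x (e x) <= T" by metis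
  have g: "gauge (%x. ball x (e x))" using e by (auto simp: gauge_def)
  have cb: "T <= cbox 0 1" "box 0 (1::real) ~= {}" using T by auto
  obtain \<D> where D: "countable \<D>" "\<Union>\<D> <= cbox 0 1"
      "!!K. K \<in> \<D> ==> interior K ~= {} & (\<exists>c d. K = cbox c d)"
      "pairwise (%A B. interior A \<inter> interior B = {}) \<D>"
      "!!K. K \<in> \<D> ==> \<exists>x \<in> T \<inter> K. K <= ball x (e x)"
      "T <= \<Union>\<D>"
  proof (rule covering_lemma[OF cb g])
    fix \<D>
    assume "countable \<D>" "\<Union>\<D> <= cbox 0 1"
      "!!K. K \<in> \<D> ==> interior K ~= {} & (\<exists>c d. K = cbox c d)"
      "pairwise (%A B. interior A \<inter> interior B = {}) \<D>"
      "!!K. K \<in> \<D> ==> \<exists>x \<in> T \<inter> K. K <= ball x (e x)"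
      "T <= \<Union>\<D>"
    then show thesis by (rule that)
  qed
  have KT: "K <= T" if "K \<in> \<D>" for K using D(5)[OF that] e(2) by blast
  have Kcd: "\<exists>s t. K = {s..t} & interior K = {s<..<t} & s < t & 0 <= s & t <= 1" if "K \<in> \<D>" for K
  proof -
    obtain s t where st: "K = {s..t}" using D(3)[OF \<open>K \<in> \<D>\<close>] by (auto simp: cbox_interval)
    then have i: "interior K = {s<..<t}" "s < t" using D(3)[OF \<open>K \<in> \<D>\<close>] by auto
    have "K <= cbox 0 1" using D(2) \<open>K \<in> \<D>\<close> by blast
    then have sub: "{s..t} <= {0..1}" unfolding st cbox_interval .
    have "0 <= s" "t <= 1" using subsetD[OF sub, of s] subsetD[OF sub, of t] i(2) by simp_all
    then show ?thesis using st i by (intro exI[of _ s] exI[of _ t]) simp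
  qed
  have bd: "K - interior K \<in> null_sets lborel" if K: "K \<in> \<D>" for K
  proof -
    obtain s t where "K = {s..t}" "interior K = {s<..<t}" using Kcd[OF K] by blast
    then have "K - interior K <= {s, t}" by auto
    then have "finite (K - interior K)" by (rule finite_subset) simp
    then show ?thesis by (rule finite_imp_null_set_lborel)
  qed
  define I where "I = (\<Union>K\<in>\<D>. interior K)"
  have Iopen: "open I" unfolding I_def by (intro open_UN) auto
  have null: "T - I \<in> null_sets lborel"
  proof (rule null_sets_subset)
    show "(\<Union>K\<in>\<D>. K - interior K) \<in> null_sets lborel" using D(1) bd by (rule null_sets_UN')
    show "T - I \<in> sets lborel" using T(1) Iopen by (simp add: borel_open)
    show "T - I <= (\<Union>K\<in>\<D>. K - interior K)" using D(6) unfolding I_def by blast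
  qed
  have IT: "I <= T" unfolding I_def using KT interior_subset by blast
  have disj: "disjoint_family_on interior \<D>"
    using D(4) unfolding pairwise_def disjoint_family_on_def by blast
  have "emeasure lborel T = emeasure lborel I"
  proof -
    have "T = I \<union> (T - I)" using IT by blast
    then show ?thesis using emeasure_Un_null_set[OF _ null, of I] Iopen by (simp add: borel_open)
  qed
  also have "... = (\<integral>\<^sup>+K. emeasure lborel (interior K) \<partial>count_space \<D>)"
    unfolding I_def using D(1) disj by (intro emeasure_UN_countable) auto
  finally have "ennreal c * emeasure lborel T = (\<integral>\<^sup>+K. ennreal c * emeasure lborel (interior K) \<partial>count_space \<D>)"
    by (simp add: nn_integral_cmult)
  also have "... <= (\<integral>\<^sup>+K. emeasure (density lborel k) (interior K) \<partial>count_space \<D>)"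
  proof (intro nn_integral_mono)
    fix K assume "K \<in> space (count_space \<D>)"
    then have K: "K \<in> \<D>" by simp
    obtain s t where st: "K = {s..t}" "interior K = {s<..<t}" "s < t" "0 <= s" "t <= 1" using Kcd[OF K] by blast
    have "ennreal c * emeasure lborel (interior K) = ennreal (c * (t - s))" using st c by (simp add: ennreal_mult)
    also have "... <= (\<integral>\<^sup>+q\<in>{s..t}. k q \<partial>lborel)" using int st by simp
    also have "... = (\<integral>\<^sup>+q\<in>{s<..<t}. k q \<partial>lborel)"
    proof (rule nn_integral_cong_AE)
      have "AE q in lborel. q ~= s" "AE q in lborel. q ~= t" by (rule AE_lborel_singleton)+
      then show "AE q in lborel. k q * indicator {s..t} q = k q * indicator {s<..<t} q"
        by eventually_elim (auto simp: indicator_def)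
    qed
    also have "... = emeasure (density lborel k) (interior K)" using k st by (simp add: emeasure_density)
    finally show "ennreal c * emeasure lborel (interior K) <= emeasure (density lborel k) (interior K)" .
  qed
  also have "... = emeasure (density lborel k) I"
    unfolding I_def using D(1) disj by (intro emeasure_UN_countable[symmetric]) auto
  also have "... <= emeasure (density lborel k) T" using IT T(1) by (intro emeasure_mono) (auto simp: borel_open)
  also have "... = (\<integral>\<^sup>+q\<in>T. k q \<partial>lborel)" using k T(1) by (intro emeasure_density) (auto simp: borel_open)
  finally show ?thesis .
qed

text \<open>By outer regularity of the finite measure with density \<open>k\<close>, the bound for open sets passes to the set where
  \<open>k < c\<close>, which contradicts the strict inequality there unless the set is null.\<close>
lemma density_lower_bound_AE:
  fixes k :: "real => ennreal"
  assumes k: "(%q. k q * indicator {0..1} q) \<in> borel_measurable lborel" and fin: "(\<integral>\<^sup>+q\<in>{0..1}. k q \<partial>lborel) < \<infinity>"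
    and int: "!!s t. 0 <= s ==> s < t ==> t <= 1 ==> ennreal (c * (t - s)) <= (\<integral>\<^sup>+q\<in>{s..t}. k q \<partial>lborel)" and c: "0 <= c"
  shows "AE q in lborel. q \<in> {0..1} --> ennreal c <= k q"
proof -
  let ?k = "%q. k q * indicator {0..1} q"
  define S where "S = {q \<in> {0<..<1}. ?k q < ennreal c}"
  have Sm: "S \<in> sets borel"
  proof -
    have "{q \<in> space lborel. ?k q < ennreal c} \<in> sets lborel" using k by measurable
    then have "{0<..<1} \<inter> {q \<in> space lborel. ?k q < ennreal c} \<in> sets lborel" by (intro sets.Int) auto
    moreover have "S = {0<..<1} \<inter> {q \<in> space lborel. ?k q < ennreal c}" by (auto simp: S_def)
    ultimately show ?thesis by simp
  qed
  have int': "ennreal (c * (t - s)) <= (\<integral>\<^sup>+q\<in>{s..t}. ?k q \<partial>lborel)" if "0 <= s" "s < t" "t <= 1" for s t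
  proof -
    have "(\<integral>\<^sup>+q\<in>{s..t}. ?k q \<partial>lborel) = (\<integral>\<^sup>+q\<in>{s..t}. k q \<partial>lborel)"
      using that by (intro nn_integral_cong) (auto simp: indicator_def)
    then show ?thesis using int[OF that] by simp
  qed
  have "ennreal c * emeasure lborel S <= emeasure (density lborel ?k) S"
  proof -
    have "emeasure (density lborel ?k) (space (density lborel ?k)) = (\<integral>\<^sup>+q\<in>{0..1}. k q \<partial>lborel)"
      using k by (subst emeasure_density) (auto intro!: nn_integral_cong simp: indicator_def)
    then have "emeasure (density lborel ?k) (space (density lborel ?k)) ~= \<infinity>" using fin by auto
    then have "emeasure (density lborel ?k) S = (INF U \<in> {U. S <= U & open U}. emeasure (density lborel ?k) U)"
      using Sm by (intro outer_regular) auto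
    also have "ennreal c * emeasure lborel S <= ..."
    proof (rule INF_greatest)
      fix U assume "U \<in> {U. S <= U & open U}"
      then have U: "S <= U \<inter> {0<..<1}" "open (U \<inter> {0<..<1})" "open U" by (auto simp: S_def)
      have "ennreal c * emeasure lborel S <= ennreal c * emeasure lborel (U \<inter> {0<..<1})"
        using U by (intro mult_left_mono emeasure_mono) (auto simp: borel_open)
      also have "... <= (\<integral>\<^sup>+q\<in>U \<inter> {0<..<1}. ?k q \<partial>lborel)"
        by (rule open_density_lower_bound[OF k U(2) _ int' c]) auto
      also have "... <= (\<integral>\<^sup>+q\<in>U. ?k q \<partial>lborel)" by (intro nn_integral_mono) (auto simp: indicator_def)
      also have "... = emeasure (density lborel ?k) U" using k U by (subst emeasure_density) (auto simp: borel_open)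
      finally show "ennreal c * emeasure lborel S <= emeasure (density lborel ?k) U" .
    qed
    finally show ?thesis .
  qed
  also have "emeasure (density lborel ?k) S = (\<integral>\<^sup>+q\<in>S. ?k q \<partial>lborel)" using k Sm by (intro emeasure_density) auto
  finally have le: "(\<integral>\<^sup>+q. ennreal c * indicator S q \<partial>lborel) <= (\<integral>\<^sup>+q\<in>S. ?k q \<partial>lborel)"
    using Sm by (simp add: nn_integral_cmult_indicator)
  have "emeasure lborel S = 0"
  proof (rule ccontr)
    assume pos: "emeasure lborel S ~= 0"
    have "(\<integral>\<^sup>+q\<in>S. ?k q \<partial>lborel) < (\<integral>\<^sup>+q. ennreal c * indicator S q \<partial>lborel)"
    proof (rule nn_integral_less)
      show "(%q. ?k q * indicator S q) \<in> borel_measurable lborel" using borel_measurable_times_ennreal[OF k borel_measurable_indicator[of S]] Sm by simp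
      show "(%q. ennreal c * indicator S q) \<in> borel_measurable lborel" using Sm by auto
      have "(\<integral>\<^sup>+q\<in>S. ?k q \<partial>lborel) <= (\<integral>\<^sup>+q\<in>{0..1}. k q \<partial>lborel)" by (intro nn_integral_mono) (auto simp: indicator_def)
      then show "(\<integral>\<^sup>+q\<in>S. ?k q \<partial>lborel) ~= \<infinity>" using fin by auto
      show "AE q in lborel. ?k q * indicator S q <= ennreal c * indicator S q"
        by (intro always_eventually allI) (auto simp: S_def indicator_def)
      show "~ (AE q in lborel. ennreal c * indicator S q <= ?k q * indicator S q)"
      proof
        assume "AE q in lborel. ennreal c * indicator S q <= ?k q * indicator S q"
        then have "AE q in lborel. q \<notin> S" by eventually_elim (auto simp: S_def indicator_def split: if_splits)
        then have "emeasure lborel S = 0" using Sm AE_iff_measurable[of S lborel "%q. q \<notin> S"] by auto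
        then show False using pos by simp
      qed
    qed
    then show False using le by simp
  qed
  then have "S \<in> null_sets lborel" using Sm by (auto simp: null_sets_def)
  then have "AE q in lborel. q \<notin> S" by (rule AE_not_in)
  moreover have "AE q in lborel. q ~= (0::real)" "AE q in lborel. q ~= (1::real)" by (rule AE_lborel_singleton)+
  ultimately show ?thesis
    by eventually_elim (auto simp: S_def indicator_def not_less)
qed

section \<open>The minimal weak upper gradient of a piecewise linear function\<close>

text \<open>The mean value inequality for an integrand that dominates the local Lipschitz constant
  and is lower semicontinuous up to \<open>\<eta>\<close>.\<close>
lemma increment_le_nn_integral_pointwise:
  fixes f :: "real => real" and k :: "real => ennreal"
  assumes ab: "a <= b" and k: "(%s. k s * indicator {a..b} s) \<in> borel_measurable lborel"
    and F: "F \<in> null_sets lebesgue" and L: "0 <= L"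
    and lip: "!!x y. F ~= {} ==> a <= x ==> x <= y ==> y <= b ==> \<bar>f y - f x\<bar> <= L * (y - x)"
    and loc: "!!x. x \<in> {a..b} - F ==> \<exists>c\<ge>0. \<forall>\<eta>>0. \<exists>\<delta>>0. \<forall>q\<in>{a..b}. \<bar>q - x\<bar> < \<delta> -->
        \<bar>f q - f x\<bar> <= (c + \<eta>) * \<bar>q - x\<bar> & ennreal c <= k q + ennreal \<eta>"
  shows "ennreal \<bar>f b - f a\<bar> <= (\<integral>\<^sup>+s\<in>{a..b}. k s \<partial>lborel)"
proof (rule increment_le_nn_integral[OF ab k F L lip])
  fix x \<eta> :: real assume x: "x \<in> {a..b} - F" and \<eta>: "0 < \<eta>"
  obtain c where c: "0 <= c" "!!\<eta>. 0 < \<eta> ==> \<exists>\<delta>>0. \<forall>q\<in>{a..b}. \<bar>q - x\<bar> < \<delta> -->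
        \<bar>f q - f x\<bar> <= (c + \<eta>) * \<bar>q - x\<bar> & ennreal c <= k q + ennreal \<eta>" using loc[OF x] by blast
  obtain \<delta> where \<delta>: "0 < \<delta>" "!!q. q \<in> {a..b} ==> \<bar>q - x\<bar> < \<delta> ==> \<bar>f q - f x\<bar> <= (c + \<eta> / 2) * \<bar>q - x\<bar>"
     "!!q. q \<in> {a..b} ==> \<bar>q - x\<bar> < \<delta> ==> ennreal c <= k q + ennreal (\<eta> / 2)"
    using c(2)[of "\<eta> / 2"] \<eta> by (metis half_gt_zero)
  have "ennreal \<bar>f y' - f x'\<bar> <= (\<integral>\<^sup>+s\<in>{x'<..y'}. k s \<partial>lborel) + ennreal (\<eta> * (y' - x'))"
    if h: "a <= x'" "x' <= x" "x <= y'" "y' <= b" "y' - x' < \<delta>" for x' y'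
  proof -
    have "\<bar>f x' - f x\<bar> <= (c + \<eta> / 2) * \<bar>x' - x\<bar>" by (rule \<delta>(2)) (use h in auto)
    moreover have "\<bar>f y' - f x\<bar> <= (c + \<eta> / 2) * \<bar>y' - x\<bar>" by (rule \<delta>(2)) (use h in auto)
    ultimately have "\<bar>f y' - f x'\<bar> <= (c + \<eta> / 2) * \<bar>y' - x\<bar> + (c + \<eta> / 2) * \<bar>x' - x\<bar>" by linarith
    also have "... = c * (y' - x') + \<eta> / 2 * (y' - x')" using h by (simp add: field_simps)
    finally have 1: "ennreal \<bar>f y' - f x'\<bar> <= ennreal (c * (y' - x')) + ennreal (\<eta> / 2 * (y' - x'))"
      using c(1) \<eta> h by (simp add: ennreal_plus[symmetric] del: ennreal_plus)
    have "(%s. (k s * indicator {a..b} s) * indicator {x'<..y'} s) \<in> borel_measurable lborel"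
      using k by (rule borel_measurable_times_ennreal) auto
    also have "(%s. (k s * indicator {a..b} s) * indicator {x'<..y'} s) = (%s. k s * indicator {x'<..y'} s)"
      using h by (auto simp: indicator_def)
    finally have km: "(%s. k s * indicator {x'<..y'} s) \<in> borel_measurable lborel" .
    have "ennreal (c * (y' - x')) = (\<integral>\<^sup>+s. ennreal c * indicator {x'<..y'} s \<partial>lborel)"
      using h c by (simp add: nn_integral_cmult_indicator ennreal_mult)
    also have "... <= (\<integral>\<^sup>+s. k s * indicator {x'<..y'} s + ennreal (\<eta> / 2) * indicator {x'<..y'} s \<partial>lborel)"
      using h \<delta>(3) by (intro nn_integral_mono) (auto simp: indicator_def)
    also have "... = (\<integral>\<^sup>+s\<in>{x'<..y'}. k s \<partial>lborel) + ennreal (\<eta> / 2 * (y' - x'))"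
    proof -
      have "ennreal (\<eta> / 2 * (y' - x')) = ennreal (\<eta> / 2) * ennreal (y' - x')" using h \<eta> by (intro ennreal_mult) auto
      then show ?thesis using h km by (simp only:) (subst nn_integral_add, auto simp: nn_integral_cmult_indicator)
    qed
    finally have "ennreal \<bar>f y' - f x'\<bar> <= ((\<integral>\<^sup>+s\<in>{x'<..y'}. k s \<partial>lborel) + ennreal (\<eta> / 2 * (y' - x'))) + ennreal (\<eta> / 2 * (y' - x'))"
      using 1 by (meson add_right_mono order_trans)
    also have "... = (\<integral>\<^sup>+s\<in>{x'<..y'}. k s \<partial>lborel) + ennreal (\<eta> * (y' - x'))"
      using \<eta> h by (simp add: add.assoc ennreal_plus[symmetric] del: ennreal_plus)
    finally show ?thesis .
  qed
  then show "\<exists>\<delta>>0. \<forall>x' y'. a <= x' & x' <= x & x <= y' & y' <= b & y' - x' < \<delta> -->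
        ennreal \<bar>f y' - f x'\<bar> <= (\<integral>\<^sup>+s\<in>{x'<..y'}. k s \<partial>lborel) + ennreal (\<eta> * (y' - x'))"
    using \<delta>(1) by blast
qed

lemma unit_interval_powr_le:
  fixes f :: "real => ennreal"
  assumes f: "(%t. f t * indicator {0..1} t) \<in> borel_measurable lborel" and p: "1 < p"
  shows "ennreal_powr (\<integral>\<^sup>+t\<in>{0..1}. f t \<partial>lborel) p <= ennreal (2 powr p) * (\<integral>\<^sup>+t\<in>{0..1}. ennreal_powr (f t) p \<partial>lborel)"
    and "0 < \<eta> ==> (\<integral>\<^sup>+t\<in>{0..1}. f t \<partial>lborel) <= ennreal \<eta> + ennreal (\<eta> powr (1 - p)) * (\<integral>\<^sup>+t\<in>{0..1}. ennreal_powr (f t) p \<partial>lborel)"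
proof -
  let ?M = "restrict_space lborel {0..1::real}"
  have f': "f \<in> borel_measurable ?M" using f by (subst borel_measurable_restrict_space_iff_ennreal) auto
  have M: "emeasure ?M (space ?M) <= 1" by (simp add: space_restrict_space emeasure_restrict_space)
  have I: "(\<integral>\<^sup>+x. g x \<partial>?M) = (\<integral>\<^sup>+t\<in>{0..1}. g t \<partial>lborel)" for g by (rule nn_integral_restrict_space) auto
  show "ennreal_powr (\<integral>\<^sup>+t\<in>{0..1}. f t \<partial>lborel) p <= ennreal (2 powr p) * (\<integral>\<^sup>+t\<in>{0..1}. ennreal_powr (f t) p \<partial>lborel)"
    using powr_nn_integral_le[OF f' M p] unfolding I .
  show "(\<integral>\<^sup>+t\<in>{0..1}. f t \<partial>lborel) <= ennreal \<eta> + ennreal (\<eta> powr (1 - p)) * (\<integral>\<^sup>+t\<in>{0..1}. ennreal_powr (f t) p \<partial>lborel)" if "0 < \<eta>"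
    using nn_integral_le_powr[OF f' M that p] unfolding I .
qed

context weighted_filling
begin

lemma single_edge_le:
  assumes f: "f \<in> borel_measurable (metric_borel Y)" and n: "N v w"
  shows "wt v * (\<integral>\<^sup>+t\<in>{0..1}. f (edge v w t) \<partial>lborel) <= (\<integral>\<^sup>+x. f x \<partial>\<mu>)"
proof -
  let ?I = "%v w. (wt v + wt w) * (\<integral>\<^sup>+t\<in>{0..1}. f (edge v w t) \<partial>lborel)"
  have "wt v * (\<integral>\<^sup>+t\<in>{0..1}. f (edge v w t) \<partial>lborel) <= ?I v w" by (intro mult_right_mono) auto
  also have "... <= (\<integral>\<^sup>+w. ?I v w \<partial>count_space {w. N v w})" using n by (intro nn_integral_ge_point) auto
  also have "... <= (\<integral>\<^sup>+v. (\<integral>\<^sup>+w. ?I v w \<partial>count_space {w. N v w}) \<partial>count_space V)"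
    using N_V[OF n] by (intro nn_integral_ge_point[of v V "%v. \<integral>\<^sup>+w. ?I v w \<partial>count_space {w. N v w}"]) auto
  finally show ?thesis using nn_integral_\<mu>[OF f] by (simp add: edge_int_def)
qed

text \<open>A segment of an edge has positive modulus: an admissible function has, by convexity, a
  definite amount of energy on the edge, whose measure is comparable to its length.\<close>
lemma edge_not_exceptional:
  assumes p: "1 < p" and \<Gamma>: "p_modulus Y \<mu> p \<Gamma> = 0" and n: "N v w" and st: "0 <= s" "s < t" "t <= 1"
  shows "(edge v w, s, t) \<notin> \<Gamma>"
proof
  assume in_\<Gamma>: "(edge v w, s, t) \<in> \<Gamma>"
  have "wt v * ennreal ((1 / 2) powr p) <= p_modulus Y \<mu> p \<Gamma>"
    unfolding p_modulus_def
  proof (rule INF_greatest)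
    fix h assume "h \<in> {h \<in> borel_measurable (metric_borel Y). \<forall>(\<gamma>, a, b)\<in>\<Gamma>. 1 <= line_integral Y h \<gamma> a b}"
    then have h: "h \<in> borel_measurable (metric_borel Y)" "1 <= line_integral Y h (edge v w) s t" using in_\<Gamma> by auto
    let ?J = "\<integral>\<^sup>+q\<in>{0..1}. ennreal_powr (h (edge v w q)) p \<partial>lborel"
    have "1 <= (\<integral>\<^sup>+q\<in>{s..t}. h (edge v w q) * ennreal (\<rho> (edge_point v w q)) \<partial>lborel)"
      using h(2) edge_line_integral[OF n st h(1)] by simp
    also have "... <= (\<integral>\<^sup>+q\<in>{0..1}. h (edge v w q) \<partial>lborel)"
    proof (rule nn_integral_mono)
      fix q
      have "h (edge v w q) * ennreal (\<rho> (edge_point v w q)) <= h (edge v w q) * 1"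
        by (intro mult_left_mono) (auto simp: ennreal_le_1)
      then show "h (edge v w q) * ennreal (\<rho> (edge_point v w q)) * indicator {s..t} q <= h (edge v w q) * indicator {0..1} q"
        using st by (auto simp: indicator_def)
    qed
    also have "... <= ennreal (1 / 2) + ennreal ((1 / 2) powr (1 - p)) * ?J"
      using edge_measurable[OF n h(1)] p by (intro unit_interval_powr_le) auto
    finally have le: "1 <= ennreal (1 / 2) + ennreal ((1 / 2) powr (1 - p)) * ?J" .
    have "ennreal ((1 / 2) powr p) <= ?J"
    proof (cases ?J)
      case (real J)
      then have "ennreal (1 / 2) + ennreal ((1 / 2) powr (1 - p)) * ?J = ennreal (1 / 2 + (1 / 2) powr (1 - p) * J)"
        by (simp add: ennreal_mult)
      then have "ennreal 1 <= ennreal (1 / 2 + (1 / 2) powr (1 - p) * J)" using le by (simp only: ennreal_1)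
      then have "1 <= 1 / 2 + (1 / 2) powr (1 - p) * J" by (subst (asm) ennreal_le_iff) (use real in auto)
      then have "(1 / 2) powr p * (1 / 2) <= (1 / 2) powr p * ((1 / 2) powr (1 - p) * J)" by (intro mult_left_mono) auto
      also have "... = 1 / 2 * J" by (simp add: mult.assoc[symmetric] flip: powr_add)
      finally show ?thesis using real by (simp add: ennreal_leI)
    qed simp
    then have "wt v * ennreal ((1 / 2) powr p) <= wt v * ?J" by (intro mult_left_mono) auto
    also have "... <= (\<integral>\<^sup>+x. ennreal_powr (h x) p \<partial>\<mu>)" using h(1) n by (intro single_edge_le measurable_ennreal_powr)
    finally show "wt v * ennreal ((1 / 2) powr p) <= (\<integral>\<^sup>+x. ennreal_powr (h x) p \<partial>\<mu>)" .
  qed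
  then have "wt v * ennreal ((1 / 2) powr p) = 0" using \<Gamma> by simp
  then show False using wt_pos[of v] by simp
qed

lemma weak_upper_gradient_edge:
  assumes p: "1 < p" and h: "weak_upper_gradient Y \<mu> p u h" and n: "N v w" and st: "0 <= s" "s < t" "t <= 1"
  shows "ennreal \<bar>u (edge v w t) - u (edge v w s)\<bar> <= (\<integral>\<^sup>+q\<in>{s..t}. h (edge v w q) * ennreal (\<rho> (edge_point v w q)) \<partial>lborel)"
proof -
  obtain \<Gamma> where "p_modulus Y \<mu> p \<Gamma> = 0" and \<Gamma>: "!!\<gamma> a b. rectifiable_curve Y \<gamma> a b ==> ~ \<gamma> constant_on {a..b} ==> (\<gamma>, a, b) \<notin> \<Gamma> ==>
          ennreal \<bar>u (\<gamma> b) - u (\<gamma> a)\<bar> <= line_integral Y h \<gamma> a b" and hm: "h \<in> borel_measurable (metric_borel Y)"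
    using h unfolding weak_upper_gradient_def by blast
  from edge_not_exceptional[OF p this(1) n st] have "(edge v w, s, t) \<notin> \<Gamma>" .
  then have "ennreal \<bar>u (edge v w t) - u (edge v w s)\<bar> <= line_integral Y h (edge v w) s t"
    using st by (intro \<Gamma> edge_rectifiable[OF n] edge_not_constant[OF n]) auto
  then show ?thesis using edge_line_integral[OF n st hm] by simp
qed

lemma emb_inj: "x \<in> points ==> y \<in> points ==> emb x = emb y ==> x = y"
proof -
  assume xy: "x \<in> points" "y \<in> points" "emb x = emb y"
  then have "mdist Xe x y = 0" using emb_isometric[OF xy(1,2)] emb_in by simp
  then show "x = y" using xy by simp
qed

lemma edge_in_open_edges: "N v w ==> 0 < t ==> t < 1 ==> edge v w t \<in> open_edges"
  unfolding open_edges_def by blast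

text \<open>The derivative of a piecewise linear function along an edge with respect to \<open>d\<^sub>\<epsilon>\<close>. The vertices
  and the boundary form a null set, and the infinite value there excludes all curves that spend
  a positive amount of time in it.\<close>
definition slope :: "('z \<times> nat => real) => (nat => 'z \<times> nat => real) set => ennreal" where
  "slope f F = (if F \<in> open_edges
     then SUP (v, w, t) \<in> {(v, w, t). N v w & 0 < t & t < 1 & F = edge v w t}. ennreal (\<bar>f v - f w\<bar> / \<rho> (edge_point v w t))
     else \<infinity>)"

lemma slope_edge:
  assumes n: "N v w" and t: "0 < t" "t < 1"
  shows "slope f (edge v w t) = ennreal (\<bar>f v - f w\<bar> / \<rho> (edge_point v w t))"
proof -
  have supp: "{u. edge_point v w t u ~= 0} = {v, w}" if "N v w" "0 < t" "t < 1" for v w t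
    using N_irrefl[OF that(1)] that by (auto simp: edge_point_def vertex_point_def indicator_def of_bool_def split: if_splits)
  have "\<bar>f v' - f w'\<bar> / \<rho> (edge_point v' w' t') = \<bar>f v - f w\<bar> / \<rho> (edge_point v w t)"
    if h: "N v' w'" "0 < t'" "t' < 1" "edge v w t = edge v' w' t'" for v' w' t'
  proof -
    have eq: "edge_point v w t = edge_point v' w' t'"
      using h t by (intro emb_inj) (auto intro!: edge_point_in n)
    then have "{v, w} = {v', w'}" using supp[OF n t] supp[OF h(1-3)] by simp
    then have "\<bar>f v' - f w'\<bar> = \<bar>f v - f w\<bar>" by (auto simp: doubleton_eq_iff)
    then show ?thesis using eq by simp
  qed
  then have "(SUP (v', w', t') \<in> {(v', w', t'). N v' w' & 0 < t' & t' < 1 & edge v w t = edge v' w' t'}.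
      ennreal (\<bar>f v' - f w'\<bar> / \<rho> (edge_point v' w' t'))) =
    (SUP x \<in> {(v', w', t'). N v' w' & 0 < t' & t' < 1 & edge v w t = edge v' w' t'}. ennreal (\<bar>f v - f w\<bar> / \<rho> (edge_point v w t)))"
    by (intro SUP_cong) auto
  also have "... = ennreal (\<bar>f v - f w\<bar> / \<rho> (edge_point v w t))"
    by (intro SUP_const) (use n t in blast)
  finally show ?thesis unfolding slope_def using edge_in_open_edges[OF n t] by (simp only: if_True)
qed

definition linear_on_edges :: "('z \<times> nat => real) => ((nat => 'z \<times> nat => real) set => real) => bool" where
  "linear_on_edges f u \<longleftrightarrow> (\<forall>v w t. N v w --> t \<in> {0..1} --> u (edge v w t) = (1 - t) * f v + t * f w)"

lemma linear_on_edgesD: "linear_on_edges f u ==> N v w ==> t \<in> {0..1} ==> u (edge v w t) = (1 - t) * f v + t * f w"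
  unfolding linear_on_edges_def by blast

text \<open>The function is linear in the parameter of the edge, and for nearby points of the edge \<open>d\<^sub>\<epsilon>\<close> is \<open>\<rho>\<close> times the difference
  of the parameters up to a factor close to one.\<close>
lemma slope_local:
  assumes n: "N v w" and t: "0 < t" "t < 1" and u: "linear_on_edges f u" and \<eta>: "0 < \<eta>"
  shows "\<exists>\<delta>>0. \<forall>G\<in>mspace Y. mdist Y (edge v w t) G < \<delta> --> G \<in> open_edges \<and>
     \<bar>u G - u (edge v w t)\<bar> <= (\<bar>f v - f w\<bar> / \<rho> (edge_point v w t) + \<eta>) * mdist Y (edge v w t) G \<and>
     ennreal (\<bar>f v - f w\<bar> / \<rho> (edge_point v w t)) <= slope f G + ennreal \<eta>"
proof -
  define a where "a = \<bar>f v - f w\<bar>"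
  define R where "R = \<rho> (edge_point v w t)"
  have a: "0 <= a" by (simp add: a_def)
  have R: "0 < R" "R <= 1" by (simp_all add: R_def)
  obtain \<delta>0 where \<delta>0: "\<delta>0 > 0" "!!F. F \<in> mspace Y ==> mdist Y (edge v w t) F < \<delta>0 ==> \<exists>s. 0 < s & s < 1 & F = edge v w s"
    using near_open_edge[OF n t] by blast
  define \<delta> where "\<delta> = min \<delta>0 (min (R\<^sup>2) (\<eta> * R ^ 3 / (a + 1)))"
  have \<delta>: "0 < \<delta>" using \<delta>0 R \<eta> a by (simp add: \<delta>_def)
  have "G \<in> open_edges & \<bar>u G - u (edge v w t)\<bar> <= (a / R + \<eta>) * mdist Y (edge v w t) G & ennreal (a / R) <= slope f G + ennreal \<eta>"
    if G: "G \<in> mspace Y" "mdist Y (edge v w t) G < \<delta>" for G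
  proof -
    obtain s where s: "0 < s" "s < 1" "G = edge v w s" using \<delta>0(2)[OF G(1)] G(2) by (auto simp: \<delta>_def)
    define k where "k = \<bar>t - s\<bar>"
    define D where "D = mdist Y (edge v w t) G"
    have k: "0 <= k" "k <= 1" using s t by (auto simp: k_def)
    have D: "0 <= D" "D <= R\<^sup>2" "D * (a + 1) <= \<eta> * R ^ 3"
      using G(2) a by (auto simp: D_def \<delta>_def field_simps)
    have "k * R * exp (- (1 / 4) * k) <= D"
      using edge_dist_ge[OF n, of t s] s t by (simp add: k_def R_def D_def)
    moreover have "1 - k / 4 <= exp (- (1 / 4) * k)" using exp_ge_add_one_self[of "- (1 / 4) * k"] by simp
    then have "k * R * (1 - k / 4) <= k * R * exp (- (1 / 4) * k)" using k R by (intro mult_left_mono) auto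
    ultimately have kD: "k * R * (1 - k / 4) <= D" by linarith
    have "k * R * (1 / 2) <= k * R * (1 - k / 4)" using k R by (intro mult_left_mono) auto
    then have kR: "k * R <= 2 * D" using kD by linarith
    have "k * R = k * R * (1 - k / 4) + (k * R) * (k / 4)" by (simp add: algebra_simps)
    also have "... <= D + (2 * D) * (k / 4)" using kD kR k by (intro add_mono mult_right_mono) auto
    finally have "k * R <= D + D * k / 2" by simp
    then have "(k * R) * R <= (D + D * k / 2) * R" using R by (intro mult_right_mono) auto
    also have "... = D * R + D * (k * R) / 2" by (simp add: algebra_simps)
    also have "... <= D * R + D * (2 * D) / 2" using kR D by (intro add_left_mono divide_right_mono mult_left_mono) auto
    finally have kRR: "k * R * R <= D * R + D * D" by simp
    have aD: "a * D <= \<eta> * R ^ 3" using D by (simp add: algebra_simps)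
    have "\<eta> * R ^ 3 <= \<eta> * R\<^sup>2" using \<eta> R by (intro mult_left_mono power_decreasing) auto
    with aD have aD2: "a * D <= \<eta> * (R * R)" by (simp add: power2_eq_square)
    have "a * (k * R * R) <= a * (D * R + D * D)" using kRR a by (intro mult_left_mono)
    also have "... = a * D * R + (a * D) * D" by (simp add: algebra_simps)
    also have "... <= a * D * R + (\<eta> * (R * R)) * D" using aD2 D by (intro add_left_mono mult_right_mono)
    also have "... = ((a / R + \<eta>) * D) * (R * R)" using R by (simp add: field_simps)
    finally have "(a * k) * (R * R) <= ((a / R + \<eta>) * D) * (R * R)" by (simp add: mult_ac)
    then have 1: "a * k <= (a / R + \<eta>) * D" using R by (simp add: mult_le_cancel_right)
    have "u G - u (edge v w t) = (s - t) * (f w - f v)"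
      using linear_on_edgesD[OF u n, of s] linear_on_edgesD[OF u n, of t] s t by (simp add: algebra_simps)
    then have ua: "\<bar>u G - u (edge v w t)\<bar> = a * k" by (simp add: abs_mult a_def k_def abs_minus_commute)
    define S where "S = \<rho> (edge_point v w s)"
    have "\<bar>R - S\<bar> <= 1 / 4 * dG (edge_point v w t) (edge_point v w s)"
      unfolding R_def S_def using \<rho>_lipschitz edge_point_in[OF n] s t by simp
    then have RS: "\<bar>R - S\<bar> <= k / 4" using dG_edge[OF n, of t s] s t by (simp add: k_def)
    have "S <= R + k / 4" "R - k / 4 <= S" using RS unfolding abs_le_iff by linarith+
    note RS = this
    have "S * R <= (R + k / 4) * R" using RS R by (intro mult_right_mono) auto
    then have SR: "S * R - R * R <= D / 2" using kR by (simp add: algebra_simps)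
    have "(R - k / 4) * R <= S * R" using RS R by (intro mult_right_mono) auto
    then have "R * R - D / 2 <= S * R" using kR by (simp add: algebra_simps)
    then have SR2: "R * R / 2 <= S * R" using D by (simp add: power2_eq_square)
    have S: "0 < S" by (simp add: S_def)
    have "a * (S * R - R * R) <= a * (D / 2)" using SR a by (intro mult_left_mono)
    also have "... <= \<eta> * R ^ 3 / 2" using aD by simp
    also have "... = \<eta> * R * (R * R / 2)" by (simp add: power3_eq_cube)
    also have "... <= \<eta> * R * (S * R)" using SR2 \<eta> R by (intro mult_left_mono) auto
    finally have "a * S * R <= (a * R + \<eta> * S * R) * R" by (simp add: algebra_simps)
    then have "a * S <= a * R + \<eta> * S * R" using R by (simp add: mult_le_cancel_right)
    then have "a / R <= a / S + \<eta>" using R S by (simp add: field_simps)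
    then have 2: "ennreal (a / R) <= slope f G + ennreal \<eta>"
      unfolding s(3) slope_edge[OF n s(1,2)] a_def[symmetric] S_def[symmetric] using a S \<eta>
      by (simp add: ennreal_plus[symmetric] del: ennreal_plus)
    have "G \<in> open_edges" using edge_in_open_edges[OF n s(1,2)] s(3) by simp
    then show ?thesis using 1 2 ua by (simp add: D_def)
  qed
  then show ?thesis using \<delta> unfolding a_def R_def by blast
qed

lemma openin_metric_borel: "openin YM.mtopology U ==> U \<in> sets (metric_borel Y)"
  unfolding metric_borel_def using openin_subset[of "mtopology_of Y"]
  by (subst sets_measure_of) (auto simp: mtopology_of_def intro!: sigma_sets.Basic dest: openin_subset)

text \<open>The slope is lower semicontinuous on the open set of open edges and infinite on its complement.\<close>
lemma slope_measurable: "slope f \<in> borel_measurable (metric_borel Y)"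
proof (rule borel_measurableI_greater)
  fix c :: ennreal
  let ?S = "{F \<in> open_edges. c < slope f F}"
  have sub: "open_edges <= mspace Y" using open_edges_openin openin_subset by fastforce
  have "openin YM.mtopology ?S"
    unfolding YM.openin_mtopology
  proof (intro conjI allI impI)
    show "?S <= mspace Y" using sub by auto
    fix F assume "F \<in> ?S"
    then obtain v w t where h: "N v w" "0 < t" "t < 1" "F = edge v w t" and cF: "c < slope f F" by (auto simp: open_edges_def)
    define x where "x = \<bar>f v - f w\<bar> / \<rho> (edge_point v w t)"
    have x: "slope f F = ennreal x" "0 <= x" using slope_edge[OF h(1-3)] h(4) by (simp_all add: x_def)
    obtain c' where c': "c = ennreal c'" "0 <= c'" "c' < x" using cF x by (cases c) (auto simp: ennreal_less_iff)
    obtain u :: "(nat => 'z \<times> nat => real) set => real" where u: "linear_on_edges f u"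
    proof
      show "linear_on_edges f (%F. pl f (SOME x. x \<in> points & emb x = F))"
        unfolding linear_on_edges_def
      proof (intro allI impI)
        fix v w t assume n: "N v w" and t: "t \<in> {0..1::real}"
        have "(SOME x. x \<in> points & emb x = edge v w t) = edge_point v w t"
          using emb_inj edge_point_in[OF n t] by (intro some_equality) auto
        then show "pl f (SOME x. x \<in> points & emb x = edge v w t) = (1 - t) * f v + t * f w"
          using pl_edge[OF N_irrefl[OF n]] by simp
      qed
    qed
    obtain \<delta> where \<delta>: "\<delta> > 0" "!!G. G \<in> mspace Y ==> mdist Y F G < \<delta> ==> G \<in> open_edges & ennreal x <= slope f G + ennreal ((x - c') / 2)"
      using slope_local[OF h(1-3) u, of "(x - c') / 2"] c' unfolding h(4) x_def by fastforce
    have "G \<in> ?S" if G: "G \<in> YM.mball F \<delta>" for G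
    proof -
      have *: "G \<in> open_edges" "ennreal x <= slope f G + ennreal ((x - c') / 2)" using \<delta>(2)[of G] G by auto
      have "c < slope f G"
      proof (rule ccontr)
        assume "~ ?thesis"
        then have "ennreal x <= ennreal c' + ennreal ((x - c') / 2)" using * c' by (metis add_right_mono not_less order_trans)
        then have "x <= c' + (x - c') / 2" using c' x by (simp add: ennreal_plus[symmetric] del: ennreal_plus)
        then show False using c' by (simp add: field_simps)
      qed
      then show ?thesis using * by simp
    qed
    then show "\<exists>q>0. YM.mball F q <= ?S" using \<delta>(1) by blast
  qed
  then have S: "?S \<in> sets (metric_borel Y)" by (rule openin_metric_borel)
  have O: "open_edges \<in> sets (metric_borel Y)" by (rule openin_metric_borel[OF open_edges_openin])
  show "{F \<in> space (metric_borel Y). c < slope f F} \<in> sets (metric_borel Y)"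
  proof (cases "c = \<infinity>")
    case False
    then have "{F \<in> space (metric_borel Y). c < slope f F} = (space (metric_borel Y) - open_edges) \<union> ?S"
      using sub by (auto simp: slope_def less_top)
    then show ?thesis using S O by (simp only: sets.Un sets.compl_sets)
  qed simp
qed

text \<open>Every rectifiable curve satisfies the inequality: along a curve that meets the vertices or the boundary in a set of positive
  length the integral of the slope is infinite, and on all other curves the mean value inequality applies.\<close>
lemma slope_weak_upper_gradient:
  assumes p: "1 < p" and u: "linear_on_edges f u" and L: "0 <= L" "!!F G. F \<in> mspace Y ==> G \<in> mspace Y ==> \<bar>u F - u G\<bar> <= L * mdist Y F G"
  shows "weak_upper_gradient Y \<mu> p u (slope f)"
  unfolding weak_upper_gradient_def
proof (intro conjI exI[of _ "{}"] allI impI slope_measurable)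
  have "p_modulus Y \<mu> p {} <= (\<integral>\<^sup>+x. ennreal_powr 0 p \<partial>\<mu>)"
    unfolding p_modulus_def by (rule INF_lower2[of "%_. 0"]) auto
  then show "p_modulus Y \<mu> p {} = 0" by simp
  fix \<gamma> a b assume "rectifiable_curve Y \<gamma> a b & ~ \<gamma> constant_on {a..b} & (\<gamma>, a, b) \<notin> {}"
  then obtain \<sigma> l where \<sigma>: "unit_speed Y \<sigma> l" "\<sigma> 0 = \<gamma> a" "\<sigma> l = \<gamma> b"
    "!!g. line_integral Y g \<gamma> a b = (\<integral>\<^sup>+x\<in>{0..l}. g (\<sigma> x) \<partial>lborel)"
    using rectifiable_unit_speed[of Y \<gamma> a b] by auto
  have l: "0 <= l" using unit_speed_nonneg[OF \<sigma>(1)] .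
  have cont: "continuous_map (top_of_set {0..l}) (mtopology_of Y) \<sigma>"
    using unit_speed_rectifiable[OF \<sigma>(1)] by (simp add: rectifiable_curve_def)
  define F where "F = {s \<in> {0..l}. \<sigma> s \<notin> open_edges}"
  have "openin (top_of_set {0..l}) {s \<in> {0..l}. \<sigma> s \<in> open_edges}"
    using cont open_edges_openin by (simp add: continuous_map_def mtopology_of_def)
  then have "{s \<in> {0..l}. \<sigma> s \<in> open_edges} \<in> sets borel"
    by (auto simp: openin_open borel_open)
  moreover have "F = {0..l} - {s \<in> {0..l}. \<sigma> s \<in> open_edges}" by (auto simp: F_def)
  ultimately have Fm: "F \<in> sets borel" by simp
  have "ennreal \<bar>u (\<sigma> l) - u (\<sigma> 0)\<bar> <= (\<integral>\<^sup>+s\<in>{0..l}. slope f (\<sigma> s) \<partial>lborel)"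
  proof (cases "emeasure lborel F = 0")
    case False
    have "(\<integral>\<^sup>+s. \<infinity> * indicator F s \<partial>lborel) <= (\<integral>\<^sup>+s\<in>{0..l}. slope f (\<sigma> s) \<partial>lborel)"
      by (intro nn_integral_mono) (auto simp: F_def indicator_def slope_def)
    moreover have "(\<integral>\<^sup>+s. \<infinity> * indicator F s \<partial>lborel) = \<infinity>"
      using Fm False by (subst nn_integral_cmult_indicator) (auto simp: ennreal_top_mult)
    ultimately show ?thesis by (simp add: top_unique)
  next
    case True
    then have Fn: "F \<in> null_sets lebesgue" using Fm by (intro null_sets_completionI) (auto simp: null_sets_def)
    show ?thesis
    proof (rule increment_le_nn_integral_pointwise[OF l curve_measurable_indicator[OF cont slope_measurable] Fn L(1)])
      fix x y assume xy: "0 <= x" "x <= y" "y <= l"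
      have "\<bar>u (\<sigma> y) - u (\<sigma> x)\<bar> <= L * mdist Y (\<sigma> y) (\<sigma> x)"
        using xy by (intro L(2) unit_speed_mspace[OF \<sigma>(1)]) auto
      also have "... <= L * \<bar>y - x\<bar>" using xy L(1) unit_speed_lipschitz[OF \<sigma>(1), of y x] by (intro mult_left_mono) auto
      finally show "\<bar>u (\<sigma> y) - u (\<sigma> x)\<bar> <= L * (y - x)" using xy by simp
    next
      fix x assume x: "x \<in> {0..l} - F"
      then obtain v w t where h: "N v w" "0 < t" "t < 1" "\<sigma> x = edge v w t" by (auto simp: F_def open_edges_def)
      let ?c = "\<bar>f v - f w\<bar> / \<rho> (edge_point v w t)"
      have "\<exists>\<delta>>0. \<forall>q\<in>{0..l}. \<bar>q - x\<bar> < \<delta> --> \<bar>u (\<sigma> q) - u (\<sigma> x)\<bar> <= (?c + \<eta>) * \<bar>q - x\<bar> & ennreal ?c <= slope f (\<sigma> q) + ennreal \<eta>"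
        if \<eta>: "0 < \<eta>" for \<eta>
      proof -
        obtain \<delta> where \<delta>: "\<delta> > 0" "!!G. G \<in> mspace Y ==> mdist Y (\<sigma> x) G < \<delta> ==>
           \<bar>u G - u (\<sigma> x)\<bar> <= (?c + \<eta>) * mdist Y (\<sigma> x) G & ennreal ?c <= slope f G + ennreal \<eta>"
          using slope_local[OF h(1-3) u \<eta>] unfolding h(4) by blast
        have "\<bar>u (\<sigma> q) - u (\<sigma> x)\<bar> <= (?c + \<eta>) * \<bar>q - x\<bar> & ennreal ?c <= slope f (\<sigma> q) + ennreal \<eta>"
          if q: "q \<in> {0..l}" "\<bar>q - x\<bar> < \<delta>" for q
        proof -
          have d: "mdist Y (\<sigma> x) (\<sigma> q) <= \<bar>q - x\<bar>" using unit_speed_lipschitz[OF \<sigma>(1), of x q] x q by (simp add: abs_minus_commute)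
          have *: "\<bar>u (\<sigma> q) - u (\<sigma> x)\<bar> <= (?c + \<eta>) * mdist Y (\<sigma> x) (\<sigma> q) & ennreal ?c <= slope f (\<sigma> q) + ennreal \<eta>"
            using d q by (intro \<delta>(2) unit_speed_mspace[OF \<sigma>(1)]) auto
          have "(?c + \<eta>) * mdist Y (\<sigma> x) (\<sigma> q) <= (?c + \<eta>) * \<bar>q - x\<bar>" using d \<eta> by (intro mult_left_mono) auto
          then show ?thesis using * by linarith
        qed
        then show ?thesis using \<delta>(1) by blast
      qed
      moreover have "0 <= ?c" by simp
      ultimately show "\<exists>c\<ge>0. \<forall>\<eta>>0. \<exists>\<delta>>0. \<forall>q\<in>{0..l}. \<bar>q - x\<bar> < \<delta> -->
          \<bar>u (\<sigma> q) - u (\<sigma> x)\<bar> <= (c + \<eta>) * \<bar>q - x\<bar> & ennreal c <= slope f (\<sigma> q) + ennreal \<eta>" by blast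
    qed
  qed
  then show "ennreal \<bar>u (\<gamma> b) - u (\<gamma> a)\<bar> <= line_integral Y (slope f) \<gamma> a b" using \<sigma> by simp
qed

lemma slope_energy_edge:
  assumes n: "N (z, i) w" and p: "1 < p"
  shows "(\<integral>\<^sup>+t\<in>{0..1}. ennreal_powr (slope f (edge (z, i) w t)) p \<partial>lborel) <= ennreal ((2 * \<bar>f (z, i) - f w\<bar> / r i) powr p)"
proof -
  have "(\<integral>\<^sup>+t\<in>{0..1}. ennreal_powr (slope f (edge (z, i) w t)) p \<partial>lborel) \<le>
     (\<integral>\<^sup>+t. ennreal ((2 * \<bar>f (z, i) - f w\<bar> / r i) powr p) * indicator {0..1::real} t \<partial>lborel)"
  proof (intro nn_integral_mono_AE)
    have "AE t in lborel. t ~= (0::real)" "AE t in lborel. t ~= (1::real)" by (rule AE_lborel_singleton)+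
    then show "AE t in lborel. ennreal_powr (slope f (edge (z, i) w t)) p * indicator {0..1} t <= ennreal ((2 * \<bar>f (z, i) - f w\<bar> / r i) powr p) * indicator {0..1} t"
    proof eventually_elim
      case (elim t)
      show ?case
      proof (cases "t \<in> {0..1}")
        case True
        then have t: "0 < t" "t < 1" using elim by auto
        have "\<bar>f (z, i) - f w\<bar> / \<rho> (edge_point (z, i) w t) <= \<bar>f (z, i) - f w\<bar> / (r i / 2)"
          using weight_bounds(1)[OF n True] by (intro divide_left_mono) auto
        then have "ennreal_powr (slope f (edge (z, i) w t)) p <= ennreal_powr (ennreal (2 * \<bar>f (z, i) - f w\<bar> / r i)) p"
          unfolding slope_edge[OF n t] using p by (intro ennreal_powr_mono ennreal_leI) (auto simp: mult.commute)
        also have "... = ennreal ((2 * \<bar>f (z, i) - f w\<bar> / r i) powr p)" by (intro ennreal_powr_ennreal) auto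
        finally show ?thesis by (simp add: indicator_def)
      qed simp
    qed
  qed
  then show ?thesis by (subst (asm) nn_integral_cmult_indicator) auto
qed

text \<open>Along every segment of an edge any other weak upper gradient integrates to at least the increment of
  \<open>u\<close>, that is, to the integral of the slope; the density bound turns this into a pointwise inequality.\<close>
lemma slope_minimal:
  assumes p: "1 < p" and u: "linear_on_edges f u" and L: "0 <= L" "!!F G. F \<in> mspace Y ==> G \<in> mspace Y ==> \<bar>u F - u G\<bar> <= L * mdist Y F G"
    and fin: "(\<integral>\<^sup>+x. ennreal_powr (slope f x) p \<partial>\<mu>) < \<infinity>"
  shows "minimal_weak_upper_gradient Y \<mu> p u (slope f)"
  unfolding minimal_weak_upper_gradient_def
proof (intro conjI allI impI slope_weak_upper_gradient[OF p u L] fin)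
  fix h assume "weak_upper_gradient Y \<mu> p u h & (\<integral>\<^sup>+x. ennreal_powr (h x) p \<partial>\<mu>) < \<infinity>"
  then have h: "weak_upper_gradient Y \<mu> p u h" "(\<integral>\<^sup>+x. ennreal_powr (h x) p \<partial>\<mu>) < \<infinity>" by auto
  have hm: "h \<in> borel_measurable (metric_borel Y)" using h by (simp add: weak_upper_gradient_def)
  have on_edge: "AE q in lborel. q \<in> {0..1} --> slope f (edge v w q) <= h (edge v w q)" if n: "N v w" for v w
  proof -
    let ?k = "%q. h (edge v w q) * ennreal (\<rho> (edge_point v w q))"
    have eq: "(%q. ?k q * indicator {0..1} q) = (%q. (h (edge v w q) * indicator {0..1} q) * ennreal (wclamp v w q))"
      by (auto simp: indicator_def wclamp_eq)
    have "wclamp v w \<in> borel_measurable borel" using wclamp_continuous[OF n] by (rule borel_measurable_continuous_onI)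
    then have km: "(%q. ?k q * indicator {0..1} q) \<in> borel_measurable lborel"
      unfolding eq using edge_measurable[OF n hm] by (subst borel_measurable_times_ennreal) auto
    have "wt v * (\<integral>\<^sup>+q\<in>{0..1}. ennreal_powr (h (edge v w q)) p \<partial>lborel) < \<infinity>"
      using single_edge_le[OF measurable_ennreal_powr[OF hm] n] h(2) by (rule le_less_trans)
    then have fin: "(\<integral>\<^sup>+q\<in>{0..1}. ennreal_powr (h (edge v w q)) p \<partial>lborel) < \<infinity>"
      using wt_pos[of v] by (auto simp: ennreal_mult_less_top)
    have "(\<integral>\<^sup>+q\<in>{0..1}. ?k q \<partial>lborel) <= (\<integral>\<^sup>+q\<in>{0..1}. h (edge v w q) \<partial>lborel)"
    proof (intro nn_integral_mono mult_right_mono)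
      show "?k q <= h (edge v w q)" for q
        using mult_left_mono[of "ennreal (\<rho> (edge_point v w q))" 1 "h (edge v w q)"] by (simp add: ennreal_le_1)
    qed simp
    also have "... <= ennreal 1 + ennreal (1 powr (1 - p)) * (\<integral>\<^sup>+q\<in>{0..1}. ennreal_powr (h (edge v w q)) p \<partial>lborel)"
      using edge_measurable[OF n hm] p by (intro unit_interval_powr_le) auto
    also have "... < \<infinity>" using fin by (simp add: ennreal_add_less_top)
    finally have kfin: "(\<integral>\<^sup>+q\<in>{0..1}. ?k q \<partial>lborel) < \<infinity>" .
    have "ennreal (\<bar>f v - f w\<bar> * (t - s)) <= (\<integral>\<^sup>+q\<in>{s..t}. ?k q \<partial>lborel)" if st: "0 <= s" "s < t" "t <= 1" for s t
    proof -
      have "u (edge v w t) - u (edge v w s) = (t - s) * (f w - f v)"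
        using linear_on_edgesD[OF u n, of s] linear_on_edgesD[OF u n, of t] st by (simp add: algebra_simps)
      then have "\<bar>u (edge v w t) - u (edge v w s)\<bar> = \<bar>f v - f w\<bar> * (t - s)" using st by (simp add: abs_mult abs_minus_commute)
      then show ?thesis using weak_upper_gradient_edge[OF p h(1) n st] by simp
    qed
    from density_lower_bound_AE[OF km kfin this] have "AE q in lborel. q \<in> {0..1} --> ennreal \<bar>f v - f w\<bar> <= ?k q" by simp
    moreover have "AE t in lborel. t ~= (0::real)" "AE t in lborel. t ~= (1::real)" by (rule AE_lborel_singleton)+
    ultimately show ?thesis
    proof eventually_elim
      case (elim q)
      show ?case
      proof
        assume q: "q \<in> {0..1}"
        then have q': "0 < q" "q < 1" using elim by auto
        let ?R = "\<rho> (edge_point v w q)"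
        have "ennreal (\<bar>f v - f w\<bar> / ?R) = ennreal (1 / ?R) * ennreal \<bar>f v - f w\<bar>" by (simp add: ennreal_mult[symmetric])
        also have "... <= ennreal (1 / ?R) * ?k q" using elim q by (intro mult_left_mono) auto
        also have "... = h (edge v w q) * ennreal (1 / ?R * ?R)" by (simp only: ennreal_mult' less_imp_le[OF \<rho>_pos(1)] mult_ac)
        also have "?R ~= 0" using \<rho>_pos(1)[of "edge_point v w q"] by linarith
        then have "h (edge v w q) * ennreal (1 / ?R * ?R) = h (edge v w q)" by simp
        finally show "slope f (edge v w q) <= h (edge v w q)" unfolding slope_edge[OF n q'] .
      qed
    qed
  qed
  let ?B = "{x \<in> space (metric_borel Y). h x < slope f x}"
  have B: "?B \<in> sets (metric_borel Y)" using hm slope_measurable[of f] by measurable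
  have "edge_int (indicator ?B) = edge_int (%_. 0)"
    unfolding edge_int_def
  proof (intro nn_integral_cong)
    fix v w assume "w \<in> space (count_space {w. N v w})"
    then have n: "N v w" by simp
    have "(\<integral>\<^sup>+t\<in>{0..1}. indicator ?B (edge v w t) \<partial>lborel) = (\<integral>\<^sup>+t\<in>{0..1::real}. 0 \<partial>lborel)"
    proof (rule nn_integral_cong_AE)
      show "AE t in lborel. indicator ?B (edge v w t) * indicator {0..1} t = (0 * indicator {0..1::real} t :: ennreal)"
        using on_edge[OF n] by eventually_elim (auto simp: indicator_def not_less)
    qed
    then show "(wt v + wt w) * (\<integral>\<^sup>+t\<in>{0..1}. indicator ?B (edge v w t) \<partial>lborel) = (wt v + wt w) * (\<integral>\<^sup>+t\<in>{0..1::real}. 0 \<partial>lborel)" by (simp only:)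
  qed
  then have "emeasure \<mu> ?B = 0" using emeasure_\<mu>[OF B] by (simp add: edge_int_def)
  then show "AE x in \<mu>. slope f x <= h x"
    using B by (subst AE_iff_measurable[of ?B]) (auto simp: not_le)
qed

end

section \<open>Discrete inequalities\<close>

lemma ennreal_powr_mult:
  assumes "0 <= a" "0 < p"
  shows "ennreal_powr (ennreal a * x) p = ennreal (a powr p) * ennreal_powr x p"
proof (cases x)
  case (real y)
  then show ?thesis using assms by (simp add: ennreal_mult[symmetric] ennreal_powr_ennreal powr_mult)
next
  case top
  show ?thesis
  proof (cases "a = 0")
    case False
    then have "ennreal a ~= 0" "ennreal (a powr p) ~= 0" using assms by auto
    then show ?thesis using top by (simp add: ennreal_mult_top)
  qed (use top assms in simp)
qed

text \<open>The sum is at most \<open>n\<close> times its largest term.\<close>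
lemma ennreal_powr_sum_le:
  fixes c :: "'b => ennreal"
  assumes S: "finite S" and n: "card {s \<in> S. c s ~= 0} <= n" and p: "0 < p"
  shows "ennreal_powr (\<Sum>s\<in>S. c s) p <= ennreal (real n powr p) * (\<Sum>s\<in>S. ennreal_powr (c s) p)"
proof -
  let ?T = "{s \<in> S. c s ~= 0}"
  have eq: "(\<Sum>s\<in>S. c s) = (\<Sum>s\<in>?T. c s)" using S by (intro sum.mono_neutral_right) auto
  show ?thesis
  proof (cases "?T = {}")
    case True
    then have "(\<Sum>s\<in>S. c s) = 0" unfolding eq by simp
    then show ?thesis by simp
  next
    case False
    then have "Max (c ` ?T) \<in> c ` ?T" using S by (intro Max_in) auto
    then obtain s where s: "s \<in> ?T" "Max (c ` ?T) = c s" by auto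
    have "(\<Sum>s\<in>?T. c s) <= (\<Sum>_\<in>?T. c s)"
      using S s(2) by (intro sum_mono) (metis (no_types, lifting) Max_ge finite_imageI finite_subset imageI mem_Collect_eq subsetI)
    also have "... = of_nat (card ?T) * c s" by simp
    also have "... <= of_nat n * c s" using n by (intro mult_right_mono) auto
    finally have "(\<Sum>s\<in>S. c s) <= ennreal (real n) * c s" unfolding eq by (simp add: ennreal_of_nat_eq_real_of_nat)
    then have "ennreal_powr (\<Sum>s\<in>S. c s) p <= ennreal_powr (ennreal (real n) * c s) p" using p by (rule ennreal_powr_mono)
    also have "... = ennreal (real n powr p) * ennreal_powr (c s) p" using p by (intro ennreal_powr_mult) auto
    also have "... <= ennreal (real n powr p) * (\<Sum>s\<in>S. ennreal_powr (c s) p)"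
      using S s(1) by (intro mult_left_mono member_le_sum) auto
    finally show ?thesis .
  qed
qed

lemma ennreal_powr_add_le:
  assumes "0 < p"
  shows "ennreal_powr (x + y) p <= ennreal (2 powr p) * (ennreal_powr x p + ennreal_powr y p)"
proof -
  have "card {s \<in> (UNIV :: bool set). (if s then x else y) ~= 0} <= card (UNIV :: bool set)"
    by (rule card_mono) auto
  then have "card {s \<in> (UNIV :: bool set). (if s then x else y) ~= 0} <= 2" by simp
  from ennreal_powr_sum_le[OF _ this assms] show ?thesis by (simp add: UNIV_bool add.commute)
qed

lemma term_le_suminf: "(f :: nat => ennreal) k <= suminf f"
  using sum_le_suminf[of f "{k}"] by simp

lemma suminf_swap: "(\<Sum>i. \<Sum>k. (f :: nat => nat => ennreal) i k) = (\<Sum>k. \<Sum>i. f i k)"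
proof -
  have "(\<Sum>i. \<Sum>k. f i k) = (\<integral>\<^sup>+i. (\<Sum>k. f i k) \<partial>count_space UNIV)" by (simp add: nn_integral_count_space_nat)
  also have "... = (\<Sum>k. \<integral>\<^sup>+i. f i k \<partial>count_space UNIV)" by (rule nn_integral_suminf) simp
  finally show ?thesis by (simp add: nn_integral_count_space_nat)
qed

lemma suminf_shift_le: "(\<Sum>i. (f :: nat => ennreal) (i + k)) <= (\<Sum>i. f i)"
proof (rule suminf_le_const[OF summableI])
  fix n
  have "(\<Sum>i<n. f (i + k)) = (\<Sum>j\<in>(%i. i + k) ` {..<n}. f j)" by (subst sum.reindex) (auto simp: inj_on_def)
  also have "... <= (\<Sum>i. f i)" by (rule sum_le_suminf[OF summableI]) auto
  finally show "(\<Sum>i<n. f (i + k)) <= (\<Sum>i. f i)" .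
qed

lemma suminf_geometric: "0 <= a ==> 0 <= l ==> l < 1 ==> (\<Sum>k. ennreal (a * l ^ k)) = ennreal (a / (1 - l))"
  using sums_mult[OF geometric_sums, of l a] by (intro suminf_ennreal_eq) auto

lemma weighted_suminf_powr_le:
  fixes a :: "nat => ennreal"
  assumes Q: "1 < Q" and p: "0 < p"
  shows "ennreal_powr (\<Sum>k. a k) p <= ennreal ((1 / (1 - Q powr (- 1 / p))) powr p) * (\<Sum>k. ennreal (Q ^ k) * ennreal_powr (a k) p)"
proof -
  define l where "l = Q powr (- 1 / p)"
  have l: "0 < l" "l < 1" using Q p by (auto simp: l_def powr_less_one)
  let ?T = "\<Sum>k. ennreal (Q ^ k) * ennreal_powr (a k) p"
  show ?thesis unfolding l_def[symmetric]
  proof (cases ?T)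
    case (real T)
    have "a k <= ennreal (T powr (1 / p) * l ^ k)" for k
    proof -
      have le: "ennreal (Q ^ k) * ennreal_powr (a k) p <= ennreal T"
        using term_le_suminf[of "%k. ennreal (Q ^ k) * ennreal_powr (a k) p" k] real by simp
      have Qk: "0 < Q ^ k" using Q by simp
      show ?thesis
      proof (cases "a k")
        case (real b)
        then have "ennreal (Q ^ k * b powr p) <= ennreal T" using le Qk by (simp add: ennreal_powr_ennreal ennreal_mult)
        then have "Q ^ k * b powr p <= T" using \<open>0 <= T\<close> by (simp add: ennreal_le_iff)
        then have "b powr p <= T * (1 / Q ^ k)" using Qk by (simp add: field_simps)
        then have "(b powr p) powr (1 / p) <= (T * (1 / Q ^ k)) powr (1 / p)" using p by (intro powr_mono2) auto
        moreover have "(b powr p) powr (1 / p) = b" using p real by (simp add: powr_powr)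
        moreover have "(T * (1 / Q ^ k)) powr (1 / p) = T powr (1 / p) * (1 / Q ^ k) powr (1 / p)"
          by (rule powr_mult)
        moreover have "(1 / Q ^ k) powr (1 / p) = l ^ k"
        proof -
          have "1 / Q ^ k = Q powr (- real k)" using Q by (simp add: powr_minus powr_realpow divide_inverse)
          moreover have "l ^ k = l powr real k" using l by (simp add: powr_realpow)
          ultimately show ?thesis by (simp add: l_def powr_powr)
        qed
        ultimately show ?thesis using real by (simp add: ennreal_leI)
      next
        case top
        then show ?thesis using le Qk Q by (simp add: ennreal_mult_top top_unique)
      qed
    qed
    then have "(\<Sum>k. a k) <= (\<Sum>k. ennreal (T powr (1 / p) * l ^ k))" by (intro suminf_le) auto
    also have "... = ennreal (T powr (1 / p) / (1 - l))" using l by (intro suminf_geometric) auto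
    finally have "ennreal_powr (\<Sum>k. a k) p <= ennreal_powr (ennreal (T powr (1 / p) / (1 - l))) p" using p by (rule ennreal_powr_mono)
    also have "... = ennreal ((1 / (1 - l)) powr p * T)"
    proof -
      have "(T powr (1 / p) / (1 - l)) powr p = ((1 / (1 - l)) * T powr (1 / p)) powr p" by simp
      also have "... = (1 / (1 - l)) powr p * (T powr (1 / p)) powr p" by (rule powr_mult)
      also have "(T powr (1 / p)) powr p = T" using p \<open>0 <= T\<close> by (simp add: powr_powr)
      finally show ?thesis using l by (subst ennreal_powr_ennreal) auto
    qed
    also have "... = ennreal ((1 / (1 - l)) powr p) * ?T" using real by (simp add: ennreal_mult)
    finally show "ennreal_powr (\<Sum>k. a k) p <= ennreal ((1 / (1 - l)) powr p) * ?T" .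
  next
    case top
    then show "ennreal_powr (\<Sum>k. a k) p <= ennreal ((1 / (1 - l)) powr p) * ?T" using l by (simp add: ennreal_mult_top)
  qed
qed

text \<open>A discrete Hardy inequality. The weights grow geometrically, so a tail sum is dominated, up to
  a factor, by the supremum of its terms with half of the weights.\<close>
lemma discrete_hardy:
  assumes Q: "1 < Q" and p: "0 < p"
  obtains C where "0 <= C" "!!D :: nat => ennreal.
     (\<Sum>i. ennreal (Q ^ (2 * i)) * ennreal_powr (\<Sum>k. D (i + k)) p) <= ennreal C * (\<Sum>j. ennreal (Q ^ (2 * j)) * ennreal_powr (D j) p)"
proof
  define K where "K = (1 / (1 - Q powr (- 1 / p))) powr p"
  define G where "G = 1 / (1 - 1 / Q)"
  have K: "0 <= K" and G: "0 <= G" using Q by (auto simp: K_def G_def)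
  show "0 <= K * G" using K G by simp
  fix D :: "nat => ennreal"
  let ?R = "\<Sum>j. ennreal (Q ^ (2 * j)) * ennreal_powr (D j) p"
  have "(\<Sum>i. ennreal (Q ^ (2 * i)) * ennreal_powr (\<Sum>k. D (i + k)) p) \<le>
     (\<Sum>i. \<Sum>k. ennreal K * (ennreal ((1 / Q) ^ k) * (ennreal (Q ^ (2 * (i + k))) * ennreal_powr (D (i + k)) p)))"
  proof (rule suminf_le)
    fix i
    have "ennreal (Q ^ (2 * i)) * ennreal_powr (\<Sum>k. D (i + k)) p \<le>
       ennreal (Q ^ (2 * i)) * (ennreal K * (\<Sum>k. ennreal (Q ^ k) * ennreal_powr (D (i + k)) p))"
      using weighted_suminf_powr_le[OF Q p, of "%k. D (i + k)"] unfolding K_def by (rule mult_left_mono) simp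
    also have "... = (\<Sum>k. ennreal K * ((ennreal (Q ^ (2 * i)) * ennreal (Q ^ k)) * ennreal_powr (D (i + k)) p))"
      by (simp only: ennreal_suminf_cmult[symmetric] mult_ac)
    also have "... = (\<Sum>k. ennreal K * (ennreal ((1 / Q) ^ k) * (ennreal (Q ^ (2 * (i + k))) * ennreal_powr (D (i + k)) p)))"
    proof (intro arg_cong[where f = suminf] ext)
      fix k
      have "Q ^ (2 * i) * Q ^ k = (1 / Q) ^ k * Q ^ (2 * (i + k))"
        using Q by (simp add: power_add power_mult power2_eq_square power_mult_distrib field_simps)
      then have "ennreal (Q ^ (2 * i)) * ennreal (Q ^ k) = ennreal ((1 / Q) ^ k) * ennreal (Q ^ (2 * (i + k)))"
        using Q by (simp add: ennreal_mult[symmetric])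
      then show "ennreal K * ((ennreal (Q ^ (2 * i)) * ennreal (Q ^ k)) * ennreal_powr (D (i + k)) p) =
        ennreal K * (ennreal ((1 / Q) ^ k) * (ennreal (Q ^ (2 * (i + k))) * ennreal_powr (D (i + k)) p))" by (simp only: mult.assoc)
    qed
    finally show "ennreal (Q ^ (2 * i)) * ennreal_powr (\<Sum>k. D (i + k)) p \<le>
       (\<Sum>k. ennreal K * (ennreal ((1 / Q) ^ k) * (ennreal (Q ^ (2 * (i + k))) * ennreal_powr (D (i + k)) p)))" .
  qed auto
  also have "... = (\<Sum>k. \<Sum>i. ennreal K * (ennreal ((1 / Q) ^ k) * (ennreal (Q ^ (2 * (i + k))) * ennreal_powr (D (i + k)) p)))"
    by (rule suminf_swap)
  also have "... = (\<Sum>k. ennreal K * (ennreal ((1 / Q) ^ k) * (\<Sum>i. ennreal (Q ^ (2 * (i + k))) * ennreal_powr (D (i + k)) p)))"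
    by (simp only: ennreal_suminf_cmult)
  also have "... <= (\<Sum>k. ennreal K * (ennreal ((1 / Q) ^ k) * ?R))"
  proof (rule suminf_le)
    fix k
    have "(\<Sum>i. ennreal (Q ^ (2 * (i + k))) * ennreal_powr (D (i + k)) p) <= ?R"
      by (rule suminf_shift_le)
    then show "ennreal K * (ennreal ((1 / Q) ^ k) * (\<Sum>i. ennreal (Q ^ (2 * (i + k))) * ennreal_powr (D (i + k)) p)) \<le>
      ennreal K * (ennreal ((1 / Q) ^ k) * ?R)" by (simp only: mult_left_mono zero_le)
  qed auto
  also have "... = ennreal K * ((\<Sum>k. ennreal ((1 / Q) ^ k)) * ?R)"
    by (simp only: ennreal_suminf_cmult ennreal_suminf_multc)
  also have "(\<Sum>k. ennreal ((1 / Q) ^ k)) = ennreal G"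
  proof -
    have "(\<Sum>k. ennreal (1 * (1 / Q) ^ k)) = ennreal (1 / (1 - 1 / Q))" by (rule suminf_geometric) (use Q in auto)
    then show ?thesis unfolding mult_1 G_def .
  qed
  also have "ennreal K * (ennreal G * ?R) = ennreal (K * G) * ?R" using K G by (simp add: ennreal_mult mult.assoc)
  finally show "(\<Sum>i. ennreal (Q ^ (2 * i)) * ennreal_powr (\<Sum>k. D (i + k)) p) <= ennreal (K * G) * ?R" .
qed

section \<open>Volumes, overlaps and vertex energies\<close>

locale hardy_filling = weighted_filling A z0 \<nu> \<beta> for A :: "nat => 'z::metric_space set" and z0 :: 'z and \<nu> \<beta> +
  fixes p \<theta> :: real
  assumes p: "1 < p" and \<theta>: "0 < \<theta>" "\<theta> < 1" and \<beta>: "\<beta> = p * (1 - \<theta>) / 4"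
begin

abbreviation "rneg i \<equiv> r i powr (- \<theta> * p)"
abbreviation "rpos i \<equiv> r i powr (p * (1 - \<theta>))"
abbreviation "abs_p x \<equiv> ennreal (\<bar>x\<bar> powr p)"
abbreviation "dist_p E x \<equiv> ennreal_powr (dist_to_set Y x (bdry ` E)) p"

definition vol :: "'z => real => real" where "vol x s = measure \<nu> (ball x s)"

lemma ball_sets [measurable, simp]: "ball x s \<in> sets \<nu>" by (simp add: sets_\<nu>)

lemma emeasure_ball: "0 < s ==> emeasure \<nu> (ball x s) = ennreal (vol x s)"
  unfolding vol_def using ball_finite[of s x] by (intro emeasure_eq_ennreal_measure) auto

lemma vol_pos: "0 < s ==> 0 < vol x s"
  using ball_pos[of s x] emeasure_ball[of s x] by simp

lemma vol_mono: "0 < s ==> 0 < t ==> ball x s <= ball y t ==> vol x s <= vol y t"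
  using emeasure_mono[of "ball x s" "ball y t" \<nu>] vol_pos[of t y] by (simp add: emeasure_ball ennreal_le_iff)

lemma ex_doubling: "\<exists>C\<ge>1. \<forall>x s. 0 < s --> vol x (2 * s) <= C * vol x s"
proof (rule doubling_constant)
  fix C assume C: "1 <= C" "!!x s. 0 < s ==> emeasure \<nu> (ball x (2 * s)) <= ennreal C * emeasure \<nu> (ball x s)"
  have "vol x (2 * s) <= C * vol x s" if s: "0 < s" for x s
    using C(2)[OF s, of x] C(1) s vol_pos[OF s, of x]
    by (simp add: emeasure_ball ennreal_mult[symmetric] ennreal_le_iff)
  then show ?thesis using C(1) by blast
qed

text \<open>Six doublings give a comparison of volumes between a ball and one of 64 times the radius, which absorbs all
  constants that relate neighboring vertices.\<close>
definition K :: real where "K = (SOME C. 1 <= C & (\<forall>x s. 0 < s --> vol x (2 * s) <= C * vol x s)) ^ 6"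

lemma K_ge_1: "1 <= K" and vol_64: "0 < s ==> vol x (64 * s) <= K * vol x s"
proof -
  define C where "C = (SOME C. 1 <= C & (\<forall>x s. 0 < s --> vol x (2 * s) <= C * vol x s))"
  have C: "1 <= C" "!!x s. 0 < s ==> vol x (2 * s) <= C * vol x s"
    using someI_ex[OF ex_doubling[unfolded Bex_def]] unfolding C_def by blast+
  have K: "K = C ^ 6" by (simp add: K_def C_def)
  show "1 <= K" unfolding K using C(1) by simp
  have *: "0 < s ==> vol x (2 ^ n * s) <= C ^ n * vol x s" for n s
  proof (induction n)
    case (Suc n)
    have "vol x (2 * (2 ^ n * s)) <= C * vol x (2 ^ n * s)" using Suc by (intro C) auto
    also have "... <= C * (C ^ n * vol x s)" using Suc C(1) by (intro mult_left_mono) auto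
    finally show ?case by (simp add: mult_ac)
  qed simp
  show "0 < s ==> vol x (64 * s) <= K * vol x s" using *[of s 6] K by simp
qed

lemma vol_compare:
  assumes "0 < s" "0 < t" "dist x y + s <= 64 * t" shows "vol x s <= K * vol y t"
proof -
  have "ball x s <= ball y (64 * t)"
  proof
    fix w assume "w \<in> ball x s"
    then have "dist y w < dist x y + s" using dist_triangle[of y w x] by (simp add: dist_commute)
    then show "w \<in> ball y (64 * t)" using assms by simp
  qed
  then have "vol x s <= vol y (64 * t)" using assms by (intro vol_mono) auto
  also have "... <= K * vol y t" by (rule vol_64) fact
  finally show ?thesis .
qed

definition Mo :: nat where "Mo = nat \<lceil>K\<rceil>"

text \<open>Balls of half the radius around the points of a net are disjoint and, by doubling, have volumes
  comparable to the ball that contains them all.\<close>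
lemma overlap: "card {z \<in> A i. dist z y < 4 * r i} <= Mo"
proof -
  let ?S = "{z \<in> A i. dist z y < 4 * r i}" and ?b = "%z. ball z (r i / 2)"
  have fin: "finite ?S" by simp
  have disj: "disjoint_family_on ?b ?S"
    unfolding disjoint_family_on_def
  proof (intro ballI impI)
    fix a b assume ab: "a \<in> ?S" "b \<in> ?S" "a ~= b"
    have "False" if x: "x \<in> ball a (r i / 2)" "x \<in> ball b (r i / 2)" for x
    proof -
      have "dist a b <= dist a x + dist b x" by (metis dist_commute dist_triangle)
      then show False using x A_separated[of a i b] ab by simp
    qed
    then show "?b a \<inter> ?b b = {}" by blast
  qed
  have "real (card ?S) * vol y (5 * r i) = (\<Sum>z\<in>?S. vol y (5 * r i))" by simp
  also have "... <= (\<Sum>z\<in>?S. K * vol z (r i / 2))"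
  proof (intro sum_mono vol_compare)
    fix z assume "z \<in> ?S"
    then have "dist y z < 4 * r i" by (simp add: dist_commute)
    then show "dist y z + 5 * r i <= 64 * (r i / 2)" using r_pos(1)[of i] by linarith
  qed auto
  also have "... = K * (\<Sum>z\<in>?S. vol z (r i / 2))" by (simp add: sum_distrib_left)
  also have "(\<Sum>z\<in>?S. vol z (r i / 2)) = measure \<nu> (\<Union>z\<in>?S. ?b z)"
    unfolding vol_def using fin disj ball_finite[of "r i / 2"] by (intro measure_finite_Union[symmetric]) (auto simp: less_top)
  also have "... <= vol y (5 * r i)"
    unfolding vol_def
  proof (intro measure_mono_fmeasurable)
    show "(\<Union>z\<in>?S. ?b z) <= ball y (5 * r i)"
    proof
      fix x assume "x \<in> (\<Union>z\<in>?S. ?b z)"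
      then obtain z where z: "dist z y < 4 * r i" "dist z x < r i / 2" by auto
      have "dist y x <= dist z y + dist z x" by (metis dist_commute dist_triangle)
      then have "dist y x < 5 * r i" using z r_pos(1)[of i] by linarith
      then show "x \<in> ball y (5 * r i)" by simp
    qed
    show "ball y (5 * r i) \<in> fmeasurable \<nu>" using ball_finite[of "5 * r i" y] by (intro fmeasurableI) auto
  qed (auto intro!: sets.finite_UN)
  finally have "real (card ?S) * vol y (5 * r i) <= K * vol y (5 * r i)" using K_ge_1 by (simp add: mult_left_mono)
  then have "real (card ?S) <= K" using vol_pos[of "5 * r i" y] by simp
  then show ?thesis unfolding Mo_def by linarith
qed

definition nb :: "'z => nat => ('z \<times> nat) set" where "nb z i = {w. N (z, i) w}"

lemma nb_finite [simp]: "finite (nb z i)" and card_nb: "card (nb z i) <= 3 * Mo"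
proof -
  let ?T = "%j. (%y. (y, j)) ` {y \<in> A j. dist y z < 4 * r j}"
  have sub: "nb z i <= (\<Union>j\<in>{i - 1, i, Suc i}. ?T j)"
  proof
    fix w assume "w \<in> nb z i"
    then obtain y j where w: "w = (y, j)" "N (z, i) (y, j)" by (cases w) (auto simp: nb_def)
    have "dist y z < 4 * r j" using neighbors_close(1)[OF neighbors_sym[OF w(2)]] .
    moreover have "j \<in> {i - 1, i, Suc i}" using neighbors_close(4,5)[OF w(2)] by auto
    ultimately show "w \<in> (\<Union>j\<in>{i - 1, i, Suc i}. ?T j)" using w neighbors_close(7)[OF w(2)] by blast
  qed
  have fin: "finite (\<Union>j\<in>{i - 1, i, Suc i}. ?T j)" by auto
  show "finite (nb z i)" using sub fin by (rule finite_subset)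
  have "card (nb z i) <= card (\<Union>j\<in>{i - 1, i, Suc i}. ?T j)" using fin sub by (rule card_mono)
  also have "... <= (\<Sum>j\<in>{i - 1, i, Suc i}. card (?T j))" by (rule card_UN_le) simp
  also have "... <= (\<Sum>j\<in>{i - 1, i, Suc i}. Mo)"
    by (intro sum_mono order_trans[OF card_image_le overlap]) auto
  also have "... <= 3 * Mo" by (simp add: card_insert_if)
  finally show "card (nb z i) <= 3 * Mo" .
qed

abbreviation "mm z i \<equiv> vol z (r i)"

lemma mm_pos [simp]: "0 < mm z i" "0 <= mm z i" using vol_pos[of "r i" z] by auto

text \<open>This is the place where \<open>\<beta>/\<epsilon> = p(1 - \<theta>)\<close> enters.\<close>
lemma wt_real: "wt (z, i) = ennreal (rpos i * mm z i)"
proof -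
  have "exp (- \<beta> * real i) = rpos i" unfolding r_def powr_def \<beta> by (simp add: mult_ac)
  then show ?thesis unfolding wt_eq by (simp add: emeasure_ball ennreal_mult)
qed

lemma wt_neighbor: "N (z, i) w ==> wt w <= ennreal (2 powr (p * (1 - \<theta>)) * K) * wt (z, i)"
proof -
  assume n: "N (z, i) w"
  obtain y j where w: "w = (y, j)" by (cases w)
  note nc = neighbors_close[OF n[unfolded w]]
  have "rpos j <= (2 * r i) powr (p * (1 - \<theta>))" using nc p \<theta> by (intro powr_mono2) auto
  also have "... = 2 powr (p * (1 - \<theta>)) * rpos i" by (rule powr_mult)
  finally have 1: "rpos j <= 2 powr (p * (1 - \<theta>)) * rpos i" .
  have "dist y z + r j <= 64 * r i" using nc(1,2) r_pos(1)[of i] unfolding dist_commute[of y z] by linarith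
  then have 2: "mm y j <= K * mm z i" by (intro vol_compare) auto
  have "rpos j * mm y j <= (2 powr (p * (1 - \<theta>)) * rpos i) * (K * mm z i)"
    using 1 2 K_ge_1 by (intro mult_mono) auto
  then show "wt w <= ennreal (2 powr (p * (1 - \<theta>)) * K) * wt (z, i)"
    unfolding w wt_real using K_ge_1 by (subst ennreal_mult[symmetric]) (auto intro!: ennreal_leI simp: mult_ac)
qed

lemma level_sum: "(\<integral>\<^sup>+v. g v \<partial>count_space V) = (\<Sum>i. \<Sum>z\<in>A i. g (z, i))" for g :: "'z \<times> nat => ennreal"
proof -
  have s: "(\<Sum>i. g v * of_bool (snd v = i)) = g v" for v
    using suminf_finite[of "{snd v}" "%i. g v * of_bool (snd v = i)"] by simp
  have "(\<integral>\<^sup>+v. g v \<partial>count_space V) = (\<integral>\<^sup>+v. (\<Sum>i. g v * of_bool (snd v = i)) \<partial>count_space V)" unfolding s ..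
  also have "... = (\<Sum>i. \<integral>\<^sup>+v. g v * of_bool (snd v = i) \<partial>count_space V)" by (rule nn_integral_suminf) simp
  also have "... = (\<Sum>i. \<Sum>z\<in>A i. g (z, i))"
  proof (intro arg_cong[where f = suminf] ext)
    fix i
    have "(\<integral>\<^sup>+v. g v * of_bool (snd v = i) \<partial>count_space V) = (\<Sum>v\<in>(%z. (z, i)) ` A i. g v * of_bool (snd v = i))"
      by (rule nn_integral_count_space') (auto simp: filling_vertices_def)
    also have "... = (\<Sum>z\<in>A i. g (z, i))" by (subst sum.reindex) (auto simp: inj_on_def)
    finally show "(\<integral>\<^sup>+v. g v * of_bool (snd v = i) \<partial>count_space V) = (\<Sum>z\<in>A i. g (z, i))" .
  qed
  finally show ?thesis .
qed

lemma edge_int_levels: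
  "edge_int f = (\<Sum>i. \<Sum>z\<in>A i. \<Sum>w\<in>nb z i. (wt (z, i) + wt w) * (\<integral>\<^sup>+ t\<in>{0..1}. f (edge (z, i) w t) \<partial>lborel))"
  unfolding edge_int_def level_sum nb_def[symmetric] by (simp add: nn_integral_count_space_finite)

text \<open>The Dirichlet energy of the piecewise linear extension, up to constants.\<close>
definition vertex_energy :: "('z \<times> nat => real) => ennreal" where
  "vertex_energy U = (\<Sum>i. \<Sum>z\<in>A i. \<Sum>w\<in>nb z i. ennreal (rneg i * mm z i * \<bar>U (z, i) - U w\<bar> powr p))"

definition Dl :: "('z \<times> nat => real) => nat => 'z => ennreal" where
  "Dl U j x = (\<Sum>a\<in>A j. indicator (ball a (r j)) x * (\<Sum>w\<in>nb a j. ennreal \<bar>U (a, j) - U w\<bar>))"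

text \<open>An upper bound for the variation along the part from level \<open>i\<close> on of any chain that descends to \<open>x\<close>.\<close>
definition Sl :: "('z \<times> nat => real) => nat => 'z => ennreal" where
  "Sl U i x = (\<Sum>k. Dl U (i + k) x)"

abbreviation "tail_energy U \<equiv> (\<Sum>i. ennreal (rneg i) * (\<integral>\<^sup>+x. ennreal_powr (Sl U i x) p \<partial>\<nu>))"
abbreviation "hardy_lhs E u \<equiv> (\<integral>\<^sup>+x. abs_p (u x) * ennreal (infdist x E powr (- \<theta> * p)) \<partial>\<nu>)"

lemma Dl_measurable [measurable]: "Dl U j \<in> borel_measurable \<nu>" unfolding Dl_def by measurable
lemma Sl_measurable [measurable]: "Sl U j \<in> borel_measurable \<nu>" unfolding Sl_def by measurable

text \<open>Only boundedly many balls of one level contain a given point, and only boundedly many edges end in a vertex, so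
  the power of the sum is at most a multiple of the sum of the powers.\<close>
lemma Dl_energy:
  "(\<integral>\<^sup>+x. ennreal_powr (Dl U j x) p \<partial>\<nu>) <= ennreal (real Mo powr p * real (3 * Mo) powr p) *
     (\<Sum>a\<in>A j. \<Sum>w\<in>nb a j. ennreal (mm a j * \<bar>U (a, j) - U w\<bar> powr p))"
proof -
  let ?c = "%a. \<Sum>w\<in>nb a j. ennreal \<bar>U (a, j) - U w\<bar>" and ?d = "%a. \<Sum>w\<in>nb a j. abs_p (U (a, j) - U w)"
  have "ennreal_powr (Dl U j x) p <= ennreal (real Mo powr p * real (3 * Mo) powr p) * (\<Sum>a\<in>A j. indicator (ball a (r j)) x * ?d a)" for x
  proof -
    have "card {a \<in> A j. indicator (ball a (r j)) x * ?c a ~= 0} <= card {a \<in> A j. dist a x < 4 * r j}"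
    proof (rule card_mono)
      show "{a \<in> A j. indicator (ball a (r j)) x * ?c a ~= 0} <= {a \<in> A j. dist a x < 4 * r j}"
      proof
        fix a assume "a \<in> {a \<in> A j. indicator (ball a (r j)) x * ?c a ~= 0}"
        then have a: "a \<in> A j" "dist a x < r j" by (auto split: split_indicator_asm)
        have "dist a x < 4 * r j" using r_pos(1)[of j] a(2) by linarith
        then show "a \<in> {a \<in> A j. dist a x < 4 * r j}" using a(1) by simp
      qed
    qed simp
    also have "... <= Mo" by (rule overlap)
    finally have "ennreal_powr (Dl U j x) p <= ennreal (real Mo powr p) * (\<Sum>a\<in>A j. ennreal_powr (indicator (ball a (r j)) x * ?c a) p)"
      unfolding Dl_def using p by (intro ennreal_powr_sum_le) auto
    also have "... <= ennreal (real Mo powr p) * (\<Sum>a\<in>A j. indicator (ball a (r j)) x * (ennreal (real (3 * Mo) powr p) * ?d a))"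
    proof (intro mult_left_mono sum_mono)
      fix a
      have "card {w \<in> nb a j. ennreal \<bar>U (a, j) - U w\<bar> ~= 0} <= 3 * Mo"
        using card_mono[of "nb a j" "{w \<in> nb a j. ennreal \<bar>U (a, j) - U w\<bar> ~= 0}"] card_nb[of a j] by auto
      then have "ennreal_powr (?c a) p <= ennreal (real (3 * Mo) powr p) * (\<Sum>w\<in>nb a j. ennreal_powr (ennreal \<bar>U (a, j) - U w\<bar>) p)"
        using p by (intro ennreal_powr_sum_le) auto
      then have "ennreal_powr (?c a) p <= ennreal (real (3 * Mo) powr p) * ?d a" by (simp only: ennreal_powr_ennreal abs_ge_zero)
      then show "ennreal_powr (indicator (ball a (r j)) x * ?c a) p <= indicator (ball a (r j)) x * (ennreal (real (3 * Mo) powr p) * ?d a)"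
        by (cases "x \<in> ball a (r j)") auto
    qed auto
    also have "... = ennreal (real Mo powr p * real (3 * Mo) powr p) * (\<Sum>a\<in>A j. indicator (ball a (r j)) x * ?d a)"
      by (simp only: ennreal_mult powr_ge_zero sum_distrib_left mult_ac)
    finally show ?thesis .
  qed
  then have "(\<integral>\<^sup>+x. ennreal_powr (Dl U j x) p \<partial>\<nu>) \<le>
     (\<integral>\<^sup>+x. ennreal (real Mo powr p * real (3 * Mo) powr p) * (\<Sum>a\<in>A j. indicator (ball a (r j)) x * ?d a) \<partial>\<nu>)"
    by (rule nn_integral_mono)
  also have "... = ennreal (real Mo powr p * real (3 * Mo) powr p) * (\<Sum>a\<in>A j. \<integral>\<^sup>+x. indicator (ball a (r j)) x * ?d a \<partial>\<nu>)"
    by (subst nn_integral_cmult, measurable) (subst nn_integral_sum, auto)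
  also have "(\<Sum>a\<in>A j. \<integral>\<^sup>+x. indicator (ball a (r j)) x * ?d a \<partial>\<nu>) = (\<Sum>a\<in>A j. \<Sum>w\<in>nb a j. ennreal (mm a j * \<bar>U (a, j) - U w\<bar> powr p))"
  proof (rule sum.cong[OF refl])
    fix a
    have "(\<integral>\<^sup>+x. indicator (ball a (r j)) x * ?d a \<partial>\<nu>) = ennreal (mm a j) * ?d a"
      by (subst nn_integral_multc) (auto simp: emeasure_ball)
    also have "... = (\<Sum>w\<in>nb a j. ennreal (mm a j * \<bar>U (a, j) - U w\<bar> powr p))"
      unfolding sum_distrib_left by (intro sum.cong refl ennreal_mult[symmetric]) auto
    finally show "(\<integral>\<^sup>+x. indicator (ball a (r j)) x * ?d a \<partial>\<nu>) = (\<Sum>w\<in>nb a j. ennreal (mm a j * \<bar>U (a, j) - U w\<bar> powr p))" .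
  qed
  finally show ?thesis .
qed

text \<open>The discrete Hardy inequality, applied to the increments at the single levels.\<close>
lemma Sl_energy:
  obtains C where "0 <= C" "!!U. tail_energy U <= ennreal C * vertex_energy U"
proof -
  define Q where "Q = exp (\<theta> * p / 8)"
  have Q: "1 < Q" using \<theta> p by (simp add: Q_def)
  have rQ: "rneg i = Q ^ (2 * i)" for i
  proof -
    have "Q ^ (2 * i) = exp (real (2 * i) * (\<theta> * p / 8))" unfolding Q_def by (simp only: exp_of_nat_mult)
    then show ?thesis by (simp add: powr_def r_def)
  qed
  obtain C where C: "0 <= C" "!!D :: nat => ennreal.
     (\<Sum>i. ennreal (Q ^ (2 * i)) * ennreal_powr (\<Sum>k. D (i + k)) p) <= ennreal C * (\<Sum>j. ennreal (Q ^ (2 * j)) * ennreal_powr (D j) p)"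
    using discrete_hardy[OF Q, of p] p by auto
  define M where "M = real Mo powr p * real (3 * Mo) powr p"
  have M: "0 <= M" by (simp add: M_def)
  show ?thesis
  proof (rule that)
    show "0 <= C * M" using C M by simp
    fix U
    have "tail_energy U =
       (\<integral>\<^sup>+x. (\<Sum>i. ennreal (Q ^ (2 * i)) * ennreal_powr (Sl U i x) p) \<partial>\<nu>)"
      unfolding rQ by (subst nn_integral_suminf) (auto simp: nn_integral_cmult)
    also have "... <= (\<integral>\<^sup>+x. ennreal C * (\<Sum>j. ennreal (Q ^ (2 * j)) * ennreal_powr (Dl U j x) p) \<partial>\<nu>)"
      unfolding Sl_def by (intro nn_integral_mono C(2))
    also have "... = ennreal C * (\<Sum>j. ennreal (Q ^ (2 * j)) * (\<integral>\<^sup>+x. ennreal_powr (Dl U j x) p \<partial>\<nu>))"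
      by (subst nn_integral_cmult, measurable) (subst nn_integral_suminf, auto simp: nn_integral_cmult)
    also have "... <= ennreal C * (\<Sum>j. ennreal (Q ^ (2 * j)) * (ennreal M * (\<Sum>a\<in>A j. \<Sum>w\<in>nb a j. ennreal (mm a j * \<bar>U (a, j) - U w\<bar> powr p))))"
      unfolding M_def by (intro mult_left_mono suminf_le Dl_energy) auto
    also have "... = ennreal C * (\<Sum>j. ennreal M * (\<Sum>a\<in>A j. \<Sum>w\<in>nb a j. ennreal (rneg j * mm a j * \<bar>U (a, j) - U w\<bar> powr p)))"
    proof -
      have "ennreal (rneg j * mm a j * \<bar>U (a, j) - U w\<bar> powr p) = ennreal (Q ^ (2 * j)) * ennreal (mm a j * \<bar>U (a, j) - U w\<bar> powr p)" for a w j
        unfolding rQ mult.assoc using Q by (intro ennreal_mult) auto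
      then have "ennreal (Q ^ (2 * j)) * (ennreal M * (\<Sum>a\<in>A j. \<Sum>w\<in>nb a j. ennreal (mm a j * \<bar>U (a, j) - U w\<bar> powr p))) =
         ennreal M * (\<Sum>a\<in>A j. \<Sum>w\<in>nb a j. ennreal (rneg j * mm a j * \<bar>U (a, j) - U w\<bar> powr p))" for j
        by (simp only: sum_distrib_left mult_ac)
      then show ?thesis by (simp only:)
    qed
    also have "... = ennreal (C * M) * vertex_energy U" unfolding vertex_energy_def using C M by (simp add: ennreal_mult mult.assoc)
    finally show "tail_energy U <= ennreal (C * M) * vertex_energy U" .
  qed
qed

end

section \<open>Traces of functions on the filling\<close>

lemma ennreal_divide_le:
  assumes "0 < q0" "q0 <= q" shows "X / ennreal q <= ennreal (1 / q0) * X"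
proof -
  have "inverse (ennreal q) <= ennreal (1 / q0)"
    using assms by (simp add: inverse_ennreal inverse_eq_divide frac_le ennreal_leI)
  then have "X * inverse (ennreal q) <= X * ennreal (1 / q0)" by (intro mult_left_mono) auto
  then show ?thesis by (simp add: divide_ennreal_def mult.commute)
qed

lemma sum_inj_geometric_le:
  assumes "finite S" "inj_on g S" "0 <= (l::real)" "l < 1"
  shows "(\<Sum>i\<in>S. l ^ (g i)) <= 1 / (1 - l)"
proof -
  have "(\<Sum>i\<in>S. l ^ (g i)) = (\<Sum>k\<in>g ` S. l ^ k)" using assms by (simp add: sum.reindex)
  also have "... <= (\<Sum>k. l ^ k)" using assms by (intro sum_le_suminf summable_geometric) auto
  also have "... = 1 / (1 - l)" using geometric_sums[of l] assms by (simp add: sums_iff)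
  finally show ?thesis .
qed

context hardy_filling
begin

lemma r_nonzero [simp]: "r i ~= 0"
  by (simp add: r_def)

text \<open>The terms are geometric on both sides of the level where \<open>\<alpha>\<^sup>-\<^sup>i\<close> is comparable to \<open>d\<close>.\<close>
lemma level_series:
  obtains C where "0 < C" "!!d. 0 < d ==>
    (\<Sum>i. ennreal (rpos i / (d + r i) powr p)) <= ennreal (C * d powr (- \<theta> * p))"
proof
  define a where "a = p * (1 - \<theta>)"
  define b where "b = \<theta> * p"
  have ab: "0 < a" "0 < b" "p = a + b" using p \<theta> by (auto simp: a_def b_def algebra_simps)
  define l where "l = max (exp (- a / 4)) (exp (- b / 4))"
  have l: "0 < l" "l < 1" using ab by (auto simp: l_def max_def)
  show "0 < 2 / (1 - l)" using l by simp
  fix d :: real assume d: "0 < d"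
  obtain n where "\<forall>i\<ge>n. r i < d" using small_r[OF d] by blast
  then have ex: "r n <= d" by (simp add: less_imp_le)
  define i0 where "i0 = (LEAST i. r i <= d)"
  have i0: "r i0 <= d" unfolding i0_def by (rule LeastI[of _ n]) fact
  have below: "d < r i" if "i < i0" for i using not_less_Least[of i "%i. r i <= d"] that by (simp add: i0_def not_le)
  have r_shift: "r (i + k) = exp (- (real k / 4)) * r i" for i k
    by (simp add: r_def exp_add[symmetric] add_divide_distrib)
  have up: "r i powr a / (d + r i) powr p <= d powr (- b) * l ^ (i - i0)" if i: "i0 <= i" for i
  proof -
    have "r i = exp (- (real (i - i0) / 4)) * r i0" using r_shift[of i0 "i - i0"] i by simp
    also have "... <= exp (- (real (i - i0) / 4)) * d" using i0 by (intro mult_left_mono) auto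
    finally have "r i powr a <= (exp (- (real (i - i0) / 4)) * d) powr a" using ab by (intro powr_mono2) auto
    also have "... = exp (- (real (i - i0) / 4)) powr a * d powr a" by (rule powr_mult)
    also have "exp (- (real (i - i0) / 4)) powr a = exp (- a / 4) ^ (i - i0)"
      by (simp add: powr_def flip: exp_of_nat_mult)
    also have "exp (- a / 4) ^ (i - i0) * d powr a <= l ^ (i - i0) * d powr a"
      by (intro mult_right_mono power_mono) (auto simp: l_def)
    finally have 1: "r i powr a <= l ^ (i - i0) * d powr a" .
    have 2: "d powr p <= (d + r i) powr p" using d p by (intro powr_mono2) auto
    have "r i powr a / (d + r i) powr p <= (l ^ (i - i0) * d powr a) / d powr p"
      using 1 2 d l by (intro frac_le) auto
    also have "... = d powr (- b) * l ^ (i - i0)" unfolding ab(3) powr_add powr_minus using d by (simp add: field_simps)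
    finally show ?thesis .
  qed
  have down: "r i powr a / (d + r i) powr p <= d powr (- b) * l ^ (i0 - 1 - i)" if i: "i < i0" for i
  proof -
    define k where "k = i0 - 1 - i"
    have "i0 - 1 = i + k" "i0 - 1 < i0" using i by (auto simp: k_def)
    then have "d < exp (- (real k / 4)) * r i" using below[of "i0 - 1"] r_shift[of i k] by simp
    then have "exp (real k / 4) * d <= exp (real k / 4) * (exp (- (real k / 4)) * r i)" by (intro mult_left_mono) auto
    also have "... = r i" by (simp add: mult.assoc[symmetric] flip: exp_add)
    finally have "r i powr (- b) <= (exp (real k / 4) * d) powr (- b)" using ab d by (intro powr_mono2') auto
    also have "... = exp (real k / 4) powr (- b) * d powr (- b)" by (rule powr_mult)
    also have "exp (real k / 4) powr (- b) = exp (- b / 4) ^ k"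
      by (simp add: powr_def flip: exp_of_nat_mult)
    also have "exp (- b / 4) ^ k * d powr (- b) <= l ^ k * d powr (- b)"
      by (intro mult_right_mono power_mono) (auto simp: l_def)
    finally have 1: "r i powr (- b) <= l ^ k * d powr (- b)" .
    have "r i powr a / (d + r i) powr p <= r i powr a / r i powr p"
    proof (intro divide_left_mono powr_mono2 mult_pos_pos)
      have "0 < d + r i" using d r_pos(1)[of i] by linarith
      then show "0 < (d + r i) powr p" "0 < r i powr p" by simp_all
    qed (use d p in auto)
    also have "... = r i powr (- b)" unfolding ab(3) powr_add powr_minus by (simp add: field_simps)
    finally show ?thesis using 1 by (simp add: k_def mult.commute)
  qed
  have fin: "(\<Sum>i<n. r i powr a / (d + r i) powr p) <= 2 / (1 - l) * d powr (- b)" for n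
  proof -
    let ?S = "{i \<in> {..<n}. i0 <= i}" and ?T = "{i \<in> {..<n}. ~ i0 <= i}"
    have "(\<Sum>i<n. r i powr a / (d + r i) powr p) = (\<Sum>i\<in>?S. r i powr a / (d + r i) powr p) + (\<Sum>i\<in>?T. r i powr a / (d + r i) powr p)"
      by (subst sum.union_disjoint[symmetric]) (auto intro!: sum.cong)
    also have "... <= (\<Sum>i\<in>?S. d powr (- b) * l ^ (i - i0)) + (\<Sum>i\<in>?T. d powr (- b) * l ^ (i0 - 1 - i))"
      using up down by (intro add_mono sum_mono) auto
    also have "... = d powr (- b) * ((\<Sum>i\<in>?S. l ^ (i - i0)) + (\<Sum>i\<in>?T. l ^ (i0 - 1 - i)))"
      by (simp add: sum_distrib_left distrib_left)
    also have "... <= d powr (- b) * (1 / (1 - l) + 1 / (1 - l))"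
      using l by (intro mult_left_mono add_mono sum_inj_geometric_le) (auto simp: inj_on_def)
    finally show ?thesis by (simp add: field_simps)
  qed
  show "(\<Sum>i. ennreal (rpos i / (d + r i) powr p)) <= ennreal (2 / (1 - l) * d powr (- \<theta> * p))"
  proof (rule suminf_le_const[OF summableI])
    fix n
    have "(\<Sum>i<n. ennreal (r i powr a / (d + r i) powr p)) = ennreal (\<Sum>i<n. r i powr a / (d + r i) powr p)"
      by (rule sum_ennreal) auto
    also have "... <= ennreal (2 / (1 - l) * d powr (- b))" by (rule ennreal_leI[OF fin])
    finally show "(\<Sum>i<n. ennreal (rpos i / (d + r i) powr p)) <= ennreal (2 / (1 - l) * d powr (- \<theta> * p))"
      by (simp add: a_def b_def)
  qed
qed

definition edge_energy :: "((nat => 'z \<times> nat => real) set => ennreal) => 'z \<times> nat => 'z \<times> nat => ennreal" where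
  "edge_energy h v w = (\<integral>\<^sup>+t\<in>{0..1}. ennreal_powr (h (edge v w t)) p \<partial>lborel)"

lemma edge_sum_le:
  assumes "f \<in> borel_measurable (metric_borel Y)"
  shows "(\<Sum>i. \<Sum>z\<in>A i. \<Sum>w\<in>nb z i. wt (z, i) * (\<integral>\<^sup>+t\<in>{0..1}. f (edge (z, i) w t) \<partial>lborel)) <= (\<integral>\<^sup>+x. f x \<partial>\<mu>)"
  unfolding nn_integral_\<mu>[OF assms] edge_int_levels
  by (intro suminf_le sum_mono mult_right_mono) auto

lemma edge_energy_sum_le:
  assumes "h \<in> borel_measurable (metric_borel Y)"
  shows "(\<Sum>i. \<Sum>z\<in>A i. \<Sum>w\<in>nb z i. wt (z, i) * edge_energy h (z, i) w) <= (\<integral>\<^sup>+x. ennreal_powr (h x) p \<partial>\<mu>)"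
  unfolding edge_energy_def by (rule edge_sum_le[OF measurable_ennreal_powr[OF assms]])

text \<open>The weak upper gradient inequality on the segment from the vertex to the point, followed by the power mean
  inequality; the segment has length at most \<open>2 r\<^sub>i\<close>.\<close>
lemma edge_oscillation:
  assumes h: "weak_upper_gradient Y \<mu> p u h" and n: "N (z, i) w" and t: "t \<in> {0..1}"
  shows "abs_p (u (edge (z, i) w t) - u (vert (z, i))) <= ennreal ((4 * r i) powr p) * edge_energy h (z, i) w"
proof (cases "t = 0")
  case False
  have hm: "h \<in> borel_measurable (metric_borel Y)" using h by (simp add: weak_upper_gradient_def)
  have t: "0 < t" "t <= 1" using t False by auto
  let ?I = "\<integral>\<^sup>+q\<in>{0..1}. h (edge (z, i) w q) \<partial>lborel"
  have "ennreal \<bar>u (edge (z, i) w t) - u (edge (z, i) w 0)\<bar> \<le>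
     (\<integral>\<^sup>+q\<in>{0..t}. h (edge (z, i) w q) * ennreal (\<rho> (edge_point (z, i) w q)) \<partial>lborel)"
    using t by (intro weak_upper_gradient_edge[OF p h n]) auto
  also have "... <= (\<integral>\<^sup>+q. ennreal (2 * r i) * (h (edge (z, i) w q) * indicator {0..1} q) \<partial>lborel)"
  proof (rule nn_integral_mono)
    fix q
    show "h (edge (z, i) w q) * ennreal (\<rho> (edge_point (z, i) w q)) * indicator {0..t} q <= ennreal (2 * r i) * (h (edge (z, i) w q) * indicator {0..1} q)"
    proof (cases "q \<in> {0..t}")
      case True
      then have q: "q \<in> {0..1}" using t by auto
      have "h (edge (z, i) w q) * ennreal (\<rho> (edge_point (z, i) w q)) <= h (edge (z, i) w q) * ennreal (2 * r i)"
        using weight_bounds(2)[OF n q] by (intro mult_left_mono ennreal_leI) auto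
      then show ?thesis using True q by (simp add: mult.commute)
    qed simp
  qed
  also have "... = ennreal (2 * r i) * ?I"
    using edge_measurable[OF n hm] by (intro nn_integral_cmult) simp
  finally have "ennreal_powr (ennreal \<bar>u (edge (z, i) w t) - u (vert (z, i))\<bar>) p <= ennreal_powr (ennreal (2 * r i) * ?I) p"
    using p by (intro ennreal_powr_mono) auto
  also have "... = ennreal ((2 * r i) powr p) * ennreal_powr ?I p" using p by (intro ennreal_powr_mult) auto
  also have "... <= ennreal ((2 * r i) powr p) * (ennreal (2 powr p) * edge_energy h (z, i) w)"
    unfolding edge_energy_def using edge_measurable[OF n hm] p by (intro mult_left_mono unit_interval_powr_le) auto
  also have "... = ennreal ((4 * r i) powr p) * edge_energy h (z, i) w"
    unfolding mult.assoc[symmetric] ennreal_mult[OF powr_ge_zero powr_ge_zero, symmetric] powr_mult[symmetric]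
    by (simp add: mult.commute)
  finally show ?thesis by (simp add: ennreal_powr_ennreal)
qed (use p in simp)

lemma VE_le_energy:
  assumes h: "weak_upper_gradient Y \<mu> p u h"
  shows "vertex_energy (%v. u (vert v)) <= ennreal (4 powr p) * (\<integral>\<^sup>+x. ennreal_powr (h x) p \<partial>\<mu>)"
proof -
  have hm: "h \<in> borel_measurable (metric_borel Y)" using h by (simp add: weak_upper_gradient_def)
  have "vertex_energy (%v. u (vert v)) <= (\<Sum>i. \<Sum>z\<in>A i. \<Sum>w\<in>nb z i. ennreal (4 powr p) * (wt (z, i) * edge_energy h (z, i) w))"
    unfolding vertex_energy_def
  proof (intro suminf_le sum_mono)
    fix i z w assume "w \<in> nb z i"
    then have n: "N (z, i) w" by (simp add: nb_def)
    have "ennreal (rneg i * mm z i * \<bar>u (vert (z, i)) - u (vert w)\<bar> powr p) =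
      ennreal (rneg i * mm z i) * abs_p (u (edge (z, i) w 1) - u (vert (z, i)))"
      by (simp add: ennreal_mult abs_minus_commute)
    also have "... <= ennreal (rneg i * mm z i) * (ennreal ((4 * r i) powr p) * edge_energy h (z, i) w)"
      by (intro mult_left_mono edge_oscillation[OF h n]) auto
    also have "... = ennreal (4 powr p) * (wt (z, i) * edge_energy h (z, i) w)"
    proof -
      have "rneg i * r i powr p = rpos i"
        unfolding powr_add[symmetric] by (simp add: algebra_simps)
      then have "rneg i * mm z i * (4 * r i) powr p = 4 powr p * (rpos i * mm z i)"
        unfolding powr_mult by (simp add: mult_ac)
      then have "ennreal (rneg i * mm z i) * ennreal ((4 * r i) powr p) = ennreal (4 powr p) * ennreal (rpos i * mm z i)"
        by (simp only: ennreal_mult[symmetric] mult_nonneg_nonneg powr_ge_zero mm_pos(2))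
      then show ?thesis unfolding wt_real by (simp only: mult.assoc[symmetric])
    qed
    finally show "ennreal (rneg i * mm z i * \<bar>u (vert (z, i)) - u (vert w)\<bar> powr p) <= ennreal (4 powr p) * (wt (z, i) * edge_energy h (z, i) w)" .
  qed auto
  also have "... = ennreal (4 powr p) * (\<Sum>i. \<Sum>z\<in>A i. \<Sum>w\<in>nb z i. wt (z, i) * edge_energy h (z, i) w)"
    by (simp only: sum_distrib_left[symmetric] ennreal_suminf_cmult)
  also have "... <= ennreal (4 powr p) * (\<integral>\<^sup>+x. ennreal_powr (h x) p \<partial>\<mu>)"
    by (intro mult_left_mono edge_energy_sum_le[OF hm]) auto
  finally show ?thesis .
qed

text \<open>A Lipschitz function on the filling determines its boundary values along the chains of vertices
  that descend to a boundary point, which gives a telescoping sum.\<close>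
lemma trace_tail:
  assumes L: "0 <= L" "!!F G. F \<in> mspace Y ==> G \<in> mspace Y ==> \<bar>u F - u G\<bar> <= L * mdist Y F G"
    and z: "z \<in> A i" "dist z x < r i"
  shows "ennreal \<bar>u (bdry x) - u (vert (z, i))\<bar> <= Sl (%v. u (vert v)) i x"
proof -
  define \<zeta> where "\<zeta> = (%j. if j = i then z else near j x)"
  have c: "chain x \<zeta>" using z near by (simp add: chain_def \<zeta>_def)
  let ?U = "%v. u (vert v)"
  have step: "ennreal \<bar>?U (\<zeta> j, j) - ?U (\<zeta> (Suc j), Suc j)\<bar> <= Dl ?U j x" for j
  proof -
    have a: "\<zeta> j \<in> A j" "x \<in> ball (\<zeta> j) (r j)" using c by (auto simp: chain_def)
    have "(\<zeta> (Suc j), Suc j) \<in> nb (\<zeta> j) j" using chain_step[OF c] by (simp add: nb_def)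
    then have "ennreal \<bar>?U (\<zeta> j, j) - ?U (\<zeta> (Suc j), Suc j)\<bar> <= (\<Sum>w\<in>nb (\<zeta> j) j. ennreal \<bar>?U (\<zeta> j, j) - ?U w\<bar>)"
      by (intro member_le_sum[of _ _ "%w. ennreal \<bar>?U (\<zeta> j, j) - ?U w\<bar>"]) auto
    also have "... = indicator (ball (\<zeta> j) (r j)) x * (\<Sum>w\<in>nb (\<zeta> j) j. ennreal \<bar>?U (\<zeta> j, j) - ?U w\<bar>)"
      using a by simp
    also have "... <= Dl ?U j x" unfolding Dl_def
      using a by (intro member_le_sum[of _ _ "%a. indicator (ball a (r j)) x * (\<Sum>w\<in>nb a j. ennreal \<bar>?U (a, j) - ?U w\<bar>)"]) auto
    finally show ?thesis .
  qed
  have part: "ennreal \<bar>?U (\<zeta> (i + n), i + n) - ?U (\<zeta> i, i)\<bar> <= (\<Sum>k<n. Dl ?U (i + k) x)" for n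
  proof (induction n)
    case (Suc n)
    have "ennreal \<bar>?U (\<zeta> (i + Suc n), i + Suc n) - ?U (\<zeta> i, i)\<bar> \<le>
      ennreal \<bar>?U (\<zeta> (i + n), i + n) - ?U (\<zeta> i, i)\<bar> + ennreal \<bar>?U (\<zeta> (i + n), i + n) - ?U (\<zeta> (Suc (i + n)), Suc (i + n))\<bar>"
      by (simp add: ennreal_plus[symmetric] del: ennreal_plus)
    also have "... <= (\<Sum>k<n. Dl ?U (i + k) x) + Dl ?U (i + n) x" using Suc step[of "i + n"] by (rule add_mono)
    finally show ?case by simp
  qed simp
  have all: "ennreal \<bar>?U (\<zeta> (i + n), i + n) - ?U (\<zeta> i, i)\<bar> <= Sl ?U i x" for n
    using part[of n] sum_le_suminf[OF summableI, of "{..<n}" "%k. Dl ?U (i + k) x"] unfolding Sl_def by force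
  have vin: "vert (\<zeta> j, j) \<in> mspace Y" for j using c by (auto simp: chain_def intro!: vert_in)
  have "(%n. \<bar>?U (\<zeta> n, n) - ?U (\<zeta> i, i)\<bar>) \<longlonglongrightarrow> \<bar>u (bdry x) - ?U (\<zeta> i, i)\<bar>"
  proof (intro tendsto_intros)
    have "(%n. mdist Y (vert (\<zeta> n, n)) (bdry x)) \<longlonglongrightarrow> 0"
    proof (rule LIMSEQ_I)
      fix e :: real assume "0 < e"
      then obtain m where "\<forall>n\<ge>m. vert (\<zeta> n, n) \<in> mspace Y & mdist Y (vert (\<zeta> n, n)) (bdry x) < e"
        using bdry_limit[OF c] unfolding YM.limit_metric_sequentially by blast
      then show "\<exists>no. \<forall>n\<ge>no. norm (mdist Y (vert (\<zeta> n, n)) (bdry x) - 0) < e"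
        by (intro exI[of _ m]) simp
    qed
    then have "(%n. L * mdist Y (vert (\<zeta> n, n)) (bdry x)) \<longlonglongrightarrow> 0" by (rule tendsto_mult_right_zero)
    then have "(%n. u (vert (\<zeta> n, n)) - u (bdry x)) \<longlonglongrightarrow> 0"
      by (rule Lim_null_comparison[rotated]) (use L(2)[OF vin bdry_in] in \<open>auto intro!: always_eventually\<close>)
    then show "(%n. ?U (\<zeta> n, n)) \<longlonglongrightarrow> u (bdry x)" by (rule LIM_zero_cancel)
  qed
  then have "(%n. \<bar>?U (\<zeta> (i + n), i + n) - ?U (\<zeta> i, i)\<bar>) \<longlonglongrightarrow> \<bar>u (bdry x) - ?U (\<zeta> i, i)\<bar>"
    using LIMSEQ_ignore_initial_segment[of _ _ i] by (simp add: add.commute)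
  then have "(%n. ennreal \<bar>?U (\<zeta> (i + n), i + n) - ?U (\<zeta> i, i)\<bar>) \<longlonglongrightarrow> ennreal \<bar>u (bdry x) - ?U (\<zeta> i, i)\<bar>"
    by (rule tendsto_ennrealI)
  then have "ennreal \<bar>u (bdry x) - ?U (\<zeta> i, i)\<bar> <= Sl ?U i x" by (rule LIMSEQ_le_const2) (use all in blast)
  then show ?thesis by (simp add: \<zeta>_def)
qed

abbreviation "level_wt E i x \<equiv> ennreal (rpos i / (infdist x E + r i) powr p)"

lemma overlap_sum_le:
  fixes X :: ennreal assumes s: "s <= 4 * r i"
  shows "(\<Sum>a\<in>A i. indicator (ball a s) x * X) <= ennreal (real Mo) * X"
proof -
  have "(\<Sum>a\<in>A i. indicator (ball a s) x * X) = (\<Sum>a\<in>A i. indicator (ball a s) x) * X"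
    by (simp add: sum_distrib_right)
  also have "(\<Sum>a\<in>A i. indicator (ball a s) x :: ennreal) = of_nat (card {a \<in> A i. dist a x < s})"
    by (simp add: indicator_def Int_def)
  also have "... * X <= of_nat Mo * X"
  proof (intro mult_right_mono of_nat_mono order_trans[OF _ overlap[of i x]])
    have "dist a x < 4 * r i" if "dist a x < s" for a using that s by linarith
    then show "card {a \<in> A i. dist a x < s} <= card {a \<in> A i. dist a x < 4 * r i}"
      by (intro card_mono) auto
  qed auto
  finally show ?thesis by (simp add: ennreal_of_nat_eq_real_of_nat)
qed

lemma r_le_4r: "r i <= 4 * r i" "2 * r i <= 4 * r i"
  using r_pos(1)[of i] by linarith+

lemma edge_weight_le: "N (z, i) w ==> wt (z, i) + wt w <= ennreal (1 + 2 powr (p * (1 - \<theta>)) * K) * wt (z, i)"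
proof -
  assume n: "N (z, i) w"
  have "wt (z, i) + wt w <= 1 * wt (z, i) + ennreal (2 powr (p * (1 - \<theta>)) * K) * wt (z, i)" using wt_neighbor[OF n] by (simp add: add_left_mono)
  also have "... = ennreal (1 + 2 powr (p * (1 - \<theta>)) * K) * wt (z, i)" using K_ge_1 by (subst ennreal_plus) (auto simp: distrib_right)
  finally show ?thesis .
qed

definition besov_energy :: "('z => real) => ennreal" where
  "besov_energy u = (\<integral>\<^sup>+x. (\<integral>\<^sup>+y. abs_p (u x - u y) /
     (ennreal (dist x y powr (\<theta> * p)) * emeasure \<nu> (ball x (dist x y))) \<partial>\<nu>) \<partial>\<nu>)"

text \<open>The singular kernel is dominated by a sum over the vertices, which separates the variables;
  this takes the place of the theorem of Fubini on \<open>Z \<times> Z\<close>.\<close>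
lemma besov_energy_le_tails:
  obtains C where "0 <= C" "!!u L. 0 <= L ==> (!!F G. F \<in> mspace Y ==> G \<in> mspace Y ==> \<bar>u F - u G\<bar> <= L * mdist Y F G) ==>
    besov_energy (%x. u (bdry x)) <= ennreal C * tail_energy (%v. u (vert v))"
proof
  define C0 where "C0 = 2 powr (\<theta> * p) * K * (2 powr p * 2 powr p)"
  have C0: "0 <= C0" using K_ge_1 by (simp add: C0_def)
  show "0 <= C0 * ((K + 1) * real Mo)" using C0 K_ge_1 by simp
  fix u :: "(nat => 'z \<times> nat => real) set => real" and L :: real
  assume L: "0 <= L" "!!F G. F \<in> mspace Y ==> G \<in> mspace Y ==> \<bar>u F - u G\<bar> <= L * mdist Y F G"
  let ?U = "%v. u (vert v)" and ?u = "%x. u (bdry x)"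
  define T where "T = (%i x. ennreal_powr (Sl ?U i x) p)"
  have Tm [measurable]: "T i \<in> borel_measurable \<nu>" for i unfolding T_def by measurable
  define c where "c = (%i a. ennreal (rneg i / mm a i))"
  define k where "k = (%i a x y. c i a * (indicator (ball a (r i)) x * (indicator (ball a (2 * r i)) y * (T i x + T i y))))"
  have pw: "abs_p (?u x - ?u y) / (ennreal (dist x y powr (\<theta> * p)) * emeasure \<nu> (ball x (dist x y)))
     <= ennreal C0 * (\<Sum>i. \<Sum>a\<in>A i. k i a x y)" for x y
  proof (cases "x = y")
    case False
    define d where "d = dist x y"
    have d: "0 < d" "d < 1" using False dist_less_1 by (auto simp: d_def)
    obtain i where i: "r (Suc i) <= d" "d < r i" using level_exists[OF d] by blast
    have rd: "r i <= 2 * d" using r_le_Suc[of i] i by linarith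
    let ?a = "near i x" and ?b = "near i y"
    have ab: "?a \<in> A i" "?b \<in> A i" "dist ?a x < r i" "dist ?b y < r i" using near by auto
    have ay: "dist ?a y < 2 * r i" using dist_triangle[of ?a y x] ab i by (simp add: d_def)
    have "ennreal \<bar>?U (?a, i) - ?U (?b, i)\<bar> <= Sl ?U i x"
    proof (cases "?a = ?b")
      case False
      have n: "(?b, i) \<in> nb ?a i"
      proof -
        have "dist ?b y < 2 * r i" using ab(4) r_pos(1)[of i] by linarith
        then show ?thesis unfolding nb_def using same_level_neighbors[OF ab(1,2) ay _ False] by simp
      qed
      have "ennreal \<bar>?U (?a, i) - ?U (?b, i)\<bar> <= (\<Sum>w\<in>nb ?a i. ennreal \<bar>?U (?a, i) - ?U w\<bar>)"
        using n by (intro member_le_sum[of _ _ "%w. ennreal \<bar>?U (?a, i) - ?U w\<bar>"]) auto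
      also have "... = indicator (ball ?a (r i)) x * (\<Sum>w\<in>nb ?a i. ennreal \<bar>?U (?a, i) - ?U w\<bar>)" using ab by simp
      also have "... <= Dl ?U i x" unfolding Dl_def
        using ab by (intro member_le_sum[of _ _ "%a. indicator (ball a (r i)) x * (\<Sum>w\<in>nb a i. ennreal \<bar>?U (a, i) - ?U w\<bar>)"]) auto
      also have "... <= Sl ?U i x" unfolding Sl_def using term_le_suminf[of "%k. Dl ?U (i + k) x" 0] by simp
      finally show ?thesis .
    qed simp
    note s1 = this
    have s2: "ennreal \<bar>?u x - ?U (?a, i)\<bar> <= Sl ?U i x" by (rule trace_tail[OF L ab(1,3)])
    have s3: "ennreal \<bar>?u y - ?U (?b, i)\<bar> <= Sl ?U i y" by (rule trace_tail[OF L ab(2,4)])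
    have s4: "ennreal \<bar>?u x - ?u y\<bar> <= ennreal \<bar>?u x - ?U (?a, i)\<bar> + ennreal \<bar>?U (?a, i) - ?U (?b, i)\<bar> + ennreal \<bar>?u y - ?U (?b, i)\<bar>"
      by (simp add: ennreal_plus[symmetric] del: ennreal_plus)
    have "ennreal \<bar>?u x - ?u y\<bar> <= Sl ?U i x + Sl ?U i x + Sl ?U i y"
      by (rule order_trans[OF s4 add_mono[OF add_mono[OF s2 s1] s3]])
    also have "... <= Sl ?U i x + Sl ?U i x + (Sl ?U i y + Sl ?U i y)" by (intro add_left_mono) (simp add: add_increasing)
    also have "... = ennreal 2 * (Sl ?U i x + Sl ?U i y)" by (simp only: ennreal_numeral mult_2 ac_simps)
    finally have "ennreal_powr (ennreal \<bar>?u x - ?u y\<bar>) p <= ennreal_powr (ennreal 2 * (Sl ?U i x + Sl ?U i y)) p"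
      using p by (intro ennreal_powr_mono) auto
    also have "... = ennreal (2 powr p) * ennreal_powr (Sl ?U i x + Sl ?U i y) p" using p by (intro ennreal_powr_mult) auto
    also have "... <= ennreal (2 powr p) * (ennreal (2 powr p) * (T i x + T i y))"
      unfolding T_def using p by (intro mult_left_mono ennreal_powr_add_le) auto
    finally have num: "abs_p (?u x - ?u y) <= ennreal (2 powr p * 2 powr p) * (T i x + T i y)"
      by (simp add: ennreal_powr_ennreal ennreal_mult mult.assoc)
    define q0 where "q0 = r i powr (\<theta> * p) * mm ?a i / (2 powr (\<theta> * p) * K)"
    have q0: "0 < q0" using K_ge_1 by (simp add: q0_def)
    have "q0 <= d powr (\<theta> * p) * vol x d"
    proof -
      have "dist ?a x + r i <= 64 * d" using ab(3) rd d(1) by linarith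
      then have "mm ?a i <= K * vol x d" by (rule vol_compare[OF r_pos(1) d(1)])
      moreover have "r i powr (\<theta> * p) <= (2 * d) powr (\<theta> * p)" using rd p \<theta> by (intro powr_mono2) auto
      ultimately have "r i powr (\<theta> * p) * mm ?a i <= (2 * d) powr (\<theta> * p) * (K * vol x d)" by (intro mult_mono) auto
      then show ?thesis using K_ge_1 unfolding q0_def powr_mult by (simp add: field_simps)
    qed
    have "abs_p (?u x - ?u y) / (ennreal (d powr (\<theta> * p)) * emeasure \<nu> (ball x d)) =
      abs_p (?u x - ?u y) / ennreal (d powr (\<theta> * p) * vol x d)"
      using d by (simp add: emeasure_ball ennreal_mult vol_pos less_imp_le)
    also have "... <= ennreal (1 / q0) * abs_p (?u x - ?u y)" by (rule ennreal_divide_le) fact+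
    also have "... <= ennreal (1 / q0) * (ennreal (2 powr p * 2 powr p) * (T i x + T i y))" using num by (intro mult_left_mono) auto
    also have "... = ennreal C0 * (c i ?a * (T i x + T i y))"
    proof -
      have "1 / q0 * (2 powr p * 2 powr p) = C0 * (rneg i / mm ?a i)"
        using K_ge_1 by (simp add: q0_def C0_def powr_minus field_simps)
      then have "ennreal (1 / q0) * ennreal (2 powr p * 2 powr p) = ennreal C0 * c i ?a"
        unfolding c_def using q0 C0 by (simp add: ennreal_mult[symmetric])
      then show ?thesis by (simp only: mult.assoc[symmetric])
    qed
    also have "c i ?a * (T i x + T i y) = k i ?a x y" using ab ay by (simp add: k_def)
    also have "k i ?a x y <= (\<Sum>a\<in>A i. k i a x y)"
      using ab by (intro member_le_sum[of _ _ "%a. k i a x y"]) auto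
    also have "... <= (\<Sum>i. \<Sum>a\<in>A i. k i a x y)" by (rule term_le_suminf[of "%i. \<Sum>a\<in>A i. k i a x y"])
    finally show ?thesis by (simp add: d_def mult_left_mono)
  qed (use p in simp)
  have inner: "(\<integral>\<^sup>+y. k i a x y \<partial>\<nu>) = c i a * (indicator (ball a (r i)) x *
      (T i x * ennreal (vol a (2 * r i)) + (\<integral>\<^sup>+x. indicator (ball a (2 * r i)) x * T i x \<partial>\<nu>)))" for i a x
  proof -
    have "(\<integral>\<^sup>+y. indicator (ball a (2 * r i)) y * (T i x + T i y) \<partial>\<nu>) =
      (\<integral>\<^sup>+y. T i x * indicator (ball a (2 * r i)) y + indicator (ball a (2 * r i)) y * T i y \<partial>\<nu>)"
      by (intro nn_integral_cong) (simp add: indicator_def)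
    also have "... = T i x * ennreal (vol a (2 * r i)) + (\<integral>\<^sup>+x. indicator (ball a (2 * r i)) x * T i x \<partial>\<nu>)"
      by (subst nn_integral_add) (auto simp: nn_integral_cmult_indicator emeasure_ball)
    finally have e: "(\<integral>\<^sup>+y. indicator (ball a (2 * r i)) y * (T i x + T i y) \<partial>\<nu>) = ..." .
    have m: "(%y. indicator (ball a (2 * r i)) y * (T i x + T i y)) \<in> borel_measurable \<nu>" by measurable
    show ?thesis unfolding k_def e[symmetric]
      by (subst nn_integral_cmult, use m in measurable) (subst nn_integral_cmult[OF m], rule refl)
  qed
  have Tx: "(\<integral>\<^sup>+x. (\<integral>\<^sup>+y. k i a x y \<partial>\<nu>) \<partial>\<nu>) <= ennreal (K + 1) * (ennreal (rneg i) * (\<integral>\<^sup>+x. indicator (ball a (2 * r i)) x * T i x \<partial>\<nu>))" for i a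
  proof -
    let ?J = "\<integral>\<^sup>+x. indicator (ball a (2 * r i)) x * T i x \<partial>\<nu>"

    have "(\<integral>\<^sup>+x. (\<integral>\<^sup>+y. k i a x y \<partial>\<nu>) \<partial>\<nu>) = c i a * (\<integral>\<^sup>+x. indicator (ball a (r i)) x * T i x * ennreal (vol a (2 * r i)) + ?J * indicator (ball a (r i)) x \<partial>\<nu>)"
      unfolding inner by (subst nn_integral_cmult[symmetric]) (auto simp: distrib_left mult_ac)
    also have "... = c i a * ((\<integral>\<^sup>+x. indicator (ball a (r i)) x * T i x \<partial>\<nu>) * ennreal (vol a (2 * r i)) + ?J * ennreal (mm a i))"
      by (subst nn_integral_add) (auto simp: nn_integral_cmult_indicator nn_integral_multc emeasure_ball)
    also have "... <= c i a * (?J * ennreal (K * mm a i) + ?J * ennreal (mm a i))"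
    proof (intro mult_left_mono add_right_mono mult_mono)
      show "(\<integral>\<^sup>+x. indicator (ball a (r i)) x * T i x \<partial>\<nu>) <= ?J"
      proof -
        have "dist a x < 2 * r i" if "dist a x < r i" for x using that r_pos(1)[of i] by linarith
        then show ?thesis by (intro nn_integral_mono mult_right_mono) (auto simp: indicator_def)
      qed
      show "ennreal (vol a (2 * r i)) <= ennreal (K * mm a i)" using r_pos(1)[of i] by (intro ennreal_leI vol_compare) auto
    qed auto
    also have "... = (c i a * ennreal ((K + 1) * mm a i)) * ?J"
      using K_ge_1 by (simp add: distrib_right ennreal_plus distrib_left mult_ac)
    also have "c i a * ennreal ((K + 1) * mm a i) = ennreal (K + 1) * ennreal (rneg i)"
    proof -
      have "rneg i / mm a i * ((K + 1) * mm a i) = (K + 1) * rneg i"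
      proof -
        have "mm a i ~= 0" using mm_pos[of a i] by linarith
        then show ?thesis by (simp add: field_simps)
      qed
      then show ?thesis
        unfolding c_def using K_ge_1 by (subst (1 2) ennreal_mult[symmetric]) (auto simp del: ennreal_plus)
    qed
    finally show ?thesis by (simp add: mult.assoc)
  qed
  have km: "(%y. k i a x y) \<in> borel_measurable \<nu>" "(%x. \<integral>\<^sup>+y. k i a x y \<partial>\<nu>) \<in> borel_measurable \<nu>" for i a x
  proof -
    show "(%y. k i a x y) \<in> borel_measurable \<nu>" unfolding k_def by measurable
    show "(%x. \<integral>\<^sup>+y. k i a x y \<partial>\<nu>) \<in> borel_measurable \<nu>" unfolding inner by measurable
  qed
  have "besov_energy ?u <= (\<integral>\<^sup>+x. (\<integral>\<^sup>+y. ennreal C0 * (\<Sum>i. \<Sum>a\<in>A i. k i a x y) \<partial>\<nu>) \<partial>\<nu>)"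
    unfolding besov_energy_def by (intro nn_integral_mono pw)
  also have "... = (\<integral>\<^sup>+x. ennreal C0 * (\<Sum>i. \<Sum>a\<in>A i. (\<integral>\<^sup>+y. k i a x y \<partial>\<nu>)) \<partial>\<nu>)"
    using km(1) by (simp add: nn_integral_cmult nn_integral_suminf nn_integral_sum)
  also have "... = ennreal C0 * (\<Sum>i. \<Sum>a\<in>A i. (\<integral>\<^sup>+x. (\<integral>\<^sup>+y. k i a x y \<partial>\<nu>) \<partial>\<nu>))"
    using km(2) by (simp add: nn_integral_cmult nn_integral_suminf nn_integral_sum)
  also have "... <= ennreal C0 * (\<Sum>i. \<Sum>a\<in>A i. ennreal (K + 1) * (ennreal (rneg i) * (\<integral>\<^sup>+x. indicator (ball a (2 * r i)) x * T i x \<partial>\<nu>)))"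
    by (intro mult_left_mono suminf_le sum_mono Tx) auto
  also have "... = ennreal C0 * (\<Sum>i. ennreal (K + 1) * (ennreal (rneg i) * (\<integral>\<^sup>+x. (\<Sum>a\<in>A i. indicator (ball a (2 * r i)) x * T i x) \<partial>\<nu>)))"
  proof -
    have "(\<integral>\<^sup>+x. (\<Sum>a\<in>A i. indicator (ball a (2 * r i)) x * T i x) \<partial>\<nu>) = (\<Sum>a\<in>A i. \<integral>\<^sup>+x. indicator (ball a (2 * r i)) x * T i x \<partial>\<nu>)" for i
      by (rule nn_integral_sum) measurable
    then show ?thesis by (simp only: sum_distrib_left)
  qed
  also have "... <= ennreal C0 * (\<Sum>i. ennreal (K + 1) * (ennreal (rneg i) * (ennreal (real Mo) * (\<integral>\<^sup>+x. T i x \<partial>\<nu>))))"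
  proof (intro mult_left_mono suminf_le)
    fix i
    have "(\<integral>\<^sup>+x. (\<Sum>a\<in>A i. indicator (ball a (2 * r i)) x * T i x) \<partial>\<nu>) <= (\<integral>\<^sup>+x. ennreal (real Mo) * T i x \<partial>\<nu>)"
      by (intro nn_integral_mono overlap_sum_le r_le_4r)
    then show "(\<integral>\<^sup>+x. (\<Sum>a\<in>A i. indicator (ball a (2 * r i)) x * T i x) \<partial>\<nu>) <= ennreal (real Mo) * (\<integral>\<^sup>+x. T i x \<partial>\<nu>)"
      by (simp add: nn_integral_cmult)
  qed auto
  also have "... = ennreal (C0 * ((K + 1) * real Mo)) * (\<Sum>i. ennreal (rneg i) * (\<integral>\<^sup>+x. T i x \<partial>\<nu>))"
  proof -
    have "ennreal (K + 1) * (ennreal (rneg i) * (ennreal (real Mo) * X)) = (ennreal (K + 1) * ennreal (real Mo)) * (ennreal (rneg i) * X)" for i X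
      by (simp only: mult_ac)
    then show ?thesis using C0 K_ge_1 by (simp only: ennreal_suminf_cmult) (simp add: ennreal_mult mult.assoc)
  qed
  finally show "besov_energy ?u <= ennreal (C0 * ((K + 1) * real Mo)) * tail_energy ?U"
    unfolding T_def .
qed

lemma AE_open_edges: "AE x in \<mu>. x \<in> open_edges"
proof -
  let ?B = "space (metric_borel Y) - open_edges"
  have B: "?B \<in> sets (metric_borel Y)" by (intro sets.compl_sets openin_metric_borel open_edges_openin)
  have "edge_int (indicator ?B) = edge_int (%_. 0)"
    unfolding edge_int_def
  proof (intro nn_integral_cong)
    fix v w assume "w \<in> space (count_space {w. N v w})"
    then have n: "N v w" by simp
    have "(\<integral>\<^sup>+t\<in>{0..1}. indicator ?B (edge v w t) \<partial>lborel) = (\<integral>\<^sup>+t\<in>{0..1::real}. 0 \<partial>lborel)"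
    proof (rule nn_integral_cong_AE)
      have "AE t in lborel. t ~= (0::real)" "AE t in lborel. t ~= (1::real)" by (rule AE_lborel_singleton)+
      then show "AE t in lborel. indicator ?B (edge v w t) * indicator {0..1} t = (0 * indicator {0..1::real} t :: ennreal)"
      proof eventually_elim
        case (elim t)
        show ?case
        proof (cases "t \<in> {0..1}")
          case True
          then have "edge v w t \<in> open_edges" using edge_in_open_edges[OF n, of t] elim by simp
          then show ?thesis by simp
        qed simp
      qed
    qed
    then show "(wt v + wt w) * (\<integral>\<^sup>+t\<in>{0..1}. indicator ?B (edge v w t) \<partial>lborel) = (wt v + wt w) * (\<integral>\<^sup>+t\<in>{0..1::real}. 0 \<partial>lborel)" by (simp only:)
  qed
  then have "emeasure \<mu> ?B = 0" using emeasure_\<mu>[OF B] by (simp add: edge_int_def)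
  then have "?B \<in> null_sets \<mu>" using B by (auto simp: null_sets_def)
  then show ?thesis by (rule AE_I'[of ?B]) (auto simp: space_\<mu>)
qed

text \<open>The infimum may be over an uncountable set, so openness of sublevel sets is used.\<close>
lemma dist_to_set_measurable:
  assumes S: "S <= mspace Y" shows "(%x. dist_to_set Y x S) \<in> borel_measurable (metric_borel Y)"
proof (rule borel_measurableI_less)
  fix c :: ennreal
  have "openin YM.mtopology {x \<in> mspace Y. dist_to_set Y x S < c}"
    unfolding YM.openin_mtopology
  proof (intro conjI allI impI)
    fix x assume "x \<in> {x \<in> mspace Y. dist_to_set Y x S < c}"
    then obtain y where y: "y \<in> S" "ennreal (mdist Y x y) < c" and x: "x \<in> mspace Y" by (auto simp: dist_to_set_def INF_less_iff)
    obtain e where e: "ennreal (mdist Y x y) < ennreal e" "ennreal e <= c"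
      using y(2) by (metis ennreal_cases ennreal_less_top less_top order_less_imp_le dense order_refl)
    have e': "mdist Y x y < e" using e(1) by (simp add: ennreal_less_iff)
    have "z \<in> {x \<in> mspace Y. dist_to_set Y x S < c}" if z: "z \<in> YM.mball x (e - mdist Y x y)" for z
    proof -
      have zm: "z \<in> mspace Y" "mdist Y x z < e - mdist Y x y" using z by auto
      have "mdist Y z y <= mdist Y z x + mdist Y x y" using zm x y S by (intro YM.triangle) auto
      then have "mdist Y z y < e" using zm unfolding YM.commute[of z x] by linarith
      then have "ennreal (mdist Y z y) < c" using e(2) by (metis ennreal_less_iff less_le_trans mdist_nonneg)
      then have "dist_to_set Y z S < c" using y(1) unfolding dist_to_set_def INF_less_iff by blast
      then show ?thesis using zm by simp
    qed
    then show "\<exists>q>0. YM.mball x q <= {x \<in> mspace Y. dist_to_set Y x S < c}"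
      using e' by (intro exI[of _ "e - mdist Y x y"]) auto
  qed auto
  then show "{x \<in> space (metric_borel Y). dist_to_set Y x S < c} \<in> sets (metric_borel Y)"
    using openin_metric_borel by simp
qed

lemma lipschitz_measurable:
  assumes L: "0 <= L" "!!F G. F \<in> mspace Y ==> G \<in> mspace Y ==> \<bar>u F - u G\<bar> <= L * mdist Y F G"
  shows "u \<in> borel_measurable (metric_borel Y)"
  unfolding borel_measurable_iff_greater
proof
  fix a :: real
  have "openin YM.mtopology {x \<in> mspace Y. a < u x}"
    unfolding YM.openin_mtopology
  proof (intro conjI allI impI)
    fix x assume "x \<in> {x \<in> mspace Y. a < u x}"
    then have x: "x \<in> mspace Y" "a < u x" by auto
    define q where "q = (u x - a) / (L + 1)"
    have q: "0 < q" using x L by (simp add: q_def)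
    have "a < u y" if y: "y \<in> YM.mball x q" for y
    proof -
      have "\<bar>u x - u y\<bar> <= L * mdist Y x y" using y x by (intro L) auto
      also have "... <= L * q" using y L by (intro mult_left_mono) (auto intro: less_imp_le)
      also have "... < (L + 1) * q" using q by simp
      also have "... = u x - a" using L by (simp add: q_def)
      finally show ?thesis by linarith
    qed
    then show "\<exists>q>0. YM.mball x q <= {x \<in> mspace Y. a < u x}" using q by (intro exI[of _ q]) auto
  qed auto
  then show "{x \<in> space (metric_borel Y). a < u x} \<in> sets (metric_borel Y)" using openin_metric_borel by simp
qed

lemma dist_to_set_euclidean:
  assumes "S ~= {}" shows "dist_to_set euclidean_metric x S = ennreal (infdist x S)"
proof (rule antisym)
  show "ennreal (infdist x S) <= dist_to_set euclidean_metric x S"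
    unfolding dist_to_set_def by (intro INF_greatest) (simp add: infdist_le ennreal_leI)
  show "dist_to_set euclidean_metric x S <= ennreal (infdist x S)"
  proof (rule ennreal_le_epsilon)
    fix e :: real assume e: "0 < e"
    have "(INF y\<in>S. dist x y) < infdist x S + e" using assms e by (simp add: infdist_notempty)
    then obtain y where y: "y \<in> S" "dist x y < infdist x S + e"
      using assms by (subst (asm) cINF_less_iff) (auto intro: bdd_belowI[of _ 0])
    have "dist_to_set euclidean_metric x S <= ennreal (dist x y)" unfolding dist_to_set_def using y by (intro INF_lower2[of y]) auto
    also have "... <= ennreal (infdist x S + e)" using y by (intro ennreal_leI) auto
    also have "... = ennreal (infdist x S) + ennreal e" using e infdist_nonneg by (intro ennreal_plus) auto
    finally show "dist_to_set euclidean_metric x S <= ennreal (infdist x S) + ennreal e" .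
  qed
qed

lemma dist_to_set_edge_ge:
  assumes "N (z, i) w" "t \<in> {0..1}" "S ~= {}"
  shows "ennreal ((infdist z S + r i) / 110) <= dist_to_set Y (edge (z, i) w t) (bdry ` S)"
  unfolding dist_to_set_def
proof (intro INF_greatest, elim imageE)
  fix y e assume y: "y = bdry e" "e \<in> S"
  have "infdist z S + r i <= 110 * mdist Y (edge (z, i) w t) (bdry e)"
    using edge_bdry_dist_ge[OF assms(1,2), of e] infdist_le[OF y(2), of z] by linarith
  then show "ennreal ((infdist z S + r i) / 110) <= ennreal (mdist Y (edge (z, i) w t) y)"
    unfolding y by (intro ennreal_leI) (simp add: field_simps)
qed

lemma dist_to_set_edge_le:
  assumes "N (z, i) w" "t \<in> {0..1}" "S ~= {}"
  shows "dist_to_set Y (edge (z, i) w t) (bdry ` S) <= ennreal (88 * (infdist z S + r i))"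
proof -
  have "(INF y\<in>S. dist z y) < infdist z S + r i" using assms by (simp add: infdist_notempty)
  then obtain e where e: "e \<in> S" "dist z e < infdist z S + r i"
    using assms by (subst (asm) cINF_less_iff) (auto intro: bdd_belowI[of _ 0])
  have "dist_to_set Y (edge (z, i) w t) (bdry ` S) <= ennreal (mdist Y (edge (z, i) w t) (bdry e))"
    unfolding dist_to_set_def using e by (intro INF_lower) auto
  also have "... <= ennreal (88 * (infdist z S + r i))"
  proof (rule ennreal_leI)
    have "mdist Y (edge (z, i) w t) (bdry e) <= 44 * dist z e + 44 * r i" using edge_bdry_dist_le[OF assms(1,2), of e] by simp
    also have "... <= 88 * infdist z S + 88 * r i" using e(2) infdist_nonneg[of z S] by linarith
    finally show "mdist Y (edge (z, i) w t) (bdry e) <= 88 * (infdist z S + r i)" by simp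
  qed
  finally show ?thesis .
qed

lemma trace_continuous:
  assumes L: "0 <= L" "!!F G. F \<in> mspace Y ==> G \<in> mspace Y ==> \<bar>u F - u G\<bar> <= L * mdist Y F G"
  shows "\<bar>u (bdry x) - u (bdry y)\<bar> <= L * 44 * dist x y" "continuous_on UNIV (%x. u (bdry x))"
proof -
  show *: "\<bar>u (bdry x) - u (bdry y)\<bar> <= L * 44 * dist x y" for x y
  proof -
    have "\<bar>u (bdry x) - u (bdry y)\<bar> <= L * mdist Y (bdry x) (bdry y)" by (intro L(2) bdry_in)
    also have "... <= L * (44 * dist x y)" by (intro mult_left_mono bdry_lipschitz L(1))
    finally show ?thesis by simp
  qed
  show "continuous_on UNIV (%x. u (bdry x))"
    by (rule lipschitz_on_continuous_on[of "L * 44"], rule lipschitz_onI) (use * L(1) in \<open>auto simp: dist_real_def\<close>)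
qed

lemma continuous_measurable_\<nu>: "continuous_on UNIV f ==> f \<in> borel_measurable \<nu>"
  using borel_measurable_continuous_onI[of f] measurable_cong_sets[OF sets_\<nu> refl] by blast

lemma ennreal_divide_antimono: "a <= b ==> (x::ennreal) / b <= x / a"
proof -
  assume "a <= b"
  then have "inverse b <= inverse a"
    by (simp add: less_eq_ennreal.rep_eq inverse_ennreal.rep_eq ereal_inverse_antimono)
  then show ?thesis unfolding divide_ennreal_def by (rule mult_left_mono) simp
qed

text \<open>The value at the vertex is compared with the trace at all points of the ball \<open>B(z, r\<^sub>i)\<close>, whose volume is
  part of the weight of the vertex.\<close>
lemma vertex_value_le:
  assumes L: "0 <= L" "!!F G. F \<in> mspace Y ==> G \<in> mspace Y ==> \<bar>u F - u G\<bar> <= L * mdist Y F G"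
    and E: "E ~= {}" and z: "z \<in> A i"
  shows "wt (z, i) * ennreal (\<bar>u (vert (z, i))\<bar> powr p / (infdist z E + r i) powr p) \<le>
    ennreal (4 powr p) * (\<integral>\<^sup>+x. indicator (ball z (r i)) x * (abs_p (u (bdry x)) * level_wt E i x
      + ennreal (rneg i) * ennreal_powr (Sl (%v. u (vert v)) i x) p) \<partial>\<nu>)"
proof -
  let ?a = "p * (1 - \<theta>)" and ?U = "%v. u (vert v)"
  let ?G = "%x. abs_p (u (bdry x)) * ennreal (r i powr ?a / (infdist x E + r i) powr p) + ennreal (rneg i) * ennreal_powr (Sl ?U i x) p"
  have um [measurable]: "(%x. u (bdry x)) \<in> borel_measurable \<nu>" by (rule continuous_measurable_\<nu>[OF trace_continuous(2)[OF L]])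
  have dm [measurable]: "(%x. infdist x E) \<in> borel_measurable \<nu>" by (intro continuous_measurable_\<nu> continuous_intros)
  have "wt (z, i) * ennreal (\<bar>?U (z, i)\<bar> powr p / (infdist z E + r i) powr p) =
    (\<integral>\<^sup>+x. ennreal (r i powr ?a * (\<bar>?U (z, i)\<bar> powr p / (infdist z E + r i) powr p)) * indicator (ball z (r i)) x \<partial>\<nu>)"
    by (subst nn_integral_cmult_indicator) (auto simp: wt_real emeasure_ball ennreal_mult[symmetric] mult_ac)
  also have "... <= (\<integral>\<^sup>+x. ennreal (4 powr p) * (indicator (ball z (r i)) x * ?G x) \<partial>\<nu>)"
  proof (rule nn_integral_mono)
    fix x
    show "ennreal (r i powr ?a * (\<bar>?U (z, i)\<bar> powr p / (infdist z E + r i) powr p)) * indicator (ball z (r i)) x <= ennreal (4 powr p) * (indicator (ball z (r i)) x * ?G x)"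
    proof (cases "x \<in> ball z (r i)")
      case True
      then have zx: "dist z x < r i" by simp
      define c where "c = r i powr ?a / (infdist x E + r i) powr p"
      have c: "0 <= c" by (simp add: c_def)
      have dpos: "0 < infdist x E + r i" "0 < infdist z E + r i"
        using infdist_nonneg[of x E] infdist_nonneg[of z E] r_pos(1)[of i] by linarith+
      have cr: "c <= rneg i"
      proof -
        have "c <= r i powr ?a / r i powr p" unfolding c_def
          using dpos infdist_nonneg[of x E] p by (intro divide_left_mono powr_mono2 mult_pos_pos) auto
        also have "... = rneg i" unfolding powr_diff[symmetric] by (simp add: algebra_simps)
        finally show ?thesis .
      qed
      have "infdist x E <= infdist z E + dist x z" by (rule infdist_triangle)
      then have "infdist x E + r i <= 2 * infdist z E + 2 * r i" using zx infdist_nonneg[of z E] unfolding dist_commute[of x z] by linarith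
      then have "infdist x E + r i <= 2 * (infdist z E + r i)" by simp
      then have "(infdist x E + r i) powr p <= (2 * (infdist z E + r i)) powr p" using dpos p by (intro powr_mono2) auto
      then have "(infdist x E + r i) powr p <= 2 powr p * (infdist z E + r i) powr p" by (simp only: powr_mult)
      then have "r i powr ?a / (infdist z E + r i) powr p <= 2 powr p * c"
        using dpos unfolding c_def by (simp add: field_simps)
      then have 1: "r i powr ?a * (\<bar>?U (z, i)\<bar> powr p / (infdist z E + r i) powr p) <= 2 powr p * c * \<bar>?U (z, i)\<bar> powr p"
        using mult_right_mono[of "r i powr ?a / (infdist z E + r i) powr p" "2 powr p * c" "\<bar>?U (z, i)\<bar> powr p"] by simp
      have "ennreal \<bar>?U (z, i)\<bar> <= ennreal \<bar>u (bdry x)\<bar> + ennreal \<bar>u (bdry x) - ?U (z, i)\<bar>"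
        by (simp add: ennreal_plus[symmetric] del: ennreal_plus)
      also have "... <= ennreal \<bar>u (bdry x)\<bar> + Sl ?U i x" by (intro add_left_mono trace_tail[OF L z zx])
      finally have "ennreal_powr (ennreal \<bar>?U (z, i)\<bar>) p <= ennreal_powr (ennreal \<bar>u (bdry x)\<bar> + Sl ?U i x) p"
        using p by (intro ennreal_powr_mono) auto
      also have "... <= ennreal (2 powr p) * (ennreal_powr (ennreal \<bar>u (bdry x)\<bar>) p + ennreal_powr (Sl ?U i x) p)"
        using p by (intro ennreal_powr_add_le) auto
      finally have 2: "abs_p (?U (z, i)) <= ennreal (2 powr p) * (abs_p (u (bdry x)) + ennreal_powr (Sl ?U i x) p)"
        by (simp add: ennreal_powr_ennreal)
      have "ennreal (r i powr ?a * (\<bar>?U (z, i)\<bar> powr p / (infdist z E + r i) powr p)) <= ennreal (2 powr p * c * \<bar>?U (z, i)\<bar> powr p)"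
        using 1 by (rule ennreal_leI)
      also have "... = ennreal (2 powr p * c) * abs_p (?U (z, i))" using c by (intro ennreal_mult) auto
      also have "... <= ennreal (2 powr p * c) * (ennreal (2 powr p) * (abs_p (u (bdry x)) + ennreal_powr (Sl ?U i x) p))"
        using 2 by (intro mult_left_mono) auto
      also have "... = ennreal (4 powr p) * (abs_p (u (bdry x)) * ennreal c + ennreal c * ennreal_powr (Sl ?U i x) p)"
      proof -
        have "(4::real) powr p = 2 powr p * 2 powr p" by (simp flip: powr_mult)
        then have "ennreal (2 powr p * c) * ennreal (2 powr p) = ennreal (4 powr p) * ennreal c"
          using c by (simp add: ennreal_mult[symmetric] mult_ac)
        then have "ennreal (2 powr p * c) * (ennreal (2 powr p) * X) = ennreal (4 powr p) * (ennreal c * X)" for X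
          by (simp only: mult.assoc[symmetric])
        then show ?thesis by (simp only: distrib_left mult.commute[of "abs_p (u (bdry x))"])
      qed
      also have "... <= ennreal (4 powr p) * ?G x"
        unfolding c_def[symmetric] using cr by (intro mult_left_mono add_left_mono mult_right_mono ennreal_leI) auto
      finally show ?thesis using True by simp
    qed simp
  qed
  also have "... = ennreal (4 powr p) * (\<integral>\<^sup>+x. indicator (ball z (r i)) x * ?G x \<partial>\<nu>)"
    using um dm by (intro nn_integral_cmult) measurable
  finally show ?thesis .
qed

text \<open>On an edge at \<open>(z, i)\<close> the quotient is comparable to \<open>|u|\<^sup>p/(d(z, E) + r\<^sub>i)\<^sup>p\<close>, and \<open>u\<close> differs from its value at the
  vertex by what the gradient permits. Summed over the levels, the weights \<open>r\<^sub>i\<^sup>p\<^sup>(\<^sup>1\<^sup>-\<^sup>\<theta>\<^sup>)/(d + r\<^sub>i)\<^sup>p\<close> give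
  \<open>d\<^sup>-\<^sup>\<theta>\<^sup>p\<close>, the weight of the fractional inequality.\<close>
lemma hardy_lhs_le:
  assumes E: "E ~= {}"
  obtains C where "0 <= C" "!!u h L. 0 <= L ==> (!!F G. F \<in> mspace Y ==> G \<in> mspace Y ==> \<bar>u F - u G\<bar> <= L * mdist Y F G) ==>
     weak_upper_gradient Y \<mu> p u h ==> (!!x. infdist x E = 0 ==> u (bdry x) = 0) ==>
     (\<integral>\<^sup>+x. abs_p (u x) / dist_p E x \<partial>\<mu>) \<le>
     ennreal C * (hardy_lhs E (%x. u (bdry x))
       + tail_energy (%v. u (vert v))
       + (\<integral>\<^sup>+x. ennreal_powr (h x) p \<partial>\<mu>))"
proof -
  obtain C1 where C1: "0 < C1" "!!d. 0 < d ==> (\<Sum>i. ennreal (rpos i / (d + r i) powr p)) <= ennreal (C1 * d powr (- \<theta> * p))"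
    using level_series by blast
  define K1 where "K1 = 1 + 2 powr (p * (1 - \<theta>)) * K"
  define c1 where "c1 = (2 powr p * 440 powr p :: real)"
  define M where "M = 3 * real Mo * (4 powr p * (real Mo * (C1 + 1)))"
  have K1: "0 <= K1" and c1: "0 <= c1" and M: "0 <= M" using K_ge_1 C1 by (auto simp: K1_def c1_def M_def)
  show ?thesis
  proof (rule that)
    show "0 <= K1 * c1 * (M + 1)" using K1 c1 M by simp
    fix u h L
    assume L: "0 <= L" "!!F G. F \<in> mspace Y ==> G \<in> mspace Y ==> \<bar>u F - u G\<bar> <= L * mdist Y F G"
      and h: "weak_upper_gradient Y \<mu> p u h" and u0: "!!x. infdist x E = 0 ==> u (bdry x) = 0"
    let ?U = "%v. u (vert v)" and ?f = "%x. abs_p (u x) / dist_p E x"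
    let ?H = "\<integral>\<^sup>+x. ennreal_powr (h x) p \<partial>\<mu>" and ?S = "tail_energy ?U"
    let ?R = "\<integral>\<^sup>+x. abs_p (u (bdry x)) * ennreal (infdist x E powr (- \<theta> * p)) \<partial>\<nu>"
    have hm: "h \<in> borel_measurable (metric_borel Y)" using h by (simp add: weak_upper_gradient_def)
    have um [measurable]: "(%x. u (bdry x)) \<in> borel_measurable \<nu>" by (rule continuous_measurable_\<nu>[OF trace_continuous(2)[OF L]])
    have dm [measurable]: "(%x. infdist x E) \<in> borel_measurable \<nu>" by (intro continuous_measurable_\<nu> continuous_intros)
    have bE: "bdry ` E <= mspace Y" using bdry_in by blast
    have fm: "?f \<in> borel_measurable (metric_borel Y)"
      using lipschitz_measurable[OF L] measurable_ennreal_powr[OF dist_to_set_measurable[OF bE], of p] by measurable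
    define q where "q = (%z i. \<bar>?U (z, i)\<bar> powr p / (infdist z E + r i) powr p)"
    have on_edge: "(\<integral>\<^sup>+t\<in>{0..1}. ?f (edge (z, i) w t) \<partial>lborel) <= ennreal c1 * (ennreal (q z i) + edge_energy h (z, i) w)" if n: "N (z, i) w" for z i w
    proof -
      define d where "d = infdist z E + r i"
      have d: "0 < d" "r i <= d" using infdist_nonneg[of z E] r_pos(1)[of i] unfolding d_def by linarith+
      have pt: "?f (edge (z, i) w t) <= ennreal c1 * (ennreal (q z i) + edge_energy h (z, i) w)" if t: "t \<in> {0..1}" for t
      proof -
        have "ennreal ((d / 110) powr p) <= dist_p E (edge (z, i) w t)"
          using ennreal_powr_mono[OF dist_to_set_edge_ge[OF n t E], of p] p d by (simp add: ennreal_powr_ennreal d_def)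
        then have "?f (edge (z, i) w t) <= abs_p (u (edge (z, i) w t)) / ennreal ((d / 110) powr p)"
          by (rule ennreal_divide_antimono)
        also have "... <= ennreal (1 / (d / 110) powr p) * abs_p (u (edge (z, i) w t))"
          using d by (intro ennreal_divide_le) auto
        also have "... <= ennreal (1 / (d / 110) powr p) * (ennreal (2 powr p) * (abs_p (?U (z, i)) + ennreal ((4 * r i) powr p) * edge_energy h (z, i) w))"
        proof (rule mult_left_mono)
          have "ennreal_powr (ennreal \<bar>u (edge (z, i) w t)\<bar>) p <= ennreal_powr (ennreal \<bar>?U (z, i)\<bar> + ennreal \<bar>u (edge (z, i) w t) - ?U (z, i)\<bar>) p"
            using p by (intro ennreal_powr_mono) (auto simp: ennreal_plus[symmetric] simp del: ennreal_plus)
          also have "... <= ennreal (2 powr p) * (ennreal_powr (ennreal \<bar>?U (z, i)\<bar>) p + ennreal_powr (ennreal \<bar>u (edge (z, i) w t) - ?U (z, i)\<bar>) p)"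
            using p by (intro ennreal_powr_add_le) auto
          also have "... <= ennreal (2 powr p) * (abs_p (?U (z, i)) + ennreal ((4 * r i) powr p) * edge_energy h (z, i) w)"
            using edge_oscillation[OF h n t] by (intro mult_left_mono add_mono) (auto simp: ennreal_powr_ennreal)
          finally show "abs_p (u (edge (z, i) w t)) <= ennreal (2 powr p) * (abs_p (?U (z, i)) + ennreal ((4 * r i) powr p) * edge_energy h (z, i) w)"
            by (simp add: ennreal_powr_ennreal)
        qed simp
        also have "... = ennreal (2 powr p) * (ennreal (1 / (d / 110) powr p) * abs_p (?U (z, i)) + ennreal (1 / (d / 110) powr p) * ennreal ((4 * r i) powr p) * edge_energy h (z, i) w)"
          by (simp only: distrib_left mult_ac)
        also have "... <= ennreal (2 powr p) * (ennreal (440 powr p) * ennreal (q z i) + ennreal (440 powr p) * edge_energy h (z, i) w)"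
        proof (intro mult_left_mono add_mono mult_right_mono)
          have e: "1 / (d / 110) powr p = 110 powr p / d powr p" using d by (simp add: powr_divide)
          have "110 powr p / d powr p * \<bar>?U (z, i)\<bar> powr p <= 440 powr p / d powr p * \<bar>?U (z, i)\<bar> powr p"
            using p by (intro mult_right_mono divide_right_mono powr_mono2) auto
          then show "ennreal (1 / (d / 110) powr p) * abs_p (?U (z, i)) <= ennreal (440 powr p) * ennreal (q z i)"
            unfolding e q_def d_def[symmetric] by (simp add: ennreal_mult[symmetric] ennreal_leI)
          have "110 powr p / d powr p * (4 * r i) powr p = (440 * r i) powr p / d powr p"
            by (simp add: powr_mult[symmetric])
          also have "... <= (440 * d) powr p / d powr p" using d p by (intro divide_right_mono powr_mono2) auto
          also have "... = 440 powr p" unfolding powr_mult using d by simp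
          finally show "ennreal (1 / (d / 110) powr p) * ennreal ((4 * r i) powr p) <= ennreal (440 powr p)"
            unfolding e by (simp add: ennreal_mult[symmetric] ennreal_leI)
        qed auto
        also have "... = ennreal c1 * (ennreal (q z i) + edge_energy h (z, i) w)"
          unfolding c1_def by (simp add: ennreal_mult distrib_left mult.assoc)
        finally show ?thesis .
      qed
      have "(\<integral>\<^sup>+t\<in>{0..1}. ?f (edge (z, i) w t) \<partial>lborel) <= (\<integral>\<^sup>+t. (ennreal c1 * (ennreal (q z i) + edge_energy h (z, i) w)) * indicator {0..1::real} t \<partial>lborel)"
      proof (rule nn_integral_mono)
        fix t :: real
        show "?f (edge (z, i) w t) * indicator {0..1} t <= (ennreal c1 * (ennreal (q z i) + edge_energy h (z, i) w)) * indicator {0..1} t"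
          using pt[of t] by (cases "t \<in> {0..1}") auto
      qed
      also have "... = ennreal c1 * (ennreal (q z i) + edge_energy h (z, i) w)" by (subst nn_integral_cmult_indicator) auto
      finally show ?thesis .
    qed
    have vsum: "(\<Sum>i. \<Sum>z\<in>A i. wt (z, i) * ennreal (q z i)) <= ennreal (4 powr p * (real Mo * (C1 + 1))) * (?R + ?S)"
    proof -
      let ?G = "%i x. abs_p (u (bdry x)) * level_wt E i x + ennreal (rneg i) * ennreal_powr (Sl ?U i x) p"
      have Gm [measurable]: "?G i \<in> borel_measurable \<nu>" for i using um dm by measurable
      have "(\<Sum>i. \<Sum>z\<in>A i. wt (z, i) * ennreal (q z i)) <= (\<Sum>i. \<Sum>z\<in>A i. ennreal (4 powr p) * (\<integral>\<^sup>+x. indicator (ball z (r i)) x * ?G i x \<partial>\<nu>))"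
        unfolding q_def by (intro suminf_le sum_mono vertex_value_le[OF L E]) auto
      also have "... = ennreal (4 powr p) * (\<Sum>i. \<integral>\<^sup>+x. (\<Sum>z\<in>A i. indicator (ball z (r i)) x * ?G i x) \<partial>\<nu>)"
      proof -
        have "(\<integral>\<^sup>+x. (\<Sum>z\<in>A i. indicator (ball z (r i)) x * ?G i x) \<partial>\<nu>) = (\<Sum>z\<in>A i. \<integral>\<^sup>+x. indicator (ball z (r i)) x * ?G i x \<partial>\<nu>)" for i
          using Gm[of i] by (intro nn_integral_sum) measurable
        then show ?thesis by (simp only: sum_distrib_left[symmetric] ennreal_suminf_cmult)
      qed
      also have "... <= ennreal (4 powr p) * (\<Sum>i. \<integral>\<^sup>+x. ennreal (real Mo) * ?G i x \<partial>\<nu>)"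
        by (intro mult_left_mono suminf_le nn_integral_mono overlap_sum_le r_le_4r) auto
      also have "(\<Sum>i. \<integral>\<^sup>+x. ennreal (real Mo) * ?G i x \<partial>\<nu>) = ennreal (real Mo) * (\<Sum>i. \<integral>\<^sup>+x. ?G i x \<partial>\<nu>)"
        using Gm by (simp only: nn_integral_cmult ennreal_suminf_cmult)
      also have "(\<Sum>i. \<integral>\<^sup>+x. ?G i x \<partial>\<nu>) = (\<Sum>i. (\<integral>\<^sup>+x. abs_p (u (bdry x)) * level_wt E i x \<partial>\<nu>)) + ?S"
      proof -
        have "(\<integral>\<^sup>+x. ?G i x \<partial>\<nu>) = (\<integral>\<^sup>+x. abs_p (u (bdry x)) * level_wt E i x \<partial>\<nu>) + ennreal (rneg i) * (\<integral>\<^sup>+x. ennreal_powr (Sl ?U i x) p \<partial>\<nu>)" for i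
          using um dm by (subst nn_integral_add, measurable) (subst nn_integral_cmult, auto)
        then show ?thesis by (simp only: suminf_add[OF summableI summableI, symmetric])
      qed
      also have "(\<Sum>i. (\<integral>\<^sup>+x. abs_p (u (bdry x)) * level_wt E i x \<partial>\<nu>)) =
        (\<integral>\<^sup>+x. abs_p (u (bdry x)) * (\<Sum>i. level_wt E i x) \<partial>\<nu>)"
        unfolding ennreal_suminf_cmult[symmetric] using um dm by (intro nn_integral_suminf[symmetric]) measurable
      also have "... <= (\<integral>\<^sup>+x. ennreal C1 * (abs_p (u (bdry x)) * ennreal (infdist x E powr (- \<theta> * p))) \<partial>\<nu>)"
      proof (rule nn_integral_mono)
        fix x
        show "abs_p (u (bdry x)) * (\<Sum>i. level_wt E i x) <= ennreal C1 * (abs_p (u (bdry x)) * ennreal (infdist x E powr (- \<theta> * p)))"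
        proof (cases "infdist x E = 0")
          case False
          then have "0 < infdist x E" using infdist_nonneg[of x E] by simp
          then have "abs_p (u (bdry x)) * (\<Sum>i. level_wt E i x) <= abs_p (u (bdry x)) * ennreal (C1 * infdist x E powr (- \<theta> * p))"
            by (intro mult_left_mono C1) auto
          then show ?thesis using C1(1) by (simp add: ennreal_mult mult_ac)
        qed (use u0 p in simp)
      qed
      also have "... = ennreal C1 * ?R" using um dm by (intro nn_integral_cmult) measurable
      finally have "(\<Sum>i. \<Sum>z\<in>A i. wt (z, i) * ennreal (q z i)) <= ennreal (4 powr p) * (ennreal (real Mo) * (ennreal C1 * ?R + ?S))"
        by (simp add: mult_left_mono add_right_mono)
      also have "... <= ennreal (4 powr p) * (ennreal (real Mo) * (ennreal (C1 + 1) * ?R + ennreal (C1 + 1) * ?S))"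
      proof (rule mult_left_mono, rule mult_left_mono, rule add_mono)
        have "1 * ?S <= ennreal (C1 + 1) * ?S" using C1(1) by (intro mult_right_mono) auto
        then show "?S <= ennreal (C1 + 1) * ?S" by simp
        show "ennreal C1 * ?R <= ennreal (C1 + 1) * ?R" by (intro mult_right_mono ennreal_leI) auto
      qed auto
      also have "... = (ennreal (4 powr p) * (ennreal (real Mo) * ennreal (C1 + 1))) * (?R + ?S)"
        by (simp only: distrib_left mult.assoc)
      also have "ennreal (4 powr p) * (ennreal (real Mo) * ennreal (C1 + 1)) = ennreal (4 powr p * (real Mo * (C1 + 1)))"
        using C1(1) by (simp add: ennreal_mult del: ennreal_plus)
      finally show ?thesis .
    qed
    have "(\<integral>\<^sup>+x. ?f x \<partial>\<mu>) = (\<Sum>i. \<Sum>z\<in>A i. \<Sum>w\<in>nb z i. (wt (z, i) + wt w) * (\<integral>\<^sup>+t\<in>{0..1}. ?f (edge (z, i) w t) \<partial>lborel))"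
      using nn_integral_\<mu>[OF fm] edge_int_levels by simp
    also have "... <= (\<Sum>i. \<Sum>z\<in>A i. \<Sum>w\<in>nb z i. ennreal (K1 * c1) * (wt (z, i) * ennreal (q z i) + wt (z, i) * edge_energy h (z, i) w))"
    proof (intro suminf_le sum_mono)
      fix i z w assume "w \<in> nb z i"
      then have n: "N (z, i) w" by (simp add: nb_def)
      have "(wt (z, i) + wt w) * (\<integral>\<^sup>+t\<in>{0..1}. ?f (edge (z, i) w t) \<partial>lborel) <= (ennreal K1 * wt (z, i)) * (ennreal c1 * (ennreal (q z i) + edge_energy h (z, i) w))"
        unfolding K1_def by (intro mult_mono on_edge[OF n] edge_weight_le[OF n]) auto
      also have "... = ennreal (K1 * c1) * (wt (z, i) * ennreal (q z i) + wt (z, i) * edge_energy h (z, i) w)"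
        using K1 c1 by (simp add: ennreal_mult distrib_left mult_ac)
      finally show "(wt (z, i) + wt w) * (\<integral>\<^sup>+t\<in>{0..1}. ?f (edge (z, i) w t) \<partial>lborel) <= ennreal (K1 * c1) * (wt (z, i) * ennreal (q z i) + wt (z, i) * edge_energy h (z, i) w)" .
    qed auto
    also have "... = ennreal (K1 * c1) * ((\<Sum>i. \<Sum>z\<in>A i. \<Sum>w\<in>nb z i. wt (z, i) * ennreal (q z i)) + (\<Sum>i. \<Sum>z\<in>A i. \<Sum>w\<in>nb z i. wt (z, i) * edge_energy h (z, i) w))"
      by (simp only: sum_distrib_left[symmetric] ennreal_suminf_cmult sum.distrib suminf_add[OF summableI summableI, symmetric])
    also have "... <= ennreal (K1 * c1) * (ennreal M * (?R + ?S) + ?H)"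
    proof (intro mult_left_mono add_mono)
      have "(\<Sum>i. \<Sum>z\<in>A i. \<Sum>w\<in>nb z i. wt (z, i) * ennreal (q z i)) <= (\<Sum>i. \<Sum>z\<in>A i. ennreal (3 * real Mo) * (wt (z, i) * ennreal (q z i)))"
      proof (intro suminf_le sum_mono)
        fix i z
        have "(\<Sum>w\<in>nb z i. wt (z, i) * ennreal (q z i)) = of_nat (card (nb z i)) * (wt (z, i) * ennreal (q z i))" by simp
        also have "... <= of_nat (3 * Mo) * (wt (z, i) * ennreal (q z i))" by (intro mult_right_mono of_nat_mono card_nb) auto
        also have "of_nat (3 * Mo) = ennreal (3 * real Mo)" by (subst ennreal_of_nat_eq_real_of_nat) simp
        finally show "(\<Sum>w\<in>nb z i. wt (z, i) * ennreal (q z i)) <= ennreal (3 * real Mo) * (wt (z, i) * ennreal (q z i))" .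
      qed auto
      also have "... = ennreal (3 * real Mo) * (\<Sum>i. \<Sum>z\<in>A i. wt (z, i) * ennreal (q z i))"
        by (simp only: sum_distrib_left[symmetric] ennreal_suminf_cmult)
      also have "... <= ennreal (3 * real Mo) * (ennreal (4 powr p * (real Mo * (C1 + 1))) * (?R + ?S))"
        using vsum by (intro mult_left_mono) auto
      also have "... = ennreal M * (?R + ?S)" unfolding M_def mult.assoc[symmetric] using C1 by (subst ennreal_mult[symmetric]) (auto simp: mult.assoc)
      finally show "(\<Sum>i. \<Sum>z\<in>A i. \<Sum>w\<in>nb z i. wt (z, i) * ennreal (q z i)) <= ennreal M * (?R + ?S)" .
      show "(\<Sum>i. \<Sum>z\<in>A i. \<Sum>w\<in>nb z i. wt (z, i) * edge_energy h (z, i) w) <= ?H" by (rule edge_energy_sum_le[OF hm])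
    qed auto
    also have "... <= ennreal (K1 * c1) * (ennreal (M + 1) * (?R + ?S) + ennreal (M + 1) * ?H)"
    proof (intro mult_left_mono add_mono mult_right_mono)
      have "1 * ?H <= ennreal (M + 1) * ?H" using M by (intro mult_right_mono) auto
      then show "?H <= ennreal (M + 1) * ?H" by simp
    qed (auto intro: ennreal_leI)
    also have "... = ennreal (K1 * c1 * (M + 1)) * (?R + ?S + ?H)"
    proof -
      have "ennreal (K1 * c1 * (M + 1)) = ennreal (K1 * c1) * ennreal (M + 1)" using K1 c1 M by (intro ennreal_mult) auto
      then show ?thesis by (simp only: distrib_left mult.assoc)
    qed
    finally show "(\<integral>\<^sup>+x. ?f x \<partial>\<mu>) <= ennreal (K1 * c1 * (M + 1)) * (?R + ?S + ?H)" .
  qed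
qed

end

section \<open>From the boundary to the filling\<close>

lemma Lip_c_lipschitz:
  assumes "u \<in> Lip_c M \<Omega>"
  obtains L where "0 <= L" "!!F G. F \<in> mspace M ==> G \<in> mspace M ==> \<bar>u F - u G\<bar> <= L * mdist M F G"
proof -
  have "Lipschitz_continuous_map M euclidean_metric u" using assms by (simp add: Lip_c_def)
  then obtain B where "0 < B" "\<forall>x\<in>mspace M. \<forall>y\<in>mspace M. dist (u x) (u y) <= B * mdist M x y"
    by (auto simp: Lipschitz_continuous_map_pos)
  then show ?thesis using that[of B] by (auto simp: dist_real_def)
qed

lemma Lip_c_support:
  assumes "u \<in> Lip_c M \<Omega>" "x \<in> mspace M" "u x ~= 0" shows "x \<in> \<Omega>"
proof -
  have "{x \<in> mspace M. u x ~= 0} <= mtopology_of M closure_of {x \<in> mspace M. u x ~= 0}"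
    by (rule closure_of_subset) auto
  then show ?thesis using assms by (auto simp: Lip_c_def Let_def)
qed

context hardy_filling
begin

lemma trace_Lip_c:
  assumes u: "u \<in> Lip_c Y (mspace Y - bdry ` E)"
  shows "(%x. u (bdry x)) \<in> Lip_c euclidean_metric (UNIV - E)"
proof -
  obtain L where L: "0 <= L" "!!F G. F \<in> mspace Y ==> G \<in> mspace Y ==> \<bar>u F - u G\<bar> <= L * mdist Y F G"
    using Lip_c_lipschitz[OF u] by blast
  let ?S = "{x \<in> mspace Y. u x ~= 0}"
  let ?K = "mtopology_of Y closure_of ?S"
  have K: "?K <= mspace Y - bdry ` E" using u by (simp add: Lip_c_def Let_def)
  have "Lipschitz_continuous_map euclidean_metric Y bdry"
    unfolding Lipschitz_continuous_map_def using bdry_in bdry_lipschitz by auto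
  then have "continuous_map euclidean (mtopology_of Y) bdry"
    using Lipschitz_continuous_imp_continuous_map by fastforce
  then have "closedin euclidean {x \<in> topspace euclidean. bdry x \<in> ?K}"
    by (rule closedin_continuous_map_preimage) simp
  then have cl: "closed {x. bdry x \<in> ?K}" by simp
  have "?S <= ?K" by (rule closure_of_subset) auto
  then have "{x. u (bdry x) ~= 0} <= {x. bdry x \<in> ?K}" using bdry_in by blast
  then have sub: "closure {x. u (bdry x) ~= 0} <= {x. bdry x \<in> ?K}" using cl by (rule closure_minimal)
  have "compact (closure {x. u (bdry x) ~= 0})" using compact_Int_closed[OF cpt closed_closure] by simp
  moreover have "closure {x. u (bdry x) ~= 0} <= UNIV - E" using sub K by blast
  moreover have "Lipschitz_continuous_map euclidean_metric euclidean_metric (%x. u (bdry x))"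
    unfolding Lipschitz_continuous_map_def using trace_continuous(1)[OF L] by (auto simp: dist_real_def)
  ultimately show ?thesis by (simp add: Lip_c_def Let_def)
qed

lemma AE_not_bdry: "AE x in \<mu>. x \<in> mspace Y - bdry ` E"
  using AE_open_edges
proof eventually_elim
  case (elim x)
  then obtain v w t where "N v w" "0 < t" "t < 1" "x = edge v w t" by (auto simp: open_edges_def)
  then show ?case using edge_in[of v w t] edge_not_bdry[of v w t] by auto
qed

lemma nn_integral_off_bdry: "(\<integral>\<^sup>+x\<in>mspace Y - bdry ` E. f x \<partial>\<mu>) = (\<integral>\<^sup>+x. f x \<partial>\<mu>)"
proof (rule nn_integral_cong_AE)
  show "AE x in \<mu>. f x * indicator (mspace Y - bdry ` E) x = f x"
    using AE_not_bdry[of E] by eventually_elim simp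
qed

lemma fractional_weight:
  assumes E: "closed E" "E ~= {}" and u0: "x \<in> E ==> c = 0"
  shows "abs_p c / ennreal_powr (dist_to_set euclidean_metric x E) (\<theta> * p) * indicator (UNIV - E) x =
    abs_p c * ennreal (infdist x E powr (- \<theta> * p))"
proof (cases "x \<in> E")
  case False
  then have d: "0 < infdist x E" using E in_closed_iff_infdist_zero[of E x] infdist_nonneg[of x E] by fastforce
  have "abs_p c / ennreal (infdist x E powr (\<theta> * p)) = ennreal (\<bar>c\<bar> powr p / infdist x E powr (\<theta> * p))"
    using d by (intro divide_ennreal) auto
  also have "... = ennreal (\<bar>c\<bar> powr p * infdist x E powr (- \<theta> * p))" by (simp add: powr_minus divide_inverse)
  also have "... = abs_p c * ennreal (infdist x E powr (- \<theta> * p))" by (intro ennreal_mult) auto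
  finally show ?thesis using False infdist_nonneg[of x E] by (simp only: dist_to_set_euclidean[OF E(2)] ennreal_powr_ennreal) simp
qed (use u0 p in simp)

text \<open>The trace \<open>u \<circ> bdry\<close> is an admissible test function for the fractional inequality.\<close>
lemma hardy_of_fractional:
  assumes E: "closed E" "E ~= {}" and F: "fractional_hardy_inequality euclidean_metric \<nu> \<theta> p (UNIV - E)"
  shows "hardy_inequality Y \<mu> p (mspace Y - bdry ` E)"
proof (rule hardy_lhs_le[OF E(2)], rule besov_energy_le_tails, rule Sl_energy)
  fix C1 C2 C3
  assume C1: "0 <= C1" "!!u h L. 0 <= L ==> (!!F G. F \<in> mspace Y ==> G \<in> mspace Y ==> \<bar>u F - u G\<bar> <= L * mdist Y F G) ==>
     weak_upper_gradient Y \<mu> p u h ==> (!!x. infdist x E = 0 ==> u (bdry x) = 0) ==>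
     (\<integral>\<^sup>+x. abs_p (u x) / dist_p E x \<partial>\<mu>) \<le>
     ennreal C1 * (hardy_lhs E (%x. u (bdry x))
       + tail_energy (%v. u (vert v))
       + (\<integral>\<^sup>+x. ennreal_powr (h x) p \<partial>\<mu>))"
  assume C2: "0 <= C2" "!!u L. 0 <= L ==> (!!F G. F \<in> mspace Y ==> G \<in> mspace Y ==> \<bar>u F - u G\<bar> <= L * mdist Y F G) ==>
    besov_energy (%x. u (bdry x)) <= ennreal C2 * tail_energy (%v. u (vert v))"
  assume C3: "0 <= C3" "!!U. tail_energy U <= ennreal C3 * vertex_energy U"
  have b: "mball_of euclidean_metric x s = ball x s" for x :: 'z and s by auto
  obtain Cf where Cf1: "1 <= Cf" and Cf0: "\<forall>u\<in>Lip_c euclidean_metric (UNIV - E).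
      (\<integral>\<^sup>+x\<in>UNIV - E. (abs_p (u x) / ennreal_powr (dist_to_set euclidean_metric x (mspace euclidean_metric - (UNIV - E))) (\<theta> * p)) \<partial>\<nu>)
      <= ennreal Cf * (\<integral>\<^sup>+x. (\<integral>\<^sup>+y. abs_p (u x - u y) /
        (ennreal (mdist euclidean_metric x y powr (\<theta> * p)) * emeasure \<nu> (mball_of euclidean_metric x (mdist euclidean_metric x y))) \<partial>\<nu>) \<partial>\<nu>)"
    using F unfolding fractional_hardy_inequality_def by blast
  have UE: "mspace euclidean_metric - (UNIV - E) = E" by auto
  have Cf: "1 <= Cf" "!!u. u \<in> Lip_c euclidean_metric (UNIV - E) ==>
     (\<integral>\<^sup>+x\<in>UNIV - E. (abs_p (u x) / ennreal_powr (dist_to_set euclidean_metric x E) (\<theta> * p)) \<partial>\<nu>) <= ennreal Cf * besov_energy u"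
    using Cf1 bspec[OF Cf0] unfolding UE b besov_energy_def by simp_all
  define c where "c = C3 * 4 powr p"
  define CC where "CC = C1 * (Cf * C2 * c + c + 1)"
  have c: "0 <= c" "0 <= CC" using C1(1) C2(1) C3(1) Cf(1) by (auto simp: c_def CC_def)
  have main: "(\<integral>\<^sup>+x\<in>mspace Y - bdry ` E. (abs_p (u x) / dist_p E x) \<partial>\<mu>)
     <= ennreal (max 1 CC) * (\<integral>\<^sup>+x\<in>mspace Y - bdry ` E. ennreal_powr (g x) p \<partial>\<mu>)"
    if u: "u \<in> Lip_c Y (mspace Y - bdry ` E)" and g: "weak_upper_gradient Y \<mu> p u g" for u g
  proof -
    obtain L where L: "0 <= L" "!!F G. F \<in> mspace Y ==> G \<in> mspace Y ==> \<bar>u F - u G\<bar> <= L * mdist Y F G"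
      using Lip_c_lipschitz[OF u] by blast
    have u0: "u (bdry x) = 0" if "x \<in> E" for x using Lip_c_support[OF u bdry_in, of x] that by blast
    have u0': "u (bdry x) = 0" if "infdist x E = 0" for x
      using u0[of x] that in_closed_iff_infdist_zero[OF E] by simp
    let ?H = "\<integral>\<^sup>+x. ennreal_powr (g x) p \<partial>\<mu>"
    let ?S = "tail_energy (%v. u (vert v))"
    let ?R = "\<integral>\<^sup>+x. abs_p (u (bdry x)) * ennreal (infdist x E powr (- \<theta> * p)) \<partial>\<nu>"
    have "?S <= ennreal C3 * (ennreal (4 powr p) * ?H)"
      by (rule order_trans[OF C3(2) mult_left_mono[OF VE_le_energy[OF g]]]) simp
    then have S: "?S <= ennreal c * ?H" unfolding c_def using C3(1) by (simp add: ennreal_mult mult.assoc)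
    have "?R = (\<integral>\<^sup>+x\<in>UNIV - E. (abs_p (u (bdry x)) / ennreal_powr (dist_to_set euclidean_metric x E) (\<theta> * p)) \<partial>\<nu>)"
      by (intro nn_integral_cong fractional_weight[symmetric] E u0)
    also have "... <= ennreal Cf * besov_energy (%x. u (bdry x))" by (rule Cf(2)[OF trace_Lip_c[OF u]])
    also have "... <= ennreal Cf * (ennreal C2 * ?S)" using C2(2)[OF L] by (intro mult_left_mono) auto
    also have "... <= ennreal Cf * (ennreal C2 * (ennreal c * ?H))" using S by (intro mult_left_mono) auto
    also have "... = ennreal (Cf * C2 * c) * ?H" using C2(1) Cf(1) c by (simp add: ennreal_mult mult.assoc)
    finally have R: "?R <= ennreal (Cf * C2 * c) * ?H" .
    have "(\<integral>\<^sup>+x. abs_p (u x) / dist_p E x \<partial>\<mu>) <= ennreal C1 * (?R + ?S + ?H)"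
      by (rule C1(2)[OF L g u0'])
    also have "... <= ennreal C1 * (ennreal (Cf * C2 * c) * ?H + ennreal c * ?H + ennreal 1 * ?H)"
      using R S by (intro mult_left_mono add_mono) auto
    also have "... = ennreal CC * ?H"
    proof -
      have nn: "0 <= Cf * C2 * c" using C2(1) Cf(1) c by simp
      have "ennreal CC = ennreal C1 * ennreal (Cf * C2 * c + c + 1)" unfolding CC_def using C1(1) c nn by (intro ennreal_mult) auto
      also have "ennreal (Cf * C2 * c + c + 1) = ennreal (Cf * C2 * c) + ennreal c + ennreal 1"
        by (simp only: ennreal_plus nn c(1) add_nonneg_nonneg zero_le_one)
      finally show ?thesis by (simp only: distrib_right[symmetric] mult.assoc)
    qed
    also have "... <= ennreal (max 1 CC) * ?H" by (intro mult_right_mono ennreal_leI) auto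
    finally show ?thesis unfolding nn_integral_off_bdry .
  qed
  have eq: "mspace Y - (mspace Y - bdry ` E) = bdry ` E" using bdry_in by blast
  show ?thesis unfolding hardy_inequality_def eq
    by (intro exI[of _ "max 1 CC"] conjI ballI allI impI main) (auto simp: minimal_weak_upper_gradient_def)
qed

section \<open>From the filling to the boundary\<close>

lemma space_\<nu>: "space \<nu> = UNIV"
  using sets_eq_imp_space_eq[OF sets_\<nu>] by simp

lemma finite_\<nu>: "finite_measure \<nu>"
proof
  have "space \<nu> = ball z0 1" using dist_less_1 by (auto simp: space_\<nu>)
  then show "emeasure \<nu> (space \<nu>) ~= \<infinity>" using ball_finite[of 1 z0] by simp
qed

text \<open>The radius is chosen such that the balls of all neighbors are contained in the ball.\<close>
definition osc :: "('z => real) => 'z => nat => real => ennreal" where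
  "osc u z i s = (\<integral>\<^sup>+y. indicator (ball z (8 * r i)) y * abs_p (s - u y) \<partial>\<nu>)"

definition mean_osc :: "('z => real) => 'z => nat => ennreal" where
  "mean_osc u z i = ennreal (1 / mm z i) * (\<integral>\<^sup>+x. indicator (ball z (r i)) x * osc u z i (u x) \<partial>\<nu>)"

definition osc_energy :: "('z => real) => ennreal" where
  "osc_energy u = (\<Sum>i. \<Sum>z\<in>A i. ennreal (rneg i) * mean_osc u z i)"

text \<open>A substitute for the mean of \<open>u\<close> over the ball: sample values satisfy the same oscillation estimates and need
  only integrals of nonnegative functions.\<close>
definition good_point :: "('z => real) => 'z => nat => 'z" where
  "good_point u z i = (SOME x. x \<in> ball z (r i) & osc u z i (u x) <= 2 * mean_osc u z i)"

definition sample :: "('z => real) => 'z \<times> nat => real" where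
  "sample u v = u (good_point u (fst v) (snd v))"

lemma osc_measurable: "u \<in> borel_measurable \<nu> ==> osc u z i \<in> borel_measurable borel"
proof -
  assume [measurable]: "u \<in> borel_measurable \<nu>"
  interpret finite_measure \<nu> by (rule finite_\<nu>)
  show ?thesis unfolding osc_def by (rule borel_measurable_nn_integral) measurable
qed

lemma osc_comp_measurable: "u \<in> borel_measurable \<nu> ==> (%x. osc u z i (u x)) \<in> borel_measurable \<nu>"
  using measurable_compose[OF _ osc_measurable] by blast

text \<open>If the oscillation exceeded twice its mean on the whole ball, integration over the ball would force the mean, and
  then the oscillation almost everywhere in the ball, to vanish.\<close>
lemma good_point:
  assumes um: "u \<in> borel_measurable \<nu>"
  shows "dist z (good_point u z i) < r i" "osc u z i (u (good_point u z i)) <= 2 * mean_osc u z i"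
proof -
  have m [measurable]: "(%x. osc u z i (u x)) \<in> borel_measurable \<nu>" by (rule osc_comp_measurable[OF um])
  let ?B = "ball z (r i)"
  have m0: "mm z i ~= 0" by (rule less_imp_neq[OF mm_pos(1), symmetric])
  have "\<exists>x. x \<in> ?B & osc u z i (u x) <= 2 * mean_osc u z i"
  proof (rule ccontr)
    assume "~ ?thesis"
    then have big: "2 * mean_osc u z i < osc u z i (u x)" if "x \<in> ?B" for x using that by (meson not_le)
    have "mean_osc u z i ~= top"
    proof
      assume "mean_osc u z i = top"
      then have "2 * mean_osc u z i = top" by (simp add: ennreal_mult_eq_top_iff)
      then show False using big[of z] by simp
    qed
    then obtain c where c: "0 <= c" "mean_osc u z i = ennreal c" by (cases "mean_osc u z i") auto
    have "2 * mean_osc u z i * ennreal (mm z i) = (\<integral>\<^sup>+x. 2 * mean_osc u z i * indicator ?B x \<partial>\<nu>)"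
      by (subst nn_integral_cmult_indicator) (auto simp: emeasure_ball)
    also have "... <= (\<integral>\<^sup>+x. indicator ?B x * osc u z i (u x) \<partial>\<nu>)"
    proof (rule nn_integral_mono)
      fix x show "2 * mean_osc u z i * indicator ?B x <= indicator ?B x * osc u z i (u x)"
        using less_imp_le[OF big, of x] by (cases "x \<in> ?B") auto
    qed
    also have "... = ennreal (mm z i) * mean_osc u z i"
    proof -
      have e: "mm z i * (1 / mm z i) = 1" unfolding times_divide_eq_right mult_1_right by (rule divide_self[OF m0])
      have "ennreal (mm z i) * ennreal (1 / mm z i) = ennreal (mm z i * (1 / mm z i))" by (rule ennreal_mult[symmetric]) simp_all
      then have "ennreal (mm z i) * ennreal (1 / mm z i) = 1" by (simp only: e ennreal_1)
      then show ?thesis unfolding mean_osc_def by (simp only: mult.assoc[symmetric] mult_1_left)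
    qed
    finally have "ennreal (2 * c * mm z i) <= ennreal (mm z i * c)"
      using c(1) unfolding c(2) by (simp add: ennreal_mult)
    then have "2 * c * mm z i <= mm z i * c" using c(1) by (simp add: ennreal_le_iff)
    then have "c * mm z i <= 0" by simp
    then have "c = 0" using mm_pos(1)[of z i] c(1) by (simp add: mult_le_0_iff)
    then have "mean_osc u z i = 0" using c by simp
    moreover have "ennreal (1 / mm z i) ~= 0" by (simp add: m0)
    ultimately have "(\<integral>\<^sup>+x. indicator ?B x * osc u z i (u x) \<partial>\<nu>) = 0" unfolding mean_osc_def by simp
    then have "AE x in \<nu>. indicator ?B x * osc u z i (u x) = 0" by (subst (asm) nn_integral_0_iff_AE) auto
    then have "AE x in \<nu>. ~ x \<in> ?B"
    proof eventually_elim
      case (elim x)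
      show ?case
      proof
        assume "x \<in> ?B"
        then show False using elim big[of x] by simp
      qed
    qed
    then have "emeasure \<nu> {x \<in> space \<nu>. x \<in> ?B} = 0" by (rule emeasure_eq_0_AE)
    moreover have "{x \<in> space \<nu>. x \<in> ?B} = ?B" by (auto simp: space_\<nu>)
    ultimately have "emeasure \<nu> ?B = 0" by simp
    then show False using ball_pos[of "r i" z] by simp
  qed
  then have "good_point u z i \<in> ?B & osc u z i (u (good_point u z i)) <= 2 * mean_osc u z i"
    unfolding good_point_def by (rule someI_ex)
  then show "dist z (good_point u z i) < r i" "osc u z i (u (good_point u z i)) <= 2 * mean_osc u z i" by auto
qed

lemma powr_triangle: "abs_p (a - b) <= ennreal (2 powr p) * (abs_p (a - t) + abs_p (b - t))"
proof -
  have "ennreal_powr (ennreal \<bar>a - b\<bar>) p <= ennreal_powr (ennreal \<bar>a - t\<bar> + ennreal \<bar>b - t\<bar>) p"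
    using p by (intro ennreal_powr_mono) (auto simp: ennreal_plus[symmetric] simp del: ennreal_plus)
  also have "... <= ennreal (2 powr p) * (ennreal_powr (ennreal \<bar>a - t\<bar>) p + ennreal_powr (ennreal \<bar>b - t\<bar>) p)"
    using p by (intro ennreal_powr_add_le) auto
  finally show ?thesis by (simp add: ennreal_powr_ennreal)
qed

text \<open>The ball of \<open>w\<close> is contained in the large balls of both vertices, so both sample values are compared with the
  values of \<open>u\<close> on it.\<close>
lemma sample_difference:
  assumes um: "u \<in> borel_measurable \<nu>" and n: "N (z, i) (y, j)"
  shows "ennreal (mm z i * \<bar>sample u (z, i) - sample u (y, j)\<bar> powr p) \<le>
    ennreal (K * 2 powr p * 2) * (mean_osc u z i + mean_osc u y j)"
proof -
  note [measurable] = um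
  note nc = neighbors_close[OF n]
  let ?a = "sample u (z, i)" and ?b = "sample u (y, j)"
  have sub: "dist z t < 8 * r i" if "dist y t < r j" for t
    using dist_triangle[of z t y] nc(1,2) that r_pos(1)[of i] by linarith
  have sub2: "dist y t < 8 * r j" if "dist y t < r j" for t using that r_pos(1)[of j] by linarith
  have "abs_p (?a - ?b) * ennreal (mm y j) = (\<integral>\<^sup>+t. abs_p (?a - ?b) * indicator (ball y (r j)) t \<partial>\<nu>)"
    by (subst nn_integral_cmult_indicator) (auto simp: emeasure_ball)
  also have "... <= (\<integral>\<^sup>+t. ennreal (2 powr p) * (indicator (ball z (8 * r i)) t * abs_p (?a - u t) +
      indicator (ball y (8 * r j)) t * abs_p (?b - u t)) \<partial>\<nu>)"
  proof (rule nn_integral_mono)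
    fix t
    show "abs_p (?a - ?b) * indicator (ball y (r j)) t <= ennreal (2 powr p) * (indicator (ball z (8 * r i)) t * abs_p (?a - u t) +
      indicator (ball y (8 * r j)) t * abs_p (?b - u t))"
      using sub[of t] sub2[of t] powr_triangle[of ?a ?b "u t"] by (cases "dist y t < r j") auto
  qed
  also have "... = ennreal (2 powr p) * (osc u z i ?a + osc u y j ?b)"
    unfolding osc_def by (subst nn_integral_cmult, measurable) (subst nn_integral_add, auto)
  also have "... <= ennreal (2 powr p) * (2 * mean_osc u z i + 2 * mean_osc u y j)"
    using good_point(2)[OF um, of z i] good_point(2)[OF um, of y j] unfolding sample_def by (intro mult_left_mono add_mono) auto
  finally have 1: "abs_p (?a - ?b) * ennreal (mm y j) <= ennreal (2 powr p) * (2 * mean_osc u z i + 2 * mean_osc u y j)" .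
  have "dist z y + r i <= 64 * r j" using nc(1,3) r_pos(1)[of j] by linarith
  then have "mm z i <= K * mm y j" by (intro vol_compare) auto
  then have "mm z i * \<bar>?a - ?b\<bar> powr p <= K * (\<bar>?a - ?b\<bar> powr p * mm y j)"
    using mult_right_mono[of "mm z i" "K * mm y j" "\<bar>?a - ?b\<bar> powr p"] by (simp add: mult_ac)
  then have "ennreal (mm z i * \<bar>?a - ?b\<bar> powr p) <= ennreal (K * (\<bar>?a - ?b\<bar> powr p * mm y j))" by (rule ennreal_leI)
  also have "... = ennreal K * (abs_p (?a - ?b) * ennreal (mm y j))" using K_ge_1 by (simp add: ennreal_mult)
  also have "... <= ennreal K * (ennreal (2 powr p) * (2 * mean_osc u z i + 2 * mean_osc u y j))" using 1 by (intro mult_left_mono) auto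
  also have "... = (ennreal K * ennreal (2 powr p) * ennreal 2) * (mean_osc u z i + mean_osc u y j)"
    by (simp only: distrib_left mult.assoc ennreal_numeral)
  also have "ennreal K * ennreal (2 powr p) * ennreal 2 = ennreal (K * 2 powr p * 2)" using K_ge_1 by (simp add: ennreal_mult)
  finally show ?thesis .
qed

text \<open>The set of directed edges is invariant under reversal.\<close>
lemma neighbor_sum_swap:
  fixes G :: "'z \<times> nat => ennreal"
  shows "(\<Sum>i. \<Sum>z\<in>A i. \<Sum>w\<in>nb z i. G w) = (\<Sum>i. \<Sum>z\<in>A i. of_nat (card (nb z i)) * G (z, i))"
proof -
  have NV: "v \<in> V" "w \<in> V" if "N v w" for v w using that by (auto simp: filling_neighbors_def)
  let ?f = "%x. G (snd x) * indicator {(v, w). N v w} x"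
  have "(\<Sum>i. \<Sum>z\<in>A i. \<Sum>w\<in>nb z i. G w) = (\<integral>\<^sup>+v. (\<integral>\<^sup>+w. G w \<partial>count_space {w. N v w}) \<partial>count_space V)"
    unfolding level_sum nb_def[symmetric] by (simp add: nn_integral_count_space_finite)
  also have "... = (\<integral>\<^sup>+v. (\<integral>\<^sup>+w. ?f (v, w) \<partial>count_space UNIV) \<partial>count_space UNIV)"
  proof -
    have 1: "(\<integral>\<^sup>+v. (\<integral>\<^sup>+w. G w \<partial>count_space {w. N v w}) \<partial>count_space V) =
      (\<integral>\<^sup>+v. (\<integral>\<^sup>+w. G w \<partial>count_space {w. N v w}) * indicator V v \<partial>count_space UNIV)"
      by (subst nn_integral_count_space_indicator) auto
    have 2: "(\<integral>\<^sup>+w. G w \<partial>count_space {w. N v w}) * indicator V v = (\<integral>\<^sup>+w. ?f (v, w) \<partial>count_space UNIV)" for v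
    proof (cases "v \<in> V")
      case True
      have "indicator {w. N v w} w = (indicator {(v, w). N v w} (v, w) :: ennreal)" for w by (simp add: indicator_def)
      then show ?thesis using True by (simp add: nn_integral_count_space_indicator)
    next
      case False
      then have "~ N v w" for w using NV by blast
      then show ?thesis using False by (simp add: indicator_def)
    qed
    show ?thesis unfolding 1 2 ..
  qed
  also have "... = (\<integral>\<^sup>+w. (\<integral>\<^sup>+v. ?f (v, w) \<partial>count_space UNIV) \<partial>count_space UNIV)"
    by (rule trans[OF nn_integral_fst_count_space[of ?f] nn_integral_snd_count_space[of ?f, symmetric]])
  also have "... = (\<integral>\<^sup>+w. (\<integral>\<^sup>+v. G w \<partial>count_space {v. N w v}) * indicator V w \<partial>count_space UNIV)"
  proof (rule nn_integral_cong)
    fix w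
    have "(\<integral>\<^sup>+v. ?f (v, w) \<partial>count_space UNIV) = (\<integral>\<^sup>+v. G w * indicator {v. N w v} v \<partial>count_space UNIV)"
      by (intro nn_integral_cong) (auto simp: indicator_def dest: neighbors_sym)
    also have "... = (\<integral>\<^sup>+v. G w \<partial>count_space {v. N w v})" by (subst nn_integral_count_space_indicator) auto
    also have "... = (\<integral>\<^sup>+v. G w \<partial>count_space {v. N w v}) * indicator V w"
    proof (cases "w \<in> V")
      case False
      then have "~ N w v" for v using NV by blast
      then have "{v. N w v} = {}" by blast
      then show ?thesis by (simp only: nn_integral_empty space_count_space mult_zero_left)
    qed simp
    finally show "(\<integral>\<^sup>+v. ?f (v, w) \<partial>count_space UNIV) = (\<integral>\<^sup>+v. G w \<partial>count_space {v. N w v}) * indicator V w" .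
  qed
  also have "... = (\<integral>\<^sup>+w. (\<integral>\<^sup>+v. G w \<partial>count_space {v. N w v}) \<partial>count_space V)"
    by (subst (2) nn_integral_count_space_indicator) auto
  also have "... = (\<Sum>i. \<Sum>z\<in>A i. of_nat (card (nb z i)) * G (z, i))"
    unfolding level_sum nb_def[symmetric] by (simp add: nn_integral_count_space_finite mult.commute)
  finally show ?thesis .
qed

lemma vertex_energy_sample_le:
  assumes um: "u \<in> borel_measurable \<nu>"
  shows "vertex_energy (sample u) <= ennreal (2 powr (\<theta> * p) * (K * 2 powr p * 2) * (6 * real Mo)) * osc_energy u"
proof -
  define G where "G = (%v. ennreal (r (snd v) powr (- \<theta> * p)) * mean_osc u (fst v) (snd v))"
  define c where "c = 2 powr (\<theta> * p) * (K * 2 powr p * 2)"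
  have c: "0 <= c" using K_ge_1 by (simp add: c_def)
  have edge: "ennreal (rneg i * mm z i * \<bar>sample u (z, i) - sample u w\<bar> powr p) <= ennreal c * (G (z, i) + G w)" if n: "N (z, i) w" for z i w
  proof -
    obtain y j where w: "w = (y, j)" by (cases w)
    note n = n[unfolded w]
    have "rneg i <= (r j / 2) powr (- \<theta> * p)"
      using neighbors_close(2)[OF n] r_pos(1)[of j] p \<theta> by (intro powr_mono2') auto
    also have "... = 2 powr (\<theta> * p) * rneg j" by (simp add: powr_divide powr_minus field_simps)
    finally have rr: "rneg i <= 2 powr (\<theta> * p) * rneg j" .
    have "1 * rneg i <= 2 powr (\<theta> * p) * rneg i"
      using p \<theta> ge_one_powr_ge_zero[of 2 "\<theta> * p"] by (intro mult_right_mono) auto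
    then have ri: "rneg i <= 2 powr (\<theta> * p) * rneg i" by simp
    have "ennreal (rneg i * mm z i * \<bar>sample u (z, i) - sample u w\<bar> powr p) =
      ennreal (rneg i) * ennreal (mm z i * \<bar>sample u (z, i) - sample u w\<bar> powr p)"
      by (simp add: ennreal_mult[symmetric] mult.assoc)
    also have "... <= ennreal (rneg i) * (ennreal (K * 2 powr p * 2) * (mean_osc u z i + mean_osc u y j))"
      unfolding w by (intro mult_left_mono sample_difference[OF um n]) auto
    also have "... = ennreal (K * 2 powr p * 2) * (ennreal (rneg i) * mean_osc u z i + ennreal (rneg i) * mean_osc u y j)"
      by (simp only: distrib_left mult_ac)
    also have "... <= ennreal (K * 2 powr p * 2) * (ennreal (2 powr (\<theta> * p) * rneg i) * mean_osc u z i + ennreal (2 powr (\<theta> * p) * rneg j) * mean_osc u y j)"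
      using rr ri by (intro mult_left_mono add_mono mult_right_mono ennreal_leI) auto
    also have "... = ennreal (K * 2 powr p * 2) * (ennreal (2 powr (\<theta> * p)) * (G (z, i) + G w))"
      unfolding G_def w by (simp add: ennreal_mult distrib_left mult.assoc)
    also have "... = ennreal c * (G (z, i) + G w)"
    proof -
      have "ennreal c = ennreal (K * 2 powr p * 2) * ennreal (2 powr (\<theta> * p))"
        unfolding c_def using K_ge_1 by (subst ennreal_mult[symmetric]) (auto simp: mult.commute)
      then show ?thesis by (simp only: mult.assoc)
    qed
    finally show ?thesis .
  qed
  have "vertex_energy (sample u) <= (\<Sum>i. \<Sum>z\<in>A i. \<Sum>w\<in>nb z i. ennreal c * (G (z, i) + G w))"
    unfolding vertex_energy_def
  proof (intro suminf_le sum_mono)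
    fix i z w assume "w \<in> nb z i"
    then show "ennreal (rneg i * mm z i * \<bar>sample u (z, i) - sample u w\<bar> powr p) <= ennreal c * (G (z, i) + G w)"
      by (intro edge) (simp add: nb_def)
  qed auto
  also have "... = ennreal c * ((\<Sum>i. \<Sum>z\<in>A i. \<Sum>w\<in>nb z i. G (z, i)) + (\<Sum>i. \<Sum>z\<in>A i. \<Sum>w\<in>nb z i. G w))"
    by (simp only: sum_distrib_left[symmetric] ennreal_suminf_cmult sum.distrib suminf_add[OF summableI summableI, symmetric])
  also have "... = ennreal c * ((\<Sum>i. \<Sum>z\<in>A i. of_nat (card (nb z i)) * G (z, i)) + (\<Sum>i. \<Sum>z\<in>A i. of_nat (card (nb z i)) * G (z, i)))"
    unfolding neighbor_sum_swap by simp
  also have "... <= ennreal c * (ennreal (3 * real Mo) * osc_energy u + ennreal (3 * real Mo) * osc_energy u)"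
  proof -
    have "(\<Sum>i. \<Sum>z\<in>A i. of_nat (card (nb z i)) * G (z, i)) <= (\<Sum>i. \<Sum>z\<in>A i. of_nat (3 * Mo) * G (z, i))"
    proof (intro suminf_le sum_mono)
      fix i z show "of_nat (card (nb z i)) * G (z, i) <= of_nat (3 * Mo) * G (z, i)"
        by (intro mult_right_mono of_nat_mono card_nb) auto
    qed auto
    also have "... = of_nat (3 * Mo) * osc_energy u"
      unfolding osc_energy_def G_def by (simp only: sum_distrib_left[symmetric] ennreal_suminf_cmult fst_conv snd_conv)
    also have "of_nat (3 * Mo) = ennreal (3 * real Mo)" by (subst ennreal_of_nat_eq_real_of_nat) simp
    finally show ?thesis by (intro mult_left_mono add_mono) auto
  qed
  also have "... = ennreal (c * (6 * real Mo)) * osc_energy u"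
  proof -
    have "ennreal (c * (6 * real Mo)) = ennreal c * (ennreal (3 * real Mo) + ennreal (3 * real Mo))"
    proof -
      have "ennreal (c * (6 * real Mo)) = ennreal c * ennreal (6 * real Mo)" using c by (intro ennreal_mult) auto
      moreover have "ennreal (6 * real Mo) = ennreal (3 * real Mo) + ennreal (3 * real Mo)" by (subst ennreal_plus[symmetric]) auto
      ultimately show ?thesis by (simp only:)
    qed
    then show ?thesis by (simp only: distrib_right mult.assoc)
  qed
  finally show ?thesis unfolding c_def .
qed

end

text \<open>Simple functions below \<open>C f\<close> are multiples of simple functions below \<open>f\<close>. The kernel of the Besov energy, with a ball
  of varying radius in it, enters only through this bound.\<close>
lemma nn_integral_cmult_le:
  assumes C: "0 <= C" shows "(\<integral>\<^sup>+x. ennreal C * f x \<partial>M) <= ennreal C * (\<integral>\<^sup>+x. f x \<partial>M)"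
proof (cases "C = 0")
  case False
  then have C: "0 < C" using C by simp
  have e: "ennreal C * ennreal (1 / C) = 1" "ennreal (1 / C) * ennreal C = 1" using C by (simp_all add: ennreal_mult[symmetric])
  show ?thesis unfolding nn_integral_def[of M "%x. ennreal C * f x"]
  proof (rule SUP_least)
    fix g assume "g \<in> {g. simple_function M g & g <= (%x. ennreal C * f x)}"
    then have g: "simple_function M g" "!!x. g x <= ennreal C * f x" by (auto simp: le_fun_def)
    have hm: "(%x. ennreal (1 / C) * g x) \<in> borel_measurable M"
      using borel_measurable_simple_function[OF g(1)] by measurable
    have hf: "ennreal (1 / C) * g x <= f x" for x
    proof -
      have "ennreal (1 / C) * g x <= ennreal (1 / C) * (ennreal C * f x)" by (intro mult_left_mono g) simp
      also have "... = f x" unfolding mult.assoc[symmetric] e by simp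
      finally show ?thesis .
    qed
    have "integral\<^sup>S M g = (\<integral>\<^sup>+x. g x \<partial>M)" by (rule nn_integral_eq_simple_integral[symmetric, OF g(1)])
    also have "... = (\<integral>\<^sup>+x. ennreal C * (ennreal (1 / C) * g x) \<partial>M)" unfolding mult.assoc[symmetric] e by simp
    also have "... = ennreal C * (\<integral>\<^sup>+x. ennreal (1 / C) * g x \<partial>M)" by (rule nn_integral_cmult[OF hm])
    also have "... <= ennreal C * (\<integral>\<^sup>+x. f x \<partial>M)" by (intro mult_left_mono nn_integral_mono hf) simp
    finally show "integral\<^sup>S M g <= ennreal C * (\<integral>\<^sup>+x. f x \<partial>M)" .
  qed
qed simp

context hardy_filling
begin

text \<open>If \<open>x\<close> lies in the ball of \<open>(z, i)\<close> and \<open>y\<close> in the ball with eight times the radius, then \<open>d(x, y) < 9 r\<^sub>i\<close>.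
  So only the levels with \<open>r\<^sub>i > d/9\<close> contribute, over which \<open>r\<^sub>i\<^sup>-\<^sup>\<theta>\<^sup>p\<close> has a geometric sum, and boundedly many
  balls of each level contain \<open>x\<close>.\<close>
lemma fractional_kernel_ge:
  obtains C where "0 <= C" "!!(u :: 'z => real) x y. (\<Sum>i. \<Sum>z\<in>A i. ennreal (rneg i) * (ennreal (1 / mm z i) * (indicator (ball z (r i)) x *
      (indicator (ball z (8 * r i)) y * abs_p (u x - u y))))) \<le>
    ennreal C * (abs_p (u x - u y) / (ennreal (dist x y powr (\<theta> * p)) * emeasure \<nu> (ball x (dist x y))))"
proof -
  obtain C1 where C1: "0 < C1" "!!d. 0 < d ==> (\<Sum>i. ennreal (rpos i / (d + r i) powr p)) <= ennreal (C1 * d powr (- \<theta> * p))"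
    using level_series by blast
  define C where "C = real Mo * (K * 10 powr p * C1)"
  show thesis
  proof (rule that)
    show "0 <= C" using C1 K_ge_1 by (simp add: C_def)
    fix u :: "'z => real" and x y
    let ?g = "\<bar>u x - u y\<bar> powr p"
    let ?t = "%i z. ennreal (rneg i) * (ennreal (1 / mm z i) * (indicator (ball z (r i)) x * (indicator (ball z (8 * r i)) y * ennreal ?g)))"
    show "(\<Sum>i. \<Sum>z\<in>A i. ?t i z) <= ennreal C * (ennreal ?g / (ennreal (dist x y powr (\<theta> * p)) * emeasure \<nu> (ball x (dist x y))))"
    proof (cases "x = y")
      case False
      define d where "d = dist x y"
      have d: "0 < d" using False by (simp add: d_def)
      have v: "0 < vol x d" by (rule vol_pos[OF d])
      define s where "s = (%i. rpos i / (d + r i) powr p)"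
      have s0: "0 <= s i" for i by (simp add: s_def)
      have tm: "?t i z <= indicator (ball z (r i)) x * ennreal (K * 10 powr p / vol x d * ?g * s i)" for i z
      proof (cases "x \<in> ball z (r i) & y \<in> ball z (8 * r i)")
        case True
        then have zx: "dist z x < r i" and zy: "dist z y < 8 * r i" by auto
        have d9: "d < 9 * r i" using dist_triangle2[of x y z] zx zy unfolding d_def dist_commute[of x z] dist_commute[of y z] by linarith
        have "dist x z + d <= 64 * r i" using d9 zx r_pos(1)[of i] unfolding dist_commute[of x z] by linarith
        then have "vol x d <= K * mm z i" using d by (intro vol_compare) auto
        then have m: "1 / mm z i <= K / vol x d" using v mm_pos(1)[of z i] by (simp add: field_simps)
        have "(d + r i) powr p <= (10 * r i) powr p" using d d9 p by (intro powr_mono2) auto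
        then have "(d + r i) powr p <= 10 powr p * r i powr p" by (simp only: powr_mult)
        moreover have "0 < (d + r i) powr p" "0 < r i powr p"
        proof -
          have "d + r i ~= 0" using d r_pos(1)[of i] by linarith
          then show "0 < (d + r i) powr p" "0 < r i powr p" by simp_all
        qed
        ultimately have "1 / r i powr p <= 10 powr p / (d + r i) powr p" by (simp add: field_simps)
        then have "rpos i * (1 / r i powr p) <= rpos i * (10 powr p / (d + r i) powr p)"
          by (rule mult_left_mono) simp
        moreover have "rpos i * (1 / r i powr p) = rneg i"
        proof -
          have "rpos i / r i powr p = r i powr (p * (1 - \<theta>) - p)" by (rule powr_diff[symmetric])
          also have "p * (1 - \<theta>) - p = - \<theta> * p" by (simp add: algebra_simps)
          finally show ?thesis by simp
        qed
        ultimately have rs: "rneg i <= 10 powr p * s i" by (simp add: s_def mult.commute)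
        have "rneg i * (1 / mm z i * ?g) <= (10 powr p * s i) * (K / vol x d * ?g)"
          using rs m s0[of i] v K_ge_1 by (intro mult_mono mult_right_mono) auto
        also have "... = K * 10 powr p / vol x d * ?g * s i" by simp
        finally have "ennreal (rneg i * (1 / mm z i * ?g)) <= ennreal (K * 10 powr p / vol x d * ?g * s i)" by (rule ennreal_leI)
        moreover have "ennreal (rneg i) * (ennreal (1 / mm z i) * ennreal ?g) = ennreal (rneg i * (1 / mm z i * ?g))"
        proof -
          have "0 <= 1 / mm z i" by simp
          then show ?thesis by (simp only: ennreal_mult powr_ge_zero mult_nonneg_nonneg)
        qed
        moreover have "indicator (ball z (r i)) x = (1 :: ennreal)" "indicator (ball z (8 * r i)) y = (1 :: ennreal)" using True by auto
        ultimately show ?thesis by (simp only: mult_1_left)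
      qed auto
      have "(\<Sum>i. \<Sum>z\<in>A i. ?t i z) <= (\<Sum>i. ennreal (real Mo) * ennreal (K * 10 powr p / vol x d * ?g * s i))"
      proof (rule suminf_le)
        fix i
        have "(\<Sum>z\<in>A i. ?t i z) <= (\<Sum>z\<in>A i. indicator (ball z (r i)) x * ennreal (K * 10 powr p / vol x d * ?g * s i))" by (intro sum_mono tm)
        also have "... <= ennreal (real Mo) * ennreal (K * 10 powr p / vol x d * ?g * s i)" by (rule overlap_sum_le[OF r_le_4r(1)])
        finally show "(\<Sum>z\<in>A i. ?t i z) <= ennreal (real Mo) * ennreal (K * 10 powr p / vol x d * ?g * s i)" .
      qed auto
      also have "... = ennreal (real Mo * (K * 10 powr p / vol x d * ?g)) * (\<Sum>i. ennreal (s i))"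
      proof -
        define q where "q = K * 10 powr p / vol x d * ?g"
        have q: "0 <= q" using v K_ge_1 by (simp add: q_def)
        have "ennreal (q * s i) = ennreal q * ennreal (s i)" for i by (rule ennreal_mult[OF q s0])
        moreover have "ennreal (real Mo * q) = ennreal (real Mo) * ennreal q" using q by (intro ennreal_mult) auto
        ultimately show ?thesis unfolding q_def[symmetric] by (simp only: mult.assoc ennreal_suminf_cmult)
      qed
      also have "... <= ennreal (real Mo * (K * 10 powr p / vol x d * ?g)) * ennreal (C1 * d powr (- \<theta> * p))"
        using C1(2)[OF d] unfolding s_def by (intro mult_left_mono) auto
      also have "... = ennreal (C * (?g / (d powr (\<theta> * p) * vol x d)))"
        using v K_ge_1 C1 by (subst ennreal_mult[symmetric]) (auto simp: C_def powr_minus divide_inverse mult_ac)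
      also have "... = ennreal C * (ennreal ?g / (ennreal (d powr (\<theta> * p)) * emeasure \<nu> (ball x d)))"
      proof -
        have "ennreal (d powr (\<theta> * p)) * emeasure \<nu> (ball x d) = ennreal (d powr (\<theta> * p) * vol x d)"
          using d v by (simp add: emeasure_ball ennreal_mult)
        moreover have "ennreal ?g / ennreal (d powr (\<theta> * p) * vol x d) = ennreal (?g / (d powr (\<theta> * p) * vol x d))"
          using d v by (intro divide_ennreal mult_pos_pos) auto
        ultimately show ?thesis using v C1 K_ge_1 by (subst ennreal_mult) (auto simp: C_def)
      qed
      finally show ?thesis unfolding d_def .
    qed (use p in simp)
  qed
qed

lemma osc_energy_bound:
  assumes C0: "0 <= C" and C: "!!x y. (\<Sum>i. \<Sum>z\<in>A i. ennreal (rneg i) * (ennreal (1 / mm z i) * (indicator (ball z (r i)) x *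
      (indicator (ball z (8 * r i)) y * abs_p (u x - u y))))) \<le>
    ennreal C * (abs_p (u x - u y) / (ennreal (dist x y powr (\<theta> * p)) * emeasure \<nu> (ball x (dist x y))))"
    and um: "u \<in> borel_measurable \<nu>"
  shows "osc_energy u <= ennreal C * besov_energy u"
proof -
  note [measurable] = um
  have om [measurable]: "(%x. osc u z i (u x)) \<in> borel_measurable \<nu>" for z i by (rule osc_comp_measurable[OF um])
  let ?c = "%i. ennreal (rneg i)" and ?m = "%i z. ennreal (1 / mm z i)"
  let ?g = "%i z x y. indicator (ball z (8 * r i)) y * abs_p (u x - u y)"
  have gm [measurable]: "?g i z x \<in> borel_measurable \<nu>" for i z x by measurable
  have inner: "(\<integral>\<^sup>+y. ?c i * (?m i z * (indicator (ball z (r i)) x * ?g i z x y)) \<partial>\<nu>) = ?c i * (?m i z * (indicator (ball z (r i)) x * osc u z i (u x)))" for i z x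
    unfolding osc_def by ((simp add: nn_integral_cmult; fail) | ((subst nn_integral_cmult, measurable)+, (rule refl)?))
  have outer: "(\<integral>\<^sup>+x. ?c i * (?m i z * (indicator (ball z (r i)) x * osc u z i (u x))) \<partial>\<nu>) = ?c i * mean_osc u z i" for i z
  proof -
    have a: "(%x. indicator (ball z (r i)) x * osc u z i (u x)) \<in> borel_measurable \<nu>" by measurable
    show ?thesis unfolding mean_osc_def by ((simp add: nn_integral_cmult; fail) | ((subst nn_integral_cmult, measurable)+, (rule refl)?))
  qed
  have "osc_energy u = (\<integral>\<^sup>+x. (\<Sum>i. \<Sum>z\<in>A i. ?c i * (?m i z * (indicator (ball z (r i)) x * osc u z i (u x)))) \<partial>\<nu>)"
    unfolding osc_energy_def outer[symmetric] by (subst nn_integral_suminf, measurable) (subst nn_integral_sum, measurable)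
  also have "... = (\<integral>\<^sup>+x. (\<integral>\<^sup>+y. (\<Sum>i. \<Sum>z\<in>A i. ?c i * (?m i z * (indicator (ball z (r i)) x * ?g i z x y))) \<partial>\<nu>) \<partial>\<nu>)"
    unfolding inner[symmetric] by (subst nn_integral_suminf, measurable) (subst nn_integral_sum, measurable)
  also have "... <= (\<integral>\<^sup>+x. ennreal C * (\<integral>\<^sup>+y. abs_p (u x - u y) / (ennreal (dist x y powr (\<theta> * p)) * emeasure \<nu> (ball x (dist x y))) \<partial>\<nu>) \<partial>\<nu>)"
    by (intro nn_integral_mono order_trans[OF nn_integral_mono[OF C] nn_integral_cmult_le[OF C0]])
  also have "... <= ennreal C * besov_energy u" unfolding besov_energy_def by (rule nn_integral_cmult_le[OF C0])
  finally show ?thesis .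
qed

lemma osc_energy_le:
  obtains C where "0 <= C" "!!u. u \<in> borel_measurable \<nu> ==> osc_energy u <= ennreal C * besov_energy u"
proof (rule fractional_kernel_ge)
  fix C assume C: "0 <= C" "!!(u :: 'z => real) x y. (\<Sum>i. \<Sum>z\<in>A i. ennreal (rneg i) * (ennreal (1 / mm z i) * (indicator (ball z (r i)) x *
      (indicator (ball z (8 * r i)) y * abs_p (u x - u y))))) \<le>
    ennreal C * (abs_p (u x - u y) / (ennreal (dist x y powr (\<theta> * p)) * emeasure \<nu> (ball x (dist x y))))"
  show thesis
  proof (rule that[OF C(1)])
    fix u :: "'z => real" assume "u \<in> borel_measurable \<nu>"
    then show "osc_energy u <= ennreal C * besov_energy u" by (intro osc_energy_bound C)
  qed
qed

lemma slope_energy_le: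
  obtains C where "0 <= C" "!!f. (\<integral>\<^sup>+x. ennreal_powr (slope f x) p \<partial>\<mu>) <= ennreal C * vertex_energy f"
proof
  define K1 where "K1 = 1 + 2 powr (p * (1 - \<theta>)) * K"
  have K1: "0 <= K1" using K_ge_1 by (simp add: K1_def)
  show "0 <= K1 * 2 powr p" using K1 by simp
  fix f
  have "(\<integral>\<^sup>+x. ennreal_powr (slope f x) p \<partial>\<mu>) = (\<Sum>i. \<Sum>z\<in>A i. \<Sum>w\<in>nb z i. (wt (z, i) + wt w) * (\<integral>\<^sup>+t\<in>{0..1}. ennreal_powr (slope f (edge (z, i) w t)) p \<partial>lborel))"
    unfolding nn_integral_\<mu>[OF measurable_ennreal_powr[OF slope_measurable]] edge_int_levels ..
  also have "... <= (\<Sum>i. \<Sum>z\<in>A i. \<Sum>w\<in>nb z i. ennreal (K1 * 2 powr p) * ennreal (rneg i * mm z i * \<bar>f (z, i) - f w\<bar> powr p))"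
  proof (intro suminf_le sum_mono)
    fix i z w assume "w \<in> nb z i"
    then have n: "N (z, i) w" by (simp add: nb_def)
    let ?D = "\<bar>f (z, i) - f w\<bar>"
    have "(wt (z, i) + wt w) * (\<integral>\<^sup>+t\<in>{0..1}. ennreal_powr (slope f (edge (z, i) w t)) p \<partial>lborel) <= (ennreal K1 * wt (z, i)) * ennreal ((2 * ?D / r i) powr p)"
      unfolding K1_def by (intro mult_mono slope_energy_edge[OF n p] edge_weight_le[OF n]) auto
    also have "... = ennreal (K1 * (rpos i * mm z i) * (2 * ?D / r i) powr p)"
      unfolding wt_real using K1 by (simp add: ennreal_mult)
    also have "K1 * (rpos i * mm z i) * (2 * ?D / r i) powr p = K1 * 2 powr p * (rneg i * mm z i * ?D powr p)"
    proof -
      have "(2 * ?D / r i) powr p = 2 powr p * ?D powr p / r i powr p" by (simp add: powr_divide powr_mult)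
      moreover have "rneg i = rpos i / r i powr p" unfolding powr_diff[symmetric] by (simp add: algebra_simps)
      ultimately show ?thesis by simp
    qed
    also have "ennreal (K1 * 2 powr p * (rneg i * mm z i * ?D powr p)) = ennreal (K1 * 2 powr p) * ennreal (rneg i * mm z i * ?D powr p)"
      using K1 by (intro ennreal_mult) auto
    finally show "(wt (z, i) + wt w) * (\<integral>\<^sup>+t\<in>{0..1}. ennreal_powr (slope f (edge (z, i) w t)) p \<partial>lborel) <= ennreal (K1 * 2 powr p) * ennreal (rneg i * mm z i * ?D powr p)" .
  qed auto
  also have "... = ennreal (K1 * 2 powr p) * vertex_energy f" unfolding vertex_energy_def by (simp only: sum_distrib_left[symmetric] ennreal_suminf_cmult)
  finally show "(\<integral>\<^sup>+x. ennreal_powr (slope f x) p \<partial>\<mu>) <= ennreal (K1 * 2 powr p) * vertex_energy f" .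
qed

text \<open>The piecewise linear function is Lipschitz on the dense image of the graph.\<close>
lemma pl_extension:
  assumes k: "0 <= k" and f: "!!z i w. N (z, i) w ==> \<bar>f (z, i) - f w\<bar> <= k * r i"
  obtains u L where "linear_on_edges f u" "0 <= L" "!!F G. F \<in> mspace Y ==> G \<in> mspace Y ==> \<bar>u F - u G\<bar> <= L * mdist Y F G"
proof -
  define g where "g F = pl f (inv_into points emb F)" for F
  have inj: "inj_on emb points" using emb_inj by (auto simp: inj_on_def)
  have g: "g (emb x) = pl f x" if "x \<in> points" for x using inv_into_f_f[OF inj that] by (simp add: g_def)
  have "\<bar>g F - g G\<bar> <= 2 * k * mdist Y F G" if "F \<in> emb ` points" "G \<in> emb ` points" for F G
    using that pl_lipschitz_filling[OF k f] by (auto simp: g emb_isometric)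
  then have lip: "Lipschitz_continuous_map (submetric Y (emb ` points)) euclidean_metric g"
    unfolding Lipschitz_continuous_map_def by (auto simp: dist_real_def intro!: exI[of _ "2 * k"])
  have cl: "mtopology_of Y closure_of (emb ` points) = mspace Y"
  proof -
    have "\<exists>y\<in>emb ` points. y \<in> YM.mball x e" if "x \<in> mspace Y" "0 < e" for x e
      using emb_dense[OF that] that emb_in by auto
    then show ?thesis unfolding mtopology_of_def YM.metric_closure_of by auto
  qed
  have "mcomplete_of (euclidean_metric :: real metric)" by (simp add: mcomplete_of_def complete_UNIV)
  then obtain u where u: "Lipschitz_continuous_map (submetric Y (mspace Y)) euclidean_metric u" "!!x. x \<in> emb ` points ==> u x = g x"
    using Lipschitz_continuous_map_extends_to_closure_of[OF _ lip] unfolding cl by blast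
  obtain L where L: "0 < L" "\<forall>x\<in>mspace Y. \<forall>y\<in>mspace Y. dist (u x) (u y) <= L * mdist Y x y"
    using u(1) by (auto simp: Lipschitz_continuous_map_pos)
  have "linear_on_edges f u"
    unfolding linear_on_edges_def
  proof (intro allI impI)
    fix v w and t :: real assume n: "N v w" and t: "t \<in> {0..1}"
    have "u (edge v w t) = pl f (edge_point v w t)" using u(2)[of "edge v w t"] g edge_point_in[OF n t] by simp
    then show "u (edge v w t) = (1 - t) * f v + t * f w" using pl_edge[OF N_irrefl[OF n]] by simp
  qed
  then show thesis using that[of u L] L by (auto simp: dist_real_def)
qed

lemma edge_dense:
  assumes "F \<in> mspace Y" "0 < e"
  obtains v w t where "N v w" "t \<in> {0..1}" "mdist Y F (edge v w t) < e"
proof -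
  obtain x where x: "x \<in> points" "mdist Y F (emb x) < e" using emb_dense[OF assms] by blast
  show thesis using x(1)
  proof (cases rule: points_cases)
    case (1 v)
    obtain z i where v: "v = (z, i)" by (cases v)
    have "N (z, i) (z, Suc i)" using child[of z i] 1(1) v by simp
    then show thesis using that[of "(z, i)" "(z, Suc i)" 0] x 1 v by simp
  next
    case (2 v w t)
    then show thesis using that[of v w t] x by simp
  qed
qed

lemma Lip_c_on_Z:
  assumes u: "u \<in> Lip_c euclidean_metric (UNIV - E)"
  obtains L where "0 <= L" "!!x y. \<bar>u x - u y\<bar> <= L * dist x y" "(u :: 'z => real) \<in> borel_measurable \<nu>"
proof -
  obtain L where L: "0 <= L" "!!x y. \<bar>u x - u y\<bar> <= L * dist x y" using Lip_c_lipschitz[OF u] by auto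
  have "continuous_on UNIV u"
    by (rule lipschitz_on_continuous_on[of L], rule lipschitz_onI) (use L in \<open>auto simp: dist_real_def\<close>)
  then show thesis by (intro that[OF L] continuous_measurable_\<nu>)
qed

lemma sample_lipschitz:
  assumes um: "u \<in> borel_measurable \<nu>" and L: "0 <= L" "!!x y. \<bar>u x - u y\<bar> <= L * dist x y"
    and n: "N (z, i) w"
  shows "\<bar>sample u (z, i) - sample u w\<bar> <= (7 * L) * r i"
proof -
  obtain y j where w: "w = (y, j)" by (cases w)
  note n = n[unfolded w]
  let ?a = "good_point u z i" and ?b = "good_point u y j"
  have "dist ?a ?b <= dist ?a z + dist z ?b" by (rule dist_triangle)
  moreover have "dist z ?b <= dist z y + dist y ?b" by (rule dist_triangle)
  ultimately have "dist ?a ?b <= 7 * r i"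
    using good_point(1)[OF um, of z i] good_point(1)[OF um, of y j] neighbors_close(1,2)[OF n] unfolding dist_commute[of ?a z] by linarith
  then have "L * dist ?a ?b <= L * (7 * r i)" using L by (intro mult_left_mono) auto
  then show ?thesis using L(2)[of ?a ?b] unfolding w sample_def by simp
qed

lemma support_distance:
  assumes u: "u \<in> Lip_c euclidean_metric (UNIV - E)" and E: "closed E" "E ~= {}"
  obtains \<delta> where "0 < \<delta>" "!!x e. e \<in> E ==> dist x e < \<delta> ==> u x = 0"
proof -
  let ?K = "closure {x. u x ~= 0}"
  have K: "compact ?K" "?K <= UNIV - E" using u by (auto simp: Lip_c_def Let_def)
  have "\<exists>\<delta>>0. \<forall>x\<in>?K. \<delta> <= infdist x E"
  proof (cases "?K = {}")
    case False
    have c: "continuous_on ?K (%x. infdist x E)" by (intro continuous_intros)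
    obtain x0 where x0: "x0 \<in> ?K" "\<forall>x\<in>?K. infdist x0 E <= infdist x E"
      using continuous_attains_inf[OF K(1) False c] by blast
    have "x0 \<notin> E" using x0(1) K(2) by blast
    then have "infdist x0 E ~= 0" using in_closed_iff_infdist_zero[OF E] by blast
    then have "0 < infdist x0 E" using infdist_nonneg[of x0 E] by linarith
    then show ?thesis using x0(2) by blast
  qed (auto intro: exI[of _ 1])
  then obtain \<delta> where \<delta>: "0 < \<delta>" "\<forall>x\<in>?K. \<delta> <= infdist x E" by blast
  show thesis
  proof (rule that[OF \<delta>(1)], rule ccontr)
    fix x e assume h: "e \<in> E" "dist x e < \<delta>" "u x ~= 0"
    then have "x \<in> ?K" using closure_subset[of "{x. u x ~= 0}"] by blast
    then have "\<delta> <= infdist x E" using \<delta>(2) by blast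
    then show False using infdist_le[OF h(1), of x] h(2) by linarith
  qed
qed

text \<open>If a vertex or an edge is close to \<open>E\<close> compared with the distance \<open>\<delta>\<close> of \<open>E\<close> to the support of \<open>u\<close>, then the points where
  \<open>u\<close> is sampled lie outside the support. So the extension vanishes in a neighborhood of \<open>E\<close>.\<close>
lemma sample_extension:
  assumes u: "u \<in> Lip_c euclidean_metric (UNIV - E)" and E: "closed E" "E ~= {}"
  obtains v L where "linear_on_edges (sample u) v" "0 <= L" "!!F G. F \<in> mspace Y ==> G \<in> mspace Y ==> \<bar>v F - v G\<bar> <= L * mdist Y F G"
    "v \<in> Lip_c Y (mspace Y - bdry ` E)"
proof -
  obtain L0 where L0: "0 <= L0" "!!x y. \<bar>u x - u y\<bar> <= L0 * dist x y" and um: "u \<in> borel_measurable \<nu>"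
    using Lip_c_on_Z[OF u] by blast
  have L7: "0 <= 7 * L0" using L0(1) by simp
  obtain v L where v: "linear_on_edges (sample u) v" and L: "0 <= L" "!!F G. F \<in> mspace Y ==> G \<in> mspace Y ==> \<bar>v F - v G\<bar> <= L * mdist Y F G"
    using pl_extension[OF L7 sample_lipschitz[OF um L0]] by blast
  obtain \<delta> where \<delta>: "0 < \<delta>" "!!x e. e \<in> E ==> dist x e < \<delta> ==> u x = 0"
    using support_distance[OF u E] by blast
  have vertex0: "sample u (z, i) = 0" if n: "N (z, i) w" and t: "t \<in> {0..1}" and e: "e \<in> E" "mdist Y (edge (z, i) w t) (bdry e) < \<delta> / 220" for z i w t e
  proof -
    have "dist z e + r i < \<delta> / 2" using edge_bdry_dist_ge[OF n t, of e] e(2) by linarith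
    moreover have "dist (good_point u z i) e <= dist z (good_point u z i) + dist z e" by (rule dist_triangle3)
    ultimately have "dist (good_point u z i) e < \<delta>" using good_point(1)[OF um, of z i] zero_le_dist[of z e] \<delta>(1) by linarith
    then show ?thesis using \<delta>(2)[OF e(1)] by (simp add: sample_def)
  qed
  have edge0: "v (edge a w t) = 0" if n: "N a w" and t: "t \<in> {0..1}" and e: "e \<in> E" "mdist Y (edge a w t) (bdry e) < \<delta> / 220" for a w t e
  proof -
    obtain z i where a: "a = (z, i)" by (cases a)
    obtain y j where w: "w = (y, j)" by (cases w)
    have 1: "sample u a = 0" using vertex0[of z i w t e] n t e a by simp
    have "mdist Y (edge w a (1 - t)) (bdry e) < \<delta> / 220" using e(2) unfolding edge_point_swap[of a w t] .
    then have 2: "sample u w = 0" using vertex0[of y j a "1 - t" e] neighbors_sym[OF n] t e(1) w by simp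
    show ?thesis using linear_on_edgesD[OF v n t] 1 2 by simp
  qed
  have zero: "v F = 0" if F: "F \<in> mspace Y" and e: "e \<in> E" "mdist Y F (bdry e) < \<delta> / 220" for F e
  proof (rule ccontr)
    assume "v F ~= 0"
    define \<eta> where "\<eta> = min (\<bar>v F\<bar> / (L + 1)) (\<delta> / 220 - mdist Y F (bdry e))"
    have \<eta>: "0 < \<eta>" using \<open>v F ~= 0\<close> L(1) e(2) by (simp add: \<eta>_def)
    obtain a w t where G: "N a w" "t \<in> {0..1}" "mdist Y F (edge a w t) < \<eta>" using edge_dense[OF F \<eta>] by blast
    have m: "edge a w t \<in> mspace Y" by (rule edge_in[OF G(1,2)])
    have "mdist Y (edge a w t) (bdry e) <= mdist Y (edge a w t) F + mdist Y F (bdry e)"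
      using m F bdry_in by (intro YM.triangle)
    then have "mdist Y (edge a w t) (bdry e) < \<delta> / 220"
      using G(3) unfolding \<eta>_def YM.commute[of "edge a w t" F] by linarith
    then have "v (edge a w t) = 0" by (rule edge0[OF G(1,2) e(1)])
    then have "\<bar>v F\<bar> <= L * mdist Y F (edge a w t)" using L(2)[OF F m] by simp
    also have "... <= L * \<eta>" using G(3) L(1) by (intro mult_left_mono) auto
    also have "... < (L + 1) * \<eta>" using \<eta> by simp
    also have "... <= (L + 1) * (\<bar>v F\<bar> / (L + 1))" using L(1) by (intro mult_left_mono) (auto simp: \<eta>_def)
    also have "... = \<bar>v F\<bar>" using L(1) by simp
    finally show False by simp
  qed
  let ?S = "{x \<in> mspace Y. v x ~= 0}"
  have "bdry e \<notin> YM.mtopology closure_of ?S" if e: "e \<in> E" for e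
  proof
    assume "bdry e \<in> YM.mtopology closure_of ?S"
    then have "\<forall>r>0. \<exists>y\<in>?S. y \<in> YM.mball (bdry e) r" unfolding YM.metric_closure_of by blast
    moreover have "0 < \<delta> / 220" using \<delta>(1) by simp
    ultimately obtain y where y: "y \<in> ?S" "y \<in> YM.mball (bdry e) (\<delta> / 220)" by blast
    then have "mdist Y y (bdry e) < \<delta> / 220" unfolding YM.commute[of y "bdry e"] by simp
    then show False using zero[of y e] y(1) e by simp
  qed
  moreover have "compactin YM.mtopology (YM.mtopology closure_of ?S)"
    by (intro closedin_compact_space Y_compact closedin_closure_of)
  moreover have "YM.mtopology closure_of ?S <= mspace Y" using closure_of_subset_topspace[of YM.mtopology ?S] by simp
  moreover have "Lipschitz_continuous_map Y euclidean_metric v"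
    unfolding Lipschitz_continuous_map_def using L by (auto simp: dist_real_def)
  ultimately have "v \<in> Lip_c Y (mspace Y - bdry ` E)" unfolding Lip_c_def Let_def mtopology_of_def by auto
  then show thesis using that[OF v L] by blast
qed

text \<open>Along the edge from \<open>(z, i)\<close> to \<open>(z, i + 1)\<close> the distance to \<open>E\<close> is at most \<open>88(2 r\<^sub>i + r\<^sub>i) = 264 r\<^sub>i\<close>, and the value at
  the vertex differs from every value on the edge by at most the increment.\<close>
lemma vertex_value_le_edge:
  assumes v: "linear_on_edges f v" and E: "E ~= {}" and z: "z \<in> A i" "infdist z E <= 2 * r i"
  shows "ennreal (rneg i * mm z i * \<bar>f (z, i)\<bar> powr p) \<le>
    ennreal (2 powr p * 264 powr p) * (wt (z, i) * (\<integral>\<^sup>+t\<in>{0..1}. (abs_p (v (edge (z, i) (z, Suc i) t)) /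
        dist_p E (edge (z, i) (z, Suc i) t)) \<partial>lborel)) +
    ennreal (2 powr p) * ennreal (rneg i * mm z i * \<bar>f (z, i) - f (z, Suc i)\<bar> powr p)"
proof -
  let ?w = "(z, Suc i)"
  have n: "N (z, i) ?w" by (rule child[OF z(1)])
  let ?h = "%t. abs_p (v (edge (z, i) ?w t)) / dist_p E (edge (z, i) ?w t)"
  let ?I = "\<integral>\<^sup>+t\<in>{0..1}. ?h t \<partial>lborel"
  define c where "c = \<bar>f (z, i)\<bar> powr p"
  define D where "D = \<bar>f (z, i) - f ?w\<bar> powr p"
  define X where "X = (264 * r i) powr p"
  have X: "0 < X" using less_imp_neq[OF r_pos(1), of i] by (simp add: X_def)
  have pt: "ennreal (c / 2 powr p - D) <= ennreal X * ?h t" if t: "t \<in> {0..1}" for t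
  proof -
    let ?v = "v (edge (z, i) ?w t)"
    have ve: "?v = (1 - t) * f (z, i) + t * f ?w" by (rule linear_on_edgesD[OF v n t])
    have "f (z, i) - ?v = t * (f (z, i) - f ?w)" unfolding ve by (simp add: algebra_simps)
    then have "\<bar>f (z, i) - ?v\<bar> <= 1 * \<bar>f (z, i) - f ?w\<bar>" using t by (simp add: abs_mult mult_left_le_one_le)
    then have d: "\<bar>f (z, i) - ?v\<bar> powr p <= D" unfolding D_def using p by (intro powr_mono2) auto
    have "abs_p (f (z, i) - 0) <= ennreal (2 powr p) * (abs_p (f (z, i) - ?v) + abs_p (0 - ?v))"
      by (rule powr_triangle)
    also have "... = ennreal (2 powr p * (\<bar>f (z, i) - ?v\<bar> powr p + \<bar>?v\<bar> powr p))" by (simp add: ennreal_mult)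
    finally have "c <= 2 powr p * (\<bar>f (z, i) - ?v\<bar> powr p + \<bar>?v\<bar> powr p)" unfolding c_def by (simp add: ennreal_le_iff del: ennreal_plus)
    also have "... <= 2 powr p * (D + \<bar>?v\<bar> powr p)" using d by simp
    finally have "c / 2 powr p - D <= \<bar>?v\<bar> powr p" by (simp add: field_simps)
    then have "ennreal (c / 2 powr p - D) <= ennreal (X * (\<bar>?v\<bar> powr p / X))" using X by (intro ennreal_leI) simp
    also have "... = ennreal X * ennreal (\<bar>?v\<bar> powr p / X)" using X by (intro ennreal_mult) auto
    also have "ennreal (\<bar>?v\<bar> powr p / X) = abs_p ?v / ennreal X" using X by (intro divide_ennreal[symmetric]) auto
    also have "ennreal X * (abs_p ?v / ennreal X) <= ennreal X * ?h t"
    proof (intro mult_left_mono ennreal_divide_antimono)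
      have "88 * (infdist z E + r i) <= 264 * r i" using z(2) by simp
      then have "dist_to_set Y (edge (z, i) ?w t) (bdry ` E) <= ennreal (264 * r i)"
        using order_trans[OF dist_to_set_edge_le[OF n t E] ennreal_leI] by blast
      then have "dist_p E (edge (z, i) ?w t) <= ennreal_powr (ennreal (264 * r i)) p"
        using p by (intro ennreal_powr_mono) auto
      then show "dist_p E (edge (z, i) ?w t) <= ennreal X" by (simp add: ennreal_powr_ennreal X_def)
    qed simp
    finally show ?thesis .
  qed
  have "ennreal (c / 2 powr p - D) = (\<integral>\<^sup>+t. ennreal (c / 2 powr p - D) * indicator {0..1::real} t \<partial>lborel)"
    by (subst nn_integral_cmult_indicator) auto
  also have "... <= (\<integral>\<^sup>+t. ennreal X * (?h t * indicator {0..1} t) \<partial>lborel)"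
  proof (rule nn_integral_mono)
    fix t :: real show "ennreal (c / 2 powr p - D) * indicator {0..1} t <= ennreal X * (?h t * indicator {0..1} t)"
      using pt[of t] by (cases "t \<in> {0..1}") auto
  qed
  also have "... <= ennreal X * ?I" using X by (intro nn_integral_cmult_le) simp
  finally have cI: "ennreal (c / 2 powr p - D) <= ennreal X * ?I" .
  define q where "q = rneg i * mm z i"
  have q: "0 <= q" by (simp add: q_def)
  have "c <= 2 powr p * (max 0 (c / 2 powr p - D) + D)"
  proof -
    have "c = 2 powr p * (c / 2 powr p)" by simp
    also have "... <= 2 powr p * (max 0 (c / 2 powr p - D) + D)" by (intro mult_left_mono) auto
    finally show ?thesis .
  qed
  then have "q * c <= q * (2 powr p * (max 0 (c / 2 powr p - D) + D))" using q by (rule mult_left_mono)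
  also have "... = 2 powr p * q * max 0 (c / 2 powr p - D) + 2 powr p * (q * D)" by (simp add: algebra_simps)
  finally have "ennreal (q * c) <= ennreal (2 powr p * q * max 0 (c / 2 powr p - D) + 2 powr p * (q * D))" by (rule ennreal_leI)
  also have "... = ennreal (2 powr p * q) * ennreal (c / 2 powr p - D) + ennreal (2 powr p) * ennreal (q * D)"
  proof -
    have "0 <= D" by (simp add: D_def)
    moreover have "ennreal (max 0 (c / 2 powr p - D)) = ennreal (c / 2 powr p - D)" by (simp add: max_def ennreal_neg)
    ultimately show ?thesis using q by (subst ennreal_plus) (auto simp: ennreal_mult)
  qed
  also have "... <= ennreal (2 powr p * q) * (ennreal X * ?I) + ennreal (2 powr p) * ennreal (q * D)"
    using cI by (intro add_right_mono mult_left_mono) auto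
  also have "ennreal (2 powr p * q) * (ennreal X * ?I) = ennreal (2 powr p * 264 powr p) * (wt (z, i) * ?I)"
  proof -
    have "rneg i * r i powr p = rpos i" unfolding powr_add[symmetric] by (simp add: algebra_simps)
    then have "2 powr p * q * X = 2 powr p * 264 powr p * (rpos i * mm z i)"
      by (simp add: q_def X_def powr_mult)
    then have "ennreal (2 powr p * q) * ennreal X = ennreal (2 powr p * 264 powr p) * wt (z, i)"
      unfolding wt_real using q X by (simp add: ennreal_mult[symmetric])
    then show ?thesis by (simp only: mult.assoc[symmetric])
  qed
  finally show ?thesis unfolding q_def c_def D_def .
qed

text \<open>A point outside \<open>E\<close> belongs to the ball of a vertex whose level matches its distance to \<open>E\<close>. There \<open>u\<close> is
  replaced by the sample value, at the cost of the oscillation, and the sample value is charged to an edge.\<close>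
lemma fractional_lhs_le:
  assumes um: "u \<in> borel_measurable \<nu>" and E: "closed E" "E ~= {}" and u0: "!!x. x \<in> E ==> u x = 0"
    and v: "linear_on_edges (sample u) v" and L: "0 <= L" "!!F G. F \<in> mspace Y ==> G \<in> mspace Y ==> \<bar>v F - v G\<bar> <= L * mdist Y F G"
  shows "hardy_lhs E u \<le>
    ennreal (2 powr (\<theta> * p) * 2 powr p) * (ennreal (2 powr p * 264 powr p) * (\<integral>\<^sup>+x. abs_p (v x) / dist_p E x \<partial>\<mu>)
      + ennreal (2 powr p) * vertex_energy (sample u) + 2 * osc_energy u)"
proof -
  note [measurable] = um
  let ?U = "sample u" and ?f = "%x. abs_p (v x) / dist_p E x"
  define c where "c = ennreal (2 powr (\<theta> * p) * 2 powr p)"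
  define b where "b = (%i z. if infdist z E <= 2 * r i then ennreal (rneg i * \<bar>?U (z, i)\<bar> powr p) else 0)"
  define g where "g = (%i z x. ennreal (rneg i) * abs_p (?U (z, i) - u x))"
  have gm [measurable]: "g i z \<in> borel_measurable \<nu>" for i z unfolding g_def by measurable
  have pt: "abs_p (u x) * ennreal (infdist x E powr (- \<theta> * p)) <= (\<Sum>i. \<Sum>z\<in>A i. indicator (ball z (r i)) x * (c * (b i z + g i z x)))" for x
  proof (cases "x \<in> E")
    case False
    define d where "d = infdist x E"
    have "d ~= 0" using False in_closed_iff_infdist_zero[OF E] by (simp add: d_def)
    then have d0: "0 < d" using infdist_nonneg[of x E] by (simp add: d_def)
    obtain e where "e \<in> E" using E(2) by blast
    then have d1: "d < 1" using infdist_le[of e E x] dist_less_1[of x e] by (simp add: d_def)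
    obtain i where i: "r (Suc i) <= d" "d < r i" using level_exists[OF d0 d1] by blast
    let ?z = "near i x"
    have z: "?z \<in> A i" "dist ?z x < r i" using near by auto
    have "infdist ?z E <= 2 * r i" using infdist_triangle[of ?z E x] z(2) i(2) by (simp add: d_def)
    then have bz: "b i ?z = ennreal (rneg i * \<bar>?U (?z, i)\<bar> powr p)" by (simp add: b_def)
    have "d powr (- \<theta> * p) <= (r i / 2) powr (- \<theta> * p)" using i r_le_Suc[of i] r_pos(1)[of i] p \<theta> by (intro powr_mono2') auto
    also have "... = 2 powr (\<theta> * p) * rneg i" by (simp add: powr_divide powr_minus field_simps)
    finally have dr: "d powr (- \<theta> * p) <= 2 powr (\<theta> * p) * rneg i" .
    have "abs_p (u x) <= ennreal (2 powr p) * (abs_p (?U (?z, i)) + abs_p (?U (?z, i) - u x))"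
      using powr_triangle[of "u x" 0 "?U (?z, i)"] by (simp add: abs_minus_commute add.commute)
    then have "abs_p (u x) * ennreal (d powr (- \<theta> * p)) \<le>
      (ennreal (2 powr p) * (abs_p (?U (?z, i)) + abs_p (?U (?z, i) - u x))) * ennreal (2 powr (\<theta> * p) * rneg i)"
      using dr by (intro mult_mono ennreal_leI) auto
    also have "... = c * (b i ?z + g i ?z x)"
      unfolding c_def bz g_def by (simp add: ennreal_mult distrib_left distrib_right mult_ac)
    also have "... = indicator (ball ?z (r i)) x * (c * (b i ?z + g i ?z x))" using z(2) by simp
    also have "... <= (\<Sum>z\<in>A i. indicator (ball z (r i)) x * (c * (b i z + g i z x)))"
      using z(1) by (intro member_le_sum[of _ _ "%z. indicator (ball z (r i)) x * (c * (b i z + g i z x))"]) auto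
    also have "... <= (\<Sum>i. \<Sum>z\<in>A i. indicator (ball z (r i)) x * (c * (b i z + g i z x)))"
      by (rule term_le_suminf[of "%i. \<Sum>z\<in>A i. indicator (ball z (r i)) x * (c * (b i z + g i z x))"])
    finally show ?thesis unfolding d_def .
  qed (use u0 p in simp)
  have bE: "bdry ` E <= mspace Y" using bdry_in by blast
  have fm: "?f \<in> borel_measurable (metric_borel Y)"
    using lipschitz_measurable[OF L] measurable_ennreal_powr[OF dist_to_set_measurable[OF bE], of p] by measurable
  let ?e = "%i z w. wt (z, i) * (\<integral>\<^sup>+t\<in>{0..1}. ?f (edge (z, i) w t) \<partial>lborel)"
  let ?V = "%i z w. ennreal (rneg i * mm z i * \<bar>?U (z, i) - ?U w\<bar> powr p)"
  have vert: "b i z * ennreal (mm z i) <= ennreal (2 powr p * 264 powr p) * (\<Sum>w\<in>nb z i. ?e i z w) + ennreal (2 powr p) * (\<Sum>w\<in>nb z i. ?V i z w)"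
    if z: "z \<in> A i" for i z
  proof (cases "infdist z E <= 2 * r i")
    case True
    have w: "(z, Suc i) \<in> nb z i" using child[OF z] by (simp add: nb_def)
    have "b i z * ennreal (mm z i) = ennreal (rneg i * mm z i * \<bar>?U (z, i)\<bar> powr p)"
      using True by (simp add: b_def ennreal_mult[symmetric] mult_ac)
    also have "... <= ennreal (2 powr p * 264 powr p) * ?e i z (z, Suc i) + ennreal (2 powr p) * ?V i z (z, Suc i)"
      by (rule vertex_value_le_edge[OF v E(2) z True])
    also have "... <= ennreal (2 powr p * 264 powr p) * (\<Sum>w\<in>nb z i. ?e i z w) + ennreal (2 powr p) * (\<Sum>w\<in>nb z i. ?V i z w)"
      using w member_le_sum[OF w, of "?e i z"] member_le_sum[OF w, of "?V i z"] by (intro add_mono mult_left_mono) auto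
    finally show ?thesis .
  qed (simp add: b_def)
  have one: "(\<integral>\<^sup>+x. indicator (ball z (r i)) x * (c * (b i z + g i z x)) \<partial>\<nu>) \<le>
    c * (b i z * ennreal (mm z i) + ennreal (rneg i) * (2 * mean_osc u z i))" for i z
  proof -
    have "(\<integral>\<^sup>+x. indicator (ball z (r i)) x * (c * (b i z + g i z x)) \<partial>\<nu>) = (\<integral>\<^sup>+x. c * (b i z * indicator (ball z (r i)) x + indicator (ball z (r i)) x * g i z x) \<partial>\<nu>)"
      by (intro nn_integral_cong) (simp add: indicator_def)
    also have "... = c * (b i z * ennreal (mm z i) + (\<integral>\<^sup>+x. indicator (ball z (r i)) x * g i z x \<partial>\<nu>))"
      by (subst nn_integral_cmult, measurable) (subst nn_integral_add, auto simp: nn_integral_cmult_indicator emeasure_ball)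
    finally have e: "(\<integral>\<^sup>+x. indicator (ball z (r i)) x * (c * (b i z + g i z x)) \<partial>\<nu>) = c * (b i z * ennreal (mm z i) + (\<integral>\<^sup>+x. indicator (ball z (r i)) x * g i z x \<partial>\<nu>))" .
    have "(\<integral>\<^sup>+x. indicator (ball z (r i)) x * g i z x \<partial>\<nu>) <= (\<integral>\<^sup>+x. ennreal (rneg i) * (indicator (ball z (8 * r i)) x * abs_p (?U (z, i) - u x)) \<partial>\<nu>)"
    proof (rule nn_integral_mono)
      fix x
      have "dist z x < 8 * r i" if "dist z x < r i" using that r_pos(1)[of i] by linarith
      then show "indicator (ball z (r i)) x * g i z x <= ennreal (rneg i) * (indicator (ball z (8 * r i)) x * abs_p (?U (z, i) - u x))"
        by (cases "dist z x < r i") (auto simp: g_def)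
    qed
    also have "... = ennreal (rneg i) * osc u z i (?U (z, i))" unfolding osc_def by (rule nn_integral_cmult) measurable
    also have "... <= ennreal (rneg i) * (2 * mean_osc u z i)"
      using good_point(2)[OF um, of z i] by (intro mult_left_mono) (auto simp: sample_def)
    finally show ?thesis unfolding e by (intro mult_left_mono add_left_mono) auto
  qed
  have "hardy_lhs E u <= (\<integral>\<^sup>+x. (\<Sum>i. \<Sum>z\<in>A i. indicator (ball z (r i)) x * (c * (b i z + g i z x))) \<partial>\<nu>)"
    by (rule nn_integral_mono[OF pt])
  also have "... = (\<Sum>i. \<Sum>z\<in>A i. \<integral>\<^sup>+x. indicator (ball z (r i)) x * (c * (b i z + g i z x)) \<partial>\<nu>)"
    by (subst nn_integral_suminf, measurable) (subst nn_integral_sum, auto)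
  also have "... <= (\<Sum>i. \<Sum>z\<in>A i. c * (ennreal (2 powr p * 264 powr p) * (\<Sum>w\<in>nb z i. ?e i z w) + ennreal (2 powr p) * (\<Sum>w\<in>nb z i. ?V i z w)
      + 2 * (ennreal (rneg i) * mean_osc u z i)))"
  proof (intro suminf_le sum_mono)
    fix i z assume z: "z \<in> A i"
    have "ennreal (rneg i) * (2 * mean_osc u z i) = 2 * (ennreal (rneg i) * mean_osc u z i)" by (simp only: mult.left_commute)
    then have "c * (b i z * ennreal (mm z i) + ennreal (rneg i) * (2 * mean_osc u z i)) \<le>
      c * (ennreal (2 powr p * 264 powr p) * (\<Sum>w\<in>nb z i. ?e i z w) + ennreal (2 powr p) * (\<Sum>w\<in>nb z i. ?V i z w) + 2 * (ennreal (rneg i) * mean_osc u z i))"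
      by (simp only:) (intro mult_left_mono add_right_mono vert[OF z] zero_le)
    then show "(\<integral>\<^sup>+x. indicator (ball z (r i)) x * (c * (b i z + g i z x)) \<partial>\<nu>) \<le>
      c * (ennreal (2 powr p * 264 powr p) * (\<Sum>w\<in>nb z i. ?e i z w) + ennreal (2 powr p) * (\<Sum>w\<in>nb z i. ?V i z w) + 2 * (ennreal (rneg i) * mean_osc u z i))"
      by (rule order_trans[OF one])
  qed auto
  also have "... = c * (ennreal (2 powr p * 264 powr p) * (\<Sum>i. \<Sum>z\<in>A i. \<Sum>w\<in>nb z i. ?e i z w) + ennreal (2 powr p) * vertex_energy ?U + 2 * osc_energy u)"
    unfolding vertex_energy_def osc_energy_def
    by (simp only: sum_distrib_left[symmetric] ennreal_suminf_cmult sum.distrib suminf_add[OF summableI summableI, symmetric])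
  also have "... <= c * (ennreal (2 powr p * 264 powr p) * (\<integral>\<^sup>+x. ?f x \<partial>\<mu>) + ennreal (2 powr p) * vertex_energy ?U + 2 * osc_energy u)"
    by (intro mult_left_mono add_right_mono edge_sum_le[OF fm]) auto
  finally show ?thesis unfolding c_def .
qed

text \<open>If the Besov energy is infinite there is nothing to prove; otherwise the slope of the extension has finite
  energy and is its minimal weak upper gradient.\<close>
lemma fractional_of_hardy:
  assumes E: "closed E" "E ~= {}" and H: "hardy_inequality Y \<mu> p (mspace Y - bdry ` E)"
  shows "fractional_hardy_inequality euclidean_metric \<nu> \<theta> p (UNIV - E)"
proof -
  obtain C2 where C2: "0 <= C2" "!!u. u \<in> borel_measurable \<nu> ==> osc_energy u <= ennreal C2 * besov_energy u" using osc_energy_le by blast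
  obtain C3 where C3: "0 <= C3" "!!f. (\<integral>\<^sup>+x. ennreal_powr (slope f x) p \<partial>\<mu>) <= ennreal C3 * vertex_energy f" using slope_energy_le by blast
  have eq: "mspace Y - (mspace Y - bdry ` E) = bdry ` E" using bdry_in by blast
  obtain CH where CH: "1 <= CH" "!!v g. v \<in> Lip_c Y (mspace Y - bdry ` E) ==> minimal_weak_upper_gradient Y \<mu> p v g ==>
      (\<integral>\<^sup>+x. (abs_p (v x) / dist_p E x) \<partial>\<mu>) <= ennreal CH * (\<integral>\<^sup>+x. ennreal_powr (g x) p \<partial>\<mu>)"
    using H unfolding hardy_inequality_def eq nn_integral_off_bdry by blast
  define cV where "cV = 2 powr (\<theta> * p) * (K * 2 powr p * 2) * (6 * real Mo) * C2"
  define c1 where "c1 = 2 powr (\<theta> * p) * 2 powr p"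
  define c2 where "c2 = 2 powr p * 264 powr p"
  define CC where "CC = c1 * (c2 * (CH * (C3 * cV)) + 2 powr p * cV + 2 * C2)"
  have nn: "0 <= cV" "0 <= c1" "0 <= c2" using C2(1) K_ge_1 by (auto simp: cV_def c1_def c2_def)
  have CC: "0 <= CC" using nn CH(1) C2(1) C3(1) by (simp add: CC_def)
  have main: "hardy_lhs E u <= ennreal (max 1 CC) * besov_energy u"
    if u: "u \<in> Lip_c euclidean_metric (UNIV - E)" for u
  proof (cases "besov_energy u = \<infinity>")
    case True
    have "ennreal (max 1 CC) * besov_energy u = top" unfolding True by (simp add: ennreal_mult_top max_def)
    then show ?thesis by simp
  next
    case False
    obtain L0 where um: "u \<in> borel_measurable \<nu>" using Lip_c_on_Z[OF u] by blast
    have u0: "u x = 0" if "x \<in> E" for x using Lip_c_support[OF u, of x] that by auto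
    obtain v L where v: "linear_on_edges (sample u) v" and L: "0 <= L" "!!F G. F \<in> mspace Y ==> G \<in> mspace Y ==> \<bar>v F - v G\<bar> <= L * mdist Y F G"
      and vL: "v \<in> Lip_c Y (mspace Y - bdry ` E)" using sample_extension[OF u E] by blast
    let ?S = "\<integral>\<^sup>+x. ennreal_powr (slope (sample u) x) p \<partial>\<mu>"
    have "vertex_energy (sample u) <= ennreal (2 powr (\<theta> * p) * (K * 2 powr p * 2) * (6 * real Mo)) * (ennreal C2 * besov_energy u)"
      by (rule order_trans[OF vertex_energy_sample_le[OF um] mult_left_mono[OF C2(2)[OF um]]]) simp
    then have V: "vertex_energy (sample u) <= ennreal cV * besov_energy u"
      unfolding cV_def using C2(1) K_ge_1 by (subst ennreal_mult) (auto simp: mult.assoc)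
    have "?S <= ennreal C3 * (ennreal cV * besov_energy u)" by (rule order_trans[OF C3(2) mult_left_mono[OF V]]) simp
    then have S: "?S <= ennreal (C3 * cV) * besov_energy u" using C3(1) nn(1) by (simp add: ennreal_mult mult.assoc)
    have "ennreal (C3 * cV) * besov_energy u < \<infinity>" using False by (simp add: ennreal_mult_less_top less_top)
    then have fin: "?S < \<infinity>" using S by (rule order_le_less_trans[rotated])
    have "(\<integral>\<^sup>+x. (abs_p (v x) / dist_p E x) \<partial>\<mu>) <= ennreal CH * ?S"
      by (rule CH(2)[OF vL slope_minimal[OF p v L fin]])
    also have "... <= ennreal CH * (ennreal (C3 * cV) * besov_energy u)" using S by (rule mult_left_mono) simp
    also have "... = ennreal (CH * (C3 * cV)) * besov_energy u" using CH(1) C3(1) nn(1) by (subst ennreal_mult) (auto simp: mult.assoc)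
    finally have F: "(\<integral>\<^sup>+x. (abs_p (v x) / dist_p E x) \<partial>\<mu>) <= ennreal (CH * (C3 * cV)) * besov_energy u" .
    have "hardy_lhs E u \<le>
      ennreal c1 * (ennreal c2 * (\<integral>\<^sup>+x. abs_p (v x) / dist_p E x \<partial>\<mu>) + ennreal (2 powr p) * vertex_energy (sample u) + 2 * osc_energy u)"
      unfolding c1_def c2_def by (rule fractional_lhs_le[OF um E u0 v L])
    also have "... <= ennreal c1 * (ennreal c2 * (ennreal (CH * (C3 * cV)) * besov_energy u) + ennreal (2 powr p) * (ennreal cV * besov_energy u) + 2 * (ennreal C2 * besov_energy u))"
      using F V C2(2)[OF um] by (intro mult_left_mono add_mono) auto
    also have "... = (ennreal c1 * (ennreal c2 * ennreal (CH * (C3 * cV)) + ennreal (2 powr p) * ennreal cV + ennreal 2 * ennreal C2)) * besov_energy u"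
      by (simp only: distrib_left distrib_right mult.assoc ennreal_numeral)
    also have "ennreal c1 * (ennreal c2 * ennreal (CH * (C3 * cV)) + ennreal (2 powr p) * ennreal cV + ennreal 2 * ennreal C2) = ennreal CC"
    proof -
      have n: "0 <= CH * (C3 * cV)" using CH(1) C3(1) nn(1) by simp
      show ?thesis unfolding CC_def
        using n nn C2(1) by (simp only: ennreal_mult[symmetric] ennreal_plus[symmetric] mult_nonneg_nonneg add_nonneg_nonneg powr_ge_zero zero_le_numeral)
    qed
    also have "ennreal CC * besov_energy u <= ennreal (max 1 CC) * besov_energy u" by (intro mult_right_mono ennreal_leI) auto
    finally show ?thesis .
  qed
  have b: "mball_of euclidean_metric x s = ball x s" for x :: 'z and s by auto
  have UE: "mspace euclidean_metric - (UNIV - E) = E" by auto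
  show ?thesis unfolding fractional_hardy_inequality_def UE b
  proof (intro exI[of _ "max 1 CC"] conjI ballI)
    fix u assume u: "u \<in> Lip_c euclidean_metric (UNIV - E)"
    have u0: "u x = 0" if "x \<in> E" for x using Lip_c_support[OF u, of x] that by auto
    have "(\<integral>\<^sup>+x\<in>UNIV - E. (abs_p (u x) / ennreal_powr (dist_to_set euclidean_metric x E) (\<theta> * p)) \<partial>\<nu>) =
      hardy_lhs E u"
      by (intro nn_integral_cong fractional_weight E u0)
    also have "... <= ennreal (max 1 CC) * besov_energy u" by (rule main[OF u])
    finally show "(\<integral>\<^sup>+x\<in>UNIV - E. (abs_p (u x) / ennreal_powr (dist_to_set euclidean_metric x E) (\<theta> * p)) \<partial>\<nu>) <= ennreal (max 1 CC) *
      (\<integral>\<^sup>+x. (\<integral>\<^sup>+y. abs_p (u x - u y) / (ennreal (mdist euclidean_metric x y powr (\<theta> * p)) * emeasure \<nu> (ball x (mdist euclidean_metric x y))) \<partial>\<nu>) \<partial>\<nu>)"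
      unfolding besov_energy_def mdist_euclidean_metric .
  qed simp
qed

end

text \<open>The distance to the empty set is infinite, so the left-hand side vanishes.\<close>
lemma hardy_inequality_empty: "hardy_inequality M m p (mspace M)"
  unfolding hardy_inequality_def dist_to_set_def by (intro exI[of _ 1]) (simp add: ennreal_powr_def)

lemma fractional_hardy_inequality_empty: "fractional_hardy_inequality M m \<theta> p (mspace M)"
  unfolding fractional_hardy_inequality_def dist_to_set_def by (intro exI[of _ 1]) (simp add: ennreal_powr_def)

theorem theorem1p4:
  fixes \<nu> :: "'z::metric_space measure"
    and A :: "nat \<Rightarrow> 'z set" and z0 :: 'z and E :: "'z set"
    and \<alpha> \<tau> \<epsilon> p \<theta> \<beta> :: real
  assumes "compact (UNIV :: 'z set)" and "diameter (UNIV :: 'z set) < 1"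
    and "sets \<nu> = sets borel" and "doubling_measure euclidean_metric \<nu>"
    and "\<alpha> = exp (1 / 4)" and "\<tau> = 2" and "\<epsilon> = ln \<alpha>"
    and "filling_nets \<alpha> z0 A"
    and "closed E"
    and "1 < p" and "0 < \<theta>" and "\<theta> < 1" and "0 < \<beta>" and "\<beta> / \<epsilon> = p * (1 - \<theta>)"
  shows "fractional_hardy_inequality euclidean_metric \<nu> \<theta> p (UNIV - E) \<longleftrightarrow>
         hardy_inequality (completed_filling \<alpha> \<tau> \<epsilon> z0 A) (filling_measure \<alpha> \<tau> \<epsilon> z0 A \<nu> \<beta>) p
           (mspace (completed_filling \<alpha> \<tau> \<epsilon> z0 A) - filling_boundary_point \<alpha> \<tau> \<epsilon> z0 A ` E)"
proof -
  have \<epsilon>: "\<epsilon> = 1 / 4" using assms(5,7) by simp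
  interpret hardy_filling A z0 \<nu> \<beta> p \<theta>
    by unfold_locales (use assms \<epsilon> in \<open>auto simp: field_simps\<close>)
  show ?thesis
  proof (cases "E = {}")
    case True
    have "fractional_hardy_inequality euclidean_metric \<nu> \<theta> p UNIV"
      using fractional_hardy_inequality_empty[of euclidean_metric \<nu> \<theta> p] by simp
    then show ?thesis by (simp add: True hardy_inequality_empty)
  next
    case False
    then show ?thesis unfolding assms(5,6) \<epsilon> using hardy_of_fractional[OF assms(9)] fractional_of_hardy[OF assms(9)] by blast
  qed
qed

end
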